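(* In the Bayesian probit linear mixed model and two-block Gibbs sampler described in the context, suppose the design has the intercept/indicator structure described in the context and that: (B1) for each $j$, either ($a_j<0$, $b_j=0$ and $q_j\ge2$) or $b_j>0$; (B2) $2a_j+q_j-1>0$ for all $j$; (B3) $\tilde{\bm W}$ has full column rank; (B4) there exists $\bm e\in\mathbb{R}^n$ with all entries strictly positive such that $\bm e^T\tilde{\bm W}^*=\bm0$; and that there exists $s\in(0,1]\cap(0,\tilde s)$, where $\tilde s=\min\{a_1+q_1/2,\dots,a_r+q_r/2\}$, such that $$2^{-s}\sum_{j=1}^r\frac{\Gamma(q_j/2+a_j-s)}{\Gamma(q_j/2+a_j)}\Big[\operatorname{tr}\Big(R_j\big(\bm I-P_{\bm Z^T(\bm I-P_X)\bm Z}\big)R_j^T\Big)\Big]^s<1.$$ Then the Markov chain underlying the two-block Gibbs sampler is geometrically ergodic.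
   Context: Model: $y_i\in\{0,1\}$, $\bm x_i\in\mathbb{R}^p$, $\bm z_i\in\mathbb{R}^q$ known, $\bm X$ ($n\times p$) has rows $\bm x_i^T$, $\bm Z$ ($n\times q$) has rows $\bm z_i^T$, $\bm W=(\bm X,\bm Z)$ with $i$th row $\bm w_i^T$; $\bm\eta=(\bm\beta^T,\bm u^T)^T$, $\bm u=(\bm u_1^T,\dots,\bm u_r^T)^T$, $\bm u_j\in\mathbb{R}^{q_j}$, $q=\sum q_j$. $Y_i\mid\bm\beta,\bm u\overset{ind}{\sim}\mathrm{Bern}(\Phi(\bm x_i^T\bm\beta+\bm z_i^T\bm u))$, $\bm u_j\overset{ind}{\sim}N(\bm0,\tau_j^{-1}\bm I_{q_j})$, priors $\pi(\bm\beta)\propto1$, $\pi(\tau_j)\propto e^{-b_j\tau_j}\tau_j^{a_j-1}$. Design structure: first column of $\bm X$ is all ones; $\bm Z=(\bm Z_1,\dots,\bm Z_r)$ with $\bm Z_j$ the $n\times q_j$ 0/1 incidence matrix whose $(i,k)$ entry is 1 iff observation $i$ is at level $k$ of random effect $j$; $\tilde{\bm Z}_j$ is $\bm Z_j$ without its first column, $\tilde{\bm W}=(\bm X,\tilde{\bm Z}_1,\dots,\tilde{\bm Z}_r)$ with rows $\tilde{\bm w}_i^T$; $c_i=1-2y_i$ and $\tilde{\bm W}^*$ has $i$th row $c_i\tilde{\bm w}_i^T$. $P_X=\bm X(\bm X^T\bm X)^{-1}\bm X^T$; for a matrix $M$, $P_M$ is the orthogonal projection onto the column space of $M$; $R_j$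 is the $q_j\times q$ 0/1 matrix with $R_j\bm u=\bm u_j$. $\bm D(\bm\tau)=\oplus_j\tau_j\bm I_{q_j}$, $\bm\Sigma(\bm\tau)=\begin{pmatrix}\bm X^T\bm X&\bm X^T\bm Z\\ \bm Z^T\bm X&\bm Z^T\bm Z+\bm D(\bm\tau)\end{pmatrix}$. Two-block Gibbs sampler: from $\bm\eta^{(m)}$, draw independently $\tau_j\sim\mathrm{Gamma}(a_j+q_j/2,\ b_j+\bm u_j^{(m)T}\bm u_j^{(m)}/2)$ (shape, rate) and $v_i\sim N(\bm w_i^T\bm\eta^{(m)},1)$ truncated to $(0,\infty)$ if $y_i=1$ and to $(-\infty,0]$ if $y_i=0$; then draw $\bm\eta^{(m+1)}\sim N_{p+q}(\bm\Sigma(\bm\tau)^{-1}\bm W^T\bm v,\bm\Sigma(\bm\tau)^{-1})$. (The $\tau$-update on the null set where some $\bm u_j=\bm0$ with $b_j=0$ may be defined arbitrarily.) Geometric ergodicity: there exist $t\in(0,1)$ and a function $J$ with total variation distance between the $m$-step kernel from $x$ and the stationary distribution at most $J(x)t^m$. *)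

theory Defs
  imports "HOL-Probability.Probability"
begin

definition mmul :: "nat \<Rightarrow> (nat \<Rightarrow> nat \<Rightarrow> real) \<Rightarrow> (nat \<Rightarrow> nat \<Rightarrow> real) \<Rightarrow> nat \<Rightarrow> nat \<Rightarrow> real" where
  "mmul k A B i l = (\<Sum>t<k. A i t * B t l)"

definition mtrans :: "(nat \<Rightarrow> nat \<Rightarrow> real) \<Rightarrow> nat \<Rightarrow> nat \<Rightarrow> real" where
  "mtrans A i j = A j i"

definition idm :: "nat \<Rightarrow> nat \<Rightarrow> real" where
  "idm i j = (if i = j then 1 else 0)"

definition mtrace :: "nat \<Rightarrow> (nat \<Rightarrow> nat \<Rightarrow> real) \<Rightarrow> real" where
  "mtrace m A = (\<Sum>i<m. A i i)"

definition proj :: "nat \<Rightarrow> nat \<Rightarrow> (nat \<Rightarrow> nat \<Rightarrow> real) \<Rightarrow> nat \<Rightarrow> nat \<Rightarrow> real" where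
  "proj m k M = (THE P. (\<forall>i j. (m \<le> i \<or> m \<le> j) \<longrightarrow> P i j = 0) \<and>
     (\<forall>x::nat \<Rightarrow> real.
        (\<exists>c::nat \<Rightarrow> real. \<forall>i<m. (\<Sum>j<m. P i j * x j) = (\<Sum>l<k. M i l * c l)) \<and>
        (\<forall>c::nat \<Rightarrow> real. (\<Sum>i<m. (x i - (\<Sum>j<m. P i j * x j)) * (\<Sum>l<k. M i l * c l)) = 0)))"

text \<open>qs j = q_j (j < r); lev j i = level (in {0..<q_j}) of observation i for random effect j.\<close>

definition qtot :: "nat \<Rightarrow> (nat \<Rightarrow> nat) \<Rightarrow> nat" where
  "qtot r qs = (\<Sum>j<r. qs j)"

definition off :: "(nat \<Rightarrow> nat) \<Rightarrow> nat \<Rightarrow> nat" where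
  "off qs j = (\<Sum>l<j. qs l)"

definition Zmat :: "nat \<Rightarrow> (nat \<Rightarrow> nat) \<Rightarrow> (nat \<Rightarrow> nat \<Rightarrow> nat) \<Rightarrow> nat \<Rightarrow> nat \<Rightarrow> real" where
  "Zmat r qs lev i c = (if \<exists>j<r. \<exists>k<qs j. c = off qs j + k \<and> lev j i = k then 1 else 0)"

definition Wmat :: "nat \<Rightarrow> nat \<Rightarrow> (nat \<Rightarrow> nat) \<Rightarrow> (nat \<Rightarrow> nat \<Rightarrow> real) \<Rightarrow> (nat \<Rightarrow> nat \<Rightarrow> nat) \<Rightarrow> nat \<Rightarrow> nat \<Rightarrow> real" where
  "Wmat p r qs X lev i c = (if c < p then X i c else Zmat r qs lev i (c - p))"

definition offt :: "(nat \<Rightarrow> nat) \<Rightarrow> nat \<Rightarrow> nat" where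
  "offt qs j = (\<Sum>l<j. qs l - 1)"

text \<open>W~ = (X, Z~_1, ..., Z~_r) where Z~_j is Z_j without its first column; n x (p + q - r).\<close>
definition Wtmat :: "nat \<Rightarrow> nat \<Rightarrow> (nat \<Rightarrow> nat) \<Rightarrow> (nat \<Rightarrow> nat \<Rightarrow> real) \<Rightarrow> (nat \<Rightarrow> nat \<Rightarrow> nat) \<Rightarrow> nat \<Rightarrow> nat \<Rightarrow> real" where
  "Wtmat p r qs X lev i c = (if c < p then X i c
     else if \<exists>j<r. \<exists>k. k + 1 < qs j \<and> c - p = offt qs j + k \<and> lev j i = k + 1 then 1 else 0)"

definition Rmat :: "(nat \<Rightarrow> nat) \<Rightarrow> nat \<Rightarrow> nat \<Rightarrow> nat \<Rightarrow> real" where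
  "Rmat qs j k c = (if c = off qs j + k then 1 else 0)"

text \<open>Diagonal of D(tau) placed in the (p+q) x (p+q) matrix Sigma(tau) (zero in the beta block).\<close>
definition Dtau :: "nat \<Rightarrow> nat \<Rightarrow> (nat \<Rightarrow> nat) \<Rightarrow> (nat \<Rightarrow> real) \<Rightarrow> nat \<Rightarrow> real" where
  "Dtau p r qs tau c = (\<Sum>j<r. if p + off qs j \<le> c \<and> c < p + off qs j + qs j then tau j else 0)"

definition Sigma_tau :: "nat \<Rightarrow> nat \<Rightarrow> nat \<Rightarrow> (nat \<Rightarrow> nat) \<Rightarrow> (nat \<Rightarrow> nat \<Rightarrow> real) \<Rightarrow> (nat \<Rightarrow> nat \<Rightarrow> nat)
    \<Rightarrow> (nat \<Rightarrow> real) \<Rightarrow> nat \<Rightarrow> nat \<Rightarrow> real" where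
  "Sigma_tau n p r qs X lev tau c c' =
     (\<Sum>i<n. Wmat p r qs X lev i c * Wmat p r qs X lev i c') + (if c = c' then Dtau p r qs tau c else 0)"

definition normdens :: "'a measure \<Rightarrow> ('a \<Rightarrow> ennreal) \<Rightarrow> 'a measure" where
  "normdens M f = density M (\<lambda>x. f x / (\<integral>\<^sup>+ z. f z \<partial>M))"

text \<open>Gamma(shape, rate) distribution; for rate \<le> 0 (only on the null set where some u_j = 0 and
  b_j = 0) the update is defined arbitrarily as Gamma(shape, 1).\<close>
definition gamma_meas :: "real \<Rightarrow> real \<Rightarrow> real measure" where
  "gamma_meas sh rt = normdens lborel
     (\<lambda>t. ennreal (indicator {0<..} t * t powr (sh - 1) * exp (- (if rt > 0 then rt else 1) * t)))"

definition truncnorm :: "real \<Rightarrow> bool \<Rightarrow> real measure" where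
  "truncnorm m yi = normdens lborel
     (\<lambda>v. ennreal (indicator (if yi then {0<..} else {..0}) v * exp (- ((v - m)\<^sup>2) / 2)))"

definition Phi :: "real \<Rightarrow> real" where
  "Phi x = (\<integral>t. indicator {..x} t * std_normal_density t \<partial>lborel)"

definition Rsp :: "nat \<Rightarrow> (nat \<Rightarrow> real) measure" where
  "Rsp d = PiM {..<d} (\<lambda>_. lborel)"

definition usq :: "nat \<Rightarrow> (nat \<Rightarrow> nat) \<Rightarrow> (nat \<Rightarrow> real) \<Rightarrow> nat \<Rightarrow> real" where
  "usq p qs eta j = (\<Sum>k<qs j. (eta (p + off qs j + k))\<^sup>2)"

definition tau_draw :: "nat \<Rightarrow> nat \<Rightarrow> (nat \<Rightarrow> nat) \<Rightarrow> (nat \<Rightarrow> real) \<Rightarrow> (nat \<Rightarrow> real) \<Rightarrow> (nat \<Rightarrow> real) \<Rightarrow> (nat \<Rightarrow> real) measure" where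
  "tau_draw p r qs a b eta = PiM {..<r} (\<lambda>j. gamma_meas (a j + real (qs j) / 2) (b j + usq p qs eta j / 2))"

definition v_draw :: "nat \<Rightarrow> nat \<Rightarrow> nat \<Rightarrow> (nat \<Rightarrow> nat) \<Rightarrow> (nat \<Rightarrow> nat \<Rightarrow> real) \<Rightarrow> (nat \<Rightarrow> nat \<Rightarrow> nat)
    \<Rightarrow> (nat \<Rightarrow> bool) \<Rightarrow> (nat \<Rightarrow> real) \<Rightarrow> (nat \<Rightarrow> real) measure" where
  "v_draw n p r qs X lev y eta = PiM {..<n}
     (\<lambda>i. truncnorm (\<Sum>c<p + qtot r qs. Wmat p r qs X lev i c * eta c) (y i))"

text \<open>N(Sigma(tau)^{-1} W^T v, Sigma(tau)^{-1}); the mean is the solution mu of Sigma(tau) mu = W^T v.\<close>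
definition eta_draw :: "nat \<Rightarrow> nat \<Rightarrow> nat \<Rightarrow> (nat \<Rightarrow> nat) \<Rightarrow> (nat \<Rightarrow> nat \<Rightarrow> real) \<Rightarrow> (nat \<Rightarrow> nat \<Rightarrow> nat)
    \<Rightarrow> (nat \<Rightarrow> real) \<Rightarrow> (nat \<Rightarrow> real) \<Rightarrow> (nat \<Rightarrow> real) measure" where
  "eta_draw n p r qs X lev tau v =
    (let d = p + qtot r qs;
         S = Sigma_tau n p r qs X lev tau;
         mu = (THE mu. mu \<in> extensional {..<d} \<and>
                 (\<forall>c<d. (\<Sum>c'<d. S c c' * mu c') = (\<Sum>i<n. Wmat p r qs X lev i c * v i)))
     in normdens (Rsp d)
          (\<lambda>eta. ennreal (exp (- (1/2) * (\<Sum>c<d. \<Sum>c'<d. (eta c - mu c) * S c c' * (eta c' - mu c'))))))"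

definition gibbs_kernel :: "nat \<Rightarrow> nat \<Rightarrow> nat \<Rightarrow> (nat \<Rightarrow> nat) \<Rightarrow> (nat \<Rightarrow> nat \<Rightarrow> real) \<Rightarrow> (nat \<Rightarrow> nat \<Rightarrow> nat)
    \<Rightarrow> (nat \<Rightarrow> bool) \<Rightarrow> (nat \<Rightarrow> real) \<Rightarrow> (nat \<Rightarrow> real) \<Rightarrow> (nat \<Rightarrow> real) \<Rightarrow> (nat \<Rightarrow> real) measure" where
  "gibbs_kernel n p r qs X lev y a b eta =
     tau_draw p r qs a b eta \<bind> (\<lambda>tau. v_draw n p r qs X lev y eta \<bind> (\<lambda>v. eta_draw n p r qs X lev tau v))"

fun kstep :: "'a measure \<Rightarrow> ('a \<Rightarrow> 'a measure) \<Rightarrow> nat \<Rightarrow> 'a \<Rightarrow> 'a measure" where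
  "kstep S K 0 x = return S x"
| "kstep S K (Suc m) x = kstep S K m x \<bind> K"

text \<open>Marginal posterior density of eta (up to a constant): likelihood times the prior of u
  obtained by integrating the N(0, tau_j^{-1} I) density against the prior of tau_j.\<close>
definition post_dens :: "nat \<Rightarrow> nat \<Rightarrow> nat \<Rightarrow> (nat \<Rightarrow> nat) \<Rightarrow> (nat \<Rightarrow> nat \<Rightarrow> real) \<Rightarrow> (nat \<Rightarrow> nat \<Rightarrow> nat)
    \<Rightarrow> (nat \<Rightarrow> bool) \<Rightarrow> (nat \<Rightarrow> real) \<Rightarrow> (nat \<Rightarrow> real) \<Rightarrow> (nat \<Rightarrow> real) \<Rightarrow> ennreal" where
  "post_dens n p r qs X lev y a b eta =
     ennreal (\<Prod>i<n. let pr = Phi (\<Sum>c<p + qtot r qs. Wmat p r qs X lev i c * eta c)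
                     in if y i then pr else 1 - pr) *
     (\<Prod>j<r. \<integral>\<^sup>+ t. ennreal (indicator {0<..} t *
          ((t / (2 * pi)) powr (real (qs j) / 2) * exp (- t * usq p qs eta j / 2)) *
          (t powr (a j - 1) * exp (- b j * t))) \<partial>lborel)"

definition posterior :: "nat \<Rightarrow> nat \<Rightarrow> nat \<Rightarrow> (nat \<Rightarrow> nat) \<Rightarrow> (nat \<Rightarrow> nat \<Rightarrow> real) \<Rightarrow> (nat \<Rightarrow> nat \<Rightarrow> nat)
    \<Rightarrow> (nat \<Rightarrow> bool) \<Rightarrow> (nat \<Rightarrow> real) \<Rightarrow> (nat \<Rightarrow> real) \<Rightarrow> (nat \<Rightarrow> real) measure" where
  "posterior n p r qs X lev y a b =
     normdens (Rsp (p + qtot r qs)) (post_dens n p r qs X lev y a b)"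

definition tv_dist :: "'a measure \<Rightarrow> 'a measure \<Rightarrow> real" where
  "tv_dist M N = (SUP A \<in> sets M. \<bar>measure M A - measure N A\<bar>)"

definition geom_ergodic :: "'a measure \<Rightarrow> ('a \<Rightarrow> 'a measure) \<Rightarrow> 'a measure \<Rightarrow> bool" where
  "geom_ergodic S K Pst \<longleftrightarrow> (\<exists>t::real. \<exists>J :: 'a \<Rightarrow> real. 0 < t \<and> t < 1 \<and>
      (\<forall>x\<in>space S. \<forall>m. tv_dist (kstep S K m x) Pst \<le> J x * t ^ m))"

end

theory Submission
  imports Defs
begin

text \<open>
The chain satisfies a geometric drift condition towards the level sets of
\[ V(\eta) = A \lVert W\eta\rVert^2 + \sum_j \rho_j^s + \sum_{j : b_j = 0} \rho_j^{-c_j}, \]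
where \<open>\<rho>\<^sub>j\<close> is the rate of the Gamma update of \<open>\<tau>\<^sub>j\<close>, and a minorization on each of them; geometric
ergodicity then follows by contraction of a weighted oscillation seminorm.

Drift. Condition (B4) separates the column space of \<open>W\<close> from the orthant containing \<open>v\<close>, so the
posterior mean of \<open>W\<eta>\<close> is shorter than \<open>v\<close> by a fixed factor. By (B3) the kernel of \<open>W\<close> consists of
the shifts of a whole block \<open>u\<^sub>j\<close> compensated by the intercept; hence only the block mean of \<open>u\<^sub>j\<close> has a
variance that is unbounded in \<open>\<tau>\<close>, namely \<open>1 / (q\<^sub>j \<tau>\<^sub>j)\<close>, and the trace in the hypothesis is
at least \<open>1\<close>. The negative powers control the chain near \<open>u\<^sub>j = 0\<close>; their contraction constant is below
\<open>1\<close> by strict log-convexity of the Gamma function and \<open>a\<^sub>j < 0\<close>.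

Invariance. The joint density of \<open>(\<eta>, \<tau>, v)\<close> factors so that the kernel is reversible with respect to
the marginal posterior, which is proper because (B2), (B3) and (B4) make every Gaussian integral explicit.
\<close>

text \<open>Under the flat prior on \<open>beta\<close>, the vector \<open>u_j\<close> can move
  along directions that leave \<open>W eta\<close> unchanged; there only the prior precision pulls
  it back. The hypothesis gives no multiplicative slack for this pull, so in the conditional second
  moment of \<open>u_j\<close> the coefficient of \<open>1 / tau_j\<close> has to be at most 1.
  Every other contribution may be estimated crudely: it is either a constant or a multiple of
  \<open>||v||^2\<close>, and a large weight \<open>A\<close> absorbs the latter into the spare
  contraction of \<open>||W eta||^2\<close>. An exponent \<open>s \<le> 1\<close> makes powers
  subadditive, which keeps the two kinds of terms apart.

  No inverse and no determinant of \<open>Sigma(tau)\<close> is computed. Moments come from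
  comparing an integral with its image under a translation, a dilation or a reflection, normalising
  constants from a shear into independent coordinates.

  The negative powers answer an instability at \<open>b_j = 0\<close>: a short \<open>u_j\<close>
  produces a large \<open>tau_j\<close>, hence again a short \<open>u_j\<close>. On a level set of
  \<open>V\<close> they keep the Gamma rate away from 0, without which the \<open>tau\<close> draws
  would have no common minorant.\<close>

section \<open>Geometric ergodicity from drift and minorization\<close>

lemma bounded_integrable_prob:
  fixes f :: "'a \<Rightarrow> real"
  assumes "prob_space M" "f \<in> borel_measurable M" "\<And>x. x \<in> space M \<Longrightarrow> \<bar>f x\<bar> \<le> B"
  shows "integrable M f"
proof -
  interpret prob_space M by fact
  show ?thesis by (rule integrable_const_bound[where B=B]) (use assms in auto)
qed

lemma abs_integral_le:
  fixes f g :: "'a \<Rightarrow> real"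
  assumes "integrable M f" "integrable M g" "\<And>x. x \<in> space M \<Longrightarrow> \<bar>f x\<bar> \<le> g x"
  shows "\<bar>\<integral>x. f x \<partial>M\<bar> \<le> (\<integral>x. g x \<partial>M)"
  by (rule order_trans[OF integral_abs_bound integral_mono]) (use assms in auto)

text \<open>The minorant in \<open>minor\<close> need not be a probability measure; its mass plays
  the role of the usual minorization constant. It is requested for every level \<open>R\<close>
  because the contraction argument chooses \<open>R\<close> from \<open>\<gamma>\<close> and
  \<open>C\<close>.\<close>

locale drift_minorization =
  fixes S :: "'a measure" and K :: "'a \<Rightarrow> 'a measure" and V :: "'a \<Rightarrow> real" and \<gamma> C :: real
    and P :: "'a measure"
  assumes K_meas[measurable]: "K \<in> measurable S (subprob_algebra S)"
    and K_prob: "\<And>x. x \<in> space S \<Longrightarrow> prob_space (K x)"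
    and V_meas[measurable]: "V \<in> borel_measurable S"
    and V_nonneg: "\<And>x. x \<in> space S \<Longrightarrow> 0 \<le> V x"
    and \<gamma>: "0 \<le> \<gamma>" "\<gamma> < 1" and C: "0 \<le> C"
    and drift: "\<And>x. x \<in> space S \<Longrightarrow> (\<integral>\<^sup>+ y. ennreal (V y) \<partial>K x) \<le> ennreal (\<gamma> * V x + C)"
    and minor: "\<And>R. \<exists>N. sets N = sets S \<and> emeasure N (space S) \<noteq> 0 \<and> emeasure N (space S) \<noteq> \<infinity> \<and>
        (\<forall>x\<in>space S. V x \<le> R \<longrightarrow> (\<forall>A\<in>sets S. emeasure N A \<le> emeasure (K x) A))"
    and P_prob: "prob_space P" and P_sets[measurable_cong]: "sets P = sets S" and inv: "P \<bind> K = P"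
begin

lemma K_sets[simp]: "x \<in> space S \<Longrightarrow> sets (K x) = sets S"
  using sets_kernel[OF K_meas] by simp

lemma K_space[simp]: "x \<in> space S \<Longrightarrow> space (K x) = space S"
  using sets_eq_imp_space_eq[OF K_sets] by simp

lemma P_space[simp]: "space P = space S"
  using sets_eq_imp_space_eq[OF P_sets] by simp

lemma mass_1[simp]:
  "emeasure P (space S) = 1" "measure P (space S) = 1"
  "x \<in> space S \<Longrightarrow> emeasure (K x) (space S) = 1" "x \<in> space S \<Longrightarrow> measure (K x) (space S) = 1"
  using prob_space.emeasure_space_1[OF P_prob] prob_space.prob_space[OF P_prob]
    prob_space.emeasure_space_1[OF K_prob] prob_space.prob_space[OF K_prob] by auto

definition Kop :: "('a \<Rightarrow> real) \<Rightarrow> 'a \<Rightarrow> real" where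
  "Kop f x = (\<integral>y. f y \<partial>K x)"

text \<open>The class of test functions: it contains the indicators, \<open>Kop\<close> preserves
  it, and on it the Bochner and the nonnegative integral agree.\<close>

definition unit_fn :: "('a \<Rightarrow> real) \<Rightarrow> bool" where
  "unit_fn f \<longleftrightarrow> f \<in> borel_measurable S \<and> (\<forall>x\<in>space S. 0 \<le> f x \<and> f x \<le> 1)"

lemma unit_fn_integrable: "unit_fn f \<Longrightarrow> sets M = sets S \<Longrightarrow> prob_space M \<Longrightarrow> integrable M f"
  using measurable_cong_sets[of M S borel borel] sets_eq_imp_space_eq[of M S]
  by (intro bounded_integrable_prob[where B=1]) (auto simp: unit_fn_def)

lemma Kop_nn:
  assumes "unit_fn f" "x \<in> space S"
  shows "ennreal (Kop f x) = (\<integral>\<^sup>+ y. ennreal (f y) \<partial>K x)"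
  unfolding Kop_def
  by (rule nn_integral_eq_integral[symmetric])
     (use assms in \<open>auto intro!: unit_fn_integrable K_prob AE_I2 simp: unit_fn_def\<close>)

lemma Kop_unit:
  assumes f: "unit_fn f"
  shows "unit_fn (Kop f)"
proof -
  have [measurable]: "f \<in> borel_measurable S" using f by (simp add: unit_fn_def)
  have "Kop f \<in> borel_measurable S"
    unfolding Kop_def
    by (rule measurable_compose[OF K_meas integral_measurable_subprob_algebra]) auto
  moreover have "0 \<le> Kop f x" if "x \<in> space S" for x
    unfolding Kop_def using f that by (intro integral_nonneg_AE AE_I2) (auto simp: unit_fn_def)
  moreover have "Kop f x \<le> 1" if x: "x \<in> space S" for x
  proof -
    interpret K: prob_space "K x" by (rule K_prob[OF x])
    show ?thesis unfolding Kop_def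
      by (rule K.integral_le_const) (use f x in \<open>auto intro!: unit_fn_integrable K_prob AE_I2 simp: unit_fn_def\<close>)
  qed
  ultimately show ?thesis by (auto simp: unit_fn_def)
qed

lemma integral_bind_K:
  assumes f: "unit_fn f" and M: "sets M = sets S" "prob_space M"
  shows "(\<integral>x. f x \<partial>(M \<bind> K)) = (\<integral>x. Kop f x \<partial>M)"
proof -
  have [measurable]: "f \<in> borel_measurable S" using f by (simp add: unit_fn_def)
  have KM: "K \<in> measurable M (subprob_algebra S)" using K_meas M by (simp cong: measurable_cong_sets)
  have sp: "space M = space S" using M by (rule_tac sets_eq_imp_space_eq)
  have ne: "space M \<noteq> {}" by (rule prob_space.not_empty[OF M(2)])
  have s: "sets (M \<bind> K) = sets S" by (rule sets_bind[OF _ ne]) (simp add: sp)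
  have sps: "space (M \<bind> K) = space S" using s by (rule sets_eq_imp_space_eq)
  interpret M: prob_space M by fact
  have pr: "prob_space (M \<bind> K)"
    by (rule M.prob_space_bind[OF _ KM]) (auto simp: sp K_prob intro!: AE_I2)
  have "ennreal (\<integral>x. f x \<partial>(M \<bind> K)) = (\<integral>\<^sup>+ x. ennreal (f x) \<partial>(M \<bind> K))"
    by (rule nn_integral_eq_integral[symmetric])
       (use f in \<open>auto intro!: unit_fn_integrable pr s AE_I2 simp: unit_fn_def sps\<close>)
  also have "\<dots> = (\<integral>\<^sup>+ x. \<integral>\<^sup>+ y. ennreal (f y) \<partial>K x \<partial>M)"
    by (rule nn_integral_bind[OF _ KM]) simp
  also have "\<dots> = (\<integral>\<^sup>+ x. ennreal (Kop f x) \<partial>M)"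
    by (intro nn_integral_cong) (simp add: Kop_nn[OF f] sp)
  also have "\<dots> = ennreal (\<integral>x. Kop f x \<partial>M)"
    by (rule nn_integral_eq_integral)
       (use Kop_unit[OF f] in \<open>auto intro!: unit_fn_integrable M AE_I2 simp: unit_fn_def sp\<close>)
  finally show ?thesis
    using f Kop_unit[OF f] by (subst (asm) ennreal_inj) (auto intro!: integral_nonneg_AE AE_I2 simp: unit_fn_def sp sps)
qed

lemma kstep_prob: "x \<in> space S \<Longrightarrow> prob_space (kstep S K m x) \<and> sets (kstep S K m x) = sets S"
proof (induction m)
  case 0 then show ?case by (auto intro: prob_space_return)
next
  case (Suc m)
  let ?M = "kstep S K m x"
  have M: "prob_space ?M" "sets ?M = sets S" using Suc by auto
  have sp: "space ?M = space S" using M(2) by (rule sets_eq_imp_space_eq)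
  interpret M: prob_space ?M by fact
  have KM: "K \<in> measurable ?M (subprob_algebra S)" using K_meas M by (simp cong: measurable_cong_sets)
  have "prob_space (?M \<bind> K)" by (rule M.prob_space_bind[OF _ KM]) (auto simp: sp K_prob intro!: AE_I2)
  moreover have "sets (?M \<bind> K) = sets S" by (rule sets_bind[OF _ M.not_empty]) (simp add: sp)
  ultimately show ?case by simp
qed

lemma Kpow_unit: "unit_fn f \<Longrightarrow> unit_fn ((Kop ^^ m) f)"
  by (induction m) (auto intro: Kop_unit)

lemma kstep_integral: "unit_fn f \<Longrightarrow> x \<in> space S \<Longrightarrow> (\<integral>y. f y \<partial>kstep S K m x) = (Kop ^^ m) f x"
proof (induction m arbitrary: f)
  case 0 then show ?case by (auto simp: unit_fn_def integral_return)
next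
  case (Suc m)
  have "(\<integral>y. f y \<partial>kstep S K (Suc m) x) = (\<integral>y. Kop f y \<partial>kstep S K m x)"
    using integral_bind_K[OF Suc.prems(1)] kstep_prob[OF Suc.prems(2)] by simp
  also have "\<dots> = (Kop ^^ m) (Kop f) x" by (rule Suc.IH) (use Suc.prems Kop_unit in auto)
  finally show ?case by (simp add: funpow_swap1)
qed

lemma P_integral: "unit_fn f \<Longrightarrow> (\<integral>y. f y \<partial>P) = (\<integral>y. (Kop ^^ m) f y \<partial>P)"
proof (induction m)
  case (Suc m)
  have "(\<integral>y. (Kop ^^ Suc m) f y \<partial>P) = (\<integral>y. (Kop ^^ m) f y \<partial>(P \<bind> K))"
    using integral_bind_K[OF Kpow_unit[OF Suc.prems] P_sets P_prob] by simp
  then show ?case using Suc inv by simp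
qed simp

lemma V_integrable_K:
  assumes x: "x \<in> space S" shows "integrable (K x) V" "(\<integral>y. V y \<partial>K x) \<le> \<gamma> * V x + C"
proof -
  have m: "V \<in> borel_measurable (K x)" using V_meas x by (simp cong: measurable_cong_sets)
  have nn: "AE y in K x. 0 \<le> V y" using x V_nonneg by (auto intro!: AE_I2)
  have "(\<integral>\<^sup>+ y. ennreal (V y) \<partial>K x) < \<infinity>" using drift[OF x] by (auto simp: le_less_trans)
  then show i: "integrable (K x) V" using m nn by (intro integrableI_nonneg) auto
  have "ennreal (\<integral>y. V y \<partial>K x) \<le> ennreal (\<gamma> * V x + C)"
    using drift[OF x] nn_integral_eq_integral[OF i nn] by simp
  then show "(\<integral>y. V y \<partial>K x) \<le> \<gamma> * V x + C"
    using V_nonneg[OF x] \<gamma> C by (subst (asm) ennreal_le_iff) auto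
qed

text \<open>Nothing is known yet about the integral of \<open>V\<close> under \<open>P\<close>, so
  invariance is applied to truncations only. One application of \<open>K\<close> keeps both bounds
  of the minimum: the cut-off \<open>M\<close> by total mass 1, the affine part by the
  drift.\<close>

lemma truncated_V_bound:
  assumes M: "0 \<le> M"
  shows "(\<integral>\<^sup>+ x. ennreal (min (V x) M) \<partial>P) \<le> (\<integral>\<^sup>+ x. ennreal (min (\<gamma>^m * V x + (\<Sum>i<m. \<gamma>^i * C)) M) \<partial>P)"
proof (induction m)
  case (Suc m)
  let ?c = "\<Sum>i<m. \<gamma>^i * C"
  have c: "0 \<le> ?c" using \<gamma> C by (auto intro!: sum_nonneg)
  let ?f = "\<lambda>x. ennreal (min (\<gamma>^m * V x + ?c) M)"
  have KP: "K \<in> measurable P (subprob_algebra S)" using K_meas P_sets by (simp cong: measurable_cong_sets)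
  have "(\<integral>\<^sup>+ x. ?f x \<partial>P) = (\<integral>\<^sup>+ x. ?f x \<partial>(P \<bind> K))" by (simp add: inv)
  also have "\<dots> = (\<integral>\<^sup>+ x. \<integral>\<^sup>+ y. ?f y \<partial>K x \<partial>P)" by (rule nn_integral_bind[OF _ KP]) simp
  also have "\<dots> \<le> (\<integral>\<^sup>+ x. ennreal (min (\<gamma>^Suc m * V x + (\<Sum>i<Suc m. \<gamma>^i * C)) M) \<partial>P)"
  proof (rule nn_integral_mono)
    fix x assume "x \<in> space P" then have x: "x \<in> space S" by simp
    interpret Kx: prob_space "K x" by (rule K_prob[OF x])
    have mV: "V \<in> borel_measurable (K x)" using V_meas x by (simp cong: measurable_cong_sets)
    have "(\<integral>\<^sup>+ y. ?f y \<partial>K x) \<le> (\<integral>\<^sup>+ y. ennreal M \<partial>K x)" by (intro nn_integral_mono ennreal_leI) simp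
    also have "\<dots> = ennreal M" by (simp add: Kx.emeasure_space_1)
    finally have 1: "(\<integral>\<^sup>+ y. ?f y \<partial>K x) \<le> ennreal M" .
    have "(\<integral>\<^sup>+ y. ?f y \<partial>K x) \<le> (\<integral>\<^sup>+ y. ennreal (\<gamma>^m * V y + ?c) \<partial>K x)"
      by (intro nn_integral_mono ennreal_leI) simp
    also have "\<dots> = ennreal (\<gamma>^m * (\<integral>y. V y \<partial>K x) + ?c)"
      using V_integrable_K[OF x] V_nonneg \<gamma> c x
      by (subst nn_integral_eq_integral) (auto simp: Kx.prob_space intro!: AE_I2)
    also have "\<dots> \<le> ennreal (\<gamma>^m * (\<gamma> * V x + C) + ?c)"
      using V_integrable_K[OF x] \<gamma> by (intro ennreal_leI add_right_mono mult_left_mono) auto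
    also have "\<gamma>^m * (\<gamma> * V x + C) + ?c = \<gamma>^Suc m * V x + (\<Sum>i<Suc m. \<gamma>^i * C)"
      by (simp add: algebra_simps)
    finally show "(\<integral>\<^sup>+ y. ?f y \<partial>K x) \<le> ennreal (min (\<gamma>^Suc m * V x + (\<Sum>i<Suc m. \<gamma>^i * C)) M)"
      using 1 by (simp add: min_def)
  qed
  finally show ?case using Suc by (rule order_trans[rotated])
qed (auto intro!: nn_integral_mono)

text \<open>For fixed \<open>M\<close> the term \<open>\<gamma>^m * V x\<close> vanishes as
  \<open>m\<close> grows, which leaves the bound \<open>C / (1 - \<gamma>)\<close> independent of
  \<open>M\<close>; monotone convergence then removes the truncation. This makes the prefactor
  \<open>J\<close> finite.\<close>

lemma V_integrable_P: "integrable P V"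
proof -
  interpret P: prob_space P by (rule P_prob)
  define C' where "C' = C / (1 - \<gamma>)"
  have C': "0 \<le> C'" using \<gamma> C by (simp add: C'_def)
  have mV: "V \<in> borel_measurable P" using V_meas P_sets by (simp cong: measurable_cong_sets)
  have geo: "(\<Sum>i<m. \<gamma>^i * C) \<le> C'" for m
  proof -
    have "(\<Sum>i<m. \<gamma>^i * C) = C * (\<Sum>i<m. \<gamma>^i)" by (simp add: sum_distrib_left mult.commute)
    also have "\<dots> = C * ((1 - \<gamma>^m) / (1 - \<gamma>))" using \<gamma> by (simp add: sum_gp_strict)
    also have "\<dots> \<le> C * (1 / (1 - \<gamma>))" using \<gamma> C by (intro mult_left_mono divide_right_mono) auto
    finally show ?thesis by (simp add: C'_def)
  qed
  have bd: "(\<integral>\<^sup>+ x. ennreal (min (V x) M) \<partial>P) \<le> ennreal C'" if M: "0 \<le> M" for M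
  proof -
    let ?g = "\<lambda>m x. min (\<gamma>^m * V x + C') M"
    have le: "(\<integral>\<^sup>+ x. ennreal (min (V x) M) \<partial>P) \<le> (\<integral>\<^sup>+ x. ennreal (?g m x) \<partial>P)" for m
      using geo[of m] by (intro order_trans[OF truncated_V_bound[OF M, of m]] nn_integral_mono ennreal_leI min.mono) auto
    have "(\<lambda>m. \<integral>\<^sup>+ x. ennreal (?g m x) \<partial>P) \<longlonglongrightarrow> (\<integral>\<^sup>+ x. ennreal (min C' M) \<partial>P)"
    proof (rule nn_integral_dominated_convergence[where w="\<lambda>_. ennreal M"])
      show "AE x in P. (\<lambda>m. ennreal (?g m x)) \<longlonglongrightarrow> ennreal (min C' M)"
      proof (rule AE_I2, rule tendsto_ennrealI)
        fix x
        have l0: "(\<lambda>m. \<gamma>^m) \<longlonglongrightarrow> 0" using \<gamma> by (intro LIMSEQ_power_zero) auto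
        have "(\<lambda>m. \<gamma>^m * V x + C') \<longlonglongrightarrow> 0 * V x + C'" by (intro tendsto_intros l0)
        then show "(\<lambda>m. ?g m x) \<longlonglongrightarrow> min C' M" by (intro tendsto_min) auto
      qed
      show "(\<integral>\<^sup>+ x. ennreal M \<partial>P) < \<infinity>" by (simp add: P.emeasure_space_1)
    qed (use mV in \<open>auto intro!: AE_I2 ennreal_leI\<close>)
    then have "(\<integral>\<^sup>+ x. ennreal (min (V x) M) \<partial>P) \<le> (\<integral>\<^sup>+ x. ennreal (min C' M) \<partial>P)"
      by (rule LIMSEQ_le_const) (use le in auto)
    also have "\<dots> \<le> ennreal C'" by (auto simp: P.emeasure_space_1 intro!: ennreal_leI)
    finally show ?thesis .
  qed
  have "(\<integral>\<^sup>+ x. ennreal (V x) \<partial>P) = (\<integral>\<^sup>+ x. (SUP k. ennreal (min (V x) (real k))) \<partial>P)"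
  proof (rule nn_integral_cong)
    fix x assume "x \<in> space P"
    obtain k where k: "V x \<le> real k" using real_arch_simple by blast
    show "ennreal (V x) = (SUP k. ennreal (min (V x) (real k)))"
    proof (rule antisym)
      show "ennreal (V x) \<le> (SUP k. ennreal (min (V x) (real k)))"
        by (rule SUP_upper2[of k]) (use k in auto)
      show "(SUP k. ennreal (min (V x) (real k))) \<le> ennreal (V x)"
        by (intro SUP_least ennreal_leI) auto
    qed
  qed
  also have "\<dots> = (SUP k. \<integral>\<^sup>+ x. ennreal (min (V x) (real k)) \<partial>P)"
    using mV by (intro nn_integral_monotone_convergence_SUP) (auto simp: incseq_def le_fun_def intro!: ennreal_leI)
  also have "\<dots> \<le> ennreal C'" by (intro SUP_least bd) simp
  finally have "(\<integral>\<^sup>+ x. ennreal (V x) \<partial>P) < \<infinity>" by (simp add: le_less_trans)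
  then show ?thesis using mV V_nonneg by (intro integrableI_nonneg) (auto intro!: AE_I2)
qed

text \<open>The oscillation seminorm of Hairer and Mattingly, weighted by \<open>2 + \<beta> V x + \<beta> V y\<close>.\<close>

definition osc_le :: "real \<Rightarrow> real \<Rightarrow> ('a \<Rightarrow> real) \<Rightarrow> bool" where
  "osc_le \<beta> L f \<longleftrightarrow> (\<forall>x\<in>space S. \<forall>y\<in>space S. \<bar>f x - f y\<bar> \<le> L * (2 + \<beta> * (V x + V y)))"

text \<open>Passes from the seminorm to a weighted sup norm modulo constants: every
  \<open>f x - L * (1 + \<beta> * V x)\<close> lies below every
  \<open>f y + L * (1 + \<beta> * V y)\<close>, so the supremum of the former separates the two
  families.\<close>

lemma osc_le_centre:
  assumes o: "osc_le \<beta> L f" and L: "0 \<le> L" "0 \<le> \<beta>" and ne: "space S \<noteq> {}"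
  shows "\<exists>c. \<forall>x\<in>space S. \<bar>f x - c\<bar> \<le> L * (1 + \<beta> * V x)"
proof -
  let ?h = "\<lambda>x. f x - L * (1 + \<beta> * V x)"
  have le: "?h x \<le> f y + L * (1 + \<beta> * V y)" if "x \<in> space S" "y \<in> space S" for x y
  proof -
    have "f x - f y \<le> L * (2 + \<beta> * (V x + V y))" using o that by (fastforce simp: osc_le_def)
    then show ?thesis by (simp add: algebra_simps)
  qed
  obtain x0 where x0: "x0 \<in> space S" using ne by auto
  have bdd: "bdd_above (?h ` space S)" using le[OF _ x0] by (auto intro!: bdd_aboveI2)
  define c where "c = (SUP x\<in>space S. ?h x)"
  have "\<bar>f x - c\<bar> \<le> L * (1 + \<beta> * V x)" if x: "x \<in> space S" for x
  proof -
    have "?h x \<le> c" unfolding c_def by (rule cSUP_upper[OF x bdd])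
    moreover have "c \<le> f x + L * (1 + \<beta> * V x)" unfolding c_def using le[OF _ x] ne by (intro cSUP_least) auto
    ultimately show ?thesis by auto
  qed
  then show ?thesis by blast
qed

lemma sub_measure_integral_le:
  fixes g :: "'a \<Rightarrow> real"
  assumes x: "x \<in> space S" and N: "sets N = sets S" "\<And>A. A \<in> sets S \<Longrightarrow> emeasure N A \<le> emeasure (K x) A"
    and g: "integrable (K x) g" "\<And>y. y \<in> space S \<Longrightarrow> 0 \<le> g y"
  shows "integrable N g" "(\<integral>y. g y \<partial>N) \<le> (\<integral>y. g y \<partial>K x)"
proof -
  have sp: "space N = space S" using N(1) by (rule sets_eq_imp_space_eq)
  have le: "N \<le> K x" using N x by (subst le_measure) auto
  have nn: "(\<integral>\<^sup>+ y. ennreal (g y) \<partial>N) \<le> (\<integral>\<^sup>+ y. ennreal (g y) \<partial>K x)"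
    by (rule nn_integral_mono_measure[OF _ le]) (use N x in auto)
  have gm: "g \<in> borel_measurable N" using g(1) N x by (simp cong: measurable_cong_sets)
  have fin: "(\<integral>\<^sup>+ y. ennreal (g y) \<partial>K x) = ennreal (\<integral>y. g y \<partial>K x)"
    by (rule nn_integral_eq_integral) (use g x in \<open>auto intro!: AE_I2\<close>)
  then show i: "integrable N g" using nn gm g(2)
    by (intro integrableI_nonneg) (auto simp: sp le_less_trans intro!: AE_I2)
  have "ennreal (\<integral>y. g y \<partial>N) \<le> ennreal (\<integral>y. g y \<partial>K x)"
    using nn fin nn_integral_eq_integral[OF i AE_I2] g(2) by (simp add: sp)
  then show "(\<integral>y. g y \<partial>N) \<le> (\<integral>y. g y \<partial>K x)"
    by (subst (asm) ennreal_le_iff) (use g x in \<open>auto intro!: integral_nonneg_AE AE_I2\<close>)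
qed

text \<open>Pairs with \<open>V x + V y\<close> above \<open>R\<close> contract by the drift alone;
  for the remaining pairs the common part \<open>N\<close> of the two kernels cancels. The constant
  \<open>\<beta>\<close> must be small enough that the drift constant \<open>C\<close> does not
  consume the gain from \<open>N\<close>.\<close>

lemma osc_contraction:
  "\<exists>\<beta> t. 0 < \<beta> \<and> 0 < t \<and> t < 1 \<and> (\<forall>L f. 0 \<le> L \<longrightarrow> unit_fn f \<longrightarrow> osc_le \<beta> L f \<longrightarrow> osc_le \<beta> (t * L) (Kop f))"
proof -
  \<comment> \<open>Beyond this level the drift gain \<open>(1 - \<gamma>) * s\<close> is at least
    \<open>4 * C\<close>: half of it pays for the two constants \<open>C\<close>, the other half
    remains as contraction.\<close>
  define R where "R = 4 * C / (1 - \<gamma>) + 1"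
  have R: "0 < R" using \<gamma> C by (simp add: R_def add_nonneg_pos)
  obtain N where N: "sets N = sets S" "emeasure N (space S) \<noteq> 0" "emeasure N (space S) \<noteq> \<infinity>"
      and Nle: "\<And>x A. x \<in> space S \<Longrightarrow> V x \<le> R \<Longrightarrow> A \<in> sets S \<Longrightarrow> emeasure N A \<le> emeasure (K x) A"
    using minor[of R] by blast
  have spN: "space N = space S" using N(1) by (rule sets_eq_imp_space_eq)
  interpret N: finite_measure N by (rule finite_measureI) (use N spN in auto)
  define \<alpha> where "\<alpha> = measure N (space N)"
  have \<alpha>: "0 < \<alpha>" using N spN unfolding \<alpha>_def by (simp add: measure_def enn2real_positive_iff top.not_eq_extremum[symmetric] zero_less_iff_neq_zero)
  \<comment> \<open>Chosen so that \<open>2 * \<beta> * C \<le> \<alpha>\<close>; the cancellation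
    gains \<open>2 * \<alpha>\<close>, of which at least \<open>\<alpha>\<close> survives.\<close>
  define \<beta> where "\<beta> = \<alpha> / (2 * C + 1)"
  have \<beta>: "0 < \<beta>" using \<alpha> C by (simp add: \<beta>_def)
  have \<beta>C: "2 * \<beta> * C \<le> \<alpha>"
  proof -
    have "\<beta> * (2 * C + 1) = \<alpha>" using C by (simp add: \<beta>_def)
    then have "2 * \<beta> * C = \<alpha> - \<beta>" by (simp add: algebra_simps)
    then show ?thesis using \<beta> by simp
  qed
  define \<gamma>1 where "\<gamma>1 = (1 + \<gamma>) / 2"
  have \<gamma>1: "0 < \<gamma>1" "\<gamma>1 < 1" "\<gamma> \<le> \<gamma>1" using \<gamma> by (auto simp: \<gamma>1_def)
  \<comment> \<open>The contraction ratio of a far pair at the threshold \<open>s = R\<close>. Since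
    \<open>\<gamma>1 \<le> t1\<close>, the same ratio serves for all larger
    \<open>s\<close>.\<close>
  define t1 where "t1 = (2 + \<beta> * R * \<gamma>1) / (2 + \<beta> * R)"
  define t where "t = max (max t1 (1 - \<alpha> / 2)) (max \<gamma> (1 / 2))"
  have \<beta>R: "0 < \<beta> * R" using \<beta> R by simp
  have t1: "t1 < 1" using \<beta>R \<gamma>1 mult_strict_left_mono[OF \<gamma>1(2) \<beta>R] by (simp add: t1_def)
  have t1': "t1 * (2 + \<beta> * R) = 2 + \<beta> * R * \<gamma>1" using \<beta>R by (simp add: t1_def)
  have t1g: "\<gamma>1 \<le> t1"
  proof -
    have "\<gamma>1 * (2 + \<beta> * R) \<le> t1 * (2 + \<beta> * R)" unfolding t1' using \<gamma>1 by (simp add: algebra_simps)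
    then show ?thesis using \<beta>R by (simp add: mult_le_cancel_right)
  qed
  have t: "0 < t" "t < 1" "t1 \<le> t" "1 - \<alpha> / 2 \<le> t" "\<gamma> \<le> t" using t1 \<alpha> \<gamma> by (auto simp: t_def)
  have step: "osc_le \<beta> (t * L) (Kop f)" if L: "0 \<le> L" and f: "unit_fn f" and o: "osc_le \<beta> L f" for L f
  proof (unfold osc_le_def, intro ballI)
    fix x y assume x: "x \<in> space S" and y: "y \<in> space S"
    then have ne: "space S \<noteq> {}" by auto
    obtain c where c: "\<And>x. x \<in> space S \<Longrightarrow> \<bar>f x - c\<bar> \<le> L * (1 + \<beta> * V x)"
      using osc_le_centre[OF o L less_imp_le[OF \<beta>] ne] by blast
    let ?g = "\<lambda>z. L * (1 + \<beta> * V z)"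
    have fi: "integrable (K z) f" if "z \<in> space S" for z using f that by (auto intro!: unit_fn_integrable K_prob)
    have Kg: "integrable (K z) ?g" "(\<integral>u. ?g u \<partial>K z) \<le> L * (1 + \<beta> * (\<gamma> * V z + C))" if z: "z \<in> space S" for z
    proof -
      interpret Kz: prob_space "K z" by (rule K_prob[OF z])
      show "integrable (K z) ?g" using V_integrable_K[OF z] by auto
      have "(\<integral>u. ?g u \<partial>K z) = L * (1 + \<beta> * (\<integral>u. V u \<partial>K z))"
        using V_integrable_K(1)[OF z] by (simp add: Kz.prob_space)
      also have "\<dots> \<le> L * (1 + \<beta> * (\<gamma> * V z + C))"
        using V_integrable_K(2)[OF z] \<beta> L by (intro mult_left_mono add_left_mono) auto
      finally show "(\<integral>u. ?g u \<partial>K z) \<le> L * (1 + \<beta> * (\<gamma> * V z + C))" .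
    qed
    have Kc: "Kop f z - c = (\<integral>u. f u - c \<partial>K z)" if z: "z \<in> space S" for z
    proof -
      interpret Kz: prob_space "K z" by (rule K_prob[OF z])
      show ?thesis using fi[OF z] by (simp add: Kop_def Kz.prob_space)
    qed
    have fci: "integrable (K z) (\<lambda>u. f u - c)" if z: "z \<in> space S" for z
    proof -
      interpret Kz: prob_space "K z" by (rule K_prob[OF z])
      show ?thesis using fi[OF z] by simp
    qed
    define s where "s = V x + V y"
    have s0: "0 \<le> s" using V_nonneg x y by (simp add: s_def)
    show "\<bar>Kop f x - Kop f y\<bar> \<le> t * L * (2 + \<beta> * (V x + V y))"
    proof (cases "s \<le> R")
      \<comment> \<open>Far pair: both values of \<open>Kop f\<close> are compared with the centre
        \<open>c\<close>, and the drift bounds the weight \<open>?g\<close>.\<close>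
      case False
      have b: "\<bar>Kop f z - c\<bar> \<le> L * (1 + \<beta> * (\<gamma> * V z + C))" if z: "z \<in> space S" for z
      proof -
        have "\<bar>\<integral>u. f u - c \<partial>K z\<bar> \<le> (\<integral>u. ?g u \<partial>K z)"
          by (intro abs_integral_le[OF fci[OF z] Kg(1)[OF z]]) (use c z in auto)
        then show ?thesis using Kg(2)[OF z] Kc[OF z] by simp
      qed
      have "\<bar>Kop f x - Kop f y\<bar> \<le> L * (2 + \<beta> * \<gamma> * s + 2 * \<beta> * C)"
        using b[OF x] b[OF y] by (simp add: s_def algebra_simps)
      also have "2 + \<beta> * \<gamma> * s + 2 * \<beta> * C \<le> 2 + \<beta> * s * \<gamma>1"
      proof -
        have "4 * C / (1 - \<gamma>) \<le> s" using False by (simp add: R_def)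
        then have "4 * C \<le> s * (1 - \<gamma>)" using \<gamma> by (simp add: field_simps)
        then have "\<beta> * (4 * C) \<le> \<beta> * (s * (1 - \<gamma>))" using \<beta> by (intro mult_left_mono) auto
        then show ?thesis by (simp add: \<gamma>1_def field_simps)
      qed
      also have "2 + \<beta> * s * \<gamma>1 \<le> t1 * (2 + \<beta> * s)"
      proof -
        have "\<beta> * (s - R) * \<gamma>1 \<le> \<beta> * (s - R) * t1" using False \<beta> t1g by (intro mult_left_mono) auto
        then show ?thesis using t1' by (simp add: algebra_simps)
      qed
      also have "t1 * (2 + \<beta> * s) \<le> t * (2 + \<beta> * s)" using t s0 \<beta> by (intro mult_right_mono) auto
      finally show ?thesis using L by (simp add: s_def algebra_simps mult_left_mono mult_right_mono)
    next
      \<comment> \<open>Near pair: as \<open>V\<close> is nonnegative, both points lie in the level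
        set, and the integral of \<open>f - c\<close> over the common part \<open>N\<close> drops
        out of the difference.\<close>
      case True
      then have VR: "V x \<le> R" "V y \<le> R" using V_nonneg[OF x] V_nonneg[OF y] by (auto simp: s_def)
      have g0: "0 \<le> ?g u" if "u \<in> space S" for u using V_nonneg[OF that] L \<beta> by simp
      have Ng: "integrable N ?g" "\<alpha> * L \<le> (\<integral>u. ?g u \<partial>N)"
      proof -
        show i: "integrable N ?g" by (rule sub_measure_integral_le(1)[OF x N(1) Nle[OF x VR(1)] Kg(1)[OF x] g0])
        have "(\<integral>u. L \<partial>N) \<le> (\<integral>u. ?g u \<partial>N)"
          by (rule integral_mono) (use i V_nonneg L \<beta> spN in \<open>auto simp: mult_left_mono algebra_simps\<close>)
        then show "\<alpha> * L \<le> (\<integral>u. ?g u \<partial>N)" by (simp add: \<alpha>_def mult.commute)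
      qed
      have fm: "(\<lambda>u. f u - c) \<in> borel_measurable N"
        using f measurable_cong_sets[OF N(1) refl, of borel] unfolding unit_fn_def by (auto intro: borel_measurable_diff)
      have Nf: "integrable N (\<lambda>u. f u - c)"
        by (rule Bochner_Integration.integrable_bound[OF Ng(1) fm]) (use c g0 spN in \<open>auto intro!: AE_I2\<close>)
      \<comment> \<open>Monotonicity from \<open>N\<close> to \<open>K z\<close> needs nonnegative
        integrands. The functions \<open>?g - (f - c)\<close> and \<open>?g + (f - c)\<close> are
        nonnegative by the choice of \<open>c\<close> and give the two signs.\<close>
      have up: "Kop f z - c - (\<integral>u. f u - c \<partial>N) \<le> (\<integral>u. ?g u \<partial>K z) - (\<integral>u. ?g u \<partial>N)"
        and lo: "- (Kop f z - c - (\<integral>u. f u - c \<partial>N)) \<le> (\<integral>u. ?g u \<partial>K z) - (\<integral>u. ?g u \<partial>N)"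
        if z: "z \<in> space S" "V z \<le> R" for z
      proof -
        note Nz = Nle[OF z]
        have "(\<integral>u. ?g u - (f u - c) \<partial>N) \<le> (\<integral>u. ?g u - (f u - c) \<partial>K z)"
          by (rule sub_measure_integral_le(2)[OF z(1) N(1) Nz]) (use Kg fci z c in \<open>auto simp: abs_le_iff\<close>)
        then show "Kop f z - c - (\<integral>u. f u - c \<partial>N) \<le> (\<integral>u. ?g u \<partial>K z) - (\<integral>u. ?g u \<partial>N)"
          using Kc[OF z(1)]
            Bochner_Integration.integral_diff[OF Ng(1) Nf] Bochner_Integration.integral_diff[OF Kg(1)[OF z(1)] fci[OF z(1)]]
          by linarith
        have "(\<integral>u. ?g u + (f u - c) \<partial>N) \<le> (\<integral>u. ?g u + (f u - c) \<partial>K z)"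
          by (rule sub_measure_integral_le(2)[OF z(1) N(1) Nz])
             (use Kg fci z c in \<open>auto simp: abs_le_iff, smt (verit)\<close>)
        then show "- (Kop f z - c - (\<integral>u. f u - c \<partial>N)) \<le> (\<integral>u. ?g u \<partial>K z) - (\<integral>u. ?g u \<partial>N)"
          using Kc[OF z(1)]
            Bochner_Integration.integral_add[OF Ng(1) Nf] Bochner_Integration.integral_add[OF Kg(1)[OF z(1)] fci[OF z(1)]]
          by linarith
      qed
      have "\<bar>Kop f x - Kop f y\<bar> \<le> (\<integral>u. ?g u \<partial>K x) + (\<integral>u. ?g u \<partial>K y) - 2 * (\<integral>u. ?g u \<partial>N)"
        using up[OF x VR(1)] lo[OF x VR(1)] up[OF y VR(2)] lo[OF y VR(2)] by linarith
      also have "\<dots> \<le> L * (1 + \<beta> * (\<gamma> * V x + C)) + L * (1 + \<beta> * (\<gamma> * V y + C)) - 2 * (\<alpha> * L)"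
        using Kg(2)[OF x] Kg(2)[OF y] Ng(2) by linarith
      also have "\<dots> = L * (2 - 2 * \<alpha> + 2 * \<beta> * C + \<beta> * \<gamma> * s)" by (simp add: s_def algebra_simps)
      also have "\<dots> \<le> L * (t * (2 + \<beta> * s))"
      proof (rule mult_left_mono[OF _ L])
        have "\<gamma> * (\<beta> * s) \<le> t * (\<beta> * s)" using t s0 \<beta> by (intro mult_right_mono) auto
        then show "2 - 2 * \<alpha> + 2 * \<beta> * C + \<beta> * \<gamma> * s \<le> t * (2 + \<beta> * s)"
          using \<beta>C t(4) by (simp add: algebra_simps)
      qed
      finally show ?thesis by (simp add: s_def algebra_simps)
    qed
  qed
  show ?thesis using \<beta> t step by blast
qed

text \<open>An indicator oscillates by at most 1, so the contraction can start with
  \<open>L = 1\<close>. Averaging the second point over the invariant \<open>P\<close> turns the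
  weight into \<open>J\<close>.\<close>

theorem geom_ergodic_of_drift_minorization: "geom_ergodic S K P"
proof -
  obtain \<beta> t where bt: "0 < \<beta>" "0 < t" "t < 1"
    and step: "\<And>L f. 0 \<le> L \<Longrightarrow> unit_fn f \<Longrightarrow> osc_le \<beta> L f \<Longrightarrow> osc_le \<beta> (t * L) (Kop f)"
    using osc_contraction by blast
  interpret P: prob_space P by (rule P_prob)
  have osc: "osc_le \<beta> (t ^ m) ((Kop ^^ m) f)" if f: "unit_fn f" for f m
  proof (induction m)
    case 0
    have "\<bar>f x - f y\<bar> \<le> 2 + \<beta> * (V x + V y)" if "x \<in> space S" "y \<in> space S" for x y
    proof -
      have "0 \<le> \<beta> * (V x + V y)" using bt V_nonneg that by simp
      moreover have "\<bar>f x - f y\<bar> \<le> 1" using f that unfolding unit_fn_def by (smt (verit))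
      ultimately show ?thesis by linarith
    qed
    then show ?case by (simp add: osc_le_def)
  next
    case (Suc m)
    then show ?case using step[OF _ Kpow_unit[OF f] Suc] bt by simp
  qed
  let ?J = "\<lambda>x. 2 + \<beta> * (V x + (\<integral>y. V y \<partial>P))"
  have "tv_dist (kstep S K m x) P \<le> ?J x * t ^ m" if x: "x \<in> space S" for x m
  proof -
    have ks: "sets (kstep S K m x) = sets S" and kp: "prob_space (kstep S K m x)" using kstep_prob[OF x] by auto
    have ksp: "space (kstep S K m x) = space S" using ks by (rule sets_eq_imp_space_eq)
    show ?thesis unfolding tv_dist_def
    proof (rule cSUP_least)
      show "sets (kstep S K m x) \<noteq> {}" by auto
      fix A assume "A \<in> sets (kstep S K m x)"
      then have A: "A \<in> sets S" using ks by simp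
      let ?f = "indicator A :: 'a \<Rightarrow> real"
      have f: "unit_fn ?f" using A by (auto simp: unit_fn_def)
      have 1: "measure (kstep S K m x) A = (Kop ^^ m) ?f x"
        using kstep_integral[OF f x, of m] A sets.sets_into_space[OF A] ks ksp by (simp add: Int_absorb2)
      have 2: "measure P A = (\<integral>y. (Kop ^^ m) ?f y \<partial>P)"
        using P_integral[OF f, of m] A sets.sets_into_space[OF A] by (simp add: Int_absorb2)
      let ?h = "(Kop ^^ m) ?f"
      have hi: "integrable P ?h" by (rule unit_fn_integrable[OF Kpow_unit[OF f] P_sets P_prob])
      have "\<bar>?h x - (\<integral>y. ?h y \<partial>P)\<bar> = \<bar>\<integral>y. ?h x - ?h y \<partial>P\<bar>"
        using hi by (simp add: P.prob_space)
      also have "\<dots> \<le> (\<integral>y. t ^ m * (2 + \<beta> * (V x + V y)) \<partial>P)"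
        using osc[OF f, of m] x hi V_integrable_P
        by (intro abs_integral_le) (auto simp: osc_le_def)
      also have "\<dots> = ?J x * t ^ m" using V_integrable_P by (simp add: P.prob_space)
      finally show "\<bar>measure (kstep S K m x) A - measure P A\<bar> \<le> ?J x * t ^ m" using 1 2 by simp
    qed
  qed
  then show ?thesis unfolding geom_ergodic_def using bt by (intro exI[of _ t] exI[of _ ?J]) auto
qed

end

section \<open>Orthogonal projections onto column spaces\<close>

text \<open>The body of the definite description in \<open>proj\<close>, separated so that existence
  and uniqueness can be settled before the description is evaluated. Entries outside the
  \<open>m\<close> by \<open>m\<close> square are set to 0 to make the matrix unique as a
  function.\<close>

definition is_proj :: "nat \<Rightarrow> nat \<Rightarrow> (nat \<Rightarrow> nat \<Rightarrow> real) \<Rightarrow> (nat \<Rightarrow> nat \<Rightarrow> real) \<Rightarrow> bool" where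
  "is_proj m k M P \<longleftrightarrow> (\<forall>i j. (m \<le> i \<or> m \<le> j) \<longrightarrow> P i j = 0) \<and>
     (\<forall>x::nat \<Rightarrow> real.
        (\<exists>c::nat \<Rightarrow> real. \<forall>i<m. (\<Sum>j<m. P i j * x j) = (\<Sum>l<k. M i l * c l)) \<and>
        (\<forall>c::nat \<Rightarrow> real. (\<Sum>i<m. (x i - (\<Sum>j<m. P i j * x j)) * (\<Sum>l<k. M i l * c l)) = 0))"

lemma is_proj_range: "is_proj m k M P \<Longrightarrow> \<exists>c. \<forall>i<m. (\<Sum>j<m. P i j * x j) = (\<Sum>l<k. M i l * c l)"
  and is_proj_orth: "is_proj m k M P \<Longrightarrow> (\<Sum>i<m. (x i - (\<Sum>j<m. P i j * x j)) * (\<Sum>l<k. M i l * c l)) = 0"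
  and is_proj_zero: "is_proj m k M P \<Longrightarrow> m \<le> i \<or> m \<le> j \<Longrightarrow> P i j = 0"
  by (auto simp: is_proj_def)

lemma is_proj_orth_proj:
  assumes "is_proj m k M P"
  shows "(\<Sum>i<m. (x i - (\<Sum>j<m. P i j * x j)) * (\<Sum>j<m. P i j * z j)) = 0"
proof -
  obtain c where "\<forall>i<m. (\<Sum>j<m. P i j * z j) = (\<Sum>l<k. M i l * c l)" using is_proj_range[OF assms] by blast
  then show ?thesis using is_proj_orth[OF assms, of x c] by simp
qed

lemma sum_unit_vec:
  fixes f :: "nat \<Rightarrow> real"
  shows "i < m \<Longrightarrow> (\<Sum>j<m. f j * (if j = i then 1 else 0)) = f i"
  by (subst sum.mono_neutral_right[of "{..<m}" "{i}"]) auto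

text \<open>Both residuals of a unit vector are orthogonal to the difference of the two images, and
  that difference is the difference of the residuals, hence orthogonal to itself.\<close>

lemma is_proj_unique:
  assumes P: "is_proj m k M P" and Q: "is_proj m k M Q"
  shows "P = Q"
proof (intro ext)
  fix i j
  show "P i j = Q i j"
  proof (cases "i < m \<and> j < m")
    case False then show ?thesis using is_proj_zero[OF P] is_proj_zero[OF Q] by (metis not_less)
  next
    case True
    let ?x = "\<lambda>l. if l = j then 1 else 0 :: real"
    let ?p = "\<lambda>i. \<Sum>l<m. P i l * ?x l" and ?q = "\<lambda>i. \<Sum>l<m. Q i l * ?x l"
    obtain c where c: "\<forall>i<m. ?p i = (\<Sum>l<k. M i l * c l)" using is_proj_range[OF P, of ?x] by blast
    obtain e where e: "\<forall>i<m. ?q i = (\<Sum>l<k. M i l * e l)" using is_proj_range[OF Q, of ?x] by blast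
    have de: "?p i - ?q i = (\<Sum>l<k. M i l * (c l - e l))" if "i < m" for i
      using c e that by (simp only: right_diff_distrib sum_subtractf)
    have 1: "(\<Sum>i<m. (?x i - ?p i) * (?p i - ?q i)) = 0"
    proof -
      have "(\<Sum>i<m. (?x i - ?p i) * (?p i - ?q i)) = (\<Sum>i<m. (?x i - ?p i) * (\<Sum>l<k. M i l * (c l - e l)))"
        by (intro sum.cong refl) (simp only: de lessThan_iff)
      then show ?thesis using is_proj_orth[OF P, of ?x "\<lambda>l. c l - e l"] by simp
    qed
    have 2: "(\<Sum>i<m. (?x i - ?q i) * (?p i - ?q i)) = 0"
    proof -
      have "(\<Sum>i<m. (?x i - ?q i) * (?p i - ?q i)) = (\<Sum>i<m. (?x i - ?q i) * (\<Sum>l<k. M i l * (c l - e l)))"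
        by (intro sum.cong refl) (simp only: de lessThan_iff)
      then show ?thesis using is_proj_orth[OF Q, of ?x "\<lambda>l. c l - e l"] by simp
    qed
    have "(\<Sum>i<m. (?p i - ?q i)\<^sup>2) = (\<Sum>i<m. (?x i - ?q i) * (?p i - ?q i)) - (\<Sum>i<m. (?x i - ?p i) * (?p i - ?q i))"
    proof -
      have idt: "(p - q)\<^sup>2 = (x - q) * (p - q) - (x - p) * (p - q)" for p q x :: real
        by (simp add: power2_eq_square algebra_simps)
      show ?thesis by (subst sum_subtractf[symmetric], intro sum.cong refl, rule idt)
    qed
    then have "(\<Sum>i<m. (?p i - ?q i)\<^sup>2) = 0" using 1 2 by simp
    then have "(?p i - ?q i)\<^sup>2 = 0" using True by (subst (asm) sum_nonneg_eq_0_iff) auto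
    then show ?thesis using True by (simp add: sum_unit_vec)
  qed
qed

text \<open>Gram-Schmidt, one column at a time: \<open>w\<close> is the part of the new column
  orthogonal to the earlier ones. If it vanishes, the old projection still works; otherwise a
  rank-one term is added.\<close>

lemma is_proj_exists: "\<exists>P. is_proj m k M P"
proof (induction k)
  case 0
  show ?case by (rule exI[of _ "\<lambda>_ _. 0"]) (simp add: is_proj_def)
next
  case (Suc k)
  then obtain P where P: "is_proj m k M P" by blast
  define w where "w i = M i k - (\<Sum>j<m. P i j * M j k)" for i
  obtain c0 where c0: "\<forall>i<m. (\<Sum>j<m. P i j * M j k) = (\<Sum>l<k. M i l * c0 l)" using is_proj_range[OF P, of "\<lambda>j. M j k"] by blast
  define W where "W = (\<Sum>i<m. (w i)\<^sup>2)"
  have wM: "(\<Sum>i<m. w i * (\<Sum>l<k. M i l * c l)) = 0" for c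
    using is_proj_orth[OF P, of "\<lambda>j. M j k" c] by (simp add: w_def)
  have decomp: "\<exists>c'. \<forall>i<m. (\<Sum>l<Suc k. M i l * c l) = (\<Sum>l<k. M i l * c' l) + w i * c k" for c
  proof (intro exI[of _ "\<lambda>l. c l + c0 l * c k"] allI impI)
    fix i assume i: "i < m"
    have "M i k = w i + (\<Sum>l<k. M i l * c0 l)" using c0 i by (simp add: w_def)
    then have "M i k * c k = w i * c k + (\<Sum>l<k. M i l * c0 l * c k)" by (simp only: distrib_right sum_distrib_right)
    then show "(\<Sum>l<Suc k. M i l * c l) = (\<Sum>l<k. M i l * (c l + c0 l * c k)) + w i * c k"
      by (simp add: algebra_simps sum.distrib)
  qed
  show ?case
  proof (cases "W = 0")
    case True
    then have w0: "w i = 0" if "i < m" for i using that unfolding W_def by (subst (asm) sum_nonneg_eq_0_iff) auto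
    have "is_proj m (Suc k) M P" unfolding is_proj_def
    proof (intro conjI allI)
      show "\<And>i j. m \<le> i \<or> m \<le> j \<longrightarrow> P i j = 0" using is_proj_zero[OF P] by blast
      fix x :: "nat \<Rightarrow> real"
      obtain c where c: "\<forall>i<m. (\<Sum>j<m. P i j * x j) = (\<Sum>l<k. M i l * c l)" using is_proj_range[OF P] by blast
      show "\<exists>c. \<forall>i<m. (\<Sum>j<m. P i j * x j) = (\<Sum>l<Suc k. M i l * c l)"
        by (rule exI[of _ "\<lambda>l. if l < k then c l else 0"]) (use c in auto)
      fix c
      obtain c' where c': "\<forall>i<m. (\<Sum>l<Suc k. M i l * c l) = (\<Sum>l<k. M i l * c' l) + w i * c k" using decomp by blast
      have "(\<Sum>i<m. (x i - (\<Sum>j<m. P i j * x j)) * (\<Sum>l<Suc k. M i l * c l))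
          = (\<Sum>i<m. (x i - (\<Sum>j<m. P i j * x j)) * (\<Sum>l<k. M i l * c' l))"
        by (intro sum.cong refl) (use c' w0 in simp)
      then show "(\<Sum>i<m. (x i - (\<Sum>j<m. P i j * x j)) * (\<Sum>l<Suc k. M i l * c l)) = 0"
        using is_proj_orth[OF P] by simp
    qed
    then show ?thesis by blast
  next
    case False
    \<comment> \<open>The added term is the projection onto the line of \<open>w\<close>;
      \<open>W\<close> is the squared length of \<open>w\<close>.\<close>
    define P' where "P' i j = (if i < m \<and> j < m then P i j + w i * w j / W else 0)" for i j
    have P'x: "(\<Sum>j<m. P' i j * x j) = (\<Sum>j<m. P i j * x j) + w i * ((\<Sum>j<m. w j * x j) / W)" if "i < m" for i x
      using that by (simp add: P'_def algebra_simps sum.distrib sum_distrib_left sum_divide_distrib)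
    have "is_proj m (Suc k) M P'" unfolding is_proj_def
    proof (intro conjI allI)
      show "\<And>i j. m \<le> i \<or> m \<le> j \<longrightarrow> P' i j = 0" by (auto simp: P'_def)
      fix x :: "nat \<Rightarrow> real"
      obtain cx where c: "\<forall>i<m. (\<Sum>j<m. P i j * x j) = (\<Sum>l<k. M i l * cx l)" using is_proj_range[OF P] by blast
      define t where "t = (\<Sum>j<m. w j * x j) / W"
      show "\<exists>c. \<forall>i<m. (\<Sum>j<m. P' i j * x j) = (\<Sum>l<Suc k. M i l * c l)"
      proof (rule exI[of _ "\<lambda>l. if l < k then cx l - t * c0 l else t"], intro allI impI)
        fix i assume i: "i < m"
        have "w i * t = M i k * t - (\<Sum>l<k. M i l * (t * c0 l))"
          using c0 i by (simp add: w_def left_diff_distrib sum_distrib_left sum_distrib_right algebra_simps)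
        then show "(\<Sum>j<m. P' i j * x j) = (\<Sum>l<Suc k. M i l * (if l < k then cx l - t * c0 l else t))"
          using P'x[OF i, of x] c i by (simp add: t_def right_diff_distrib sum_subtractf)
      qed
      fix c
      obtain c' where c': "\<forall>i<m. (\<Sum>l<Suc k. M i l * c l) = (\<Sum>l<k. M i l * c' l) + w i * c k" using decomp by blast
      let ?r = "\<lambda>i. x i - (\<Sum>j<m. P i j * x j)"
      have rw: "(\<Sum>i<m. ?r i * w i) = (\<Sum>j<m. w j * x j)"
      proof -
        have "(\<Sum>i<m. w i * (\<Sum>j<m. P i j * x j)) = (\<Sum>i<m. w i * (\<Sum>l<k. M i l * cx l))"
          by (intro sum.cong refl) (use c in simp)
        then have "(\<Sum>i<m. w i * (\<Sum>j<m. P i j * x j)) = 0" using wM by simp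
        then show ?thesis by (simp add: algebra_simps sum_subtractf)
      qed
      have "(\<Sum>i<m. (x i - (\<Sum>j<m. P' i j * x j)) * (\<Sum>l<Suc k. M i l * c l))
          = (\<Sum>i<m. ?r i * (\<Sum>l<k. M i l * c' l) + c k * (?r i * w i) - t * (w i * (\<Sum>l<k. M i l * c' l)) - c k * t * (w i)\<^sup>2)"
        using c' P'x[of _ x] by (intro sum.cong refl) (simp add: t_def algebra_simps power2_eq_square)
      also have "\<dots> = (\<Sum>i<m. ?r i * (\<Sum>l<k. M i l * c' l)) + c k * (\<Sum>i<m. ?r i * w i)
           - t * (\<Sum>i<m. w i * (\<Sum>l<k. M i l * c' l)) - c k * t * W"
        by (simp only: sum.distrib sum_subtractf sum_distrib_left[symmetric] W_def)
      also have "\<dots> = c k * (\<Sum>j<m. w j * x j) - c k * t * W"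
        using is_proj_orth[OF P, of x c'] wM rw by simp
      also have "\<dots> = 0" using False by (simp add: t_def)
      finally show "(\<Sum>i<m. (x i - (\<Sum>j<m. P' i j * x j)) * (\<Sum>l<Suc k. M i l * c l)) = 0" .
    qed
    then show ?thesis by blast
  qed
qed

lemma is_proj_proj: "is_proj m k M (proj m k M)"
proof -
  obtain P where P: "is_proj m k M P" using is_proj_exists by blast
  have "proj m k M = (THE P. is_proj m k M P)" by (simp add: proj_def is_proj_def)
  also have "\<dots> = P" using P is_proj_unique by (intro the_equality) auto
  finally show ?thesis using P by simp
qed

lemma is_proj_sym:
  assumes P: "is_proj m k M P" and i: "i < m" "j < m"
  shows "P i j = P j i"
proof -
  have bil: "(\<Sum>a<m. x a * (\<Sum>b<m. P a b * z b)) = (\<Sum>a<m. (\<Sum>b<m. P a b * x b) * (\<Sum>b<m. P a b * z b))" for x z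
    using is_proj_orth_proj[OF P, of x z] by (simp add: left_diff_distrib sum_subtractf)
  let ?e = "\<lambda>i a. if a = i then 1 else 0 :: real"
  have e: "(\<Sum>a<m. ?e i a * f a) = f i" if "i < m" for i and f :: "nat \<Rightarrow> real"
    using sum_unit_vec[OF that, of f] by (simp add: mult.commute)
  have "P i j = (\<Sum>a<m. ?e i a * (\<Sum>b<m. P a b * ?e j b))" using i by (simp add: e sum_unit_vec)
  also have "\<dots> = (\<Sum>a<m. ?e j a * (\<Sum>b<m. P a b * ?e i b))" 
    by (rule trans[OF bil], rule trans[OF _ bil[symmetric]]) (simp only: mult.commute)
  also have "\<dots> = P j i" using i by (simp add: e sum_unit_vec)
  finally show ?thesis .
qed

lemma is_proj_fix:
  assumes P: "is_proj m k M P" and x: "\<forall>i<m. x i = (\<Sum>l<k. M i l * c l)" and i: "i < m"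
  shows "(\<Sum>j<m. P i j * x j) = x i"
proof -
  obtain e where e: "\<forall>i<m. (\<Sum>j<m. P i j * x j) = (\<Sum>l<k. M i l * e l)" using is_proj_range[OF P] by blast
  have d: "x i - (\<Sum>j<m. P i j * x j) = (\<Sum>l<k. M i l * (c l - e l))" if "i < m" for i
    using x e that by (simp only: right_diff_distrib sum_subtractf)
  have "(\<Sum>i<m. (x i - (\<Sum>j<m. P i j * x j))\<^sup>2) = 0"
  proof -
    have "(\<Sum>i<m. (x i - (\<Sum>j<m. P i j * x j))\<^sup>2)
        = (\<Sum>i<m. (x i - (\<Sum>j<m. P i j * x j)) * (\<Sum>l<k. M i l * (c l - e l)))"
      unfolding power2_eq_square by (intro sum.cong refl) (simp only: d lessThan_iff)
    then show ?thesis using is_proj_orth[OF P, of x "\<lambda>l. c l - e l"] by simp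
  qed
  then have "(x i - (\<Sum>j<m. P i j * x j))\<^sup>2 = 0" using i by (subst (asm) sum_nonneg_eq_0_iff) auto
  then show ?thesis by simp
qed

lemma is_proj_kill:
  assumes P: "is_proj m k M P" and x: "\<forall>l<k. (\<Sum>i<m. x i * M i l) = 0" and i: "i < m"
  shows "(\<Sum>j<m. P i j * x j) = 0"
proof -
  obtain e where e: "\<forall>i<m. (\<Sum>j<m. P i j * x j) = (\<Sum>l<k. M i l * e l)" using is_proj_range[OF P] by blast
  have "(\<Sum>i<m. x i * (\<Sum>l<k. M i l * e l)) = (\<Sum>l<k. e l * (\<Sum>i<m. x i * M i l))"
    by (simp add: sum_distrib_left sum_distrib_right) (subst sum.swap, simp add: mult_ac)
  also have "\<dots> = 0" using x by simp
  finally have 1: "(\<Sum>i<m. x i * (\<Sum>l<k. M i l * e l)) = 0" .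
  have "(\<Sum>i<m. (\<Sum>j<m. P i j * x j)\<^sup>2) = (\<Sum>i<m. x i * (\<Sum>l<k. M i l * e l)) - (\<Sum>i<m. (x i - (\<Sum>j<m. P i j * x j)) * (\<Sum>l<k. M i l * e l))"
    unfolding sum_subtractf[symmetric] using e by (intro sum.cong) (auto simp: power2_eq_square algebra_simps)
  also have "\<dots> = 0" using 1 is_proj_orth[OF P, of x e] by simp
  finally have "(\<Sum>j<m. P i j * x j)\<^sup>2 = 0" using i by (subst (asm) sum_nonneg_eq_0_iff) auto
  then show ?thesis by simp
qed

lemma is_proj_complement_psd:
  assumes P: "is_proj m k M P"
  shows "0 \<le> (\<Sum>i<m. x i * (x i - (\<Sum>j<m. P i j * x j)))"
proof -
  have "(\<Sum>i<m. x i * (x i - (\<Sum>j<m. P i j * x j))) = (\<Sum>i<m. (x i - (\<Sum>j<m. P i j * x j))\<^sup>2)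
     + (\<Sum>i<m. (x i - (\<Sum>j<m. P i j * x j)) * (\<Sum>j<m. P i j * x j))"
    unfolding sum.distrib[symmetric] by (intro sum.cong) (auto simp: power2_eq_square algebra_simps)
  also have "\<dots> \<ge> 0" using is_proj_orth_proj[OF P, of x x] by (simp add: sum_nonneg)
  finally show ?thesis .
qed

text \<open>The complement \<open>I - P\<close> is positive semidefinite and symmetric; this is its
  quadratic form at the difference of two unit vectors.\<close>

lemma complement_entry_bound:
  assumes P: "is_proj m k M P" and i: "i < m" "j < m"
  shows "2 * (idm i j - P i j) \<le> (1 - P i i) + (1 - P j j)"
proof (cases "i = j")
  case False
  let ?x = "\<lambda>a. (if a = i then 1 else 0) - (if a = j then 1 else 0) :: real"
  have Px: "(\<Sum>b<m. P a b * ?x b) = P a i - P a j" for a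
    using i by (simp only: right_diff_distrib sum_subtractf sum_unit_vec)
  have "(\<Sum>a<m. ?x a * f a) = f i - f j" for f :: "nat \<Rightarrow> real"
  proof -
    have "(\<Sum>a<m. ?x a * f a) = (\<Sum>a<m. f a * (if a = i then 1 else 0)) - (\<Sum>a<m. f a * (if a = j then 1 else 0))"
      unfolding sum_subtractf[symmetric] by (intro sum.cong refl) (simp add: algebra_simps)
    then show ?thesis by (simp only: sum_unit_vec[OF i(1)] sum_unit_vec[OF i(2)])
  qed
  then have "0 \<le> (?x i - (P i i - P i j)) - (?x j - (P j i - P j j))"
    using is_proj_complement_psd[OF P, of ?x] unfolding Px by (simp only:)
  then show ?thesis using is_proj_sym[OF P i] False by (simp add: idm_def)
qed (simp add: idm_def)

section \<open>Indexing of concatenated blocks\<close>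

lemma sum_lessThan_add:
  fixes f :: "nat \<Rightarrow> 'b::comm_monoid_add"
  shows "(\<Sum>c<(a::nat) + b. f c) = (\<Sum>c<a. f c) + (\<Sum>k<b. f (a + k))"
  by (induction b) (simp_all add: add.assoc)

lemma sum_blocks:
  fixes f :: "nat \<Rightarrow> 'b::comm_monoid_add"
  shows "(\<Sum>c<(\<Sum>j<(r::nat). m j :: nat). f c) = (\<Sum>j<r. \<Sum>k<m j. f ((\<Sum>l<j. m l) + k))"
proof (induction r)
  case (Suc r)
  have "(\<Sum>c<(\<Sum>j<Suc r. m j). f c) = (\<Sum>c<(\<Sum>j<r. m j) + m r. f c)" by simp
  also have "\<dots> = (\<Sum>c<(\<Sum>j<r. m j). f c) + (\<Sum>k<m r. f ((\<Sum>l<r. m l) + k))"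
    by (rule sum_lessThan_add)
  finally show ?case using Suc by simp
qed simp

lemma block_index_unique:
  fixes m :: "nat \<Rightarrow> nat"
  assumes "k < m j" "k' < m j'" "(\<Sum>l<j. m l) + k = (\<Sum>l<j'. m l) + k'"
  shows "j = j' \<and> k = k'"
proof -
  have mono: "(\<Sum>l<j. m l) + m j \<le> (\<Sum>l<j'. m l)" if "j < j'" for j j' :: nat
  proof -
    have "(\<Sum>l<j. m l) + m j = (\<Sum>l<Suc j. m l)" by simp
    also have "\<dots> \<le> (\<Sum>l<j'. m l)" by (rule sum_mono2) (use that in auto)
    finally show ?thesis .
  qed
  have "j = j'"
  proof (rule ccontr)
    assume "j \<noteq> j'" then show False using mono[of j j'] mono[of j' j] assms by (cases "j < j'") auto
  qed
  then show ?thesis using assms by simp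
qed

lemma block_index_exists:
  fixes m :: "nat \<Rightarrow> nat"
  assumes "c < (\<Sum>j<r. m j)"
  shows "\<exists>j<r. \<exists>k<m j. c = (\<Sum>l<j. m l) + k"
  using assms
proof (induction r)
  case (Suc r)
  show ?case
  proof (cases "c < (\<Sum>j<r. m j)")
    case True then show ?thesis using Suc.IH less_SucI by blast
  next
    case False
    then show ?thesis using Suc.prems by (intro exI[of _ r] conjI exI[of _ "c - (\<Sum>j<r. m j)"]) auto
  qed
qed simp

lemma block_index_less:
  fixes m :: "nat \<Rightarrow> nat"
  assumes "j < r" "k < m j" shows "(\<Sum>l<j. m l) + k < (\<Sum>l<r. m l)"
proof -
  have "(\<Sum>l<j. m l) + k < (\<Sum>l<Suc j. m l)" using assms by simp
  also have "\<dots> \<le> (\<Sum>l<r. m l)" by (rule sum_mono2) (use assms in auto)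
  finally show ?thesis .
qed

section \<open>Injective linear systems\<close>

lemma linear_family_coercive:
  fixes A :: "nat \<Rightarrow> nat \<Rightarrow> real"
  assumes inj: "\<And>x. (\<forall>i<n. (\<Sum>c<d. A i c * x c) = 0) \<Longrightarrow> (\<forall>c<d. x c = 0)"
  shows "\<exists>\<kappa>>0. \<forall>x. \<kappa> * (\<Sum>c<d. (x c)\<^sup>2) \<le> (\<Sum>i<n. (\<Sum>c<d. A i c * x c)\<^sup>2)"
proof -
  \<comment> \<open>The normal matrix is injective, so the projection onto its column space is the identity and it is onto.\<close>
  define B where "B c l = (\<Sum>i<n. A i c * A i l)" for c l
  have Bx: "(\<Sum>l<d. B c l * x l) = (\<Sum>i<n. A i c * (\<Sum>l<d. A i l * x l))" for c x
    unfolding B_def sum_distrib_right sum_distrib_left by (subst sum.swap) (simp add: mult_ac)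
  have sw: "(\<Sum>c<d. z c * (\<Sum>i<n. A i c * t i)) = (\<Sum>i<n. (\<Sum>c<d. A i c * z c) * t i)" for z t
    unfolding sum_distrib_left sum_distrib_right by (subst sum.swap) (simp add: mult_ac)
  have xBx: "(\<Sum>c<d. z c * (\<Sum>l<d. B c l * x l)) = (\<Sum>i<n. (\<Sum>c<d. A i c * z c) * (\<Sum>l<d. A i l * x l))" for x z
    unfolding Bx by (rule sw)
  obtain P where P: "is_proj d d B P" using is_proj_exists by blast
  have solv: "\<exists>c. \<forall>i<d. (\<Sum>l<d. B i l * c l) = x i" for x
  proof -
    obtain c where c: "\<forall>i<d. (\<Sum>j<d. P i j * x j) = (\<Sum>l<d. B i l * c l)" using is_proj_range[OF P] by blast
    let ?z = "\<lambda>i. x i - (\<Sum>j<d. P i j * x j)"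
    have "(\<Sum>i<n. (\<Sum>c<d. A i c * ?z c)\<^sup>2) = 0"
      using is_proj_orth[OF P, of x ?z] xBx[of ?z ?z] by (simp add: power2_eq_square)
    then have "\<forall>i<n. (\<Sum>c<d. A i c * ?z c) = 0" by (subst (asm) sum_nonneg_eq_0_iff) auto
    then have "\<forall>c<d. ?z c = 0" by (rule inj)
    then show ?thesis using c by (intro exI[of _ c]) simp
  qed
  have "\<forall>j. \<exists>c. \<forall>i<d. (\<Sum>l<d. B i l * c l) = (if i = j then 1 else 0)"
    by (rule allI, rule solv)
  from choice[OF this]
  obtain g where g: "\<And>j i. i < d \<Longrightarrow> (\<Sum>l<d. B i l * g j l) = (if i = j then 1 else 0)" by blast
  define a where "a j i = (\<Sum>c<d. A i c * g j c)" for j i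
  \<comment> \<open>Each coordinate of \<open>x\<close> is an inner product of \<open>A x\<close>
    with a fixed vector \<open>a j\<close>, so the Cauchy-Schwarz inequality bounds it. The constant
    later is \<open>1 / (T + 1)\<close>, which stays meaningful when \<open>T = 0\<close>.\<close>
  have rep: "x j = (\<Sum>i<n. (\<Sum>c<d. A i c * x c) * a j i)" if "j < d" for j x
  proof -
    have "(\<Sum>c<d. x c * (\<Sum>l<d. B c l * g j l)) = (\<Sum>c<d. x c * (if c = j then 1 else 0))" using g by simp
    also have "\<dots> = x j" by (rule sum_unit_vec[OF that])
    finally show ?thesis using xBx[of x "g j"] by (simp add: a_def)
  qed
  define T where "T = (\<Sum>j<d. \<Sum>i<n. (a j i)\<^sup>2)"
  have T: "0 \<le> T" by (simp add: T_def sum_nonneg)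
  have "(\<Sum>c<d. (x c)\<^sup>2) \<le> (T + 1) * (\<Sum>i<n. (\<Sum>c<d. A i c * x c)\<^sup>2)" for x
  proof -
    let ?N = "\<Sum>i<n. (\<Sum>c<d. A i c * x c)\<^sup>2"
    have "(\<Sum>c<d. (x c)\<^sup>2) \<le> (\<Sum>j<d. ?N * (\<Sum>i<n. (a j i)\<^sup>2))"
    proof (intro sum_mono)
      fix j assume "j \<in> {..<d}"
      then have "(x j)\<^sup>2 = (\<Sum>i<n. (\<Sum>c<d. A i c * x c) * a j i)\<^sup>2" using rep[of j x] by simp
      then show "(x j)\<^sup>2 \<le> ?N * (\<Sum>i<n. (a j i)\<^sup>2)"
        by (simp only: Cauchy_Schwarz_ineq_sum)
    qed
    also have "\<dots> = T * ?N" unfolding T_def sum_distrib_left[symmetric] by (rule mult.commute)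
    also have "\<dots> \<le> (T + 1) * ?N" by (intro mult_right_mono) (auto simp: sum_nonneg)
    finally show ?thesis .
  qed
  then show ?thesis using T by (intro exI[of _ "1 / (T + 1)"]) (auto simp: field_simps)
qed

text \<open>The residual of \<open>b\<close> after projection onto the columns of \<open>S\<close>
  is orthogonal to each column, that is, annihilated by the transpose; injectivity of the transpose
  makes it 0.\<close>

lemma posdef_solvable:
  fixes S :: "nat \<Rightarrow> nat \<Rightarrow> real"
  assumes inj: "\<And>x. (\<forall>c<d. (\<Sum>l<d. S l c * x l) = 0) \<Longrightarrow> (\<forall>c<d. x c = 0)"
  shows "\<exists>x. \<forall>c<d. (\<Sum>l<d. S c l * x l) = b c"
proof -
  obtain P where P: "is_proj d d S P" using is_proj_exists by blast
  obtain c where c: "\<forall>i<d. (\<Sum>j<d. P i j * b j) = (\<Sum>l<d. S i l * c l)" using is_proj_range[OF P] by blast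
  let ?z = "\<lambda>i. b i - (\<Sum>j<d. P i j * b j)"
  have "(\<Sum>l<d. S l e * ?z l) = 0" if "e < d" for e
  proof -
    have "(\<Sum>i<d. ?z i * (\<Sum>l<d. S i l * (if l = e then 1 else 0))) = 0" by (rule is_proj_orth[OF P])
    then show ?thesis using that by (simp add: sum_unit_vec mult.commute)
  qed
  then have "\<forall>e<d. (\<Sum>l<d. S l e * ?z l) = 0" by blast
  then have "\<forall>c<d. ?z c = 0" by (rule inj)
  then show ?thesis using c by (intro exI[of _ c]) simp
qed

section \<open>Integration over products of Lebesgue measure\<close>

interpretation lb: product_sigma_finite "\<lambda>_. lborel :: real measure"
  by standard

abbreviation lebP :: "'i set \<Rightarrow> ('i \<Rightarrow> real) measure" where
  "lebP I \<equiv> PiM I (\<lambda>_. lborel)"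

text \<open>Diagonal scalings and translations are handled one coordinate at a time. Together with
  shears, treated by Fubini below, they are all the substitutions that the Gaussian integrals
  require.\<close>

lemma nn_integral_PiM_affine:
  fixes f :: "('i \<Rightarrow> real) \<Rightarrow> ennreal"
  assumes "finite I" "f \<in> borel_measurable (lebP I)" "\<And>i. i \<in> I \<Longrightarrow> s i \<noteq> 0"
  shows "(\<integral>\<^sup>+ x. f x \<partial>lebP I) =
    (\<Prod>i\<in>I. ennreal \<bar>s i\<bar>) * (\<integral>\<^sup>+ x. f (\<lambda>i\<in>I. m i + s i * x i) \<partial>lebP I)"
  using assms
proof (induction I arbitrary: f rule: finite_induct)
  case empty
  show ?case by (simp add: PiM_empty nn_integral_count_space_finite restrict_def)
next
  case (insert i I)
  note [measurable] = insert.prems(1)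
  have s: "s i \<noteq> 0" using insert by auto
  have mi[measurable]: "(\<lambda>x. \<integral>\<^sup>+ y. f (x(i := y)) \<partial>lborel) \<in> borel_measurable (lebP I)"
    by measurable
  have "(\<integral>\<^sup>+ x. f x \<partial>lebP (insert i I)) = (\<integral>\<^sup>+ x. (\<integral>\<^sup>+ y. f (x(i := y)) \<partial>lborel) \<partial>lebP I)"
    using insert by (subst lb.product_nn_integral_insert) auto
  also have "\<dots> = (\<Prod>i\<in>I. ennreal \<bar>s i\<bar>) * (\<integral>\<^sup>+ x. (\<integral>\<^sup>+ y. f ((\<lambda>i\<in>I. m i + s i * x i)(i := y)) \<partial>lborel) \<partial>lebP I)"
    using insert by (subst insert.IH[OF mi]) auto
  also have "(\<integral>\<^sup>+ x. (\<integral>\<^sup>+ y. f ((\<lambda>i\<in>I. m i + s i * x i)(i := y)) \<partial>lborel) \<partial>lebP I)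
     = (\<integral>\<^sup>+ x. ennreal \<bar>s i\<bar> * (\<integral>\<^sup>+ y. f ((\<lambda>i\<in>I. m i + s i * x i)(i := m i + s i * y)) \<partial>lborel) \<partial>lebP I)"
  proof (rule nn_integral_cong)
    fix x assume "x \<in> space (lebP I)"
    have sp: "(\<lambda>i\<in>I. m i + s i * x i) \<in> space (lebP I)" by (auto simp: space_PiM)
    have "(\<lambda>y. f ((\<lambda>i\<in>I. m i + s i * x i)(i := y))) \<in> borel_measurable borel"
      using sp by measurable
    then show "(\<integral>\<^sup>+ y. f ((\<lambda>i\<in>I. m i + s i * x i)(i := y)) \<partial>lborel)
       = ennreal \<bar>s i\<bar> * (\<integral>\<^sup>+ y. f ((\<lambda>i\<in>I. m i + s i * x i)(i := m i + s i * y)) \<partial>lborel)"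
      by (rule nn_integral_real_affine[OF _ s])
  qed
  also have "\<dots> = (\<integral>\<^sup>+ x. ennreal \<bar>s i\<bar> * (\<integral>\<^sup>+ y. f (\<lambda>k\<in>insert i I. m k + s k * (x(i := y)) k) \<partial>lborel) \<partial>lebP I)"
  proof (intro nn_integral_cong arg_cong2[where f="(*)"] refl arg_cong[where f=f])
    fix x y
    show "(\<lambda>i\<in>I. m i + s i * x i)(i := m i + s i * y) = (\<lambda>k\<in>insert i I. m k + s k * (x(i := y)) k)"
      using insert.hyps by (auto simp: fun_eq_iff)
  qed
  also have "\<dots> = ennreal \<bar>s i\<bar> * (\<integral>\<^sup>+ x. (\<integral>\<^sup>+ y. f (\<lambda>k\<in>insert i I. m k + s k * (x(i := y)) k) \<partial>lborel) \<partial>lebP I)"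
    by (rule nn_integral_cmult) measurable
  also have "(\<integral>\<^sup>+ x. (\<integral>\<^sup>+ y. f (\<lambda>k\<in>insert i I. m k + s k * (x(i := y)) k) \<partial>lborel) \<partial>lebP I)
     = (\<integral>\<^sup>+ x. f (\<lambda>k\<in>insert i I. m k + s k * x k) \<partial>lebP (insert i I))"
    using insert.hyps by (subst lb.product_nn_integral_insert) auto
  finally show ?case by (simp only: prod.insert[OF insert.hyps] mult_ac)
qed

lemma nn_integral_PiM_translate:
  fixes f :: "('i \<Rightarrow> real) \<Rightarrow> ennreal"
  assumes "finite I" "f \<in> borel_measurable (lebP I)"
  shows "(\<integral>\<^sup>+ x. f (\<lambda>i\<in>I. m i + x i) \<partial>lebP I) = (\<integral>\<^sup>+ x. f x \<partial>lebP I)"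
  using nn_integral_PiM_affine[OF assms, of "\<lambda>_. 1" m] by simp

lemma PiM_density_lborel:
  fixes f :: "'i \<Rightarrow> real \<Rightarrow> ennreal"
  assumes I: "finite I" and f: "\<And>i. i \<in> I \<Longrightarrow> f i \<in> borel_measurable borel"
    and f1: "\<And>i. i \<in> I \<Longrightarrow> (\<integral>\<^sup>+ x. f i x \<partial>lborel) = 1"
  shows "PiM I (\<lambda>i. density lborel (f i)) = density (lebP I) (\<lambda>x. \<Prod>i\<in>I. f i (x i))"
proof -
  \<comment> \<open>The product locale asks for a sigma-finite measure at every index, so the
    factors outside \<open>I\<close> are filled with Lebesgue measure.\<close>
  define N where "N i = (if i \<in> I then density lborel (f i) else lborel)" for i
  have "prob_space (density lborel (f i))" if "i \<in> I" for i
    using f[OF that] f1[OF that] by (intro prob_spaceI) (simp add: emeasure_density)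
  then have "sigma_finite_measure (N i)" for i
    unfolding N_def by (auto intro: prob_space_imp_sigma_finite simp: sigma_finite_lborel)
  then interpret N: product_sigma_finite N by (simp add: product_sigma_finite_def)
  note [measurable] = f
  have setsN: "sets (N i) = sets borel" for i by (simp add: N_def)
  have "density (lebP I) (\<lambda>x. \<Prod>i\<in>I. f i (x i)) = PiM I N"
  proof (rule N.PiM_eqI[OF I])
    show "sets (density (lebP I) (\<lambda>x. \<Prod>i\<in>I. f i (x i))) = sets (PiM I N)"
      using setsN by (auto intro!: sets_PiM_cong)
    fix A assume A: "\<And>i. i \<in> I \<Longrightarrow> A i \<in> sets (N i)"
    then have A': "\<And>i. i \<in> I \<Longrightarrow> A i \<in> sets borel" using setsN by simp
    have mP: "Pi\<^sub>E I A \<in> sets (lebP I)" using A' I by (intro sets_PiM_I_finite) auto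
    have "emeasure (density (lebP I) (\<lambda>x. \<Prod>i\<in>I. f i (x i))) (Pi\<^sub>E I A)
       = (\<integral>\<^sup>+ x. (\<Prod>i\<in>I. f i (x i)) * indicator (Pi\<^sub>E I A) x \<partial>lebP I)"
      using mP by (subst emeasure_density) auto
    also have "\<dots> = (\<integral>\<^sup>+ x. (\<Prod>i\<in>I. f i (x i) * indicator (A i) (x i)) \<partial>lebP I)"
    proof (rule nn_integral_cong)
      fix x assume x: "x \<in> space (lebP I)"
      have "indicator (Pi\<^sub>E I A) x = (\<Prod>i\<in>I. indicator (A i) (x i) :: ennreal)"
      proof (cases "x \<in> Pi\<^sub>E I A")
        case False
        then obtain i where "i \<in> I" "x i \<notin> A i" using x by (auto simp: space_PiM PiE_iff)
        then have "(\<Prod>i\<in>I. indicator (A i) (x i) :: ennreal) = 0" using I by (intro prod_zero bexI[of _ i]) auto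
        then show ?thesis using False by simp
      qed (auto simp: PiE_iff intro!: prod.neutral[symmetric])
      then show "(\<Prod>i\<in>I. f i (x i)) * indicator (Pi\<^sub>E I A) x = (\<Prod>i\<in>I. f i (x i) * indicator (A i) (x i))"
        by (simp add: prod.distrib)
    qed
    also have "\<dots> = (\<Prod>i\<in>I. \<integral>\<^sup>+ x. f i x * indicator (A i) x \<partial>lborel)"
      using A' by (intro lb.product_nn_integral_prod[OF I]) auto
    also have "\<dots> = (\<Prod>i\<in>I. emeasure (N i) (A i))"
      using A' by (intro prod.cong refl) (simp add: N_def emeasure_density)
    finally show "emeasure (density (lebP I) (\<lambda>x. \<Prod>i\<in>I. f i (x i))) (Pi\<^sub>E I A) = (\<Prod>i\<in>I. emeasure (N i) (A i))" .
  qed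
  also have "PiM I N = PiM I (\<lambda>i. density lborel (f i))" by (intro PiM_cong) (auto simp: N_def)
  finally show ?thesis by simp
qed

text \<open>A unipotent change of variables: with the coordinates in \<open>B\<close> held fixed,
  those in \<open>A\<close> are merely translated, which costs no Jacobian. Used to decouple a
  quadratic form without a determinant.\<close>

lemma nn_integral_shear_prod:
  fixes h :: "'i \<Rightarrow> real \<Rightarrow> ennreal" and g :: "'i \<Rightarrow> ('i \<Rightarrow> real) \<Rightarrow> real"
  assumes fin: "finite A" "finite B" and AB: "A \<inter> B = {}"
    and h[measurable]: "\<And>c. h c \<in> borel_measurable borel"
    and g[measurable]: "\<And>c. c \<in> A \<Longrightarrow> g c \<in> borel_measurable (lebP B)"
  shows "(\<integral>\<^sup>+ x. (\<Prod>c\<in>A. h c (x c - g c (restrict x B))) * (\<Prod>c\<in>B. h c (x c)) \<partial>lebP (B \<union> A))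
     = (\<Prod>c\<in>B \<union> A. \<integral>\<^sup>+ x. h c x \<partial>lborel)"
proof -
  let ?f = "\<lambda>x. (\<Prod>c\<in>A. h c (x c - g c (restrict x B))) * (\<Prod>c\<in>B. h c (x c))"
  have [measurable]: "(\<lambda>x. g c (restrict x B)) \<in> borel_measurable (lebP (B \<union> A))" if "c \<in> A" for c
    by (rule measurable_compose[OF measurable_restrict_subset g[OF that]]) auto
  have mf: "?f \<in> borel_measurable (lebP (B \<union> A))"
    by measurable
  have "(\<integral>\<^sup>+ x. ?f x \<partial>lebP (B \<union> A)) = (\<integral>\<^sup>+ x. (\<integral>\<^sup>+ z. ?f (merge B A (x, z)) \<partial>lebP A) \<partial>lebP B)"
    by (rule lb.product_nn_integral_fold) (use AB fin mf in auto)
  also have "\<dots> = (\<integral>\<^sup>+ x. (\<Prod>c\<in>A. \<integral>\<^sup>+ z. h c z \<partial>lborel) * (\<Prod>c\<in>B. h c (x c)) \<partial>lebP B)"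
  proof (rule nn_integral_cong)
    fix x assume x: "x \<in> space (lebP B)"
    have "?f (merge B A (x, z)) = (\<Prod>c\<in>A. h c (z c - g c x)) * (\<Prod>c\<in>B. h c (x c))" for z
    proof -
      have "restrict (merge B A (x, z)) B = x" using x by (auto simp: space_PiM fun_eq_iff merge_def PiE_def extensional_def)
      then show ?thesis using AB
        by (intro arg_cong2[where f="(*)"] prod.cong refl) (auto simp: merge_def)
    qed
    then have "(\<integral>\<^sup>+ z. ?f (merge B A (x, z)) \<partial>lebP A) = (\<integral>\<^sup>+ z. (\<Prod>c\<in>A. h c (z c - g c x)) * (\<Prod>c\<in>B. h c (x c)) \<partial>lebP A)"
      by simp
    also have "\<dots> = (\<integral>\<^sup>+ z. (\<Prod>c\<in>A. h c (z c - g c x)) \<partial>lebP A) * (\<Prod>c\<in>B. h c (x c))"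
      by (rule nn_integral_multc) measurable
    also have "(\<integral>\<^sup>+ z. (\<Prod>c\<in>A. h c (z c - g c x)) \<partial>lebP A) = (\<Prod>c\<in>A. \<integral>\<^sup>+ z. h c (z - g c x) \<partial>lborel)"
      by (rule lb.product_nn_integral_prod[OF fin(1)]) measurable
    also have "\<dots> = (\<Prod>c\<in>A. \<integral>\<^sup>+ z. h c z \<partial>lborel)"
    proof (rule prod.cong[OF refl])
      fix c show "(\<integral>\<^sup>+ z. h c (z - g c x) \<partial>lborel) = (\<integral>\<^sup>+ z. h c z \<partial>lborel)"
        using nn_integral_real_affine[OF h, of 1 c "- g c x"] by simp
    qed
    finally show "(\<integral>\<^sup>+ z. ?f (merge B A (x, z)) \<partial>lebP A) = (\<Prod>c\<in>A. \<integral>\<^sup>+ z. h c z \<partial>lborel) * (\<Prod>c\<in>B. h c (x c))" .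
  qed
  also have "\<dots> = (\<Prod>c\<in>A. \<integral>\<^sup>+ z. h c z \<partial>lborel) * (\<integral>\<^sup>+ x. (\<Prod>c\<in>B. h c (x c)) \<partial>lebP B)"
    by (rule nn_integral_cmult) measurable
  also have "(\<integral>\<^sup>+ x. (\<Prod>c\<in>B. h c (x c)) \<partial>lebP B) = (\<Prod>c\<in>B. \<integral>\<^sup>+ x. h c x \<partial>lborel)"
    by (rule lb.product_nn_integral_prod[OF fin(2)]) measurable
  also have "(\<Prod>c\<in>A. \<integral>\<^sup>+ z. h c z \<partial>lborel) * (\<Prod>c\<in>B. \<integral>\<^sup>+ x. h c x \<partial>lborel) = (\<Prod>c\<in>B \<union> A. \<integral>\<^sup>+ x. h c x \<partial>lborel)"
    using fin AB by (subst prod.union_disjoint) (auto simp: mult.commute)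
  finally show ?thesis .
qed

section \<open>Gaussian, Gamma and beta-prime integrals\<close>

lemma nn_integral_gauss:
  assumes "0 < \<kappa>"
  shows "(\<integral>\<^sup>+ x. ennreal (exp (- \<kappa> * x\<^sup>2)) \<partial>lborel) = ennreal (sqrt (pi / \<kappa>))"
proof -
  define \<sigma> where "\<sigma> = sqrt (1 / (2 * \<kappa>))"
  have \<sigma>: "0 < \<sigma>" "\<sigma>\<^sup>2 = 1 / (2 * \<kappa>)" using assms by (auto simp: \<sigma>_def)
  have e: "exp (- \<kappa> * x\<^sup>2) = sqrt (pi / \<kappa>) * normal_density 0 \<sigma> x" for x
  proof -
    have "2 * pi * \<sigma>\<^sup>2 = pi / \<kappa>" "x\<^sup>2 / (2 * \<sigma>\<^sup>2) = \<kappa> * x\<^sup>2" using assms \<sigma> by auto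
    then show ?thesis using assms by (simp add: normal_density_def)
  qed
  have "(\<integral>\<^sup>+ x. ennreal (exp (- \<kappa> * x\<^sup>2)) \<partial>lborel) = (\<integral>\<^sup>+ x. ennreal (sqrt (pi / \<kappa>)) * ennreal (normal_density 0 \<sigma> x) \<partial>lborel)"
    unfolding e using assms by (simp add: ennreal_mult)
  also have "\<dots> = ennreal (sqrt (pi / \<kappa>)) * (\<integral>\<^sup>+ x. ennreal (normal_density 0 \<sigma> x) \<partial>lborel)"
    by (rule nn_integral_cmult) simp
  also have "(\<integral>\<^sup>+ x. ennreal (normal_density 0 \<sigma> x) \<partial>lborel) = 1"
    using \<sigma> by (subst nn_integral_eq_integral) auto
  finally show ?thesis by simp
qed

lemma nn_integral_gamma:
  assumes a: "0 < a" and \<rho>: "0 < \<rho>"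
  shows "(\<integral>\<^sup>+ t. ennreal (indicator {0<..} t * t powr (a - 1) * exp (- \<rho> * t)) \<partial>lborel) = ennreal (Gamma a * \<rho> powr (- a))"
proof -
  let ?g = "\<lambda>t. ennreal (indicator {0<..} t * t powr (a - 1) * exp (- \<rho> * t))"
  have "(\<integral>\<^sup>+ t. ?g t \<partial>lborel) = ennreal \<bar>1 / \<rho>\<bar> * (\<integral>\<^sup>+ t. ?g (0 + (1 / \<rho>) * t) \<partial>lborel)"
    using \<rho> by (intro nn_integral_real_affine) auto
  also have "(\<integral>\<^sup>+ t. ?g (0 + (1 / \<rho>) * t) \<partial>lborel)
      = (\<integral>\<^sup>+ t. ennreal (\<rho> powr (1 - a)) * ennreal (indicator {0..} t * t powr (a - 1) / exp t) \<partial>lborel)"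
  proof (rule nn_integral_cong)
    fix t :: real
    show "?g (0 + (1 / \<rho>) * t) = ennreal (\<rho> powr (1 - a)) * ennreal (indicator {0..} t * t powr (a - 1) / exp t)"
    proof (cases "t > 0")
      case True
      have "(t / \<rho>) powr (a - 1) = \<rho> powr (1 - a) * t powr (a - 1)"
        using True \<rho> by (simp add: powr_divide powr_diff field_simps)
      then show ?thesis using True \<rho> by (simp add: ennreal_mult[symmetric] exp_minus field_simps)
    next
      case False
      then show ?thesis using \<rho> by (cases "t = 0") (auto simp: indicator_def zero_less_divide_iff)
    qed
  qed
  also have "\<dots> = ennreal (\<rho> powr (1 - a)) * ennreal (Gamma a)"
    using a by (subst nn_integral_cmult) (auto simp: Gamma_conv_nn_integral_real)
  finally have "(\<integral>\<^sup>+ t. ?g t \<partial>lborel) = ennreal (1 / \<rho>) * (ennreal (\<rho> powr (1 - a)) * ennreal (Gamma a))" using \<rho> by simp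
  also have "\<dots> = ennreal (1 / \<rho> * (\<rho> powr (1 - a) * Gamma a))"
    using \<rho> less_imp_le[OF Gamma_real_pos[OF a]] by (simp only: ennreal_mult[symmetric] powr_ge_zero zero_le_divide_1_iff less_imp_le mult_nonneg_nonneg)
  also have "1 / \<rho> * (\<rho> powr (1 - a) * Gamma a) = Gamma a * \<rho> powr (- a)"
    using \<rho> by (simp add: powr_diff powr_minus field_simps)
  finally show ?thesis .
qed

text \<open>The factor \<open>(1 + t / \<Lambda>) powr (- h)\<close> is, up to
  \<open>Gamma h\<close>, a Laplace transform of \<open>x powr (h - 1) * exp (- x)\<close>.
  Exchanging the order of integration leaves two Gamma integrals.\<close>

lemma nn_integral_beta_prime:
  assumes c: "0 < c" "c < h" and \<Lambda>: "0 < \<Lambda>"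
  shows "(\<integral>\<^sup>+ t. ennreal (indicator {0<..} t * t powr (c - 1) * (1 + t / \<Lambda>) powr (- h)) \<partial>lborel)
     = ennreal (\<Lambda> powr c * Gamma c * Gamma (h - c) / Gamma h)" (is "?I = ?J")
proof -
  have h: "0 < h" using c by simp
  have Gh: "0 < Gamma h" "0 < Gamma c" "0 < Gamma (h - c)" using h c by (auto intro: Gamma_real_pos)
  let ?k = "\<lambda>t x. ennreal (indicator {0<..} t * t powr (c - 1) * (indicator {0<..} x * x powr (h - 1) * exp (- (1 + t / \<Lambda>) * x)))"
  have "(\<integral>\<^sup>+ t. ennreal (indicator {0<..} t * t powr (c - 1) * (1 + t / \<Lambda>) powr (- h)) \<partial>lborel) * ennreal (Gamma h)
      = (\<integral>\<^sup>+ t. ennreal (indicator {0<..} t * t powr (c - 1) * (1 + t / \<Lambda>) powr (- h)) * ennreal (Gamma h) \<partial>lborel)"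
    by (rule nn_integral_multc[symmetric]) measurable
  also have "\<dots> = (\<integral>\<^sup>+ t. \<integral>\<^sup>+ x. ?k t x \<partial>lborel \<partial>lborel)"
  proof (rule nn_integral_cong)
    fix t :: real
    show "ennreal (indicator {0<..} t * t powr (c - 1) * (1 + t / \<Lambda>) powr (- h)) * ennreal (Gamma h) = (\<integral>\<^sup>+ x. ?k t x \<partial>lborel)"
    proof (cases "0 < t")
      case True
      then have t: "0 < 1 + t / \<Lambda>" using \<Lambda> by (simp add: add_pos_pos)
      have "(\<integral>\<^sup>+ x. ?k t x \<partial>lborel) = (\<integral>\<^sup>+ x. ennreal (t powr (c - 1)) * ennreal (indicator {0<..} x * x powr (h - 1) * exp (- (1 + t / \<Lambda>) * x)) \<partial>lborel)"
        using True by (intro nn_integral_cong) (simp add: ennreal_mult[symmetric])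
      also have "\<dots> = ennreal (t powr (c - 1)) * ennreal (Gamma h * (1 + t / \<Lambda>) powr (- h))"
        by (subst nn_integral_cmult) (auto simp: nn_integral_gamma[OF h t, simplified])
      finally show ?thesis using True Gh by (simp add: ennreal_mult[symmetric] mult_ac)
    qed simp
  qed
  also have "\<dots> = (\<integral>\<^sup>+ x. \<integral>\<^sup>+ t. ?k t x \<partial>lborel \<partial>lborel)"
    by (rule lborel_pair.Fubini') measurable
  also have "\<dots> = (\<integral>\<^sup>+ x. ennreal (Gamma c * \<Lambda> powr c) * ennreal (indicator {0<..} x * x powr (h - c - 1) * exp (- 1 * x)) \<partial>lborel)"
  proof (rule nn_integral_cong)
    fix x :: real
    show "(\<integral>\<^sup>+ t. ?k t x \<partial>lborel) = ennreal (Gamma c * \<Lambda> powr c) * ennreal (indicator {0<..} x * x powr (h - c - 1) * exp (- 1 * x))"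
    proof (cases "0 < x")
      case True
      then have t: "0 < x / \<Lambda>" using \<Lambda> by simp
      have "(\<integral>\<^sup>+ t. ?k t x \<partial>lborel) = (\<integral>\<^sup>+ t. ennreal (x powr (h - 1) * exp (- x)) * ennreal (indicator {0<..} t * t powr (c - 1) * exp (- (x / \<Lambda>) * t)) \<partial>lborel)"
        using True by (intro nn_integral_cong) (simp add: ennreal_mult[symmetric] exp_add[symmetric] algebra_simps)
      also have "\<dots> = ennreal (x powr (h - 1) * exp (- x)) * ennreal (Gamma c * (x / \<Lambda>) powr (- c))"
        by (subst nn_integral_cmult) (auto simp: nn_integral_gamma[OF c(1) t, simplified])
      also have "\<dots> = ennreal (x powr (h - 1) * exp (- x) * (Gamma c * (x / \<Lambda>) powr (- c)))"
        using Gh by (simp add: ennreal_mult[symmetric])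
      also have "x powr (h - 1) * exp (- x) * (Gamma c * (x / \<Lambda>) powr (- c)) = (Gamma c * \<Lambda> powr c) * (x powr (h - c - 1) * exp (- x))"
        using True \<Lambda> by (simp add: powr_divide powr_minus powr_diff powr_add field_simps)
      finally show ?thesis using True Gh by (simp add: ennreal_mult[symmetric])
    qed simp
  qed
  also have "\<dots> = ennreal (Gamma c * \<Lambda> powr c) * ennreal (Gamma (h - c) * 1 powr (- (h - c)))"
    using nn_integral_gamma[of "h - c" 1] c by (subst nn_integral_cmult) auto
  also have "\<dots> = ennreal (\<Lambda> powr c * Gamma c * Gamma (h - c) / Gamma h) * ennreal (Gamma h)"
    using Gh \<Lambda> by (simp add: ennreal_mult[symmetric] mult_ac)
  finally have eq: "?I * ennreal (Gamma h) = ?J * ennreal (Gamma h)" .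
  have "?I = ?I * ennreal (Gamma h) / ennreal (Gamma h)" using Gh by (simp add: mult_divide_eq_ennreal)
  also have "\<dots> = ?J" unfolding eq using Gh by (simp add: mult_divide_eq_ennreal)
  finally show ?thesis .
qed

text \<open>Strict log-convexity: by the mean value theorem both log-increments are values of the
  increasing \<open>Digamma\<close>, taken in \<open>(x, x + c)\<close> and in
  \<open>(y - c, y)\<close>. The condition \<open>2 * c \<le> y - x\<close> keeps the two intervals
  in this order.\<close>

lemma Gamma_shift_less:
  fixes x y c :: real
  assumes "0 < x" "0 < c" "2 * c \<le> y - x"
  shows "Gamma (x + c) * Gamma (y - c) < Gamma x * Gamma y"
proof -
  have m: "x < x + c" "y - c < y" "0 < x + c" "0 < y - c" "0 < y" using assms by auto
  have d: "DERIV ln_Gamma z :> Digamma z" if "0 < z" for z :: real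
    using that by (auto intro!: derivative_eq_intros)
  obtain z1 where z1: "x < z1" "z1 < x + c" "ln_Gamma (x + c) - ln_Gamma x = (x + c - x) * Digamma z1"
    using MVT2[OF m(1), of ln_Gamma Digamma] d assms by force
  obtain z2 where z2: "y - c < z2" "z2 < y" "ln_Gamma y - ln_Gamma (y - c) = (y - (y - c)) * Digamma z2"
    using MVT2[OF m(2), of ln_Gamma Digamma] d m by force
  have "Digamma z1 < Digamma z2" using z1 z2 assms by (intro Digamma_real_strict_mono) auto
  then have "c * Digamma z1 < c * Digamma z2" using assms by (intro mult_strict_left_mono) auto
  then have "ln_Gamma (x + c) + ln_Gamma (y - c) < ln_Gamma x + ln_Gamma y" using z1(3) z2(3) by simp
  then have "exp (ln_Gamma (x + c) + ln_Gamma (y - c)) < exp (ln_Gamma x + ln_Gamma y)" by simp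
  then show ?thesis using assms m by (simp add: Gamma_real_pos_exp exp_add)
qed

section \<open>Normalised densities\<close>

lemma nn_integral_normdens:
  assumes [measurable]: "f \<in> borel_measurable M" "g \<in> borel_measurable M"
  shows "(\<integral>\<^sup>+ x. g x \<partial>normdens M f) = (\<integral>\<^sup>+ x. f x * g x \<partial>M) / (\<integral>\<^sup>+ x. f x \<partial>M)"
proof -
  have "(\<integral>\<^sup>+ x. g x \<partial>normdens M f) = (\<integral>\<^sup>+ x. f x / (\<integral>\<^sup>+ z. f z \<partial>M) * g x \<partial>M)"
    unfolding normdens_def by (rule nn_integral_density) auto
  also have "\<dots> = (\<integral>\<^sup>+ x. (f x * g x) / (\<integral>\<^sup>+ z. f z \<partial>M) \<partial>M)"
    by (intro nn_integral_cong) (simp add: divide_ennreal_def mult_ac)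
  also have "\<dots> = (\<integral>\<^sup>+ x. f x * g x \<partial>M) / (\<integral>\<^sup>+ x. f x \<partial>M)"
    by (rule nn_integral_divide) measurable
  finally show ?thesis .
qed

lemma nn_integral_normdens_le:
  assumes "f \<in> borel_measurable M" "g \<in> borel_measurable M"
    and Z: "(\<integral>\<^sup>+ x. f x \<partial>M) \<noteq> 0" "(\<integral>\<^sup>+ x. f x \<partial>M) \<noteq> \<infinity>"
    and le: "(\<integral>\<^sup>+ x. f x * g x \<partial>M) \<le> c * (\<integral>\<^sup>+ x. f x \<partial>M)"
  shows "(\<integral>\<^sup>+ x. g x \<partial>normdens M f) \<le> c"
proof -
  have "(\<integral>\<^sup>+ x. g x \<partial>normdens M f) \<le> c * (\<integral>\<^sup>+ x. f x \<partial>M) / (\<integral>\<^sup>+ x. f x \<partial>M)"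
    unfolding nn_integral_normdens[OF assms(1,2)] by (intro divide_right_mono_ennreal le)
  also have "\<dots> = c" using Z by (simp add: ennreal_mult_divide_eq)
  finally show ?thesis .
qed

lemma sets_normdens[simp, measurable_cong]: "sets (normdens M f) = sets M"
  and space_normdens[simp]: "space (normdens M f) = space M"
  by (simp_all add: normdens_def)

lemma prob_space_normdens:
  assumes [measurable]: "f \<in> borel_measurable M"
    and Z: "(\<integral>\<^sup>+ x. f x \<partial>M) \<noteq> 0" "(\<integral>\<^sup>+ x. f x \<partial>M) \<noteq> \<infinity>"
  shows "prob_space (normdens M f)"
proof (rule prob_spaceI)
  have "emeasure (normdens M f) (space M) = (\<integral>\<^sup>+ x. 1 \<partial>normdens M f)" by simp
  also have "\<dots> = 1" using Z by (subst nn_integral_normdens) (auto simp: ennreal_divide_self top.not_eq_extremum)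
  finally show "emeasure (normdens M f) (space (normdens M f)) = 1" by simp
qed

text \<open>The cancellation also holds for total mass 0 or \<infinity>, because a finite positive
  factor preserves both; so \<open>f\<close> may be a weight of infinite mass.\<close>

lemma normdens_scale:
  assumes c: "0 < c" "c \<noteq> \<infinity>" and [measurable]: "f \<in> borel_measurable M"
  shows "normdens M (\<lambda>x. c * f x) = normdens M f"
proof -
  have "(\<integral>\<^sup>+ x. c * f x \<partial>M) = c * (\<integral>\<^sup>+ x. f x \<partial>M)" by (rule nn_integral_cmult) simp
  moreover have "c * a / (c * b) = a / b" for a b :: ennreal
  proof -
    obtain r where r: "c = ennreal r" "0 < r" using c by (cases c) auto
    consider "b = \<infinity>" | "b = 0" | rb where "b = ennreal rb" "0 < rb" by (cases b) force+
    then show ?thesis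
    proof cases
      case 3
      then have "c * a / (c * b) = a * (ennreal r * ennreal (inverse (r * rb)))"
        using r by (simp add: divide_ennreal_def ennreal_mult[symmetric] inverse_ennreal mult_ac)
      also have "ennreal r * ennreal (inverse (r * rb)) = ennreal (inverse rb)" using r 3
        by (simp add: ennreal_mult[symmetric])
      finally show ?thesis using 3 by (simp add: divide_ennreal_def inverse_ennreal)
    qed (use r in \<open>auto simp: divide_ennreal_def ennreal_mult_top ennreal_top_mult ennreal_mult_eq_top_iff\<close>)
  qed
  ultimately show ?thesis unfolding normdens_def by simp
qed

section \<open>Truncated normal draws\<close>

text \<open>Here \<open>3 / 8 = 1 / 2 - 1 / 8\<close>, and halving \<open>x\<close> turns the
  exponent \<open>x^2 / 2\<close> into \<open>x^2 / 8\<close>.\<close>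

lemma exp_scale_bound: "exp (- (x\<^sup>2) / 2) * (1 + 3 / 8 * x\<^sup>2) \<le> exp (- (x\<^sup>2) / 8)" for x :: real
proof -
  have "exp (- (x\<^sup>2) / 2) * (1 + 3 / 8 * x\<^sup>2) \<le> exp (- (x\<^sup>2) / 2) * exp (3 / 8 * x\<^sup>2)"
    by (intro mult_left_mono) auto
  also have "\<dots> = exp (- (x\<^sup>2) / 8)" by (simp add: exp_add[symmetric])
  finally show ?thesis .
qed

text \<open>The map moving \<open>v\<close> halfway towards \<open>k\<close> at most doubles the
  integral of \<open>w\<close>. The hypothesis therefore reads
  \<open>Z + 3/8 * Y \<le> 2 * Z\<close> after integration, where \<open>Y\<close> is the second
  moment about \<open>k\<close>. No formula for the normalising constant is involved, so the bound
  is uniform in the parameters of \<open>w\<close>.\<close>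

lemma second_moment_by_dilation:
  fixes w :: "real \<Rightarrow> real"
  assumes [measurable]: "w \<in> borel_measurable borel" and w0: "\<And>v. 0 \<le> w v"
    and fin: "(\<integral>\<^sup>+ v. ennreal (w v) \<partial>lborel) \<noteq> \<infinity>"
    and le: "\<And>v. w v * (1 + 3 / 8 * (v - k)\<^sup>2) \<le> w (k / 2 + v / 2)"
  shows "(\<integral>\<^sup>+ v. ennreal (w v * (v - k)\<^sup>2) \<partial>lborel) \<le> ennreal (8 / 3) * (\<integral>\<^sup>+ v. ennreal (w v) \<partial>lborel)"
proof -
  let ?Z = "\<integral>\<^sup>+ v. ennreal (w v) \<partial>lborel" and ?Y = "\<integral>\<^sup>+ v. ennreal (w v * (v - k)\<^sup>2) \<partial>lborel"
  have "?Z + ennreal (3 / 8) * ?Y = (\<integral>\<^sup>+ v. ennreal (w v) + ennreal (3 / 8) * ennreal (w v * (v - k)\<^sup>2) \<partial>lborel)"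
    by (subst nn_integral_add, simp_all add: nn_integral_cmult)
  also have "\<dots> \<le> (\<integral>\<^sup>+ v. ennreal (w (k / 2 + (1/2) * v)) \<partial>lborel)"
  proof (rule nn_integral_mono)
    fix v
    have "ennreal (w v) + ennreal (3 / 8) * ennreal (w v * (v - k)\<^sup>2) = ennreal (w v * (1 + 3 / 8 * (v - k)\<^sup>2))"
      using w0[of v] by (simp add: ennreal_mult[symmetric] ennreal_plus[symmetric] algebra_simps del: ennreal_plus)
    also have "\<dots> \<le> ennreal (w (k / 2 + (1/2) * v))" using le[of v] by (intro ennreal_leI) simp
    finally show "ennreal (w v) + ennreal (3 / 8) * ennreal (w v * (v - k)\<^sup>2) \<le> ennreal (w (k / 2 + (1/2) * v))" .
  qed
  also have "\<dots> = ennreal 2 * (ennreal \<bar>1/2\<bar> * (\<integral>\<^sup>+ v. ennreal (w (k / 2 + (1/2) * v)) \<partial>lborel))"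
  proof -
    have h: "ennreal 2 * ennreal \<bar>1/2\<bar> = 1" by (subst ennreal_mult[symmetric]) auto
    show ?thesis by (simp only: mult.assoc[symmetric] h mult_1)
  qed
  also have "ennreal \<bar>1/2\<bar> * (\<integral>\<^sup>+ v. ennreal (w (k / 2 + (1/2) * v)) \<partial>lborel) = ?Z"
    by (rule nn_integral_real_affine[symmetric]) auto
  also have "ennreal 2 * ?Z = ?Z + ?Z" by (simp add: mult_2)
  finally have *: "ennreal (3 / 8) * ?Y \<le> ?Z" using fin by (simp add: ennreal_add_left_cancel_le)
  have "?Y = ennreal (8 / 3) * (ennreal (3 / 8) * ?Y)"
    by (simp add: mult.assoc[symmetric] ennreal_mult[symmetric])
  also have "\<dots> \<le> ennreal (8 / 3) * ?Z" by (intro mult_left_mono *) simp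
  finally show ?thesis .
qed

abbreviation halfline :: "bool \<Rightarrow> real set" where
  "halfline yi \<equiv> (if yi then {0<..} else {..0})"

definition tnw :: "real \<Rightarrow> bool \<Rightarrow> real \<Rightarrow> real" where
  "tnw m yi v = indicator (halfline yi) v * exp (- ((v - m)\<^sup>2) / 2)"

lemma tnw_nonneg: "0 \<le> tnw m yi v" by (simp add: tnw_def)

lemma measurable_tnw[measurable]:
  "f \<in> borel_measurable M \<Longrightarrow> g \<in> borel_measurable M \<Longrightarrow> (\<lambda>x. tnw (f x) yi (g x)) \<in> borel_measurable M"
  unfolding tnw_def by (cases yi) simp_all

lemma nn_integral_gauss_shift: "(\<integral>\<^sup>+ v. ennreal (exp (- ((v - m)\<^sup>2) / 2)) \<partial>lborel) = ennreal (sqrt (2 * pi))"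
proof -
  have "(\<integral>\<^sup>+ v. ennreal (exp (- ((v - m)\<^sup>2) / 2)) \<partial>lborel) = ennreal \<bar>1\<bar> * (\<integral>\<^sup>+ v. ennreal (exp (- ((m + 1 * v - m)\<^sup>2) / 2)) \<partial>lborel)"
    by (rule nn_integral_real_affine) auto
  then show ?thesis using nn_integral_gauss[of "1/2"] by (simp add: mult.commute)
qed

lemma tnw_integral:
  "(\<integral>\<^sup>+ v. ennreal (tnw m yi v) \<partial>lborel) \<le> ennreal (sqrt (2 * pi))"
  "(\<integral>\<^sup>+ v. ennreal (tnw m yi v) \<partial>lborel) \<noteq> \<infinity>"
  "(\<integral>\<^sup>+ v. ennreal (tnw m yi v) \<partial>lborel) \<noteq> 0"
proof -
  show le: "(\<integral>\<^sup>+ v. ennreal (tnw m yi v) \<partial>lborel) \<le> ennreal (sqrt (2 * pi))"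
    unfolding nn_integral_gauss_shift[of m, symmetric] tnw_def
    by (intro nn_integral_mono ennreal_leI) (auto simp: indicator_def)
  then show "(\<integral>\<^sup>+ v. ennreal (tnw m yi v) \<partial>lborel) \<noteq> \<infinity>" by (auto simp: top_unique)
  show "(\<integral>\<^sup>+ v. ennreal (tnw m yi v) \<partial>lborel) \<noteq> 0"
  proof
    assume "(\<integral>\<^sup>+ v. ennreal (tnw m yi v) \<partial>lborel) = 0"
    then have "emeasure lborel {v \<in> space lborel. ennreal (tnw m yi v) \<noteq> 0} = 0"
      by (subst (asm) nn_integral_0_iff) auto
    also have "{v \<in> space lborel. ennreal (tnw m yi v) \<noteq> 0} = halfline yi"
      by (auto simp: tnw_def indicator_def ennreal_eq_0_iff not_le)
    finally have e: "emeasure lborel (halfline yi) = 0" .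
    let ?J = "if yi then {0<..<1} else {-1<..<0::real}"
    have "emeasure lborel ?J \<le> emeasure lborel (halfline yi)" by (intro emeasure_mono) auto
    moreover have "emeasure lborel ?J = 1" by auto
    ultimately show False using e by simp
  qed
qed

text \<open>The leading constant must be as close to 1 as desired, as it competes with the
  contraction of the posterior mean. A dilation centre inside the closed half-line keeps the support
  invariant: 0 when \<open>m\<close> points away from it, otherwise \<open>m\<close>.\<close>

lemma tnw_second_moment:
  assumes \<epsilon>: "0 < \<epsilon>"
  shows "(\<integral>\<^sup>+ v. ennreal (tnw m yi v) * ennreal (v\<^sup>2) \<partial>lborel)
    \<le> ennreal ((1 + \<epsilon>) * m\<^sup>2 + (1 + 1 / \<epsilon>) * (8 / 3)) * (\<integral>\<^sup>+ v. ennreal (tnw m yi v) \<partial>lborel)"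
proof -
  let ?Z = "\<integral>\<^sup>+ v. ennreal (tnw m yi v) \<partial>lborel"
  have young: "v\<^sup>2 \<le> (1 + \<epsilon>) * m\<^sup>2 + (1 + 1 / \<epsilon>) * (v - m)\<^sup>2" for v
  proof -
    have "0 \<le> (\<epsilon> * m - (v - m))\<^sup>2 / \<epsilon>" using \<epsilon> by simp
    also have "(\<epsilon> * m - (v - m))\<^sup>2 / \<epsilon> = \<epsilon> * m\<^sup>2 - 2 * m * (v - m) + (v - m)\<^sup>2 / \<epsilon>"
      using \<epsilon> by (simp add: power2_eq_square field_simps)
    finally show ?thesis by (simp add: power2_eq_square algebra_simps add_divide_distrib diff_divide_distrib)
  qed
  show ?thesis
  proof (cases "\<forall>v\<in>halfline yi. m * v \<le> 0")
    \<comment> \<open>The mean lies on the wrong side. Around 0 the weight is a centred Gaussian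
      times \<open>exp (m * v)\<close>, and the exponent \<open>m * v \<le> 0\<close> only grows
      when \<open>v\<close> is halved.\<close>
    case True
    have "(\<integral>\<^sup>+ v. ennreal (tnw m yi v * (v - 0)\<^sup>2) \<partial>lborel) \<le> ennreal (8 / 3) * ?Z"
    proof (rule second_moment_by_dilation)
      fix v
      show "tnw m yi v * (1 + 3 / 8 * (v - 0)\<^sup>2) \<le> tnw m yi (0 / 2 + v / 2)"
      proof (cases "v \<in> halfline yi")
        case v: True
        then have v2: "v / 2 \<in> halfline yi" by (auto split: if_splits)
        have mv: "m * v \<le> 0" using True v by blast
        have "exp (- (v - m)\<^sup>2 / 2) * (1 + 3 / 8 * v\<^sup>2) = exp (m * v - m\<^sup>2 / 2) * (exp (- (v\<^sup>2) / 2) * (1 + 3 / 8 * v\<^sup>2))"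
        proof -
          have "- (v - m)\<^sup>2 / 2 = (m * v - m\<^sup>2 / 2) + - (v\<^sup>2) / 2" by (simp add: power2_eq_square field_simps)
          then show ?thesis by (simp only: exp_add mult.assoc)
        qed
        also have "\<dots> \<le> exp (m * v / 2 - m\<^sup>2 / 2) * exp (- (v\<^sup>2) / 8)"
          using mv by (intro mult_mono exp_scale_bound) auto
        also have "\<dots> = exp (- (v / 2 - m)\<^sup>2 / 2)"
        proof -
          have "- (v / 2 - m)\<^sup>2 / 2 = (m * v / 2 - m\<^sup>2 / 2) + - (v\<^sup>2) / 8" by (simp add: power2_eq_square field_simps)
          then show ?thesis by (simp only: exp_add)
        qed
        finally show ?thesis using v v2 by (simp add: tnw_def)
      qed (simp add: tnw_def)
    qed (use tnw_integral(2)[of m yi] in \<open>auto simp: tnw_nonneg\<close>)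
    then have "(\<integral>\<^sup>+ v. ennreal (tnw m yi v) * ennreal (v\<^sup>2) \<partial>lborel) \<le> ennreal (8 / 3) * ?Z"
      by (simp add: ennreal_mult tnw_nonneg)
    also have "\<dots> \<le> ennreal ((1 + \<epsilon>) * m\<^sup>2 + (1 + 1 / \<epsilon>) * (8 / 3)) * ?Z"
    proof (intro mult_right_mono ennreal_leI)
      have "0 \<le> (1 + \<epsilon>) * m\<^sup>2" "0 \<le> (1 / \<epsilon>) * (8/3)" using \<epsilon> by auto
      moreover have "(1 + 1 / \<epsilon>) * (8 / 3) = 8 / 3 + 1 / \<epsilon> * (8 / 3)" by (rule trans[OF distrib_right]) simp
      ultimately show "8 / 3 \<le> (1 + \<epsilon>) * m\<^sup>2 + (1 + 1 / \<epsilon>) * (8 / 3)" by linarith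
    qed simp
    finally show ?thesis .
  next
    \<comment> \<open>Now \<open>m\<close> itself lies in the half-line, so the midpoint of
      \<open>v\<close> and \<open>m\<close> does as well, by convexity.\<close>
    case False
    then have good: "v / 2 + m / 2 \<in> halfline yi" if "v \<in> halfline yi" for v
      using that by (auto split: if_splits simp: not_le zero_less_mult_iff mult_less_0_iff)
    have "(\<integral>\<^sup>+ v. ennreal (tnw m yi v * (v - m)\<^sup>2) \<partial>lborel) \<le> ennreal (8 / 3) * ?Z"
    proof (rule second_moment_by_dilation)
      fix v
      show "tnw m yi v * (1 + 3 / 8 * (v - m)\<^sup>2) \<le> tnw m yi (m / 2 + v / 2)"
      proof (cases "v \<in> halfline yi")
        case v: True
        have eq: "- ((m / 2 + v / 2 - m)\<^sup>2) / 2 = - ((v - m)\<^sup>2) / 8" by (simp add: power2_eq_square field_simps)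
        have g: "m / 2 + v / 2 \<in> halfline yi" using good[OF v] by (simp only: add.commute)
        show ?thesis unfolding tnw_def eq using v g exp_scale_bound[of "v - m"] by simp
      qed (simp add: tnw_def)
    qed (use tnw_integral(2)[of m yi] in \<open>auto simp: tnw_nonneg\<close>)
    then have q: "(\<integral>\<^sup>+ v. ennreal (tnw m yi v * (v - m)\<^sup>2) \<partial>lborel) \<le> ennreal (8 / 3) * ?Z" .
    have "(\<integral>\<^sup>+ v. ennreal (tnw m yi v) * ennreal (v\<^sup>2) \<partial>lborel)
       \<le> (\<integral>\<^sup>+ v. ennreal ((1 + \<epsilon>) * m\<^sup>2) * ennreal (tnw m yi v) + ennreal (1 + 1 / \<epsilon>) * ennreal (tnw m yi v * (v - m)\<^sup>2) \<partial>lborel)"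
    proof (rule nn_integral_mono)
      fix v
      have "tnw m yi v * v\<^sup>2 \<le> tnw m yi v * ((1 + \<epsilon>) * m\<^sup>2 + (1 + 1 / \<epsilon>) * (v - m)\<^sup>2)"
        by (intro mult_left_mono young tnw_nonneg)
      then show "ennreal (tnw m yi v) * ennreal (v\<^sup>2) \<le> ennreal ((1 + \<epsilon>) * m\<^sup>2) * ennreal (tnw m yi v) + ennreal (1 + 1 / \<epsilon>) * ennreal (tnw m yi v * (v - m)\<^sup>2)"
        using \<epsilon> tnw_nonneg[of m yi v]
        by (simp add: ennreal_mult[symmetric] ennreal_plus[symmetric] algebra_simps ennreal_leI del: ennreal_plus)
    qed
    also have "\<dots> = ennreal ((1 + \<epsilon>) * m\<^sup>2) * ?Z + ennreal (1 + 1 / \<epsilon>) * (\<integral>\<^sup>+ v. ennreal (tnw m yi v * (v - m)\<^sup>2) \<partial>lborel)"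
      by (simp add: nn_integral_add nn_integral_cmult)
    also have "\<dots> \<le> ennreal ((1 + \<epsilon>) * m\<^sup>2) * ?Z + ennreal (1 + 1 / \<epsilon>) * (ennreal (8 / 3) * ?Z)"
      by (intro add_left_mono mult_left_mono q) simp
    also have "\<dots> = (ennreal ((1 + \<epsilon>) * m\<^sup>2) + ennreal (1 + 1 / \<epsilon>) * ennreal (8 / 3)) * ?Z"
      by (simp only: distrib_right mult.assoc)
    also have "ennreal ((1 + \<epsilon>) * m\<^sup>2) + ennreal (1 + 1 / \<epsilon>) * ennreal (8 / 3) = ennreal ((1 + \<epsilon>) * m\<^sup>2 + (1 + 1 / \<epsilon>) * (8 / 3))"
      using \<epsilon> by (subst ennreal_mult[symmetric], simp, simp, subst ennreal_plus[symmetric], auto)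
    finally show ?thesis .
  qed
qed

lemma truncnorm_eq: "truncnorm m yi = normdens lborel (\<lambda>v. ennreal (tnw m yi v))"
  by (simp add: truncnorm_def tnw_def)

definition tnd :: "real \<Rightarrow> bool \<Rightarrow> real \<Rightarrow> ennreal" where
  "tnd m yi v = ennreal (tnw m yi v) / (\<integral>\<^sup>+ z. ennreal (tnw m yi z) \<partial>lborel)"

lemma truncnorm_density: "truncnorm m yi = density lborel (tnd m yi)"
  by (simp add: truncnorm_eq normdens_def tnd_def[abs_def])

lemma measurable_tnd[measurable]:
  assumes [measurable]: "f \<in> borel_measurable M" "g \<in> borel_measurable M"
  shows "(\<lambda>x. tnd (f x) yi (g x)) \<in> borel_measurable M"
  unfolding tnd_def by measurable

lemma prob_space_truncnorm: "prob_space (truncnorm m yi)"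
  unfolding truncnorm_eq by (rule prob_space_normdens[OF _ tnw_integral(3,2)]) simp

lemma tnd_integral: "(\<integral>\<^sup>+ v. tnd m yi v \<partial>lborel) = 1"
  using prob_space.emeasure_space_1[OF prob_space_truncnorm[of m yi]] unfolding truncnorm_density
  by (simp add: emeasure_density)

text \<open>For the minorization: a bound independent of \<open>m\<close> on
  \<open>m^2 \<le> R\<close>. The exponent uses \<open>(v - m)^2 \<le> 2 * v^2 + 2 * m^2\<close>,
  the normaliser the full Gaussian integral.\<close>

lemma tnd_lower:
  assumes "m\<^sup>2 \<le> R"
  shows "ennreal (indicator (halfline yi) v * exp (- (v\<^sup>2) - R) / sqrt (2 * pi)) \<le> tnd m yi v"
proof -
  have "(v - m)\<^sup>2 / 2 \<le> v\<^sup>2 + R"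
  proof -
    have "0 \<le> (v + m)\<^sup>2" by simp
    then have "(v - m)\<^sup>2 \<le> 2 * v\<^sup>2 + 2 * m\<^sup>2" by (simp add: power2_eq_square algebra_simps)
    then show ?thesis using assms by simp
  qed
  then have "indicator (halfline yi) v * exp (- (v\<^sup>2) - R) \<le> tnw m yi v"
    by (auto simp: tnw_def indicator_def)
  then have "ennreal (indicator (halfline yi) v * exp (- (v\<^sup>2) - R) / sqrt (2 * pi)) \<le> ennreal (tnw m yi v / sqrt (2 * pi))"
    by (intro ennreal_leI divide_right_mono) auto
  also have "\<dots> = ennreal (tnw m yi v) / ennreal (sqrt (2 * pi))"
    by (subst divide_ennreal) (auto simp: tnw_nonneg)
  also have "\<dots> \<le> tnd m yi v"
  proof -
    obtain z where z: "(\<integral>\<^sup>+ v. ennreal (tnw m yi v) \<partial>lborel) = ennreal z" "0 < z"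
      using tnw_integral(2,3)[of m yi] by (cases "\<integral>\<^sup>+ v. ennreal (tnw m yi v) \<partial>lborel") (auto simp: ennreal_eq_0_iff not_le)
    have "z \<le> sqrt (2 * pi)" using tnw_integral(1)[of m yi] z by simp
    then show ?thesis unfolding tnd_def z(1) using z(2) tnw_nonneg[of m yi v]
      by (subst (1 2) divide_ennreal) (auto intro!: ennreal_leI frac_le)
  qed
  finally show ?thesis .
qed

section \<open>Gamma draws\<close>

definition gaw :: "real \<Rightarrow> real \<Rightarrow> real \<Rightarrow> real" where
  "gaw sh \<rho> t = indicator {0<..} t * t powr (sh - 1) * exp (- \<rho> * t)"

text \<open>The default rate 1 built into \<open>gamma_meas\<close>. With it the moment formulas
  hold for every state, including those with a vanishing block.\<close>

definition erate :: "real \<Rightarrow> real" where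
  "erate rt = (if rt > 0 then rt else 1)"

lemma erate_pos: "0 < erate rt" by (simp add: erate_def)

lemma measurable_erate[measurable]: "erate \<in> borel_measurable borel"
  unfolding erate_def[abs_def] by measurable

lemma gaw_nonneg: "0 \<le> gaw sh \<rho> t" by (simp add: gaw_def)

lemma measurable_gaw[measurable]:
  assumes [measurable]: "f \<in> borel_measurable M" "g \<in> borel_measurable M"
  shows "(\<lambda>x. gaw sh (f x) (g x)) \<in> borel_measurable M"
  unfolding gaw_def by measurable

lemma gaw_integral:
  assumes "0 < sh" "0 < \<rho>"
  shows "(\<integral>\<^sup>+ t. ennreal (gaw sh \<rho> t) \<partial>lborel) = ennreal (Gamma sh * \<rho> powr (- sh))"
  unfolding gaw_def using nn_integral_gamma[OF assms] by simp

lemma gaw_integral_nz: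
  assumes "0 < sh" "0 < \<rho>"
  shows "(\<integral>\<^sup>+ t. ennreal (gaw sh \<rho> t) \<partial>lborel) \<noteq> 0" "(\<integral>\<^sup>+ t. ennreal (gaw sh \<rho> t) \<partial>lborel) \<noteq> \<infinity>"
  using assms Gamma_real_pos[OF assms(1)] by (auto simp: gaw_integral ennreal_eq_0_iff not_le)

lemma gamma_meas_eq: "gamma_meas sh rt = normdens lborel (\<lambda>t. ennreal (gaw sh (erate rt) t))"
  by (simp add: gamma_meas_def gaw_def erate_def)

definition gad :: "real \<Rightarrow> real \<Rightarrow> real \<Rightarrow> ennreal" where
  "gad sh \<rho> t = ennreal (gaw sh \<rho> t) / (\<integral>\<^sup>+ z. ennreal (gaw sh \<rho> z) \<partial>lborel)"

lemma gamma_meas_density: "gamma_meas sh rt = density lborel (gad sh (erate rt))"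
  by (simp add: gamma_meas_eq normdens_def gad_def[abs_def])

lemma measurable_gad[measurable]:
  assumes [measurable]: "f \<in> borel_measurable M" "g \<in> borel_measurable M"
  shows "(\<lambda>x. gad sh (f x) (g x)) \<in> borel_measurable M"
  unfolding gad_def by measurable

lemma prob_space_gamma_meas: "0 < sh \<Longrightarrow> prob_space (gamma_meas sh rt)"
  unfolding gamma_meas_eq by (rule prob_space_normdens) (auto simp: gaw_integral_nz erate_pos simp del: infinity_ennreal_def)

lemma gad_integral: "0 < sh \<Longrightarrow> 0 < \<rho> \<Longrightarrow> (\<integral>\<^sup>+ t. gad sh \<rho> t \<partial>lborel) = 1"
  using prob_space.emeasure_space_1[OF prob_space_gamma_meas[of sh \<rho>]] unfolding gamma_meas_density
  by (simp add: emeasure_density erate_def)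

lemma gad_zero: "t \<le> 0 \<Longrightarrow> gad sh \<rho> t = 0"
  by (simp add: gad_def gaw_def)

lemma gamma_meas_moment:
  assumes sh: "0 < sh" "0 < sh + e"
  shows "(\<integral>\<^sup>+ t. ennreal (t powr e) \<partial>gamma_meas sh rt) = ennreal (Gamma (sh + e) / Gamma sh * erate rt powr (- e))"
proof -
  let ?\<rho> = "erate rt"
  have \<rho>: "0 < ?\<rho>" by (rule erate_pos)
  have G: "0 < Gamma sh" "0 < Gamma (sh + e)" using sh by (auto intro: Gamma_real_pos)
  have "(\<integral>\<^sup>+ t. ennreal (gaw sh ?\<rho> t) * ennreal (t powr e) \<partial>lborel) = (\<integral>\<^sup>+ t. ennreal (gaw (sh + e) ?\<rho> t) \<partial>lborel)"
    by (intro nn_integral_cong) (auto simp: gaw_def ennreal_mult[symmetric] indicator_def powr_add[symmetric] algebra_simps)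
  then have "(\<integral>\<^sup>+ t. ennreal (t powr e) \<partial>gamma_meas sh rt) = ennreal (Gamma (sh + e) * ?\<rho> powr (- (sh + e))) / ennreal (Gamma sh * ?\<rho> powr (- sh))"
    unfolding gamma_meas_eq using sh \<rho> by (subst nn_integral_normdens) (auto simp: gaw_integral)
  also have "\<dots> = ennreal ((Gamma (sh + e) * ?\<rho> powr (- (sh + e))) / (Gamma sh * ?\<rho> powr (- sh)))"
    using G \<rho> by (subst divide_ennreal) auto
  also have "(Gamma (sh + e) * ?\<rho> powr (- (sh + e))) / (Gamma sh * ?\<rho> powr (- sh)) = Gamma (sh + e) / Gamma sh * ?\<rho> powr (- e)"
  proof -
    have "?\<rho> powr (- (sh + e)) = ?\<rho> powr (- sh) * ?\<rho> powr (- e)" by (simp add: powr_add[symmetric])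
    then show ?thesis using \<rho> by simp
  qed
  finally show ?thesis .
qed

text \<open>Uniform over rates in \<open>[l, u]\<close>: the exponential is smallest at
  \<open>u\<close>, the normalising power smallest at \<open>l\<close>.\<close>

lemma gad_lower:
  assumes sh: "0 < sh" and l: "0 < l" "l \<le> \<rho>" "\<rho> \<le> u"
  shows "ennreal (gaw sh u t * l powr sh / Gamma sh) \<le> gad sh \<rho> t"
proof -
  have \<rho>: "0 < \<rho>" using l by simp
  have G: "0 < Gamma sh" using sh by (rule Gamma_real_pos)
  have 1: "gaw sh u t \<le> gaw sh \<rho> t" using l by (auto simp: gaw_def indicator_def intro!: mult_left_mono mult_right_mono)
  have 2: "l powr sh \<le> \<rho> powr sh" using l sh by (intro powr_mono2) auto
  have "gaw sh u t * l powr sh / Gamma sh \<le> gaw sh \<rho> t * \<rho> powr sh / Gamma sh"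
    using 1 2 G by (intro divide_right_mono mult_mono) (auto simp: gaw_nonneg)
  also have "\<dots> = gaw sh \<rho> t / (Gamma sh * \<rho> powr (- sh))" using \<rho> by (simp add: powr_minus field_simps)
  finally have "ennreal (gaw sh u t * l powr sh / Gamma sh) \<le> ennreal (gaw sh \<rho> t / (Gamma sh * \<rho> powr (- sh)))"
    by (rule ennreal_leI)
  also have "\<dots> = gad sh \<rho> t" unfolding gad_def gaw_integral[OF sh \<rho>]
    using G \<rho> by (subst divide_ennreal) (auto simp: gaw_nonneg)
  finally show ?thesis .
qed

text \<open>A positive function that is log-midpoint-convex along one direction has infinite integral:
  its mass on the slab around \<open>0\<close> is at most the average mass on two opposite translated slabs.\<close>

lemma nn_integral_infinite_along_direction:
  fixes F :: "('i \<Rightarrow> real) \<Rightarrow> real"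
  assumes I: "finite I" and Fm[measurable]: "F \<in> borel_measurable (lebP I)" and Fpos: "\<And>x. 0 < F x"
    and i: "i \<in> I" "g i \<noteq> 0"
    and conv: "\<And>x t. (F x)\<^sup>2 \<le> F (\<lambda>k\<in>I. t * g k + x k) * F (\<lambda>k\<in>I. - t * g k + x k)"
  shows "(\<integral>\<^sup>+ x. ennreal (F x) \<partial>lebP I) = \<infinity>"
proof -
  let ?M = "lebP I"
  \<comment> \<open>The mass of slabs of width 2 whose centres are 3 apart, so they are disjoint and
    their masses add up to at most the whole integral.\<close>
  define a where "a k = (\<integral>\<^sup>+ x. indicator {- 1..1} (x i - 3 * real_of_int k) * ennreal (F x) \<partial>?M)" for k
  \<comment> \<open>The geometric mean in \<open>conv\<close> is replaced by the arithmetic mean,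
    which can be integrated term by term.\<close>
  have am: "(F x) \<le> (F (\<lambda>k\<in>I. t * g k + x k) + F (\<lambda>k\<in>I. - t * g k + x k)) / 2" for x t
  proof -
    let ?p = "F (\<lambda>k\<in>I. t * g k + x k)" and ?q = "F (\<lambda>k\<in>I. - t * g k + x k)"
    have "(F x)\<^sup>2 \<le> ((?p + ?q) / 2)\<^sup>2"
    proof -
      have "0 \<le> (?p - ?q)\<^sup>2" by simp
      then have "?p * ?q \<le> ((?p + ?q) / 2)\<^sup>2" by (simp add: power2_eq_square field_simps)
      then show ?thesis using conv[of x t] by linarith
    qed
    moreover have "0 \<le> (?p + ?q) / 2" using Fpos by (simp add: add_nonneg_nonneg less_imp_le)
    ultimately show ?thesis by (rule power2_le_imp_le)
  qed
  have shift: "(\<integral>\<^sup>+ x. indicator {- 1..1} (x i) * ennreal (F (\<lambda>l\<in>I. 3 * real_of_int k / g i * g l + x l)) \<partial>?M) = a k" for k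
  proof -
    let ?h = "\<lambda>x. indicator {- 1..1} (x i - 3 * real_of_int k) * ennreal (F x)"
    have "(\<integral>\<^sup>+ x. ?h (\<lambda>l\<in>I. 3 * real_of_int k / g i * g l + x l) \<partial>?M) = (\<integral>\<^sup>+ x. ?h x \<partial>?M)"
      using i by (intro nn_integral_PiM_translate I) measurable
    then show ?thesis using i by (simp add: a_def)
  qed
  have ck: "2 * a 0 \<le> a k + a (- k)" for k
  proof -
    let ?t = "3 * real_of_int k / g i"
    have "2 * a 0 = (\<integral>\<^sup>+ x. 2 * (indicator {- 1..1} (x i) * ennreal (F x)) \<partial>?M)"
      using i by (simp add: a_def nn_integral_cmult)
    also have "\<dots> \<le> (\<integral>\<^sup>+ x. indicator {- 1..1} (x i) * ennreal (F (\<lambda>l\<in>I. ?t * g l + x l)) +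
          indicator {- 1..1} (x i) * ennreal (F (\<lambda>l\<in>I. 3 * real_of_int (- k) / g i * g l + x l)) \<partial>?M)"
    proof (rule nn_integral_mono)
      fix x
      have "2 * ennreal (F x) = ennreal (2 * F x)" by (simp add: ennreal_mult' less_imp_le[OF Fpos])
      also have "\<dots> \<le> ennreal (F (\<lambda>l\<in>I. ?t * g l + x l) + F (\<lambda>l\<in>I. - ?t * g l + x l))"
        using am[of x ?t] by (intro ennreal_leI) simp
      also have "\<dots> = ennreal (F (\<lambda>l\<in>I. ?t * g l + x l)) + ennreal (F (\<lambda>l\<in>I. - ?t * g l + x l))"
        by (simp add: less_imp_le[OF Fpos])
      finally show "2 * (indicator {- 1..1} (x i) * ennreal (F x)) \<le> indicator {- 1..1} (x i) * ennreal (F (\<lambda>l\<in>I. ?t * g l + x l)) +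
          indicator {- 1..1} (x i) * ennreal (F (\<lambda>l\<in>I. 3 * real_of_int (- k) / g i * g l + x l))"
        by (auto simp: indicator_def)
    qed
    also have "\<dots> = a k + a (- k)"
      using i by (subst nn_integral_add) (measurable, simp only: shift)
    finally show ?thesis .
  qed
  have "a 0 \<noteq> 0"
  proof
    assume "a 0 = 0"
    then have "emeasure ?M {x \<in> space ?M. indicator {- 1..1} (x i) * ennreal (F x) \<noteq> 0} = 0"
      unfolding a_def using i by (subst (asm) nn_integral_0_iff) auto
    also have "{x \<in> space ?M. indicator {- 1..1} (x i) * ennreal (F x) \<noteq> 0} = Pi\<^sub>E I (\<lambda>k. if k = i then {-1..1} else UNIV)"
      using i Fpos by (auto simp: space_PiM PiE_iff indicator_def ennreal_eq_0_iff not_le extensional_def split: if_splits)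
    finally have "emeasure ?M (Pi\<^sub>E I (\<lambda>k. if k = i then {-1..1} else UNIV)) = 0" .
    moreover have "emeasure ?M (Pi\<^sub>E I (\<lambda>k. if k = i then {-1..1} else UNIV)) = (\<Prod>k\<in>I. emeasure lborel (if k = i then {-1..1::real} else UNIV))"
      using I by (subst lb.emeasure_PiM) auto
    ultimately show False using I by (auto split: if_splits)
  qed
  have bound: "of_nat (Suc N) * a 0 \<le> (\<integral>\<^sup>+ x. ennreal (F x) \<partial>?M)" for N
  proof -
    let ?S = "{- int N..int N}"
    have "2 * (of_nat (card ?S) * a 0) = (\<Sum>k\<in>?S. 2 * a 0)" by (simp add: mult_ac)
    also have "\<dots> \<le> (\<Sum>k\<in>?S. a k + a (- k))" by (intro sum_mono ck)
    also have "\<dots> = (\<Sum>k\<in>?S. a k) + (\<Sum>k\<in>?S. a (- k))" by (rule sum.distrib)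
    also have "(\<Sum>k\<in>?S. a (- k)) = (\<Sum>k\<in>?S. a k)"
      by (rule sum.reindex_bij_witness[of _ uminus uminus]) auto
    also have "(\<Sum>k\<in>?S. a k) + (\<Sum>k\<in>?S. a k) = 2 * (\<Sum>k\<in>?S. a k)" by (simp add: mult_2)
    finally have "of_nat (card ?S) * a 0 \<le> (\<Sum>k\<in>?S. a k)"
      by (simp add: ennreal_mult_le_mult_iff)
    also have "\<dots> = (\<integral>\<^sup>+ x. (\<Sum>k\<in>?S. indicator {- 1..1} (x i - 3 * real_of_int k) * ennreal (F x)) \<partial>?M)"
      unfolding a_def using i by (subst nn_integral_sum) auto
    also have "\<dots> \<le> (\<integral>\<^sup>+ x. ennreal (F x) \<partial>?M)"
    proof (rule nn_integral_mono)
      fix x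
      let ?T = "{k\<in>?S. x i - 3 * real_of_int k \<in> {- 1..1}}"
      have "card ?T \<le> Suc 0"
      proof (subst card_le_Suc0_iff_eq)
        show "\<forall>k\<in>?T. \<forall>l\<in>?T. k = l"
        proof (intro ballI)
          fix k l assume "k \<in> ?T" "l \<in> ?T"
          then have "\<bar>3 * real_of_int k - 3 * real_of_int l\<bar> < 3" by auto
          then have "\<bar>real_of_int (k - l)\<bar> < 1" by (simp add: abs_if split: if_splits)
          then show "k = l" by linarith
        qed
      qed (rule finite_subset[of _ ?S], auto)
      have "(\<Sum>k\<in>?S. indicator {- 1..1} (x i - 3 * real_of_int k) :: ennreal) = of_nat (card ?T)"
        by (simp add: indicator_def sum.If_cases Int_def of_bool_def)
      also have "\<dots> \<le> 1" using \<open>card ?T \<le> Suc 0\<close> by (cases "card ?T") auto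
      finally have "(\<Sum>k\<in>?S. indicator {- 1..1} (x i - 3 * real_of_int k)) * ennreal (F x) \<le> 1 * ennreal (F x)"
        by (intro mult_right_mono) auto
      then show "(\<Sum>k\<in>?S. indicator {- 1..1} (x i - 3 * real_of_int k) * ennreal (F x)) \<le> ennreal (F x)"
        by (simp add: sum_distrib_right)
    qed
    finally have "of_nat (card ?S) * a 0 \<le> (\<integral>\<^sup>+ x. ennreal (F x) \<partial>?M)" .
    moreover have "of_nat (Suc N) * a 0 \<le> of_nat (card ?S) * a 0"
      by (intro mult_right_mono) (auto simp del: of_nat_Suc)
    ultimately show ?thesis by (rule order_trans[rotated])
  qed
  show ?thesis
  proof (rule ccontr)
    assume fin: "(\<integral>\<^sup>+ x. ennreal (F x) \<partial>?M) \<noteq> \<infinity>"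
    then obtain z where z: "(\<integral>\<^sup>+ x. ennreal (F x) \<partial>?M) = ennreal z" "0 \<le> z" by (cases "\<integral>\<^sup>+ x. ennreal (F x) \<partial>?M") auto
    have "a 0 \<le> ennreal z" using bound[of 0] z by simp
    then obtain c where c: "a 0 = ennreal c" "0 < c" using \<open>a 0 \<noteq> 0\<close> by (cases "a 0") (auto simp: top_unique)
    obtain N where N: "z / c < real (Suc N)" by (meson less_trans lessI of_nat_less_iff reals_Archimedean2)
    have "ennreal (real (Suc N) * c) \<le> ennreal z"
      using bound[of N] z c by (simp add: ennreal_of_nat_eq_real_of_nat ennreal_mult del: of_nat_Suc)
    then have "real (Suc N) * c \<le> z" using z by (simp add: ennreal_le_iff del: of_nat_Suc)
    then show False using N c by (simp add: field_simps)
  qed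
qed

lemma sum_sq_le_sq_sum:
  fixes f :: "'a \<Rightarrow> real"
  assumes "finite A" "\<And>i. i \<in> A \<Longrightarrow> 0 \<le> f i"
  shows "(\<Sum>i\<in>A. (f i)\<^sup>2) \<le> (\<Sum>i\<in>A. f i)\<^sup>2"
  using assms
proof (induction A rule: finite_induct)
  case (insert x A)
  have "0 \<le> f x * (\<Sum>i\<in>A. f i)" using insert by (auto intro!: mult_nonneg_nonneg sum_nonneg)
  then show ?case using insert by (simp add: power2_eq_square algebra_simps)
qed simp

section \<open>Design matrix, reduced coordinates and the precision form\<close>

locale probit_gibbs =
  fixes n p r :: nat and qs :: "nat \<Rightarrow> nat" and X :: "nat \<Rightarrow> nat \<Rightarrow> real"
    and lev :: "nat \<Rightarrow> nat \<Rightarrow> nat" and y :: "nat \<Rightarrow> bool" and a b :: "nat \<Rightarrow> real"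
  assumes p_pos: "0 < p" and r_pos: "0 < r"
    and qs_pos: "\<forall>j<r. 0 < qs j"
    and lev_range: "\<forall>j<r. \<forall>i<n. lev j i < qs j"
    and intercept: "\<forall>i<n. X i 0 = 1"
    and B1: "\<forall>j<r. (a j < 0 \<and> b j = 0 \<and> 2 \<le> qs j) \<or> 0 < b j"
    and B2: "\<forall>j<r. 2 * a j + real (qs j) - 1 > 0"
    and B3: "\<forall>c::nat \<Rightarrow> real. (\<forall>i<n. (\<Sum>l<p + qtot r qs - r. Wtmat p r qs X lev i l * c l) = 0)
               \<longrightarrow> (\<forall>l<p + qtot r qs - r. c l = 0)"
    and B4: "\<exists>e::nat \<Rightarrow> real. (\<forall>i<n. 0 < e i) \<and>
               (\<forall>l<p + qtot r qs - r.
                  (\<Sum>i<n. e i * ((1 - 2 * (if y i then 1 else 0)) * Wtmat p r qs X lev i l)) = 0)"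
begin

definition d :: nat where "d = p + qtot r qs"

definition blk :: "nat \<Rightarrow> nat \<Rightarrow> nat" where "blk j k = p + off qs j + k"

definition lp :: "nat \<Rightarrow> (nat \<Rightarrow> real) \<Rightarrow> real" where
  "lp i \<eta> = (\<Sum>c<d. Wmat p r qs X lev i c * \<eta> c)"

abbreviation us :: "(nat \<Rightarrow> real) \<Rightarrow> nat \<Rightarrow> real" where
  "us \<eta> j \<equiv> usq p qs \<eta> j"

lemma us_def: "us \<eta> j = (\<Sum>k<qs j. (\<eta> (blk j k))\<^sup>2)"
  by (simp add: usq_def blk_def)

lemma us_nonneg: "0 \<le> us \<eta> j" by (simp add: us_def sum_nonneg)

lemma blk_less: "j < r \<Longrightarrow> k < qs j \<Longrightarrow> blk j k < d"
  using block_index_less[of j r k qs] by (simp add: blk_def d_def qtot_def off_def)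

lemma blk_ge: "p \<le> blk j k" by (simp add: blk_def)

lemma blk_inj: "k < qs j \<Longrightarrow> k' < qs j' \<Longrightarrow> blk j k = blk j' k' \<Longrightarrow> j = j' \<and> k = k'"
  using block_index_unique[of k qs j k' j'] by (simp add: blk_def off_def)

lemma blk_exists: "p \<le> c \<Longrightarrow> c < d \<Longrightarrow> \<exists>j<r. \<exists>k<qs j. c = blk j k"
  using block_index_exists[where c="c - p" and r=r and m=qs] by (force simp: blk_def d_def qtot_def off_def)

lemma sum_d: "(\<Sum>c<d. f c) = (\<Sum>c<p. f c) + (\<Sum>j<r. \<Sum>k<qs j. f (blk j k))" for f :: "nat \<Rightarrow> real"
  unfolding d_def qtot_def sum_lessThan_add sum_blocks blk_def off_def by (simp add: add.assoc)

lemma Zmat_blk: "j < r \<Longrightarrow> k < qs j \<Longrightarrow> Zmat r qs lev i (off qs j + k) = (if lev j i = k then 1 else 0)"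
  unfolding Zmat_def off_def using block_index_unique[of k qs j] by (auto; blast)

lemma Wmat_blk: "j < r \<Longrightarrow> k < qs j \<Longrightarrow> Wmat p r qs X lev i (blk j k) = (if lev j i = k then 1 else 0)"
  by (simp add: Wmat_def blk_def Zmat_blk)

lemma sum_level:
  fixes f :: "nat \<Rightarrow> real"
  shows "l < q \<Longrightarrow> (\<Sum>k<q. (if l = k then 1 else 0) * f k) = f l"
  by (subst sum.mono_neutral_right[of "{..<q}" "{l}"]) auto

lemma lp_eq: "i < n \<Longrightarrow> lp i \<eta> = (\<Sum>c<p. X i c * \<eta> c) + (\<Sum>j<r. \<eta> (blk j (lev j i)))"
  using lev_range unfolding lp_def sum_d
  by (simp add: Wmat_blk sum_level) (simp add: Wmat_def)

definition dt :: nat where "dt = p + qtot r qs - r"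

text \<open>Column of \<open>Wtmat\<close> belonging to level \<open>k + 1\<close> of effect
  \<open>j\<close>; level 0 is the dropped column, hence the shift by one throughout.\<close>

definition blkt :: "nat \<Rightarrow> nat \<Rightarrow> nat" where "blkt j k = p + offt qs j + k"

lemma dt_eq: "dt = p + (\<Sum>j<r. qs j - 1)"
proof -
  have "(\<Sum>j<r. qs j) = (\<Sum>j<r. qs j - 1) + r"
  proof -
    have "(\<Sum>j<r. qs j) = (\<Sum>j<r. (qs j - 1) + 1)" using qs_pos by (intro sum.cong) auto
    also have "\<dots> = (\<Sum>j<r. qs j - 1) + r" unfolding sum.distrib by simp
    finally show ?thesis .
  qed
  then show ?thesis by (simp add: dt_def qtot_def)
qed

lemma sum_dt: "(\<Sum>c<dt. f c) = (\<Sum>c<p. f c) + (\<Sum>j<r. \<Sum>k<qs j - 1. f (blkt j k))" for f :: "nat \<Rightarrow> real"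
  unfolding dt_eq sum_lessThan_add sum_blocks blkt_def offt_def by (simp add: add.assoc)

lemma blkt_inj: "k < qs j - 1 \<Longrightarrow> k' < qs j' - 1 \<Longrightarrow> blkt j k = blkt j' k' \<Longrightarrow> j = j' \<and> k = k'"
  using block_index_unique[of k "\<lambda>j. qs j - 1" j k' j'] by (simp add: blkt_def offt_def)

lemma Wtmat_blkt:
  assumes "j < r" "k < qs j - 1"
  shows "Wtmat p r qs X lev i (blkt j k) = (if lev j i = k + 1 then 1 else 0)"
proof -
  have "(\<exists>j'<r. \<exists>k'. k' + 1 < qs j' \<and> offt qs j + k = offt qs j' + k' \<and> lev j' i = k' + 1) \<longleftrightarrow> lev j i = k + 1"
  proof
    assume "\<exists>j'<r. \<exists>k'. k' + 1 < qs j' \<and> offt qs j + k = offt qs j' + k' \<and> lev j' i = k' + 1"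
    then obtain j' k' where jk: "k' + 1 < qs j'" "offt qs j + k = offt qs j' + k'" "lev j' i = k' + 1" by blast
    have "j = j' \<and> k = k'" using jk by (intro blkt_inj[OF assms(2)]) (auto simp: blkt_def)
    then show "lev j i = k + 1" using jk by simp
  next
    assume "lev j i = k + 1"
    then show "\<exists>j'<r. \<exists>k'. k' + 1 < qs j' \<and> offt qs j + k = offt qs j' + k' \<and> lev j' i = k' + 1"
      using assms by (intro exI[of _ j] conjI exI[of _ k]) auto
  qed
  then show ?thesis by (simp add: Wtmat_def blkt_def add.assoc)
qed

text \<open>The reduced coordinates of \<open>\<eta>\<close>: level effects relative to the first level, with the first
  levels absorbed into the intercept.\<close>

definition theta :: "(nat \<Rightarrow> real) \<Rightarrow> nat \<Rightarrow> real" where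
  "theta \<eta> l = (if l = 0 then \<eta> 0 + (\<Sum>j<r. \<eta> (blk j 0)) else if l < p then \<eta> l
     else (let jk = (SOME jk. fst jk < r \<and> snd jk < qs (fst jk) - 1 \<and> l = blkt (fst jk) (snd jk))
           in \<eta> (blk (fst jk) (snd jk + 1)) - \<eta> (blk (fst jk) 0)))"

lemma theta_blkt:
  assumes "j < r" "k < qs j - 1"
  shows "theta \<eta> (blkt j k) = \<eta> (blk j (k + 1)) - \<eta> (blk j 0)"
proof -
  have "(SOME jk. fst jk < r \<and> snd jk < qs (fst jk) - 1 \<and> blkt j k = blkt (fst jk) (snd jk)) = (j, k)"
  proof (rule some_equality)
    fix jk assume jk: "fst jk < r \<and> snd jk < qs (fst jk) - 1 \<and> blkt j k = blkt (fst jk) (snd jk)"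
    then have "j = fst jk \<and> k = snd jk" by (intro blkt_inj[OF assms(2)]) auto
    then show "jk = (j, k)" by (simp add: prod_eq_iff)
  qed (use assms in simp)
  moreover have "p \<le> blkt j k" by (simp add: blkt_def)
  ultimately show ?thesis using p_pos by (simp add: theta_def)
qed

lemma sum_theta_block:
  fixes f :: "nat \<Rightarrow> real"
  assumes "j < r"
  shows "(\<Sum>k<qs j - 1. f (k + 1) * (\<eta> (blk j (k + 1)) - \<eta> (blk j 0)))
       = (\<Sum>k<qs j. f k * (\<eta> (blk j k) - \<eta> (blk j 0)))"
proof -
  obtain m where m: "qs j = Suc m" using qs_pos assms by (metis Suc_pred)
  show ?thesis unfolding m by (subst sum.lessThan_Suc_shift) simp
qed

text \<open>Each observation has exactly one level per effect and the first column of
  \<open>X\<close> is constant 1. So the value of the first level can be moved from every block into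
  the intercept, after which the remaining levels enter as differences.\<close>

lemma lp_theta:
  assumes i: "i < n"
  shows "lp i \<eta> = (\<Sum>l<dt. Wtmat p r qs X lev i l * theta \<eta> l)"
proof -
  obtain p' where p': "p = Suc p'" using p_pos by (metis Suc_pred)
  have 1: "(\<Sum>c<p. Wtmat p r qs X lev i c * theta \<eta> c) = (\<Sum>c<p. X i c * \<eta> c) + (\<Sum>j<r. \<eta> (blk j 0))"
  proof -
    have "(\<Sum>c<p. Wtmat p r qs X lev i c * theta \<eta> c) = (\<Sum>c<p. X i c * \<eta> c + (if c = 0 then (\<Sum>j<r. \<eta> (blk j 0)) else 0))"
      using intercept i by (intro sum.cong) (auto simp: Wtmat_def theta_def algebra_simps)
    also have "\<dots> = (\<Sum>c<p. X i c * \<eta> c) + (\<Sum>j<r. \<eta> (blk j 0))"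
      unfolding sum.distrib using p_pos by (simp add: sum.delta)
    finally show ?thesis .
  qed
  have 2: "(\<Sum>k<qs j - 1. Wtmat p r qs X lev i (blkt j k) * theta \<eta> (blkt j k)) = \<eta> (blk j (lev j i)) - \<eta> (blk j 0)"
    if j: "j < r" for j
  proof -
    have "(\<Sum>k<qs j - 1. Wtmat p r qs X lev i (blkt j k) * theta \<eta> (blkt j k))
      = (\<Sum>k<qs j - 1. (if lev j i = k + 1 then 1 else 0) * (\<eta> (blk j (k + 1)) - \<eta> (blk j 0)))"
      using j by (intro sum.cong refl) (simp add: Wtmat_blkt theta_blkt)
    also have "\<dots> = (\<Sum>k<qs j. (if lev j i = k then 1 else 0) * (\<eta> (blk j k) - \<eta> (blk j 0)))"
      using sum_theta_block[OF j, of "\<lambda>k. if lev j i = k then 1 else 0"] by simp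
    also have "\<dots> = \<eta> (blk j (lev j i)) - \<eta> (blk j 0)" by (rule sum_level) (use lev_range j i in auto)
    finally show ?thesis .
  qed
  have "(\<Sum>l<dt. Wtmat p r qs X lev i l * theta \<eta> l) = (\<Sum>c<p. X i c * \<eta> c) + (\<Sum>j<r. \<eta> (blk j 0)) + (\<Sum>j<r. \<eta> (blk j (lev j i)) - \<eta> (blk j 0))"
    unfolding sum_dt 1 using 2 by simp
  also have "\<dots> = lp i \<eta>" unfolding lp_eq[OF i] by (simp add: sum_subtractf)
  finally show ?thesis ..
qed

text \<open>The squared norm of \<open>theta\<close>, written in the coordinates of
  \<open>\<eta>\<close>. The summands with \<open>k = 0\<close> vanish and are kept to allow sums
  over whole blocks.\<close>

definition thn :: "(nat \<Rightarrow> real) \<Rightarrow> real" where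
  "thn \<eta> = (\<eta> 0 + (\<Sum>j<r. \<eta> (blk j 0)))\<^sup>2 + (\<Sum>c\<in>{0<..<p}. (\<eta> c)\<^sup>2) +
     (\<Sum>j<r. \<Sum>k<qs j. (\<eta> (blk j k) - \<eta> (blk j 0))\<^sup>2)"

lemma thn_eq: "thn \<eta> = (\<Sum>l<dt. (theta \<eta> l)\<^sup>2)"
proof -
  have 1: "(\<Sum>c<p. (theta \<eta> c)\<^sup>2) = (\<eta> 0 + (\<Sum>j<r. \<eta> (blk j 0)))\<^sup>2 + (\<Sum>c\<in>{0<..<p}. (\<eta> c)\<^sup>2)"
  proof -
    have "{..<p} = insert 0 {0<..<p}" using p_pos by auto
    then have "(\<Sum>c<p. (theta \<eta> c)\<^sup>2) = (theta \<eta> 0)\<^sup>2 + (\<Sum>c\<in>{0<..<p}. (theta \<eta> c)\<^sup>2)" by simp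
    then show ?thesis by (simp add: theta_def)
  qed
  have 2: "(\<Sum>k<qs j - 1. (theta \<eta> (blkt j k))\<^sup>2) = (\<Sum>k<qs j. (\<eta> (blk j k) - \<eta> (blk j 0))\<^sup>2)" if j: "j < r" for j
  proof -
    have "(\<Sum>k<qs j - 1. (theta \<eta> (blkt j k))\<^sup>2)
      = (\<Sum>k<qs j - 1. (\<eta> (blk j (k + 1)) - \<eta> (blk j 0)) * (\<eta> (blk j (k + 1)) - \<eta> (blk j 0)))"
      using j by (intro sum.cong refl) (simp add: theta_blkt power2_eq_square)
    also have "\<dots> = (\<Sum>k<qs j. (\<eta> (blk j k) - \<eta> (blk j 0)) * (\<eta> (blk j k) - \<eta> (blk j 0)))"
      by (rule sum_theta_block[OF j, of "\<lambda>k. \<eta> (blk j k) - \<eta> (blk j 0)"])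
    finally show ?thesis by (simp add: power2_eq_square)
  qed
  show ?thesis unfolding thn_def sum_dt 1 using 2 by simp
qed

text \<open>(B3) in quantitative form: the linear predictors control every direction of
  \<open>\<eta>\<close> except the shifts that \<open>theta\<close> does not see.\<close>

lemma thn_coercive: "\<exists>\<kappa>>0. \<forall>\<eta>. \<kappa> * thn \<eta> \<le> (\<Sum>i<n. (lp i \<eta>)\<^sup>2)"
proof -
  obtain \<kappa> where \<kappa>: "\<kappa> > 0" "\<And>x. \<kappa> * (\<Sum>c<dt. (x c)\<^sup>2) \<le> (\<Sum>i<n. (\<Sum>c<dt. Wtmat p r qs X lev i c * x c)\<^sup>2)"
    using linear_family_coercive[where n=n and d=dt and A="Wtmat p r qs X lev"] B3 unfolding dt_def by blast
  have "\<kappa> * thn \<eta> \<le> (\<Sum>i<n. (lp i \<eta>)\<^sup>2)" for \<eta>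
    using \<kappa>(2)[of "theta \<eta>"] by (simp add: thn_eq lp_theta)
  then show ?thesis using \<kappa>(1) by blast
qed

definition \<kappa>0 :: real where "\<kappa>0 = (SOME \<kappa>. \<kappa> > 0 \<and> (\<forall>\<eta>. \<kappa> * thn \<eta> \<le> (\<Sum>i<n. (lp i \<eta>)\<^sup>2)))"

lemma \<kappa>0: "0 < \<kappa>0" "\<kappa>0 * thn \<eta> \<le> (\<Sum>i<n. (lp i \<eta>)\<^sup>2)"
  using someI_ex[OF thn_coercive] unfolding \<kappa>0_def by auto

text \<open>The direction in the kernel of \<open>W\<close> that raises block \<open>j\<close> by 1
  and lowers the intercept by 1.\<close>

definition ddir :: "nat \<Rightarrow> nat \<Rightarrow> real" where
  "ddir j c = (if c = 0 then - 1 else if \<exists>k<qs j. c = blk j k then 1 else 0)"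

lemma ddir_blk: "j < r \<Longrightarrow> j' < r \<Longrightarrow> k < qs j' \<Longrightarrow> ddir j (blk j' k) = (if j' = j then 1 else 0)"
  using p_pos blk_ge[of j' k] blk_inj[of k j' _ j] by (auto simp: ddir_def)

lemma lp_ddir: assumes i: "i < n" and j: "j < r" shows "lp i (ddir j) = 0"
proof -
  have "(\<Sum>c<p. X i c * ddir j c) = (\<Sum>c<p. X i c * (if c = 0 then - 1 else 0))"
  proof (intro sum.cong refl)
    fix c assume "c \<in> {..<p}"
    then have "\<not> (\<exists>k<qs j. c = blk j k)" using blk_ge[of j] by (metis lessThan_iff leD)
    then show "X i c * ddir j c = X i c * (if c = 0 then - 1 else 0)" by (auto simp: ddir_def)
  qed
  also have "\<dots> = - 1" using p_pos intercept i by (subst sum.mono_neutral_right[of "{..<p}" "{0}"]) auto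
  finally have 1: "(\<Sum>c<p. X i c * ddir j c) = - 1" .
  have "(\<Sum>j'<r. ddir j (blk j' (lev j' i))) = (\<Sum>j'<r. if j' = j then 1 else 0)"
    using lev_range i j by (intro sum.cong) (auto simp: ddir_blk)
  then show ?thesis unfolding lp_eq[OF i] 1 using j by simp
qed

lemma lp_add: "lp i (\<lambda>c. f c + g c) = lp i f + lp i g"
  and lp_scale: "lp i (\<lambda>c. t * f c) = t * lp i f"
  by (simp_all add: lp_def algebra_simps sum.distrib sum_subtractf sum_distrib_left)

lemma lp_cong: "(\<And>c. c < d \<Longrightarrow> f c = g c) \<Longrightarrow> lp i f = lp i g"
  by (simp add: lp_def)

lemma us_cong: "j < r \<Longrightarrow> (\<And>c. c < d \<Longrightarrow> f c = g c) \<Longrightarrow> us f j = us g j"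
  by (simp add: us_def blk_less)

text \<open>The bilinear form of \<open>Sigma_tau\<close>. It pairs linear predictors and blocks
  directly, so that test vectors such as \<open>ddir j\<close> can be inserted without touching
  matrix entries.\<close>

definition bil :: "(nat \<Rightarrow> real) \<Rightarrow> (nat \<Rightarrow> real) \<Rightarrow> (nat \<Rightarrow> real) \<Rightarrow> real" where
  "bil \<tau> x z = (\<Sum>i<n. lp i x * lp i z) + (\<Sum>j<r. \<tau> j * (\<Sum>k<qs j. x (blk j k) * z (blk j k)))"

definition Qf :: "(nat \<Rightarrow> real) \<Rightarrow> (nat \<Rightarrow> real) \<Rightarrow> real" where
  "Qf \<tau> x = (\<Sum>i<n. (lp i x)\<^sup>2) + (\<Sum>j<r. \<tau> j * us x j)"

lemma bil_self: "bil \<tau> x x = Qf \<tau> x"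
  by (simp add: bil_def Qf_def us_def power2_eq_square)

lemma Dtau_blk: "j < r \<Longrightarrow> k < qs j \<Longrightarrow> Dtau p r qs \<tau> (blk j k) = \<tau> j"
proof -
  assume j: "j < r" "k < qs j"
  have "(p + off qs j' \<le> blk j k \<and> blk j k < p + off qs j' + qs j') \<longleftrightarrow> j' = j" if "j' < r" for j'
  proof
    assume "p + off qs j' \<le> blk j k \<and> blk j k < p + off qs j' + qs j'"
    then have "blk j k - (p + off qs j') < qs j'" "blk j k = blk j' (blk j k - (p + off qs j'))" by (auto simp: blk_def)
    then show "j' = j" using blk_inj[OF j(2)] by metis
  qed (use j in \<open>auto simp: blk_def\<close>)
  then have "Dtau p r qs \<tau> (blk j k) = (\<Sum>j'<r. if j' = j then \<tau> j' else 0)"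
    unfolding Dtau_def by (intro sum.cong) auto
  then show ?thesis using j by simp
qed

lemma Dtau_beta: "c < p \<Longrightarrow> Dtau p r qs \<tau> c = 0"
  by (simp add: Dtau_def)

lemma Sigma_row:
  assumes "c < d"
  shows "(\<Sum>c'<d. Sigma_tau n p r qs X lev \<tau> c c' * z c') = (\<Sum>i<n. Wmat p r qs X lev i c * lp i z) + Dtau p r qs \<tau> c * z c"
proof -
  have "(\<Sum>c'<d. Sigma_tau n p r qs X lev \<tau> c c' * z c')
     = (\<Sum>c'<d. (\<Sum>i<n. Wmat p r qs X lev i c * (Wmat p r qs X lev i c' * z c')) + (if c = c' then 1 else 0) * (Dtau p r qs \<tau> c * z c'))"
    by (intro sum.cong) (auto simp: Sigma_tau_def distrib_right sum_distrib_right mult.assoc)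
  also have "\<dots> = (\<Sum>c'<d. \<Sum>i<n. Wmat p r qs X lev i c * (Wmat p r qs X lev i c' * z c')) + Dtau p r qs \<tau> c * z c"
    unfolding sum.distrib sum_level[OF assms, of "\<lambda>c'. Dtau p r qs \<tau> c * z c'"] ..
  also have "(\<Sum>c'<d. \<Sum>i<n. Wmat p r qs X lev i c * (Wmat p r qs X lev i c' * z c')) = (\<Sum>i<n. Wmat p r qs X lev i c * lp i z)"
    unfolding lp_def sum_distrib_left by (rule sum.swap)
  finally show ?thesis .
qed

lemma sum_W_lp: "(\<Sum>c<d. x c * (\<Sum>i<n. Wmat p r qs X lev i c * t i)) = (\<Sum>i<n. lp i x * t i)"
  unfolding lp_def sum_distrib_left sum_distrib_right by (subst sum.swap) (simp add: mult_ac)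

lemma Sigma_bil: "(\<Sum>c<d. x c * (\<Sum>c'<d. Sigma_tau n p r qs X lev \<tau> c c' * z c')) = bil \<tau> x z"
proof -
  have "(\<Sum>c<d. x c * (\<Sum>c'<d. Sigma_tau n p r qs X lev \<tau> c c' * z c'))
     = (\<Sum>c<d. x c * (\<Sum>i<n. Wmat p r qs X lev i c * lp i z)) + (\<Sum>c<d. x c * (Dtau p r qs \<tau> c * z c))"
    unfolding sum.distrib[symmetric] by (intro sum.cong refl) (simp add: Sigma_row distrib_left)
  also have "(\<Sum>c<d. x c * (Dtau p r qs \<tau> c * z c)) = (\<Sum>j<r. \<tau> j * (\<Sum>k<qs j. x (blk j k) * z (blk j k)))"
    unfolding sum_d by (simp add: Dtau_beta Dtau_blk sum_distrib_left mult_ac)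
  finally show ?thesis by (simp add: sum_W_lp bil_def)
qed

lemma Sigma_form:
  "(\<Sum>c<d. \<Sum>c'<d. x c * Sigma_tau n p r qs X lev \<tau> c c' * x c') = Qf \<tau> x"
  unfolding bil_self[symmetric] Sigma_bil[symmetric] by (simp add: sum_distrib_left mult_ac)

text \<open>(B4) speaks about the reduced matrix; through \<open>theta\<close> the same positive
  weights, with signs, annihilate the linear predictors of every \<open>\<eta>\<close>.\<close>

lemma orth:
  "\<exists>e. (\<forall>i<n. 0 < e i) \<and> (\<forall>\<eta>. (\<Sum>i<n. e i * ((1 - 2 * (if y i then 1 else 0)) * lp i \<eta>)) = 0)"
proof -
  obtain e where e: "\<forall>i<n. 0 < e i" "\<forall>l<dt. (\<Sum>i<n. e i * ((1 - 2 * (if y i then 1 else 0)) * Wtmat p r qs X lev i l)) = 0"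
    using B4 unfolding dt_def by blast
  let ?s = "\<lambda>i. 1 - 2 * (if y i then 1 else 0) :: real"
  have "(\<Sum>i<n. e i * (?s i * lp i \<eta>)) = 0" for \<eta>
  proof -
    have "(\<Sum>i<n. e i * (?s i * lp i \<eta>)) = (\<Sum>i<n. \<Sum>l<dt. theta \<eta> l * (e i * (?s i * Wtmat p r qs X lev i l)))"
      by (intro sum.cong refl) (simp add: lp_theta sum_distrib_left mult_ac)
    also have "\<dots> = (\<Sum>l<dt. theta \<eta> l * (\<Sum>i<n. e i * (?s i * Wtmat p r qs X lev i l)))"
      unfolding sum_distrib_left by (rule sum.swap)
    also have "\<dots> = 0" using e(2) by (intro sum.neutral ballI) simp
    finally show ?thesis .
  qed
  then show ?thesis using e(1) by blast
qed

definition vsup :: "(nat \<Rightarrow> real) \<Rightarrow> bool" where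
  "vsup v \<longleftrightarrow> (\<forall>i<n. v i \<in> halfline (y i))"

text \<open>On the support of \<open>v\<close> the signed entries all equal
  \<open>- \<bar>v i\<bar>\<close>, so no cancellation occurs in their weighted sum. That sum does
  not change when the linear predictors are subtracted, and Cauchy-Schwarz bounds it by the
  residual.\<close>

lemma orthant_gap:
  "\<exists>\<delta>. 0 < \<delta> \<and> \<delta> \<le> 1/2 \<and> (\<forall>v \<eta>. vsup v \<longrightarrow> \<delta> * (\<Sum>i<n. (v i)\<^sup>2) \<le> (\<Sum>i<n. (v i - lp i \<eta>)\<^sup>2))"
proof -
  let ?s = "\<lambda>i. 1 - 2 * (if y i then 1 else 0) :: real"
  obtain e where e: "\<And>i. i < n \<Longrightarrow> 0 < e i" "\<And>\<eta>. (\<Sum>i<n. e i * (?s i * lp i \<eta>)) = 0" using orth by blast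
  \<comment> \<open>Inserting 1 keeps the minimum defined and positive when
    \<open>n = 0\<close>.\<close>
  define em where "em = Min (insert 1 (e ` {..<n}))"
  have em: "0 < em" "\<And>i. i < n \<Longrightarrow> em \<le> e i" unfolding em_def using e(1) by (auto simp: Min_gr_iff)
  define E where "E = (\<Sum>i<n. (e i)\<^sup>2) + 1"
  have E: "0 < E" by (simp add: E_def add_nonneg_pos sum_nonneg)
  \<comment> \<open>The cap \<open>1/2\<close> keeps \<open>1 - \<delta>\<close> positive, as the
    later estimates of the contraction factor require.\<close>
  define \<delta> where "\<delta> = min (1/2) (em\<^sup>2 / E)"
  have "\<delta> * (\<Sum>i<n. (v i)\<^sup>2) \<le> (\<Sum>i<n. (v i - lp i \<eta>)\<^sup>2)" if v: "vsup v" for v \<eta>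
  proof -
    have sv: "?s i * v i = - \<bar>v i\<bar>" if "i < n" for i using v that by (auto simp: vsup_def split: if_splits)
    have "em\<^sup>2 * (\<Sum>i<n. (v i)\<^sup>2) \<le> (\<Sum>i<n. (e i * \<bar>v i\<bar>)\<^sup>2)"
      unfolding sum_distrib_left using em by (intro sum_mono) (auto simp: power_mult_distrib intro!: mult_right_mono power_mono)
    also have "\<dots> \<le> (\<Sum>i<n. e i * \<bar>v i\<bar>)\<^sup>2" using e(1) by (intro sum_sq_le_sq_sum) (auto simp: less_imp_le)
    also have "(\<Sum>i<n. e i * \<bar>v i\<bar>) = - (\<Sum>i<n. e i * (?s i * v i))" using sv by (simp add: sum_negf)
    also have "\<dots> = - (\<Sum>i<n. e i * (?s i * (v i - lp i \<eta>)))"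
      using e(2)[of \<eta>] by (simp only: right_diff_distrib sum_subtractf)
    also have "(- (\<Sum>i<n. e i * (?s i * (v i - lp i \<eta>))))\<^sup>2 = (\<Sum>i<n. e i * (?s i * (v i - lp i \<eta>)))\<^sup>2" by simp
    also have "\<dots> \<le> (\<Sum>i<n. (e i)\<^sup>2) * (\<Sum>i<n. (?s i * (v i - lp i \<eta>))\<^sup>2)" by (rule Cauchy_Schwarz_ineq_sum)
    also have "(\<Sum>i<n. (?s i * (v i - lp i \<eta>))\<^sup>2) = (\<Sum>i<n. (v i - lp i \<eta>)\<^sup>2)"
      by (intro sum.cong) (auto simp: power_mult_distrib)
    also have "(\<Sum>i<n. (e i)\<^sup>2) * (\<Sum>i<n. (v i - lp i \<eta>)\<^sup>2) \<le> E * (\<Sum>i<n. (v i - lp i \<eta>)\<^sup>2)"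
      by (intro mult_right_mono) (auto simp: E_def sum_nonneg)
    finally have "em\<^sup>2 / E * (\<Sum>i<n. (v i)\<^sup>2) \<le> (\<Sum>i<n. (v i - lp i \<eta>)\<^sup>2)" using E by (simp add: field_simps)
    moreover have "\<delta> * (\<Sum>i<n. (v i)\<^sup>2) \<le> em\<^sup>2 / E * (\<Sum>i<n. (v i)\<^sup>2)"
      by (intro mult_right_mono) (auto simp: \<delta>_def sum_nonneg)
    ultimately show ?thesis by linarith
  qed
  moreover have "0 < \<delta>" "\<delta> \<le> 1/2" using em E min.cobounded1[of "1/2" "em\<^sup>2 / E"] by (auto simp only: \<delta>_def min_less_iff_conj zero_less_divide_iff zero_less_power zero_less_one zero_less_numeral)
  ultimately show ?thesis by blast
qed

definition \<delta>0 :: real where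
  "\<delta>0 = (SOME \<delta>. 0 < \<delta> \<and> \<delta> \<le> 1/2 \<and> (\<forall>v \<eta>. vsup v \<longrightarrow> \<delta> * (\<Sum>i<n. (v i)\<^sup>2) \<le> (\<Sum>i<n. (v i - lp i \<eta>)\<^sup>2)))"

lemma \<delta>0: "0 < \<delta>0" "\<delta>0 \<le> 1/2" "vsup v \<Longrightarrow> \<delta>0 * (\<Sum>i<n. (v i)\<^sup>2) \<le> (\<Sum>i<n. (v i - lp i \<eta>)\<^sup>2)"
  using someI_ex[OF orthant_gap] unfolding \<delta>0_def by auto

definition PD :: "(nat \<Rightarrow> real) \<Rightarrow> bool" where
  "PD \<tau> \<longleftrightarrow> (\<forall>x. (\<exists>c<d. x c \<noteq> 0) \<longrightarrow> 0 < Qf \<tau> x)"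

text \<open>A vanishing form forces all blocks to be 0 through the positive precisions, and then the
  bound on \<open>thn\<close> forces the regression part to be 0.\<close>

lemma PD_pos: assumes \<tau>: "\<forall>j<r. 0 < \<tau> j" shows "PD \<tau>"
proof (unfold PD_def, intro allI impI)
  fix x :: "nat \<Rightarrow> real" assume "\<exists>c<d. x c \<noteq> 0"
  then obtain c where c: "c < d" "x c \<noteq> 0" by blast
  have n1: "0 \<le> (\<Sum>i<n. (lp i x)\<^sup>2)" by (simp add: sum_nonneg)
  have n2: "0 \<le> (\<Sum>j<r. \<tau> j * us x j)" using \<tau> by (intro sum_nonneg) (auto simp: us_nonneg less_imp_le)
  show "0 < Qf \<tau> x"
  proof (rule ccontr)
    assume "\<not> 0 < Qf \<tau> x"
    then have z: "(\<Sum>i<n. (lp i x)\<^sup>2) = 0" "(\<Sum>j<r. \<tau> j * us x j) = 0" using n1 n2 by (auto simp: Qf_def)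
    have "\<forall>j\<in>{..<r}. \<tau> j * us x j = 0" using z(2) \<tau>
      by (subst (asm) sum_nonneg_eq_0_iff) (auto simp: us_nonneg less_imp_le)
    then have "us x j = 0" if "j < r" for j using \<tau> that by force
    then have ub: "x (blk j k) = 0" if "j < r" "k < qs j" for j k
      using that unfolding us_def by (subst (asm) sum_nonneg_eq_0_iff) auto
    have "\<kappa>0 * thn x \<le> 0" using \<kappa>0(2)[of x] z(1) by simp
    then have t0: "thn x \<le> 0" using \<kappa>0(1) by (simp add: mult_le_0_iff)
    have "0 \<le> (\<Sum>c\<in>{0<..<p}. (x c)\<^sup>2)" "0 \<le> (\<Sum>j<r. \<Sum>k<qs j. (x (blk j k) - x (blk j 0))\<^sup>2)"
      "0 \<le> (x 0 + (\<Sum>j<r. x (blk j 0)))\<^sup>2" by (auto intro!: sum_nonneg)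
    then have t1: "(x 0 + (\<Sum>j<r. x (blk j 0)))\<^sup>2 = 0" "(\<Sum>c\<in>{0<..<p}. (x c)\<^sup>2) = 0"
      using t0 unfolding thn_def by linarith+
    have x0: "x 0 = 0" using t1(1) ub qs_pos by simp
    have xp: "x c = 0" if "0 < c" "c < p" for c using t1(2) that by (subst (asm) sum_nonneg_eq_0_iff) auto
    show False using c x0 xp ub blk_exists[of c] by (cases "c < p"; cases "c = 0") (auto simp: not_less)
  qed
qed

text \<open>The linear system determines the mean on the first \<open>d\<close> indices only;
  membership in \<open>extensional\<close> fixes the rest and makes the description in
  \<open>eta_draw\<close> unique.\<close>

lemma mean_exists:
  assumes "PD \<tau>"
  shows "\<exists>!mu. mu \<in> extensional {..<d} \<and>
     (\<forall>c<d. (\<Sum>c'<d. Sigma_tau n p r qs X lev \<tau> c c' * mu c') = (\<Sum>i<n. Wmat p r qs X lev i c * v i))"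
proof -
  let ?S = "Sigma_tau n p r qs X lev \<tau>"
  have inj: "\<forall>c<d. x c = 0" if "\<forall>c<d. (\<Sum>l<d. ?S c l * x l) = 0" for x
  proof -
    have "bil \<tau> x x = (\<Sum>c<d. x c * (\<Sum>l<d. ?S c l * x l))" by (rule Sigma_bil[symmetric])
    also have "\<dots> = 0" by (rule sum.neutral) (use that in simp)
    finally have "\<not> 0 < Qf \<tau> x" by (simp add: bil_self)
    then show ?thesis using assms unfolding PD_def by blast
  qed
  have sym: "?S l c = ?S c l" for l c unfolding Sigma_tau_def by (auto intro!: sum.cong simp: mult.commute)
  obtain x where x: "\<forall>c<d. (\<Sum>l<d. ?S c l * x l) = (\<Sum>i<n. Wmat p r qs X lev i c * v i)"
  proof -
    have inj': "\<forall>c<d. x c = 0" if "\<forall>c<d. (\<Sum>l<d. ?S l c * x l) = 0" for x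
      by (rule inj) (use that sym in simp)
    show thesis using posdef_solvable[where S="?S" and d=d and b="\<lambda>c. \<Sum>i<n. Wmat p r qs X lev i c * v i", OF inj'] that by blast
  qed
  show ?thesis
  proof (rule ex1I[of _ "restrict x {..<d}"])
    show "restrict x {..<d} \<in> extensional {..<d} \<and> (\<forall>c<d. (\<Sum>c'<d. ?S c c' * restrict x {..<d} c') = (\<Sum>i<n. Wmat p r qs X lev i c * v i))"
      using x by simp
    fix z assume z: "z \<in> extensional {..<d} \<and> (\<forall>c<d. (\<Sum>c'<d. ?S c c' * z c') = (\<Sum>i<n. Wmat p r qs X lev i c * v i))"
    have "\<forall>c<d. (\<Sum>l<d. ?S c l * (z l - x l)) = 0" using x z by (simp add: right_diff_distrib sum_subtractf)
    then have "\<forall>c<d. z c - x c = 0" by (rule inj)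
    then show "z = restrict x {..<d}" using z by (auto simp: fun_eq_iff extensional_def)
  qed
qed

text \<open>The weak form of the normal equations. Suitable test vectors \<open>x\<close> extract
  what is needed about the mean without solving for it.\<close>

lemma mean_bil:
  assumes "\<forall>c<d. (\<Sum>c'<d. Sigma_tau n p r qs X lev \<tau> c c' * mu c') = (\<Sum>i<n. Wmat p r qs X lev i c * v i)"
  shows "bil \<tau> x mu = (\<Sum>i<n. lp i x * v i)"
  unfolding Sigma_bil[symmetric] sum_W_lp[symmetric] using assms by (intro sum.cong) auto

end

section \<open>The Gaussian weight of the \<open>\<eta>\<close> draw\<close>

lemma prod_lessThan_add:
  fixes f :: "nat \<Rightarrow> 'b::comm_monoid_mult"
  shows "(\<Prod>c<(m::nat) + k. f c) = (\<Prod>c<m. f c) * (\<Prod>l<k. f (m + l))"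
  by (induction k) (simp_all add: mult.assoc)

lemma prod_blocks:
  fixes f :: "nat \<Rightarrow> 'b::comm_monoid_mult" and m :: "nat \<Rightarrow> nat"
  shows "(\<Prod>c<(\<Sum>j<(r::nat). m j). f c) = (\<Prod>j<r. \<Prod>k<m j. f ((\<Sum>l<j. m l) + k))"
proof (induction r)
  case (Suc r)
  have "(\<Prod>c<(\<Sum>j<Suc r. m j). f c) = (\<Prod>c<(\<Sum>j<r. m j) + m r. f c)" by simp
  also have "\<dots> = (\<Prod>c<(\<Sum>j<r. m j). f c) * (\<Prod>k<m r. f ((\<Sum>l<r. m l) + k))"
    by (rule prod_lessThan_add)
  finally show ?case using Suc by simp
qed simp

lemma normdens_infinite:
  assumes "(\<integral>\<^sup>+ x. ennreal (f x) \<partial>M) = \<infinity>"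
  shows "normdens M (\<lambda>x. ennreal (f x)) = density M (\<lambda>_. 0)"
  unfolding normdens_def assms by simp

context probit_gibbs
begin

lemma prod_d: "(\<Prod>c<d. f c) = (\<Prod>c<p. f c) * (\<Prod>j<r. \<Prod>k<qs j. f (blk j k))" for f :: "nat \<Rightarrow> 'b::comm_monoid_mult"
  unfolding d_def qtot_def prod_lessThan_add prod_blocks blk_def off_def by (simp add: add.assoc)

lemma measurable_coord: "f \<in> measurable M (Rsp m) \<Longrightarrow> c < m \<Longrightarrow> (\<lambda>x. f x c) \<in> borel_measurable M"
  unfolding Rsp_def by (rule measurable_compose[OF _ measurable_component_singleton, of f M "{..<m}" "\<lambda>_. lborel" c, simplified]) auto

lemma measurable_lp[measurable (raw)]:
  assumes "f \<in> measurable M (Rsp d)"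
  shows "(\<lambda>x. lp i (f x)) \<in> borel_measurable M"
  unfolding lp_def by (intro borel_measurable_sum borel_measurable_times borel_measurable_const measurable_coord[OF assms]) auto

lemma measurable_us:
  assumes "f \<in> measurable M (Rsp d)" "j < r"
  shows "(\<lambda>x. us (f x) j) \<in> borel_measurable M"
  unfolding us_def by (intro borel_measurable_sum borel_measurable_power measurable_coord[OF assms(1)] blk_less assms) auto

text \<open>The part of the joint density of \<open>(\<eta>, \<tau>, v)\<close> that couples
  \<open>\<eta>\<close> to the rest. Unlike the density centred at the mean it requires no solved
  linear system, and it is meaningful for every \<open>\<tau>\<close>.\<close>

definition G :: "(nat \<Rightarrow> real) \<Rightarrow> (nat \<Rightarrow> real) \<Rightarrow> (nat \<Rightarrow> real) \<Rightarrow> real" where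
  "G \<tau> v \<eta> = exp (- (1/2) * (\<Sum>i<n. (v i - lp i \<eta>)\<^sup>2) - (1/2) * (\<Sum>j<r. \<tau> j * us \<eta> j))"

lemma G_pos: "0 < G \<tau> v \<eta>" by (simp add: G_def)

lemma measurable_G[measurable (raw)]:
  assumes f: "f \<in> measurable M (Rsp r)" and g: "g \<in> measurable M (Rsp n)" and h: "h \<in> measurable M (Rsp d)"
  shows "(\<lambda>x. G (f x) (g x) (h x)) \<in> borel_measurable M"
proof -
  have [measurable]: "\<And>j. j \<in> {..<r} \<Longrightarrow> (\<lambda>x. us (h x) j) \<in> borel_measurable M" "\<And>i. (\<lambda>x. lp i (h x)) \<in> borel_measurable M"
    "\<And>j. j \<in> {..<r} \<Longrightarrow> (\<lambda>x. f x j) \<in> borel_measurable M" "\<And>i. i \<in> {..<n} \<Longrightarrow> (\<lambda>x. g x i) \<in> borel_measurable M"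
    using measurable_us[OF h] measurable_lp[OF h] measurable_coord[OF f] measurable_coord[OF g] by auto
  show ?thesis unfolding G_def by measurable
qed

lemma measurable_G1[measurable]: "(\<lambda>\<eta>. G \<tau> v \<eta>) \<in> borel_measurable (Rsp d)"
proof -
  have [measurable]: "\<And>j. j \<in> {..<r} \<Longrightarrow> (\<lambda>x. us x j) \<in> borel_measurable (Rsp d)"
    by (rule measurable_us) auto
  show ?thesis unfolding G_def by measurable
qed

lemma Qf_cong: "(\<And>c. c < d \<Longrightarrow> f c = g c) \<Longrightarrow> Qf \<tau> f = Qf \<tau> g"
  unfolding Qf_def using lp_cong[of f g] us_cong[of _ f g] by simp

lemma G_cong: "(\<And>c. c < d \<Longrightarrow> f c = g c) \<Longrightarrow> G \<tau> v f = G \<tau> v g"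
  unfolding G_def using lp_cong[of f g] us_cong[of _ f g] by simp

lemma us_comb: "us (\<lambda>c. t * g c + x c) j = t\<^sup>2 * us g j + 2 * t * (\<Sum>k<qs j. g (blk j k) * x (blk j k)) + us x j"
proof -
  have "us (\<lambda>c. t * g c + x c) j = (\<Sum>k<qs j. t\<^sup>2 * (g (blk j k))\<^sup>2 + 2 * t * (g (blk j k) * x (blk j k)) + (x (blk j k))\<^sup>2)"
    unfolding us_def by (intro sum.cong refl) (simp add: power2_eq_square algebra_simps)
  also have "\<dots> = t\<^sup>2 * us g j + 2 * t * (\<Sum>k<qs j. g (blk j k) * x (blk j k)) + us x j"
    by (simp only: sum.distrib sum_distrib_left[symmetric] us_def)
  finally show ?thesis .
qed

lemma lp_comb: "lp i (\<lambda>c. t * g c + x c) = t * lp i g + lp i x"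
  by (simp add: lp_add lp_scale)

lemma Qf_comb: "Qf \<tau> (\<lambda>c. t * g c + x c) = t\<^sup>2 * Qf \<tau> g + 2 * t * bil \<tau> g x + Qf \<tau> x"
proof -
  have "(\<Sum>i<n. (t * lp i g + lp i x)\<^sup>2) = (\<Sum>i<n. t\<^sup>2 * (lp i g)\<^sup>2 + 2 * t * (lp i g * lp i x) + (lp i x)\<^sup>2)"
    by (intro sum.cong refl) (simp add: power2_eq_square algebra_simps)
  then have 1: "(\<Sum>i<n. (t * lp i g + lp i x)\<^sup>2) = t\<^sup>2 * (\<Sum>i<n. (lp i g)\<^sup>2) + 2 * t * (\<Sum>i<n. lp i g * lp i x) + (\<Sum>i<n. (lp i x)\<^sup>2)"
    by (simp only: sum.distrib sum_distrib_left[symmetric])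
  have "(\<Sum>j<r. \<tau> j * us (\<lambda>c. t * g c + x c) j) = (\<Sum>j<r. t\<^sup>2 * (\<tau> j * us g j) + 2 * t * (\<tau> j * (\<Sum>k<qs j. g (blk j k) * x (blk j k))) + \<tau> j * us x j)"
    unfolding us_comb by (intro sum.cong refl) (simp add: algebra_simps)
  then have 2: "(\<Sum>j<r. \<tau> j * us (\<lambda>c. t * g c + x c) j) = t\<^sup>2 * (\<Sum>j<r. \<tau> j * us g j) + 2 * t * (\<Sum>j<r. \<tau> j * (\<Sum>k<qs j. g (blk j k) * x (blk j k))) + (\<Sum>j<r. \<tau> j * us x j)"
    by (simp only: sum.distrib sum_distrib_left[symmetric])
  show ?thesis unfolding Qf_def bil_def lp_comb 1 2 by (simp add: algebra_simps)
qed

lemma bil_sym: "bil \<tau> x z = bil \<tau> z x"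
  by (simp add: bil_def mult.commute)

lemma Gexp: "(\<Sum>i<n. (v i - lp i \<eta>)\<^sup>2) + (\<Sum>j<r. \<tau> j * us \<eta> j) = (\<Sum>i<n. (v i)\<^sup>2) - 2 * (\<Sum>i<n. lp i \<eta> * v i) + Qf \<tau> \<eta>"
proof -
  have "(\<Sum>i<n. (v i - lp i \<eta>)\<^sup>2) = (\<Sum>i<n. (v i)\<^sup>2 - 2 * (lp i \<eta> * v i) + (lp i \<eta>)\<^sup>2)"
    by (intro sum.cong refl) (simp add: power2_eq_square algebra_simps)
  then show ?thesis unfolding Qf_def by (simp add: sum.distrib sum_subtractf sum_distrib_left[symmetric])
qed

lemma G_alt: "G \<tau> v \<eta> = exp (- (1/2) * (\<Sum>i<n. (v i)\<^sup>2) + (\<Sum>i<n. lp i \<eta> * v i) - (1/2) * Qf \<tau> \<eta>)"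
proof -
  have "- (1/2) * (\<Sum>i<n. (v i - lp i \<eta>)\<^sup>2) - (1/2) * (\<Sum>j<r. \<tau> j * us \<eta> j) = - (1/2) * (\<Sum>i<n. (v i)\<^sup>2) + (\<Sum>i<n. lp i \<eta> * v i) - (1/2) * Qf \<tau> \<eta>"
    using Gexp[of v \<eta> \<tau>] by linarith
  then show ?thesis by (simp only: G_def)
qed

definition P0 :: "(nat \<Rightarrow> real) \<Rightarrow> (nat \<Rightarrow> real) \<Rightarrow> real" where
  "P0 \<tau> x = exp (- (1/2) * Qf \<tau> x)"

lemma measurable_Qf[measurable]: "Qf \<tau> \<in> borel_measurable (Rsp d)"
  unfolding Qf_def[abs_def]
  by (intro borel_measurable_add borel_measurable_times borel_measurable_const borel_measurable_sum
      borel_measurable_power measurable_lp measurable_us) auto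

lemma measurable_P0[measurable]: "P0 \<tau> \<in> borel_measurable (Rsp d)"
  unfolding P0_def[abs_def] by measurable

lemma measurable_shift[measurable]: "(\<lambda>x. \<lambda>c\<in>{..<d}. m c + x c) \<in> measurable (Rsp d) (Rsp d)"
  unfolding Rsp_def by measurable

lemma measurable_P0_diff: "(\<lambda>\<eta>. P0 \<tau> (\<lambda>c. \<eta> c - mu c)) \<in> borel_measurable (Rsp d)"
proof -
  have eq: "P0 \<tau> (\<lambda>c. \<eta> c - mu c) = P0 \<tau> (\<lambda>c\<in>{..<d}. - mu c + \<eta> c)" for \<eta>
    unfolding P0_def by (intro arg_cong[where f="\<lambda>q. exp (- (1/2) * q)"] Qf_cong) auto
  show ?thesis unfolding eq by measurable
qed

lemma nn_translate:
  "f \<in> borel_measurable (Rsp d) \<Longrightarrow> (\<integral>\<^sup>+ x. f (\<lambda>c\<in>{..<d}. m c + x c) \<partial>Rsp d) = (\<integral>\<^sup>+ x. f x \<partial>Rsp d)"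
  unfolding Rsp_def by (rule nn_integral_PiM_translate) auto

definition mean_of :: "(nat \<Rightarrow> real) \<Rightarrow> (nat \<Rightarrow> real) \<Rightarrow> nat \<Rightarrow> real" where
  "mean_of \<tau> v = (THE mu. mu \<in> extensional {..<d} \<and>
                 (\<forall>c<d. (\<Sum>c'<d. Sigma_tau n p r qs X lev \<tau> c c' * mu c') = (\<Sum>i<n. Wmat p r qs X lev i c * v i)))"

lemma eta_draw_mean:
  "eta_draw n p r qs X lev \<tau> v = normdens (Rsp d) (\<lambda>\<eta>. ennreal (P0 \<tau> (\<lambda>c. \<eta> c - mean_of \<tau> v c)))"
  unfolding eta_draw_def Let_def d_def[symmetric] mean_of_def[symmetric] Sigma_form P0_def ..

lemma mean_of:
  assumes "PD \<tau>"
  shows "bil \<tau> x (mean_of \<tau> v) = (\<Sum>i<n. lp i x * v i)"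
  using theI'[OF mean_exists[OF assms, of v]] unfolding mean_of_def[symmetric] by (intro mean_bil) blast

text \<open>Completing the square; the factor depends on \<open>\<tau>\<close> and \<open>v\<close>
  only, so normalisation removes it.\<close>

lemma P0_diff_G:
  assumes "PD \<tau>"
  shows "P0 \<tau> (\<lambda>c. \<eta> c - mean_of \<tau> v c) = exp ((1/2) * (\<Sum>i<n. (v i)\<^sup>2) - (1/2) * Qf \<tau> (mean_of \<tau> v)) * G \<tau> v \<eta>"
proof -
  have "Qf \<tau> (\<lambda>c. \<eta> c - mean_of \<tau> v c) = Qf \<tau> (\<lambda>c. - 1 * mean_of \<tau> v c + \<eta> c)" by (intro Qf_cong) simp
  also have "\<dots> = Qf \<tau> (mean_of \<tau> v) - 2 * (\<Sum>i<n. lp i \<eta> * v i) + Qf \<tau> \<eta>"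
    unfolding Qf_comb bil_sym[of \<tau> "mean_of \<tau> v"] mean_of[OF assms] by simp
  finally show ?thesis unfolding P0_def G_alt exp_add[symmetric] by (simp add: field_simps)
qed

text \<open>Along a direction \<open>g\<close> with \<open>Qf \<tau> g \<le> 0\<close> the product
  of the weight at two opposite shifts of \<open>x\<close> is its square at \<open>x\<close> times
  \<open>exp (- t^2 * Qf \<tau> g)\<close>, a factor at least 1. This is the log-midpoint-convexity
  that makes the mass infinite.\<close>

lemma not_PD_infinite:
  assumes "\<not> PD \<tau>"
  shows "(\<integral>\<^sup>+ \<eta>. ennreal (P0 \<tau> (\<lambda>c. \<eta> c - mu c)) \<partial>Rsp d) = \<infinity>" "(\<integral>\<^sup>+ \<eta>. ennreal (G \<tau> v \<eta>) \<partial>Rsp d) = \<infinity>"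
proof -
  obtain g i where g: "Qf \<tau> g \<le> 0" "i < d" "g i \<noteq> 0" using assms unfolding PD_def by force
  have tg: "t\<^sup>2 * Qf \<tau> g \<le> 0" for t using g(1) by (simp add: mult_nonneg_nonpos)
  show "(\<integral>\<^sup>+ \<eta>. ennreal (P0 \<tau> (\<lambda>c. \<eta> c - mu c)) \<partial>Rsp d) = \<infinity>"
    unfolding Rsp_def
  proof (rule nn_integral_infinite_along_direction[where i=i and g=g])
    show "(\<lambda>\<eta>. P0 \<tau> (\<lambda>c. \<eta> c - mu c)) \<in> borel_measurable (lebP {..<d})"
      using measurable_P0_diff unfolding Rsp_def .
    fix x t
    let ?x = "\<lambda>c. x c - mu c"
    have q: "Qf \<tau> (\<lambda>c. (\<lambda>k\<in>{..<d}. t * g k + x k) c - mu c) = t\<^sup>2 * Qf \<tau> g + 2 * t * bil \<tau> g ?x + Qf \<tau> ?x" for t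
      unfolding Qf_comb[symmetric] by (rule Qf_cong) simp
    have "P0 \<tau> (\<lambda>c. (\<lambda>k\<in>{..<d}. t * g k + x k) c - mu c) * P0 \<tau> (\<lambda>c. (\<lambda>k\<in>{..<d}. - t * g k + x k) c - mu c)
      = exp (- (t\<^sup>2 * Qf \<tau> g) - Qf \<tau> ?x)"
      unfolding P0_def q exp_add[symmetric] by (simp add: field_simps)
    also have "\<dots> \<ge> exp (- Qf \<tau> ?x)" using tg[of t] by simp
    finally show "(P0 \<tau> ?x)\<^sup>2 \<le> P0 \<tau> (\<lambda>c. (\<lambda>k\<in>{..<d}. t * g k + x k) c - mu c) * P0 \<tau> (\<lambda>c. (\<lambda>k\<in>{..<d}. - t * g k + x k) c - mu c)"
      unfolding P0_def power2_eq_square exp_add[symmetric] by simp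
  qed (use g in \<open>auto simp: P0_def\<close>)
  show "(\<integral>\<^sup>+ \<eta>. ennreal (G \<tau> v \<eta>) \<partial>Rsp d) = \<infinity>"
    unfolding Rsp_def
  proof (rule nn_integral_infinite_along_direction[where i=i and g=g])
    show "G \<tau> v \<in> borel_measurable (lebP {..<d})" using measurable_G1 unfolding Rsp_def by simp
    fix x t
    have q: "Qf \<tau> (\<lambda>k\<in>{..<d}. t * g k + x k) = t\<^sup>2 * Qf \<tau> g + 2 * t * bil \<tau> g x + Qf \<tau> x" for t
      unfolding Qf_comb[symmetric] by (rule Qf_cong) simp
    have l: "lp i (\<lambda>k\<in>{..<d}. t * g k + x k) = t * lp i g + lp i x" for i t
      unfolding lp_comb[symmetric] by (rule lp_cong) simp
    have l': "(\<Sum>i<n. lp i (\<lambda>k\<in>{..<d}. t * g k + x k) * v i) = t * (\<Sum>i<n. lp i g * v i) + (\<Sum>i<n. lp i x * v i)" for t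
      unfolding l by (simp add: distrib_right sum.distrib sum_distrib_left mult.assoc)
    have "G \<tau> v (\<lambda>k\<in>{..<d}. t * g k + x k) * G \<tau> v (\<lambda>k\<in>{..<d}. - t * g k + x k) = exp (- (t\<^sup>2 * Qf \<tau> g)) * (G \<tau> v x)\<^sup>2"
      unfolding G_alt q l' power2_eq_square exp_add[symmetric] by (simp add: field_simps power2_eq_square)
    also have "\<dots> \<ge> 1 * (G \<tau> v x)\<^sup>2" using tg[of t] by (intro mult_right_mono) auto
    finally show "(G \<tau> v x)\<^sup>2 \<le> G \<tau> v (\<lambda>k\<in>{..<d}. t * g k + x k) * G \<tau> v (\<lambda>k\<in>{..<d}. - t * g k + x k)" by simp
  qed (use g in \<open>auto simp: G_pos\<close>)
qed

text \<open>For precision vectors that are not positive definite both weights have infinite mass, and the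
  normalisation turns them into null measures; the junk value of the mean is therefore irrelevant.\<close>

lemma eta_draw_eq: "eta_draw n p r qs X lev \<tau> v = normdens (Rsp d) (\<lambda>\<eta>. ennreal (G \<tau> v \<eta>))"
proof (cases "PD \<tau>")
  case True
  let ?c = "exp ((1/2) * (\<Sum>i<n. (v i)\<^sup>2) - (1/2) * Qf \<tau> (mean_of \<tau> v))"
  show ?thesis unfolding eta_draw_mean P0_diff_G[OF True]
    using normdens_scale[of "ennreal ?c" "\<lambda>\<eta>. ennreal (G \<tau> v \<eta>)" "Rsp d"] by (simp add: ennreal_mult')
next
  case False
  show ?thesis unfolding eta_draw_mean normdens_infinite[OF not_PD_infinite(1)[OF False]] normdens_infinite[OF not_PD_infinite(2)[OF False]] ..
qed

section \<open>Gaussian normalising constants by shearing\<close>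

text \<open>Diagonal weights of a quadratic form lying below the exponent, after the shear by
  \<open>wco\<close>. A first level feels only the precision of its block, since the data do not see
  the common shift of a block; all other coordinates also receive
  \<open>\<delta> * \<kappa>0\<close>.\<close>

definition kap :: "real \<Rightarrow> (nat \<Rightarrow> real) \<Rightarrow> nat \<Rightarrow> real" where
  "kap \<delta> \<tau> c = (if \<exists>j<r. c = blk j 0 then 0 else \<delta> * \<kappa>0) + Dtau p r qs (\<lambda>j. \<tau> j / (2 * (3 + 2 * real (qs j)))) c"

text \<open>The shift that turns \<open>\<eta>\<close> into reduced coordinates: intercept plus
  first levels, and differences to the first level. It depends on first levels only, so the shear is
  triangular.\<close>

definition wco :: "(nat \<Rightarrow> real) \<Rightarrow> nat \<Rightarrow> real" where
  "wco \<eta> c = (if c = 0 then - (\<Sum>j<r. \<eta> (blk j 0)) else if \<exists>j<r. \<exists>k<qs j. 0 < k \<and> c = blk j k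
      then \<eta> (blk (THE j. j < r \<and> (\<exists>k<qs j. 0 < k \<and> c = blk j k)) 0) else 0)"

lemma wco_blk: assumes "j < r" "k < qs j" "0 < k" shows "wco \<eta> (blk j k) = \<eta> (blk j 0)"
proof -
  have "(THE j'. j' < r \<and> (\<exists>k'<qs j'. 0 < k' \<and> blk j k = blk j' k')) = j"
    using assms blk_inj[OF assms(2)] by (intro the_equality) auto
  moreover have "blk j k \<noteq> 0" using blk_ge[of j k] p_pos by simp
  ultimately show ?thesis using assms unfolding wco_def by auto
qed

lemma wco_blk0: assumes "j < r" shows "wco \<eta> (blk j 0) = 0"
proof -
  have "\<not> (\<exists>j'<r. \<exists>k<qs j'. 0 < k \<and> blk j 0 = blk j' k)"
    using blk_inj[of 0 j] qs_pos assms by auto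
  moreover have "blk j 0 \<noteq> 0" using blk_ge[of j 0] p_pos by simp
  ultimately show ?thesis unfolding wco_def by auto
qed

lemma wco_beta: assumes "0 < c" "c < p" shows "wco \<eta> c = 0"
proof -
  have "\<not> (\<exists>j'<r. \<exists>k<qs j'. 0 < k \<and> c = blk j' k)" using blk_ge assms by (metis leD)
  then show ?thesis using assms unfolding wco_def by auto
qed

lemma kap_beta: "c < p \<Longrightarrow> kap \<delta> \<tau> c = \<delta> * \<kappa>0"
proof -
  assume c: "c < p"
  then have "\<not> (\<exists>j<r. c = blk j 0)" using blk_ge[of _ 0] by (metis leD)
  then show ?thesis unfolding kap_def using c by (auto simp: Dtau_beta)
qed

lemma kap_blk0: "j < r \<Longrightarrow> kap \<delta> \<tau> (blk j 0) = \<tau> j / (2 * (3 + 2 * real (qs j)))"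
  using qs_pos unfolding kap_def by (auto simp: Dtau_blk)

lemma kap_blk: assumes "j < r" "k < qs j" "0 < k" shows "kap \<delta> \<tau> (blk j k) = \<delta> * \<kappa>0 + \<tau> j / (2 * (3 + 2 * real (qs j)))"
proof -
  have "\<not> (\<exists>j'<r. blk j k = blk j' 0)" using blk_inj[OF assms(2)] qs_pos assms by blast
  then show ?thesis unfolding kap_def using assms by (auto simp: Dtau_blk)
qed

text \<open>Source of the constant \<open>3 + 2 * q_j\<close>: first level and differences are
  jointly controlled by the block norm, so a share of the precision term can be spent on each
  sheared coordinate.\<close>

lemma block_norm_bound: "j < r \<Longrightarrow> (\<eta> (blk j 0))\<^sup>2 + (\<Sum>k<qs j. (\<eta> (blk j k) - \<eta> (blk j 0))\<^sup>2) \<le> (3 + 2 * real (qs j)) * us \<eta> j"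
proof -
  assume j: "j < r"
  have q0: "0 < qs j" using qs_pos j by simp
  have u0: "(\<eta> (blk j 0))\<^sup>2 \<le> us \<eta> j" unfolding us_def using q0 by (intro member_le_sum[of 0]) auto
  have "(\<Sum>k<qs j. (\<eta> (blk j k) - \<eta> (blk j 0))\<^sup>2) \<le> (\<Sum>k<qs j. 2 * (\<eta> (blk j k))\<^sup>2 + 2 * (\<eta> (blk j 0))\<^sup>2)"
  proof (intro sum_mono)
    fix k
    have "0 \<le> (\<eta> (blk j k) + \<eta> (blk j 0))\<^sup>2" by simp
    then show "(\<eta> (blk j k) - \<eta> (blk j 0))\<^sup>2 \<le> 2 * (\<eta> (blk j k))\<^sup>2 + 2 * (\<eta> (blk j 0))\<^sup>2"
      by (simp add: power2_eq_square algebra_simps)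
  qed
  also have "\<dots> = 2 * us \<eta> j + 2 * real (qs j) * (\<eta> (blk j 0))\<^sup>2" by (simp add: sum.distrib us_def sum_distrib_left)
  also have "\<dots> \<le> 2 * us \<eta> j + 2 * real (qs j) * us \<eta> j" by (intro add_left_mono mult_left_mono u0) auto
  finally show ?thesis using u0 by (simp add: algebra_simps)
qed

text \<open>The data term pays through \<open>\<kappa>0\<close> for the reduced coordinates, the
  precision term through \<open>block_norm_bound\<close> for the levels.\<close>

lemma exponent_bound:
  assumes \<delta>: "0 < \<delta>" and \<tau>: "\<forall>j<r. 0 < \<tau> j"
  shows "(\<Sum>c<d. kap \<delta> \<tau> c * (\<eta> c - wco \<eta> c)\<^sup>2) \<le> \<delta> * (\<Sum>i<n. (lp i \<eta>)\<^sup>2) + (1/2) * (\<Sum>j<r. \<tau> j * us \<eta> j)"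
proof -
  let ?c = "\<lambda>j. 1 / (2 * (3 + 2 * real (qs j)))"
  have 1: "(\<Sum>c<p. kap \<delta> \<tau> c * (\<eta> c - wco \<eta> c)\<^sup>2) = \<delta> * \<kappa>0 * ((\<eta> 0 + (\<Sum>j<r. \<eta> (blk j 0)))\<^sup>2 + (\<Sum>c\<in>{0<..<p}. (\<eta> c)\<^sup>2))"
  proof -
    have s: "{..<p} = insert 0 {0<..<p}" using p_pos by auto
    have "(\<Sum>c<p. kap \<delta> \<tau> c * (\<eta> c - wco \<eta> c)\<^sup>2) = (\<Sum>c<p. \<delta> * \<kappa>0 * (\<eta> c - wco \<eta> c)\<^sup>2)"
      by (intro sum.cong) (auto simp: kap_beta)
    also have "\<dots> = \<delta> * \<kappa>0 * (\<eta> 0 - wco \<eta> 0)\<^sup>2 + (\<Sum>c\<in>{0<..<p}. \<delta> * \<kappa>0 * (\<eta> c - wco \<eta> c)\<^sup>2)" unfolding s by simp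
    also have "(\<Sum>c\<in>{0<..<p}. \<delta> * \<kappa>0 * (\<eta> c - wco \<eta> c)\<^sup>2) = (\<Sum>c\<in>{0<..<p}. \<delta> * \<kappa>0 * (\<eta> c)\<^sup>2)"
      by (intro sum.cong) (auto simp: wco_beta)
    finally show ?thesis by (simp add: wco_def sum_distrib_left distrib_left)
  qed
  have 2: "(\<Sum>k<qs j. kap \<delta> \<tau> (blk j k) * (\<eta> (blk j k) - wco \<eta> (blk j k))\<^sup>2) =
      \<delta> * \<kappa>0 * (\<Sum>k<qs j. (\<eta> (blk j k) - \<eta> (blk j 0))\<^sup>2) + \<tau> j * ?c j * ((\<eta> (blk j 0))\<^sup>2 + (\<Sum>k<qs j. (\<eta> (blk j k) - \<eta> (blk j 0))\<^sup>2))" if j: "j < r" for j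
  proof -
    obtain m where m: "qs j = Suc m" using qs_pos j by (metis Suc_pred)
    have "(\<Sum>k<m. kap \<delta> \<tau> (blk j (Suc k)) * (\<eta> (blk j (Suc k)) - wco \<eta> (blk j (Suc k)))\<^sup>2)
       = (\<Sum>k<m. (\<delta> * \<kappa>0 + \<tau> j * ?c j) * (\<eta> (blk j (Suc k)) - \<eta> (blk j 0))\<^sup>2)"
      using j m by (intro sum.cong refl) (simp add: kap_blk wco_blk)
    then have "(\<Sum>k<qs j. kap \<delta> \<tau> (blk j k) * (\<eta> (blk j k) - wco \<eta> (blk j k))\<^sup>2)
      = \<tau> j * ?c j * (\<eta> (blk j 0))\<^sup>2 + (\<delta> * \<kappa>0 + \<tau> j * ?c j) * (\<Sum>k<m. (\<eta> (blk j (Suc k)) - \<eta> (blk j 0))\<^sup>2)"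
      using kap_blk0[OF j, of \<delta> \<tau>] wco_blk0[OF j, of \<eta>] unfolding m sum.lessThan_Suc_shift
      by (simp add: sum_distrib_left)
    moreover have "(\<Sum>k<qs j. (\<eta> (blk j k) - \<eta> (blk j 0))\<^sup>2) = (\<Sum>k<m. (\<eta> (blk j (Suc k)) - \<eta> (blk j 0))\<^sup>2)"
      unfolding m sum.lessThan_Suc_shift by simp
    ultimately show ?thesis by (simp only: distrib_left distrib_right add_ac)
  qed
  have "(\<Sum>c<d. kap \<delta> \<tau> c * (\<eta> c - wco \<eta> c)\<^sup>2) = \<delta> * \<kappa>0 * thn \<eta> + (\<Sum>j<r. \<tau> j * ?c j * ((\<eta> (blk j 0))\<^sup>2 + (\<Sum>k<qs j. (\<eta> (blk j k) - \<eta> (blk j 0))\<^sup>2)))"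
    unfolding sum_d 1 thn_def using 2 by (simp add: sum.distrib sum_distrib_left[symmetric] distrib_left)
  also have "\<delta> * \<kappa>0 * thn \<eta> \<le> \<delta> * (\<Sum>i<n. (lp i \<eta>)\<^sup>2)" using \<kappa>0(2)[of \<eta>] \<delta> by (simp add: mult.assoc)
  also have "(\<Sum>j<r. \<tau> j * ?c j * ((\<eta> (blk j 0))\<^sup>2 + (\<Sum>k<qs j. (\<eta> (blk j k) - \<eta> (blk j 0))\<^sup>2))) \<le> (1/2) * (\<Sum>j<r. \<tau> j * us \<eta> j)"
    unfolding sum_distrib_left
  proof (intro sum_mono)
    fix j assume "j \<in> {..<r}" then have j: "j < r" by simp
    have "\<tau> j * ?c j * ((\<eta> (blk j 0))\<^sup>2 + (\<Sum>k<qs j. (\<eta> (blk j k) - \<eta> (blk j 0))\<^sup>2)) \<le> \<tau> j * ?c j * ((3 + 2 * real (qs j)) * us \<eta> j)"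
      using \<tau> j by (intro mult_left_mono block_norm_bound) auto
    also have "\<dots> = (1/2) * (\<tau> j * us \<eta> j)"
    proof -
      have "?c j * (3 + 2 * real (qs j)) = 1/2" by (simp add: field_simps)
      moreover have "\<tau> j * ?c j * ((3 + 2 * real (qs j)) * us \<eta> j) = (?c j * (3 + 2 * real (qs j))) * (\<tau> j * us \<eta> j)"
        by (simp only: mult_ac)
      ultimately show ?thesis by (simp only:)
    qed
    finally show "\<tau> j * ?c j * ((\<eta> (blk j 0))\<^sup>2 + (\<Sum>k<qs j. (\<eta> (blk j k) - \<eta> (blk j 0))\<^sup>2)) \<le> (1/2) * (\<tau> j * us \<eta> j)" .
  qed
  finally show ?thesis by simp
qed

end

lemma Rsp_integral_pos:
  assumes [measurable]: "f \<in> borel_measurable (Rsp m)" and pos: "\<And>x. x \<in> space (Rsp m) \<Longrightarrow> 0 < f x"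
  shows "(\<integral>\<^sup>+ x. f x \<partial>Rsp m) \<noteq> 0"
proof
  assume "(\<integral>\<^sup>+ x. f x \<partial>Rsp m) = 0"
  then have "emeasure (Rsp m) {x \<in> space (Rsp m). f x \<noteq> 0} = 0" by (subst (asm) nn_integral_0_iff) auto
  also have "{x \<in> space (Rsp m). f x \<noteq> 0} = (\<Pi>\<^sub>E i\<in>{..<m}. UNIV)" using pos by (force simp: Rsp_def space_PiM)
  finally have "emeasure (lebP {..<m}) (\<Pi>\<^sub>E i\<in>{..<m}. UNIV) = 0" by (simp add: Rsp_def)
  moreover have "emeasure (lebP {..<m}) (\<Pi>\<^sub>E i\<in>{..<m}. UNIV) = (\<Prod>i<m. emeasure lborel (UNIV :: real set))"
    by (subst lb.emeasure_PiM) auto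
  ultimately show False by auto
qed

context probit_gibbs
begin

text \<open>How the bound on the normalising constant depends on \<open>\<tau>\<close>: in each
  block one direction, the common shift, is held by \<open>\<tau> j\<close> alone, and the other
  \<open>qs j - 1\<close> are held by the data as well, which replaces \<open>\<tau> j\<close> by
  \<open>1 + \<tau> j\<close>.\<close>

definition prof :: "(nat \<Rightarrow> real) \<Rightarrow> real" where
  "prof \<tau> = (\<Prod>j<r. \<tau> j powr (- (1/2)) * (1 + \<tau> j) powr (- (real (qs j) - 1) / 2))"

lemma kap_pos: assumes "0 < \<delta>" "\<forall>j<r. 0 < \<tau> j" "c < d" shows "0 < kap \<delta> \<tau> c"
proof (cases "c < p")
  case True then show ?thesis using assms \<kappa>0(1) by (simp add: kap_beta)
next
  case False
  then obtain j k where jk: "j < r" "k < qs j" "c = blk j k" using blk_exists[of c] assms by auto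
  have t: "0 < \<tau> j / (2 * (3 + 2 * real (qs j)))" using assms jk by simp
  show ?thesis
  proof (cases "k = 0")
    case True then show ?thesis using kap_blk0[OF jk(1), of \<delta> \<tau>] t jk by simp
  next
    case False then show ?thesis using kap_blk[OF jk(1,2), of \<delta> \<tau>] t jk assms(1) \<kappa>0(1) by (simp add: add_pos_pos)
  qed
qed

lemma gauss_product_bound:
  assumes \<delta>: "0 < \<delta>"
  shows "\<exists>C\<ge>0. \<forall>\<tau>. (\<forall>j<r. 0 < \<tau> j) \<longrightarrow> (\<Prod>c<d. sqrt (pi / kap \<delta> \<tau> c)) \<le> C * prof \<tau>"
proof -
  define D where "D j = 1 / (2 * (3 + 2 * real (qs j)))" for j
  \<comment> \<open>Below both constants, so that \<open>\<mu> j * (1 + \<tau> j)\<close> bounds the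
    weight of a higher level from below.\<close>
  define \<mu> where "\<mu> j = min (\<delta> * \<kappa>0) (D j)" for j
  have D: "0 < D j" for j by (simp add: D_def add_pos_nonneg)
  have \<mu>: "0 < \<mu> j" "\<mu> j \<le> \<delta> * \<kappa>0" "\<mu> j \<le> D j" for j using \<delta> \<kappa>0(1) D by (auto simp: \<mu>_def)
  define C where "C = (\<Prod>c<p. sqrt (pi / (\<delta> * \<kappa>0))) * (\<Prod>j<r. sqrt (pi / D j) * sqrt (pi / \<mu> j) ^ (qs j - 1))"
  have pr: "(\<Prod>k<qs j. sqrt (pi / kap \<delta> \<tau> (blk j k))) \<le>
      (sqrt (pi / D j) * sqrt (pi / \<mu> j) ^ (qs j - 1)) * (\<tau> j powr (- (1/2)) * (1 + \<tau> j) powr (- (real (qs j) - 1) / 2))"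
    if \<tau>: "\<forall>j<r. 0 < \<tau> j" and j: "j < r" for \<tau> j
  proof -
    obtain m where m: "qs j = Suc m" using qs_pos j by (metis Suc_pred)
    have t: "0 < \<tau> j" using \<tau> j by simp
    have 0: "sqrt (pi / kap \<delta> \<tau> (blk j 0)) = sqrt (pi / D j) * \<tau> j powr (- (1/2))"
    proof -
      have "kap \<delta> \<tau> (blk j 0) = \<tau> j * D j" using kap_blk0[OF j, of \<delta> \<tau>] by (simp add: D_def)
      then have "sqrt (pi / kap \<delta> \<tau> (blk j 0)) = sqrt (pi / D j) * (1 / sqrt (\<tau> j))" by (simp add: real_sqrt_divide real_sqrt_mult)
      also have "1 / sqrt (\<tau> j) = \<tau> j powr (- (1/2))" using t by (simp add: powr_minus powr_half_sqrt field_simps)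
      finally show ?thesis .
    qed
    have k: "sqrt (pi / kap \<delta> \<tau> (blk j (Suc k))) \<le> sqrt (pi / \<mu> j) * (1 + \<tau> j) powr (- (1/2))" if "k < m" for k
    proof -
      have "\<mu> j * (1 + \<tau> j) \<le> \<delta> * \<kappa>0 + \<tau> j * D j"
      proof -
        have "\<mu> j * \<tau> j \<le> \<tau> j * D j" using mult_right_mono[OF \<mu>(3)[of j], of "\<tau> j"] t by (simp add: mult.commute)
        then show ?thesis unfolding distrib_left using \<mu>(2)[of j] by linarith
      qed
      also have "\<dots> = kap \<delta> \<tau> (blk j (Suc k))" using kap_blk[OF j, of "Suc k" \<delta> \<tau>] that m by (simp add: D_def)
      finally have le: "\<mu> j * (1 + \<tau> j) \<le> kap \<delta> \<tau> (blk j (Suc k))" .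
      have "sqrt (pi / kap \<delta> \<tau> (blk j (Suc k))) \<le> sqrt (pi / (\<mu> j * (1 + \<tau> j)))"
        using le \<mu>(1)[of j] t by (intro real_sqrt_le_mono divide_left_mono mult_pos_pos) (auto intro: less_le_trans[rotated])
      also have "\<dots> = sqrt (pi / \<mu> j) * (1 / sqrt (1 + \<tau> j))" by (simp add: real_sqrt_divide real_sqrt_mult)
      also have "1 / sqrt (1 + \<tau> j) = (1 + \<tau> j) powr (- (1/2))" using t by (simp add: powr_minus powr_half_sqrt field_simps)
      finally show ?thesis .
    qed
    have "(\<Prod>k<qs j. sqrt (pi / kap \<delta> \<tau> (blk j k))) = sqrt (pi / kap \<delta> \<tau> (blk j 0)) * (\<Prod>k<m. sqrt (pi / kap \<delta> \<tau> (blk j (Suc k))))"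
      unfolding m by (rule prod.lessThan_Suc_shift)
    also have "\<dots> \<le> sqrt (pi / kap \<delta> \<tau> (blk j 0)) * (\<Prod>k<m. sqrt (pi / \<mu> j) * (1 + \<tau> j) powr (- (1/2)))"
    proof (intro mult_left_mono prod_mono conjI)
      fix i assume "i \<in> {..<m}"
      then have "blk j (Suc i) < d" using j m by (intro blk_less) auto
      then show "0 \<le> sqrt (pi / kap \<delta> \<tau> (blk j (Suc i)))" using kap_pos[OF \<delta> \<tau>] by (simp add: less_imp_le)
    next
      have "blk j 0 < d" using j m by (intro blk_less) auto
      then show "0 \<le> sqrt (pi / kap \<delta> \<tau> (blk j 0))" using kap_pos[OF \<delta> \<tau>] by (simp add: less_imp_le)
    qed (use k in auto)
    also have "(\<Prod>k<m. sqrt (pi / \<mu> j) * (1 + \<tau> j) powr (- (1/2))) = sqrt (pi / \<mu> j) ^ m * (1 + \<tau> j) powr (- real m / 2)"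
      using t by (simp add: power_mult_distrib powr_realpow[symmetric] powr_powr)
    finally show ?thesis unfolding 0 using m by (simp add: mult_ac)
  qed
  have "(\<Prod>c<d. sqrt (pi / kap \<delta> \<tau> c)) \<le> C * prof \<tau>" if \<tau>: "\<forall>j<r. 0 < \<tau> j" for \<tau>
  proof -
    have "(\<Prod>c<d. sqrt (pi / kap \<delta> \<tau> c)) = (\<Prod>c<p. sqrt (pi / kap \<delta> \<tau> c)) * (\<Prod>j<r. \<Prod>k<qs j. sqrt (pi / kap \<delta> \<tau> (blk j k)))"
      by (rule prod_d)
    also have "(\<Prod>c<p. sqrt (pi / kap \<delta> \<tau> c)) = (\<Prod>c<p. sqrt (pi / (\<delta> * \<kappa>0)))" by (intro prod.cong) (auto simp: kap_beta)
    also have "(\<Prod>c<p. sqrt (pi / (\<delta> * \<kappa>0))) * (\<Prod>j<r. \<Prod>k<qs j. sqrt (pi / kap \<delta> \<tau> (blk j k)))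
      \<le> (\<Prod>c<p. sqrt (pi / (\<delta> * \<kappa>0))) * (\<Prod>j<r. (sqrt (pi / D j) * sqrt (pi / \<mu> j) ^ (qs j - 1)) * (\<tau> j powr (- (1/2)) * (1 + \<tau> j) powr (- (real (qs j) - 1) / 2)))"
    proof (intro mult_left_mono prod_mono conjI prod_nonneg ballI)
      fix j k assume "j \<in> {..<r}" "k \<in> {..<qs j}"
      then have "blk j k < d" by (intro blk_less) auto
      then show "0 \<le> sqrt (pi / kap \<delta> \<tau> (blk j k))" using kap_pos[OF \<delta> \<tau>] by (simp add: less_imp_le)
    qed (use pr[OF \<tau>] \<delta> \<kappa>0(1) in auto)
    also have "\<dots> = C * prof \<tau>" by (simp add: C_def prof_def prod.distrib mult_ac)
    finally show ?thesis .
  qed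
  moreover have "0 \<le> C" unfolding C_def using \<delta> \<kappa>0(1) D \<mu> by (auto intro!: mult_nonneg_nonneg prod_nonneg simp: less_imp_le)
  ultimately show ?thesis by blast
qed

text \<open>The diagonal lower bound for the exponent, a shear, and a product of one-dimensional
  Gaussian integrals.\<close>

lemma gauss_bound:
  assumes \<delta>: "0 < \<delta>"
  shows "\<exists>C\<ge>0. \<forall>\<tau>. (\<forall>j<r. 0 < \<tau> j) \<longrightarrow>
    (\<integral>\<^sup>+ \<eta>. ennreal (exp (- \<delta> * (\<Sum>i<n. (lp i \<eta>)\<^sup>2) - (1/2) * (\<Sum>j<r. \<tau> j * us \<eta> j))) \<partial>Rsp d) \<le> ennreal (C * prof \<tau>)"
proof -
  obtain C where C: "C \<ge> 0" "\<And>\<tau>. (\<forall>j<r. 0 < \<tau> j) \<Longrightarrow> (\<Prod>c<d. sqrt (pi / kap \<delta> \<tau> c)) \<le> C * prof \<tau>"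
    using gauss_product_bound[OF \<delta>] by blast
  \<comment> \<open>The sheared coordinates, namely the intercept and all levels except the first
    ones; their shifts are functions of the first levels, which lie in \<open>B\<close>.\<close>
  define A where "A = {c. c < d \<and> (c = 0 \<or> (\<exists>j<r. \<exists>k<qs j. 0 < k \<and> c = blk j k))}"
  define B where "B = {..<d} - A"
  have fin: "finite A" "finite B" "A \<inter> B = {}" by (auto simp: A_def B_def)
  have BA: "B \<union> A = {..<d}" by (auto simp: A_def B_def)
  have b0: "blk j 0 \<in> B" if j: "j < r" for j
  proof -
    have "blk j 0 < d" using blk_less[OF j] qs_pos j by simp
    moreover have "blk j 0 \<noteq> 0" using blk_ge[of j 0] p_pos by simp
    moreover have "\<not> (\<exists>j'<r. \<exists>k<qs j'. 0 < k \<and> blk j 0 = blk j' k)" using blk_inj[of 0 j] qs_pos j by auto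
    ultimately show ?thesis by (auto simp: A_def B_def)
  qed
  have wB: "wco \<eta> c = 0" if "c \<in> B" for c \<eta> using that unfolding A_def B_def wco_def by auto
  have wr: "wco (restrict \<eta> B) c = wco \<eta> c" if c: "c \<in> A" for c \<eta>
  proof (cases "c = 0")
    case True then show ?thesis using b0 by (simp add: wco_def)
  next
    case False
    then obtain j k where jk: "j < r" "k < qs j" "0 < k" "c = blk j k" using c by (auto simp: A_def)
    then show ?thesis using b0 by (simp add: wco_blk)
  qed
  have wm: "(\<lambda>x. wco x c) \<in> borel_measurable (lebP B)" if c: "c \<in> A" for c
  proof (cases "c = 0")
    case True
    have "(\<lambda>x. - (\<Sum>j<r. x (blk j 0))) \<in> borel_measurable (lebP B)"
      by (intro borel_measurable_uminus borel_measurable_sum) (use b0 in simp)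
    then show ?thesis using True by (simp add: wco_def)
  next
    case False
    then obtain j k where jk: "j < r" "k < qs j" "0 < k" "c = blk j k" using c by (auto simp: A_def)
    have "(\<lambda>x. x (blk j 0)) \<in> borel_measurable (lebP B)" using b0[OF jk(1)] by simp
    then show ?thesis using jk by (simp add: wco_blk)
  qed
  have "(\<integral>\<^sup>+ \<eta>. ennreal (exp (- \<delta> * (\<Sum>i<n. (lp i \<eta>)\<^sup>2) - (1/2) * (\<Sum>j<r. \<tau> j * us \<eta> j))) \<partial>Rsp d) \<le> ennreal (C * prof \<tau>)"
    if \<tau>: "\<forall>j<r. 0 < \<tau> j" for \<tau>
  proof -
    let ?h = "\<lambda>c t. ennreal (exp (- kap \<delta> \<tau> c * t\<^sup>2))"
    have "(\<integral>\<^sup>+ \<eta>. ennreal (exp (- \<delta> * (\<Sum>i<n. (lp i \<eta>)\<^sup>2) - (1/2) * (\<Sum>j<r. \<tau> j * us \<eta> j))) \<partial>Rsp d)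
      \<le> (\<integral>\<^sup>+ \<eta>. (\<Prod>c\<in>A. ?h c (\<eta> c - wco (restrict \<eta> B) c)) * (\<Prod>c\<in>B. ?h c (\<eta> c)) \<partial>lebP (B \<union> A))"
      unfolding Rsp_def BA
    proof (rule nn_integral_mono)
      fix \<eta>
      have "exp (- \<delta> * (\<Sum>i<n. (lp i \<eta>)\<^sup>2) - (1/2) * (\<Sum>j<r. \<tau> j * us \<eta> j)) \<le> exp (- (\<Sum>c<d. kap \<delta> \<tau> c * (\<eta> c - wco \<eta> c)\<^sup>2))"
        using exponent_bound[OF \<delta> \<tau>, of \<eta>] by simp
      also have "\<dots> = (\<Prod>c<d. exp (- kap \<delta> \<tau> c * (\<eta> c - wco \<eta> c)\<^sup>2))"
        by (simp add: exp_sum sum_negf[symmetric])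
      also have "\<dots> = (\<Prod>c\<in>B. exp (- kap \<delta> \<tau> c * (\<eta> c - wco \<eta> c)\<^sup>2)) * (\<Prod>c\<in>A. exp (- kap \<delta> \<tau> c * (\<eta> c - wco \<eta> c)\<^sup>2))"
        unfolding BA[symmetric] using fin by (intro prod.union_disjoint) auto
      also have "(\<Prod>c\<in>B. exp (- kap \<delta> \<tau> c * (\<eta> c - wco \<eta> c)\<^sup>2)) = (\<Prod>c\<in>B. exp (- kap \<delta> \<tau> c * (\<eta> c)\<^sup>2))"
        by (intro prod.cong) (auto simp: wB)
      also have "(\<Prod>c\<in>A. exp (- kap \<delta> \<tau> c * (\<eta> c - wco \<eta> c)\<^sup>2)) = (\<Prod>c\<in>A. exp (- kap \<delta> \<tau> c * (\<eta> c - wco (restrict \<eta> B) c)\<^sup>2))"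
        by (intro prod.cong) (auto simp: wr)
      finally have "ennreal (exp (- \<delta> * (\<Sum>i<n. (lp i \<eta>)\<^sup>2) - (1/2) * (\<Sum>j<r. \<tau> j * us \<eta> j)))
        \<le> ennreal ((\<Prod>c\<in>B. exp (- kap \<delta> \<tau> c * (\<eta> c)\<^sup>2)) * (\<Prod>c\<in>A. exp (- kap \<delta> \<tau> c * (\<eta> c - wco (restrict \<eta> B) c)\<^sup>2)))"
        by (rule ennreal_leI)
      also have "\<dots> = (\<Prod>c\<in>A. ?h c (\<eta> c - wco (restrict \<eta> B) c)) * (\<Prod>c\<in>B. ?h c (\<eta> c))"
        by (simp add: ennreal_mult prod_nonneg prod_ennreal mult.commute)
      finally show "ennreal (exp (- \<delta> * (\<Sum>i<n. (lp i \<eta>)\<^sup>2) - (1/2) * (\<Sum>j<r. \<tau> j * us \<eta> j)))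
        \<le> (\<Prod>c\<in>A. ?h c (\<eta> c - wco (restrict \<eta> B) c)) * (\<Prod>c\<in>B. ?h c (\<eta> c))" .
    qed
    also have "\<dots> = (\<Prod>c\<in>B \<union> A. \<integral>\<^sup>+ x. ?h c x \<partial>lborel)"
      by (rule nn_integral_shear_prod[OF fin, where g="\<lambda>c x. wco x c"]) (use wm in auto)
    also have "\<dots> = (\<Prod>c<d. ennreal (sqrt (pi / kap \<delta> \<tau> c)))"
      unfolding BA by (intro prod.cong refl nn_integral_gauss kap_pos[OF \<delta> \<tau>]) auto
    also have "\<dots> = ennreal (\<Prod>c<d. sqrt (pi / kap \<delta> \<tau> c))"
      using kap_pos[OF \<delta> \<tau>] by (intro prod_ennreal) (auto simp: less_imp_le)
    also have "\<dots> \<le> ennreal (C * prof \<tau>)" by (intro ennreal_leI C(2) \<tau>)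
    finally show ?thesis .
  qed
  then show ?thesis using C(1) by blast
qed

section \<open>Finiteness of the normalising constants and integrals over the \<open>\<eta>\<close>
  draw\<close>

abbreviation NG :: "(nat \<Rightarrow> real) \<Rightarrow> (nat \<Rightarrow> real) \<Rightarrow> ennreal" where
  "NG \<tau> v \<equiv> (\<integral>\<^sup>+ \<eta>. ennreal (G \<tau> v \<eta>) \<partial>Rsp d)"

lemma NG_nz: "NG \<tau> v \<noteq> 0"
  by (rule Rsp_integral_pos) (auto simp: G_pos)

text \<open>Splitting the linear predictor as \<open>v\<close> minus the residual trades half of the
  residual for a quarter of the predictor norm, at the price of a factor depending on
  \<open>v\<close> only.\<close>

lemma NG_fin:
  assumes \<tau>: "\<forall>j<r. 0 < \<tau> j" shows "NG \<tau> v \<noteq> \<infinity>"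
proof -
  obtain C where C: "\<And>\<tau>. (\<forall>j<r. 0 < \<tau> j) \<Longrightarrow>
    (\<integral>\<^sup>+ \<eta>. ennreal (exp (- (1/4) * (\<Sum>i<n. (lp i \<eta>)\<^sup>2) - (1/2) * (\<Sum>j<r. \<tau> j * us \<eta> j))) \<partial>Rsp d) \<le> ennreal (C * prof \<tau>)"
    using gauss_bound[of "1/4"] by auto
  let ?f = "\<lambda>\<eta>. exp (- (1/4) * (\<Sum>i<n. (lp i \<eta>)\<^sup>2) - (1/2) * (\<Sum>j<r. \<tau> j * us \<eta> j))"
  have [measurable]: "\<And>j. j \<in> {..<r} \<Longrightarrow> (\<lambda>x. us x j) \<in> borel_measurable (Rsp d)" by (rule measurable_us) auto
  have "NG \<tau> v \<le> (\<integral>\<^sup>+ \<eta>. ennreal (exp ((1/2) * (\<Sum>i<n. (v i)\<^sup>2))) * ennreal (?f \<eta>) \<partial>Rsp d)"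
  proof (rule nn_integral_mono)
    fix \<eta>
    have "(\<Sum>i<n. (lp i \<eta>)\<^sup>2) \<le> (\<Sum>i<n. 2 * (v i - lp i \<eta>)\<^sup>2 + 2 * (v i)\<^sup>2)"
    proof (rule sum_mono)
      fix i
      have "0 \<le> (2 * v i - lp i \<eta>)\<^sup>2" by simp
      then show "(lp i \<eta>)\<^sup>2 \<le> 2 * (v i - lp i \<eta>)\<^sup>2 + 2 * (v i)\<^sup>2" by (simp add: power2_eq_square algebra_simps)
    qed
    also have "\<dots> = 2 * (\<Sum>i<n. (v i - lp i \<eta>)\<^sup>2) + 2 * (\<Sum>i<n. (v i)\<^sup>2)" by (simp add: sum.distrib sum_distrib_left)
    finally have "G \<tau> v \<eta> \<le> exp ((1/2) * (\<Sum>i<n. (v i)\<^sup>2) + (- (1/4) * (\<Sum>i<n. (lp i \<eta>)\<^sup>2) - (1/2) * (\<Sum>j<r. \<tau> j * us \<eta> j)))"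
      unfolding G_def by simp
    then show "ennreal (G \<tau> v \<eta>) \<le> ennreal (exp ((1/2) * (\<Sum>i<n. (v i)\<^sup>2))) * ennreal (?f \<eta>)"
      unfolding exp_add by (simp add: ennreal_mult[symmetric] ennreal_leI)
  qed
  also have "\<dots> = ennreal (exp ((1/2) * (\<Sum>i<n. (v i)\<^sup>2))) * (\<integral>\<^sup>+ \<eta>. ennreal (?f \<eta>) \<partial>Rsp d)"
    by (rule nn_integral_cmult) measurable
  also have "\<dots> \<le> ennreal (exp ((1/2) * (\<Sum>i<n. (v i)\<^sup>2))) * ennreal (C * prof \<tau>)"
    by (intro mult_left_mono C \<tau>) simp
  also have "\<dots> < \<infinity>" by (simp add: ennreal_mult_less_top)
  finally show ?thesis by simp
qed

lemma prob_space_eta_draw: "\<forall>j<r. 0 < \<tau> j \<Longrightarrow> prob_space (eta_draw n p r qs X lev \<tau> v)"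
  unfolding eta_draw_eq using NG_nz NG_fin by (intro prob_space_normdens) auto

lemma sets_eta_draw[simp, measurable_cong]: "sets (eta_draw n p r qs X lev \<tau> v) = sets (Rsp d)"
  by (simp add: eta_draw_eq)

lemma space_eta_draw[simp]: "space (eta_draw n p r qs X lev \<tau> v) = space (Rsp d)"
  by (simp add: eta_draw_eq)

abbreviation N0 :: "(nat \<Rightarrow> real) \<Rightarrow> ennreal" where
  "N0 \<tau> \<equiv> (\<integral>\<^sup>+ x. ennreal (P0 \<tau> x) \<partial>Rsp d)"

lemma P0_G0: "P0 \<tau> x = G \<tau> (\<lambda>_. 0) x"
  unfolding P0_def G_alt by simp

lemma N0_nz: "N0 \<tau> \<noteq> 0" and N0_fin: "\<forall>j<r. 0 < \<tau> j \<Longrightarrow> N0 \<tau> \<noteq> \<infinity>"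
  unfolding P0_G0 by (simp_all only: NG_nz NG_fin not_False_eq_True)

text \<open>Represents the draw as mean plus centred noise, by translation. The law of the noise
  does not depend on \<open>v\<close>.\<close>

lemma nn_integral_eta_draw:
  assumes [measurable]: "f \<in> borel_measurable (Rsp d)"
  shows "(\<integral>\<^sup>+ \<eta>. f \<eta> \<partial>eta_draw n p r qs X lev \<tau> v)
     = (\<integral>\<^sup>+ x. ennreal (P0 \<tau> x) * f (\<lambda>c\<in>{..<d}. mean_of \<tau> v c + x c) \<partial>Rsp d) / N0 \<tau>"
proof -
  let ?mu = "mean_of \<tau> v"
  note [measurable] = measurable_P0_diff
  have bck: "P0 \<tau> (\<lambda>c. (\<lambda>c\<in>{..<d}. ?mu c + x c) c - ?mu c) = P0 \<tau> x" for x
    unfolding P0_def by (intro arg_cong[where f="\<lambda>q. exp (- (1/2) * q)"] Qf_cong) auto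
  have "(\<integral>\<^sup>+ \<eta>. ennreal (P0 \<tau> (\<lambda>c. \<eta> c - ?mu c)) * f \<eta> \<partial>Rsp d) = (\<integral>\<^sup>+ x. ennreal (P0 \<tau> x) * f (\<lambda>c\<in>{..<d}. ?mu c + x c) \<partial>Rsp d)"
    by (subst nn_translate[symmetric, where m="?mu"]) (measurable, simp only: bck)
  moreover have "(\<integral>\<^sup>+ \<eta>. ennreal (P0 \<tau> (\<lambda>c. \<eta> c - ?mu c)) \<partial>Rsp d) = N0 \<tau>"
    by (subst nn_translate[symmetric, where m="?mu"]) (measurable, simp only: bck)
  ultimately show ?thesis unfolding eta_draw_mean by (subst nn_integral_normdens) auto
qed

lemma nn_integral_eta_draw_le:
  assumes \<tau>: "\<forall>j<r. 0 < \<tau> j" and f: "f \<in> borel_measurable (Rsp d)"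
    and le: "(\<integral>\<^sup>+ x. ennreal (P0 \<tau> x) * f (\<lambda>c\<in>{..<d}. mean_of \<tau> v c + x c) \<partial>Rsp d) \<le> c * N0 \<tau>"
  shows "(\<integral>\<^sup>+ \<eta>. f \<eta> \<partial>eta_draw n p r qs X lev \<tau> v) \<le> c"
proof -
  have "(\<integral>\<^sup>+ \<eta>. f \<eta> \<partial>eta_draw n p r qs X lev \<tau> v) \<le> c * N0 \<tau> / N0 \<tau>"
    unfolding nn_integral_eta_draw[OF f] by (intro divide_right_mono_ennreal le)
  also have "\<dots> = c" using N0_nz N0_fin[OF \<tau>] by (simp add: ennreal_mult_divide_eq)
  finally show ?thesis .
qed

end

section \<open>Inequalities for the hyperbolic cosine and for powers\<close>

lemma real_le_sinh: "0 \<le> x \<Longrightarrow> 2 * x \<le> exp x - exp (- x)" for x :: real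
proof -
  assume x: "0 \<le> x"
  let ?f = "\<lambda>t. exp t - exp (- t) - 2 * t :: real"
  have "?f 0 \<le> ?f x"
  proof (rule DERIV_nonneg_imp_nondecreasing[OF x])
    fix t :: real
    have "0 \<le> (exp (t / 2) - exp (- t / 2))\<^sup>2" by simp
    also have "\<dots> = exp t + exp (- t) - 2" by (simp add: power2_eq_square algebra_simps exp_add[symmetric])
    finally show "\<exists>y. (?f has_real_derivative y) (at t) \<and> 0 \<le> y"
      by (intro exI[of _ "exp t + exp (- t) - 2"]) (auto intro!: derivative_eq_intros)
  qed
  then show ?thesis by simp
qed

text \<open>The difference \<open>exp y + exp (- y) - 2\<close> is the square of
  \<open>exp (y / 2) - exp (- y / 2)\<close>.\<close>

lemma two_cosh_ge: "2 + y\<^sup>2 \<le> exp y + exp (- y)" for y :: real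
proof -
  have *: "2 + y\<^sup>2 \<le> exp y + exp (- y)" if "0 \<le> y" for y :: real
  proof -
    have "y\<^sup>2 \<le> (exp (y / 2) - exp (- (y / 2)))\<^sup>2" using real_le_sinh[of "y / 2"] that by (intro power_mono) auto
    also have "\<dots> = exp y + exp (- y) - 2" by (simp add: power2_eq_square algebra_simps exp_add[symmetric])
    finally show ?thesis by simp
  qed
  show ?thesis using *[of y] *[of "- y"] by (cases "0 \<le> y") auto
qed

lemma two_cosh_mono:
  fixes L t :: real
  assumes "0 \<le> t" "t \<le> 1"
  shows "exp (t * L) + exp (- (t * L)) \<le> exp L + exp (- L)"
proof -
  have "cosh (t * L) \<le> cosh L"
  proof -
    have "cosh \<bar>t * L\<bar> \<le> cosh \<bar>L\<bar>"
      using assms by (subst cosh_real_nonneg_le_iff) (auto simp: abs_mult mult_left_le_one_le)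
    then show ?thesis by simp
  qed
  then show ?thesis by (simp add: cosh_def)
qed

text \<open>Jensen's inequality for the concave power, through its tangent at \<open>A\<close>;
  weighted arithmetic-geometric means supply the tangent inequality.\<close>

lemma powr_moment_le:
  assumes "prob_space M" and [measurable]: "f \<in> borel_measurable M" and f0: "\<And>x. 0 \<le> f x"
    and s: "0 < s" "s \<le> 1" and A: "0 < A" and le: "(\<integral>\<^sup>+ x. ennreal (f x) \<partial>M) \<le> ennreal A"
  shows "(\<integral>\<^sup>+ x. ennreal (f x powr s) \<partial>M) \<le> ennreal (A powr s)"
proof -
  interpret prob_space M by fact
  have pt: "f x powr s \<le> A powr s * (s / A) * f x + A powr s * (1 - s)" for x
  proof (cases "f x = 0")
    case True then show ?thesis using s A by simp
  next
    case False
    then have fp: "0 < f x / A" using f0[of x] A by simp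
    have "(f x / A) powr s * 1 powr (1 - s) \<le> s * (f x / A) + (1 - s) * 1"
      using s fp by (intro Youngs_inequality_0) auto
    then have "A powr s * (f x / A) powr s \<le> A powr s * (s * (f x / A) + (1 - s))" by (intro mult_left_mono) auto
    moreover have "A powr s * (f x / A) powr s = f x powr s" using A f0[of x] by (simp add: powr_divide)
    ultimately show ?thesis by (simp add: algebra_simps)
  qed
  have "(\<integral>\<^sup>+ x. ennreal (f x powr s) \<partial>M) \<le> (\<integral>\<^sup>+ x. ennreal (A powr s * (s / A)) * ennreal (f x) + ennreal (A powr s * (1 - s)) \<partial>M)"
    using pt s A f0 by (intro nn_integral_mono) (simp add: ennreal_mult[symmetric] ennreal_plus[symmetric] ennreal_leI del: ennreal_plus)
  also have "\<dots> = ennreal (A powr s * (s / A)) * (\<integral>\<^sup>+ x. ennreal (f x) \<partial>M) + ennreal (A powr s * (1 - s))"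
    by (simp add: nn_integral_add nn_integral_cmult emeasure_space_1)
  also have "\<dots> \<le> ennreal (A powr s * (s / A)) * ennreal A + ennreal (A powr s * (1 - s))"
    by (intro add_right_mono mult_left_mono le) simp
  also have "\<dots> = ennreal (A powr s * (s / A) * A + A powr s * (1 - s))"
    using s A by (simp add: ennreal_mult[symmetric] ennreal_plus[symmetric] del: ennreal_plus)
  also have "A powr s * (s / A) * A + A powr s * (1 - s) = A powr s" using A by (simp add: algebra_simps)
  finally show ?thesis .
qed

lemma ennreal_comb:
  assumes "0 \<le> e" "0 \<le> A" "0 \<le> K" "0 \<le> B"
  shows "ennreal e * (2 * ennreal A + ennreal K * ennreal B) = ennreal (e * (2 * A + K * B))"
proof -
  have "2 * ennreal A + ennreal K * ennreal B = ennreal (2 * A) + ennreal (K * B)"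
    using assms by (simp add: ennreal_mult)
  also have "\<dots> = ennreal (2 * A + K * B)" using assms by (intro ennreal_plus[symmetric]) auto
  finally show ?thesis using assms by (simp only: ennreal_mult[symmetric] mult_nonneg_nonneg add_nonneg_nonneg zero_le_numeral)
qed

section \<open>Moments of the \<open>\<eta>\<close> draw\<close>

context probit_gibbs
begin

lemma us_scale: "us (\<lambda>c. t * x c) j = t\<^sup>2 * us x j"
  unfolding us_def sum_distrib_left by (simp add: power_mult_distrib)

lemma Qf_scale: "Qf \<tau> (\<lambda>c. t * x c) = t\<^sup>2 * Qf \<tau> x"
  unfolding Qf_def lp_scale us_scale by (simp add: power_mult_distrib sum_distrib_left algebra_simps)

text \<open>Dilation of all coordinates by \<open>sqrt 2\<close> doubles the form. Together with
  \<open>lp_noise_moment\<close> this gives a noise bound independent of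
  \<open>\<tau>\<close>.\<close>

lemma quarter_integral: "(\<integral>\<^sup>+ x. ennreal (exp (- (1/4) * Qf \<tau> x)) \<partial>Rsp d) = ennreal (sqrt 2 ^ d) * N0 \<tau>"
proof -
  have [measurable]: "Qf \<tau> \<in> borel_measurable (lebP {..<d})" using measurable_Qf by (simp add: Rsp_def)
  have q: "exp (- (1/4) * Qf \<tau> (\<lambda>c\<in>{..<d}. 0 + sqrt 2 * x c)) = P0 \<tau> x" for x
  proof -
    have "Qf \<tau> (\<lambda>c\<in>{..<d}. 0 + sqrt 2 * x c) = Qf \<tau> (\<lambda>c. sqrt 2 * x c)" by (rule Qf_cong) simp
    then show ?thesis by (simp add: Qf_scale P0_def)
  qed
  have "(\<integral>\<^sup>+ x. ennreal (exp (- (1/4) * Qf \<tau> x)) \<partial>lebP {..<d})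
     = (\<Prod>c<d. ennreal \<bar>sqrt 2\<bar>) * (\<integral>\<^sup>+ x. ennreal (exp (- (1/4) * Qf \<tau> (\<lambda>c\<in>{..<d}. 0 + sqrt 2 * x c))) \<partial>lebP {..<d})"
    by (rule nn_integral_PiM_affine) auto
  also have "\<dots> = ennreal (sqrt 2 ^ d) * N0 \<tau>" unfolding q Rsp_def by (simp add: ennreal_power)
  finally show ?thesis by (simp only: Rsp_def)
qed

text \<open>Half of the exponent is spent to absorb the factor \<open>s\<close>, by
  \<open>s / 4 \<le> exp (s / 4)\<close>; the other half integrates to a fixed multiple of
  \<open>N0\<close>.\<close>

lemma lp_noise_moment:
  assumes \<tau>: "\<forall>j<r. 0 < \<tau> j"
  shows "(\<integral>\<^sup>+ x. ennreal (P0 \<tau> x) * ennreal (\<Sum>i<n. (lp i x)\<^sup>2) \<partial>Rsp d) \<le> ennreal (4 * sqrt 2 ^ d) * N0 \<tau>"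
proof -
  have "(\<integral>\<^sup>+ x. ennreal (P0 \<tau> x) * ennreal (\<Sum>i<n. (lp i x)\<^sup>2) \<partial>Rsp d) \<le> (\<integral>\<^sup>+ x. 4 * ennreal (exp (- (1/4) * Qf \<tau> x)) \<partial>Rsp d)"
  proof (rule nn_integral_mono)
    fix x
    let ?s = "\<Sum>i<n. (lp i x)\<^sup>2" and ?T = "\<Sum>j<r. \<tau> j * us x j"
    have s: "0 \<le> ?s" by (simp add: sum_nonneg)
    have T: "0 \<le> ?T" using \<tau> by (intro sum_nonneg) (auto simp: us_nonneg less_imp_le)
    have "P0 \<tau> x * ?s = 4 * (exp (- (1/2) * (?s + ?T)) * (?s / 4))" by (simp add: P0_def Qf_def)
    also have "\<dots> \<le> 4 * (exp (- (1/2) * (?s + ?T)) * exp (?s / 4))"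
    proof -
      have "?s / 4 \<le> exp (?s / 4)" using exp_ge_add_one_self[of "?s / 4"] by linarith
      then show ?thesis by (intro mult_left_mono) auto
    qed
    also have "\<dots> \<le> 4 * exp (- (1/4) * (?s + ?T))"
    proof -
      have "- (1/2) * (?s + ?T) + ?s / 4 \<le> - (1/4) * (?s + ?T)" using T by argo
      then show ?thesis unfolding exp_add[symmetric] by (intro mult_left_mono) auto
    qed
    finally have "ennreal (P0 \<tau> x * ?s) \<le> ennreal (4 * exp (- (1/4) * Qf \<tau> x))" unfolding Qf_def by (rule ennreal_leI)
    then show "ennreal (P0 \<tau> x) * ennreal ?s \<le> 4 * ennreal (exp (- (1/4) * Qf \<tau> x))"
      using s by (simp add: ennreal_mult P0_def)
  qed
  also have "\<dots> = 4 * (ennreal (sqrt 2 ^ d) * N0 \<tau>)" by (subst nn_integral_cmult) (measurable, simp only: quarter_integral)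
  finally show ?thesis by (simp add: ennreal_mult mult.assoc)
qed

text \<open>Testing the normal equations with the mean itself bounds its squared predictor norm by
  the inner product with \<open>v\<close>. Inserted into the expanded residual this leaves
  \<open>\<delta>0 * ||v||^2 \<le> ||v||^2 - <W mu, v>\<close>.\<close>

lemma mean_contraction:
  assumes \<tau>: "\<forall>j<r. 0 < \<tau> j" and v: "vsup v"
  shows "(\<Sum>i<n. (lp i (mean_of \<tau> v))\<^sup>2) \<le> (1 - \<delta>0) * (\<Sum>i<n. (v i)\<^sup>2)"
proof -
  let ?mu = "mean_of \<tau> v"
  have "Qf \<tau> ?mu = (\<Sum>i<n. lp i ?mu * v i)" using mean_of[OF PD_pos[OF \<tau>], of ?mu v] by (simp add: bil_self)
  moreover have "(\<Sum>i<n. (lp i ?mu)\<^sup>2) \<le> Qf \<tau> ?mu" 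
  proof -
    have "0 \<le> (\<Sum>j<r. \<tau> j * us ?mu j)" using \<tau> by (intro sum_nonneg mult_nonneg_nonneg) (auto simp: us_nonneg less_imp_le)
    then show ?thesis unfolding Qf_def by simp
  qed
  ultimately have 1: "(\<Sum>i<n. (lp i ?mu)\<^sup>2) \<le> (\<Sum>i<n. lp i ?mu * v i)" by simp
  have "(\<Sum>i<n. (v i - lp i ?mu)\<^sup>2) = (\<Sum>i<n. (v i)\<^sup>2 - 2 * (lp i ?mu * v i) + (lp i ?mu)\<^sup>2)"
    by (intro sum.cong refl) (simp add: power2_eq_square algebra_simps)
  also have "\<dots> = (\<Sum>i<n. (v i)\<^sup>2) - 2 * (\<Sum>i<n. lp i ?mu * v i) + (\<Sum>i<n. (lp i ?mu)\<^sup>2)"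
    by (simp add: sum.distrib sum_subtractf sum_distrib_left)
  finally have "\<delta>0 * (\<Sum>i<n. (v i)\<^sup>2) \<le> (\<Sum>i<n. (v i)\<^sup>2) - 2 * (\<Sum>i<n. lp i ?mu * v i) + (\<Sum>i<n. (lp i ?mu)\<^sup>2)"
    using \<delta>0(3)[OF v, of ?mu] by simp
  then have "(\<Sum>i<n. lp i ?mu * v i) \<le> (\<Sum>i<n. (v i)\<^sup>2) - \<delta>0 * (\<Sum>i<n. (v i)\<^sup>2)" using 1 by linarith
  then show ?thesis using 1 by (simp add: left_diff_distrib)
qed

lemma lp_shift: "lp i (\<lambda>c\<in>{..<d}. m c + x c) = lp i m + lp i x"
  unfolding lp_add[symmetric] by (rule lp_cong) simp

text \<open>Mean and noise are separated with a small parameter, so that the contraction factor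
  \<open>1 - \<delta>0\<close> deteriorates only by \<open>1 + \<epsilon>\<close>.\<close>

lemma eta_lp_moment:
  assumes \<tau>: "\<forall>j<r. 0 < \<tau> j" and v: "vsup v" and \<epsilon>: "0 < \<epsilon>"
  shows "(\<integral>\<^sup>+ \<eta>. ennreal (\<Sum>i<n. (lp i \<eta>)\<^sup>2) \<partial>eta_draw n p r qs X lev \<tau> v)
     \<le> ennreal ((1 + \<epsilon>) * (1 - \<delta>0) * (\<Sum>i<n. (v i)\<^sup>2) + (1 + 1 / \<epsilon>) * (4 * sqrt 2 ^ d))"
proof (rule nn_integral_eta_draw_le[OF \<tau>])
  let ?mu = "mean_of \<tau> v"
  let ?a = "(1 + \<epsilon>) * (1 - \<delta>0) * (\<Sum>i<n. (v i)\<^sup>2)"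
  have a0: "0 \<le> ?a" using \<epsilon> \<delta>0 by (auto intro!: mult_nonneg_nonneg sum_nonneg)
  have pt: "(\<Sum>i<n. (lp i (\<lambda>c\<in>{..<d}. ?mu c + x c))\<^sup>2) \<le> ?a + (1 + 1 / \<epsilon>) * (\<Sum>i<n. (lp i x)\<^sup>2)" for x
  proof -
    have "(\<Sum>i<n. (lp i (\<lambda>c\<in>{..<d}. ?mu c + x c))\<^sup>2) \<le> (\<Sum>i<n. (1 + \<epsilon>) * (lp i ?mu)\<^sup>2 + (1 + 1 / \<epsilon>) * (lp i x)\<^sup>2)"
    proof (rule sum_mono)
      fix i
      have "0 \<le> (\<epsilon> * lp i ?mu - lp i x)\<^sup>2 / \<epsilon>" using \<epsilon> by simp
      also have "\<dots> = \<epsilon> * (lp i ?mu)\<^sup>2 - 2 * (lp i ?mu * lp i x) + (lp i x)\<^sup>2 / \<epsilon>" using \<epsilon> by (simp add: power2_eq_square field_simps)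
      finally show "(lp i (\<lambda>c\<in>{..<d}. ?mu c + x c))\<^sup>2 \<le> (1 + \<epsilon>) * (lp i ?mu)\<^sup>2 + (1 + 1 / \<epsilon>) * (lp i x)\<^sup>2"
        unfolding lp_shift by (simp add: power2_eq_square algebra_simps add_divide_distrib)
    qed
    also have "\<dots> = (1 + \<epsilon>) * (\<Sum>i<n. (lp i ?mu)\<^sup>2) + (1 + 1 / \<epsilon>) * (\<Sum>i<n. (lp i x)\<^sup>2)"
      by (simp only: sum.distrib sum_distrib_left)
    also have "(1 + \<epsilon>) * (\<Sum>i<n. (lp i ?mu)\<^sup>2) \<le> ?a" using mean_contraction[OF \<tau> v] \<epsilon> by (simp add: mult.assoc)
    finally show ?thesis by simp
  qed
  have "(\<integral>\<^sup>+ x. ennreal (P0 \<tau> x) * ennreal (\<Sum>i<n. (lp i (\<lambda>c\<in>{..<d}. ?mu c + x c))\<^sup>2) \<partial>Rsp d)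
    \<le> (\<integral>\<^sup>+ x. ennreal ?a * ennreal (P0 \<tau> x) + ennreal (1 + 1 / \<epsilon>) * (ennreal (P0 \<tau> x) * ennreal (\<Sum>i<n. (lp i x)\<^sup>2)) \<partial>Rsp d)"
  proof (rule nn_integral_mono)
    fix x
    have "ennreal (P0 \<tau> x) * ennreal (\<Sum>i<n. (lp i (\<lambda>c\<in>{..<d}. ?mu c + x c))\<^sup>2) \<le> ennreal (P0 \<tau> x) * ennreal (?a + (1 + 1 / \<epsilon>) * (\<Sum>i<n. (lp i x)\<^sup>2))"
      by (intro mult_left_mono ennreal_leI pt) simp
    also have "\<dots> = ennreal ?a * ennreal (P0 \<tau> x) + ennreal (1 + 1 / \<epsilon>) * (ennreal (P0 \<tau> x) * ennreal (\<Sum>i<n. (lp i x)\<^sup>2))"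
      using a0 \<epsilon> by (simp add: ennreal_plus ennreal_mult sum_nonneg distrib_left mult_ac)
    finally show "ennreal (P0 \<tau> x) * ennreal (\<Sum>i<n. (lp i (\<lambda>c\<in>{..<d}. ?mu c + x c))\<^sup>2)
       \<le> ennreal ?a * ennreal (P0 \<tau> x) + ennreal (1 + 1 / \<epsilon>) * (ennreal (P0 \<tau> x) * ennreal (\<Sum>i<n. (lp i x)\<^sup>2))" .
  qed
  also have "\<dots> = ennreal ?a * N0 \<tau> + ennreal (1 + 1 / \<epsilon>) * (\<integral>\<^sup>+ x. ennreal (P0 \<tau> x) * ennreal (\<Sum>i<n. (lp i x)\<^sup>2) \<partial>Rsp d)"
    by (subst nn_integral_add, measurable, subst nn_integral_cmult, measurable, subst nn_integral_cmult, measurable)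
  also have "\<dots> \<le> ennreal ?a * N0 \<tau> + ennreal (1 + 1 / \<epsilon>) * (ennreal (4 * sqrt 2 ^ d) * N0 \<tau>)"
    by (intro add_left_mono mult_left_mono lp_noise_moment \<tau>) simp
  also have "\<dots> = (ennreal ?a + ennreal (1 + 1 / \<epsilon>) * ennreal (4 * sqrt 2 ^ d)) * N0 \<tau>" by (simp only: distrib_right mult.assoc)
  also have "ennreal ?a + ennreal (1 + 1 / \<epsilon>) * ennreal (4 * sqrt 2 ^ d) = ennreal (?a + (1 + 1 / \<epsilon>) * (4 * sqrt 2 ^ d))"
    using a0 \<epsilon> by (subst ennreal_mult[symmetric], simp, simp, subst ennreal_plus[symmetric], auto)
  finally show "(\<integral>\<^sup>+ x. ennreal (P0 \<tau> x) * ennreal (\<Sum>i<n. (lp i (\<lambda>c\<in>{..<d}. ?mu c + x c))\<^sup>2) \<partial>Rsp d)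
    \<le> ennreal (?a + (1 + 1 / \<epsilon>) * (4 * sqrt 2 ^ d)) * N0 \<tau>" .
qed measurable

definition bsum :: "nat \<Rightarrow> (nat \<Rightarrow> real) \<Rightarrow> real" where
  "bsum j x = (\<Sum>k<qs j. x (blk j k))"

lemma measurable_bsum: "j < r \<Longrightarrow> bsum j \<in> borel_measurable (Rsp d)"
  unfolding bsum_def[abs_def] by (intro borel_measurable_sum measurable_coord[OF measurable_ident_sets[OF refl]] blk_less) auto

lemma bil_ddir: assumes j: "j < r" shows "bil \<tau> (ddir j) x = \<tau> j * bsum j x"
proof -
  have "(\<Sum>j'<r. \<tau> j' * (\<Sum>k<qs j'. ddir j (blk j' k) * x (blk j' k))) = (\<Sum>j'<r. if j' = j then \<tau> j' * bsum j' x else 0)"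
    using j by (intro sum.cong) (auto simp: ddir_blk bsum_def)
  then show ?thesis unfolding bil_def using j by (simp add: lp_ddir)
qed

lemma Qf_ddir: assumes j: "j < r" shows "Qf \<tau> (ddir j) = \<tau> j * real (qs j)"
  unfolding bil_self[symmetric] bil_ddir[OF j] using j by (simp add: bsum_def ddir_blk)

text \<open>The normal equations tested with \<open>ddir j\<close>: the data term vanishes in this
  direction, and only the penalty on the block sum remains.\<close>

lemma bsum_mean: assumes \<tau>: "\<forall>j<r. 0 < \<tau> j" and j: "j < r" shows "bsum j (mean_of \<tau> v) = 0"
proof -
  have "0 < \<tau> j" using \<tau> j by simp
  then show ?thesis using mean_of[OF PD_pos[OF \<tau>], of "ddir j" v] bil_ddir[OF j, of \<tau>] j by (simp add: lp_ddir)
qed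

text \<open>Invariance of Lebesgue measure under translations along \<open>ddir j\<close>, which change neither the
  linear predictors nor the other blocks, determines the variance of the block mean.\<close>

lemma block_mean_step:
  assumes \<tau>: "\<forall>j<r. 0 < \<tau> j" and j: "j < r" and z: "0 < z"
  shows "ennreal (exp (- z)) * (2 * N0 \<tau> + ennreal (2 * z * \<tau> j / real (qs j)) * (\<integral>\<^sup>+ x. ennreal (P0 \<tau> x) * ennreal ((bsum j x)\<^sup>2) \<partial>Rsp d)) \<le> 2 * N0 \<tau>"
proof -
  note [measurable] = measurable_bsum[OF j]
  have tj: "0 < \<tau> j" and q: "0 < qs j" using \<tau> j qs_pos by auto
  \<comment> \<open>The step length for which the translation by \<open>s\<close> along
    \<open>ddir j\<close> contributes exactly \<open>exp (- z)\<close>.\<close>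
  define s where "s = sqrt (2 * z / (\<tau> j * real (qs j)))"
  have s2: "s\<^sup>2 = 2 * z / (\<tau> j * real (qs j))" using tj q z by (simp add: s_def)
  have zz: "s\<^sup>2 * (\<tau> j * real (qs j)) = 2 * z" using tj q by (simp add: s2)
  have tr: "(\<integral>\<^sup>+ x. ennreal (P0 \<tau> (\<lambda>c\<in>{..<d}. t * ddir j c + x c)) \<partial>Rsp d) = N0 \<tau>" for t
    by (rule nn_translate[where f="\<lambda>x. ennreal (P0 \<tau> x)"]) measurable
  have Pt: "P0 \<tau> (\<lambda>c\<in>{..<d}. t * ddir j c + x c) = exp (- (t\<^sup>2 * (\<tau> j * real (qs j)) / 2)) * (P0 \<tau> x * exp (- (t * (\<tau> j * bsum j x))))" for t x
  proof -
    have "Qf \<tau> (\<lambda>c\<in>{..<d}. t * ddir j c + x c) = t\<^sup>2 * Qf \<tau> (ddir j) + 2 * t * bil \<tau> (ddir j) x + Qf \<tau> x"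
      unfolding Qf_comb[symmetric] by (rule Qf_cong) simp
    then show ?thesis unfolding P0_def Qf_ddir[OF j] bil_ddir[OF j] exp_add[symmetric] by (simp add: field_simps)
  qed
  let ?y = "\<lambda>x. s * (\<tau> j * bsum j x)"
  have sum2: "P0 \<tau> (\<lambda>c\<in>{..<d}. s * ddir j c + x c) + P0 \<tau> (\<lambda>c\<in>{..<d}. - s * ddir j c + x c) = exp (- z) * (P0 \<tau> x * (exp (?y x) + exp (- ?y x)))" for x
    unfolding Pt using zz by (simp add: algebra_simps)
  have y2: "(?y x)\<^sup>2 = 2 * z * \<tau> j / real (qs j) * (bsum j x)\<^sup>2" for x
  proof -
    have "(?y x)\<^sup>2 = s\<^sup>2 * (\<tau> j)\<^sup>2 * (bsum j x)\<^sup>2" by (simp add: power_mult_distrib)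
    also have "s\<^sup>2 * (\<tau> j)\<^sup>2 = 2 * z * \<tau> j / real (qs j)" unfolding s2 using tj by (simp add: power2_eq_square)
    finally show ?thesis .
  qed
  have "ennreal (exp (- z)) * (2 * N0 \<tau> + ennreal (2 * z * \<tau> j / real (qs j)) * (\<integral>\<^sup>+ x. ennreal (P0 \<tau> x) * ennreal ((bsum j x)\<^sup>2) \<partial>Rsp d))
     = (\<integral>\<^sup>+ x. ennreal (exp (- z)) * (2 * ennreal (P0 \<tau> x) + ennreal (2 * z * \<tau> j / real (qs j)) * (ennreal (P0 \<tau> x) * ennreal ((bsum j x)\<^sup>2))) \<partial>Rsp d)"
    by (subst nn_integral_cmult, measurable, subst nn_integral_add, measurable, subst nn_integral_cmult, measurable, subst nn_integral_cmult, measurable)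
  also have "\<dots> \<le> (\<integral>\<^sup>+ x. ennreal (P0 \<tau> (\<lambda>c\<in>{..<d}. s * ddir j c + x c)) + ennreal (P0 \<tau> (\<lambda>c\<in>{..<d}. - s * ddir j c + x c)) \<partial>Rsp d)"
  proof (rule nn_integral_mono)
    fix x
    have p: "0 \<le> P0 \<tau> u" for u by (simp add: P0_def)
    have "exp (- z) * (2 * P0 \<tau> x + 2 * z * \<tau> j / real (qs j) * (P0 \<tau> x * (bsum j x)\<^sup>2)) = exp (- z) * (P0 \<tau> x * (2 + (?y x)\<^sup>2))"
      unfolding y2 by (simp add: algebra_simps)
    also have "\<dots> \<le> exp (- z) * (P0 \<tau> x * (exp (?y x) + exp (- ?y x)))"
      by (intro mult_left_mono two_cosh_ge p) simp
    also have "\<dots> = P0 \<tau> (\<lambda>c\<in>{..<d}. s * ddir j c + x c) + P0 \<tau> (\<lambda>c\<in>{..<d}. - s * ddir j c + x c)" by (simp only: sum2)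
    finally have le: "ennreal (exp (- z) * (2 * P0 \<tau> x + 2 * z * \<tau> j / real (qs j) * (P0 \<tau> x * (bsum j x)\<^sup>2))) \<le> ennreal (P0 \<tau> (\<lambda>c\<in>{..<d}. s * ddir j c + x c)) + ennreal (P0 \<tau> (\<lambda>c\<in>{..<d}. - s * ddir j c + x c))"
      by (subst ennreal_plus[symmetric]) (auto simp only: p intro!: ennreal_leI)
    have "0 \<le> 2 * z * \<tau> j / real (qs j)" using z tj by simp
    then have "ennreal (exp (- z)) * (2 * ennreal (P0 \<tau> x) + ennreal (2 * z * \<tau> j / real (qs j)) * (ennreal (P0 \<tau> x) * ennreal ((bsum j x)\<^sup>2)))
       = ennreal (exp (- z) * (2 * P0 \<tau> x + 2 * z * \<tau> j / real (qs j) * (P0 \<tau> x * (bsum j x)\<^sup>2)))"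
      using p[of x] ennreal_comb[of "exp (- z)" "P0 \<tau> x" "2 * z * \<tau> j / real (qs j)" "P0 \<tau> x * (bsum j x)\<^sup>2"]
      by (simp only: ennreal_mult zero_le_power2 exp_ge_zero mult_nonneg_nonneg)
    then show "ennreal (exp (- z)) * (2 * ennreal (P0 \<tau> x) + ennreal (2 * z * \<tau> j / real (qs j)) * (ennreal (P0 \<tau> x) * ennreal ((bsum j x)\<^sup>2)))
      \<le> ennreal (P0 \<tau> (\<lambda>c\<in>{..<d}. s * ddir j c + x c)) + ennreal (P0 \<tau> (\<lambda>c\<in>{..<d}. - s * ddir j c + x c))" using le by simp
  qed
  also have "\<dots> = N0 \<tau> + N0 \<tau>" by (subst nn_integral_add, measurable, simp only: tr)
  finally show ?thesis by (simp only: mult_2[of "N0 \<tau>", symmetric])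
qed

text \<open>The constant is sharp: expanding \<open>block_mean_step\<close> to first order in
  \<open>z\<close> leaves exactly \<open>1 / \<tau> j\<close> for the variance part
  \<open>(bsum j x)^2 / q_j\<close>. The drift condition depends on this precision.\<close>

lemma block_mean_moment:
  assumes \<tau>: "\<forall>j<r. 0 < \<tau> j" and j: "j < r"
  shows "(\<integral>\<^sup>+ x. ennreal (P0 \<tau> x) * ennreal ((bsum j x)\<^sup>2) \<partial>Rsp d) \<le> ennreal (real (qs j) / \<tau> j) * N0 \<tau>"
proof -
  let ?A = "\<integral>\<^sup>+ x. ennreal (P0 \<tau> x) * ennreal ((bsum j x)\<^sup>2) \<partial>Rsp d"
  have tj: "0 < \<tau> j" and q: "0 < real (qs j)" using \<tau> j qs_pos by auto
  obtain n0 where n0: "N0 \<tau> = ennreal n0" "0 < n0"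
    using N0_nz[of \<tau>] N0_fin[OF \<tau>] by (cases "N0 \<tau>") (auto simp: ennreal_eq_0_iff not_le)
  \<comment> \<open>Finiteness comes first, from the single value \<open>z = 1\<close>, since the
    comparison as \<open>z\<close> tends to 0 subtracts finite quantities.\<close>
  have "?A \<noteq> \<infinity>"
  proof
    assume "?A = \<infinity>"
    then have "ennreal (exp (- 1)) * (2 * N0 \<tau> + ennreal (2 * 1 * \<tau> j / real (qs j)) * ?A) = \<infinity>"
      using tj q by (simp add: ennreal_mult_top ennreal_mult_eq_top_iff)
    moreover have "2 * N0 \<tau> < \<infinity>" unfolding n0(1) by (simp add: ennreal_mult_less_top)
    ultimately show False using block_mean_step[OF \<tau> j, of 1] by (simp add: top_unique)
  qed
  then obtain a0 where a0: "?A = ennreal a0" "0 \<le> a0" by (cases ?A) auto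
  have step: "a0 * \<tau> j / real (qs j) \<le> n0 * (1 + z)" if z: "0 < z" "z \<le> 1" for z
  proof -
    have "ennreal (exp (- z) * (2 * n0 + 2 * z * \<tau> j / real (qs j) * a0)) \<le> ennreal (2 * n0)"
    proof -
      have "0 \<le> 2 * z * \<tau> j / real (qs j)" using z tj by simp
      then have "ennreal (exp (- z)) * (2 * ennreal n0 + ennreal (2 * z * \<tau> j / real (qs j)) * ennreal a0)
        = ennreal (exp (- z) * (2 * n0 + 2 * z * \<tau> j / real (qs j) * a0))"
        using n0 a0 by (intro ennreal_comb) auto
      moreover have "2 * ennreal n0 = ennreal (2 * n0)" using n0 by (simp add: ennreal_mult)
      ultimately show ?thesis using block_mean_step[OF \<tau> j z(1)] unfolding n0(1) a0(1) by simp
    qed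
    then have "exp (- z) * (2 * n0 + 2 * z * \<tau> j / real (qs j) * a0) \<le> 2 * n0" using n0 by (simp add: ennreal_le_iff)
    then have "exp z * (exp (- z) * (2 * n0 + 2 * z * \<tau> j / real (qs j) * a0)) \<le> exp z * (2 * n0)" by (intro mult_left_mono) auto
    then have "2 * n0 + 2 * z * \<tau> j / real (qs j) * a0 \<le> exp z * (2 * n0)" by (simp add: mult.assoc[symmetric] exp_minus_inverse)
    also have "\<dots> \<le> (1 + z + z\<^sup>2) * (2 * n0)" using exp_bound[of z] z n0 by (intro mult_right_mono) auto
    finally have "(2 * z) * (a0 * \<tau> j / real (qs j)) \<le> (2 * z) * (n0 * (1 + z))" by (simp add: power2_eq_square algebra_simps)
    moreover have "0 < 2 * z" using z by simp
    ultimately show ?thesis by (simp only: mult_le_cancel_left_pos)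
  qed
  have "a0 * \<tau> j / real (qs j) \<le> n0"
  proof (rule field_le_epsilon)
    fix e :: real assume e: "0 < e"
    have "a0 * \<tau> j / real (qs j) \<le> n0 * (1 + min 1 (e / n0))" using e n0 by (intro step) auto
    also have "\<dots> \<le> n0 * (1 + e / n0)" using n0 by (intro mult_left_mono) auto
    finally show "a0 * \<tau> j / real (qs j) \<le> n0 + e" using n0 by (simp add: distrib_left)
  qed
  then have "a0 \<le> real (qs j) / \<tau> j * n0" using tj q by (simp add: field_simps)
  then show ?thesis unfolding a0(1) n0(1) using tj q n0(2) by (simp add: ennreal_mult[symmetric] ennreal_leI)
qed

text \<open>Splits a block into its mean and the deviation from it. Deviations from the mean are at
  most those from the first level, which the linear predictors control.\<close>

lemma us_split: assumes j: "j < r" shows "us \<eta> j \<le> (1 / \<kappa>0) * (\<Sum>i<n. (lp i \<eta>)\<^sup>2) + (bsum j \<eta>)\<^sup>2 / real (qs j)"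
proof -
  have q: "0 < real (qs j)" using qs_pos j by simp
  let ?u = "\<lambda>k. \<eta> (blk j k)"
  have "(\<Sum>k<qs j. (?u k - ?u 0)\<^sup>2) = (\<Sum>k<qs j. (?u k)\<^sup>2 - 2 * ?u 0 * ?u k + (?u 0)\<^sup>2)"
    by (intro sum.cong refl) (simp add: power2_eq_square algebra_simps)
  also have "\<dots> = us \<eta> j - 2 * ?u 0 * bsum j \<eta> + real (qs j) * (?u 0)\<^sup>2"
    by (simp add: sum.distrib sum_subtractf sum_distrib_left us_def bsum_def)
  finally have 1: "(\<Sum>k<qs j. (?u k - ?u 0)\<^sup>2) = us \<eta> j - 2 * ?u 0 * bsum j \<eta> + real (qs j) * (?u 0)\<^sup>2" .
  have "0 \<le> real (qs j) * (?u 0 - bsum j \<eta> / real (qs j))\<^sup>2" by simp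
  also have "\<dots> = real (qs j) * (?u 0)\<^sup>2 - 2 * ?u 0 * bsum j \<eta> + (bsum j \<eta>)\<^sup>2 / real (qs j)"
    using q by (simp add: power2_eq_square field_simps)
  finally have 2: "us \<eta> j \<le> (\<Sum>k<qs j. (?u k - ?u 0)\<^sup>2) + (bsum j \<eta>)\<^sup>2 / real (qs j)" using 1 by linarith
  have "(\<Sum>k<qs j. (?u k - ?u 0)\<^sup>2) \<le> thn \<eta>"
  proof -
    have "(\<Sum>k<qs j. (?u k - ?u 0)\<^sup>2) \<le> (\<Sum>j<r. \<Sum>k<qs j. (\<eta> (blk j k) - \<eta> (blk j 0))\<^sup>2)"
      using j by (intro member_le_sum[of j "{..<r}" "\<lambda>j. \<Sum>k<qs j. (\<eta> (blk j k) - \<eta> (blk j 0))\<^sup>2"]) (auto simp: sum_nonneg)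
    moreover have "0 \<le> (\<Sum>c\<in>{0<..<p}. (\<eta> c)\<^sup>2)" by (simp add: sum_nonneg)
    ultimately show ?thesis unfolding thn_def by (smt (verit) zero_le_power2)
  qed
  also have "thn \<eta> \<le> (1 / \<kappa>0) * (\<Sum>i<n. (lp i \<eta>)\<^sup>2)" using \<kappa>0(1) \<kappa>0(2)[of \<eta>] by (simp add: pos_le_divide_eq mult.commute)
  finally show ?thesis using 2 by linarith
qed

text \<open>The noise constant \<open>(1 + 1 / \<epsilon>) * (4 * sqrt 2 ^ d)\<close> of
  \<open>eta_lp_moment\<close> at \<open>\<epsilon> = 1\<close>.\<close>

definition Kc :: real where "Kc = 8 * sqrt 2 ^ d"

text \<open>The term \<open>1 / \<tau> j\<close> carries coefficient 1 and comes from the block mean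
  alone. The factor in front of \<open>||v||^2\<close> may be rough, because the weight
  \<open>A0\<close> absorbs it.\<close>

lemma eta_us_moment:
  assumes \<tau>: "\<forall>j<r. 0 < \<tau> j" and v: "vsup v" and j: "j < r"
  shows "(\<integral>\<^sup>+ \<eta>. ennreal (us \<eta> j) \<partial>eta_draw n p r qs X lev \<tau> v)
     \<le> ennreal ((1 / \<kappa>0) * (2 * (\<Sum>i<n. (v i)\<^sup>2) + Kc) + 1 / \<tau> j)"
proof -
  note [measurable] = measurable_bsum[OF j]
  let ?E = "eta_draw n p r qs X lev \<tau> v"
  have [measurable]: "(\<lambda>\<eta>. us \<eta> j) \<in> borel_measurable (Rsp d)" by (rule measurable_us[OF _ j]) simp
  have tj: "0 < \<tau> j" and q: "0 < real (qs j)" using \<tau> j qs_pos by auto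
  have 1: "(\<integral>\<^sup>+ \<eta>. ennreal (\<Sum>i<n. (lp i \<eta>)\<^sup>2) \<partial>?E) \<le> ennreal (2 * (\<Sum>i<n. (v i)\<^sup>2) + Kc)"
  proof -
    have "(1 + 1) * (1 - \<delta>0) * (\<Sum>i<n. (v i)\<^sup>2) \<le> 2 * (\<Sum>i<n. (v i)\<^sup>2)"
      using \<delta>0(1,2) by (intro mult_right_mono) (auto simp: sum_nonneg)
    then show ?thesis using eta_lp_moment[OF \<tau> v, of 1] by (intro order_trans[OF eta_lp_moment[OF \<tau> v, of 1]] ennreal_leI) (auto simp: Kc_def)
  qed
  have 2: "(\<integral>\<^sup>+ \<eta>. ennreal ((bsum j \<eta>)\<^sup>2) \<partial>?E) \<le> ennreal (real (qs j) / \<tau> j)"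
  proof (rule nn_integral_eta_draw_le[OF \<tau>])
    have "bsum j (\<lambda>c\<in>{..<d}. mean_of \<tau> v c + x c) = bsum j x" for x
    proof -
      have "bsum j (\<lambda>c\<in>{..<d}. mean_of \<tau> v c + x c) = bsum j (mean_of \<tau> v) + bsum j x"
        unfolding bsum_def using j by (simp add: blk_less sum.distrib)
      then show ?thesis by (simp add: bsum_mean[OF \<tau> j])
    qed
    then show "(\<integral>\<^sup>+ x. ennreal (P0 \<tau> x) * ennreal ((bsum j (\<lambda>c\<in>{..<d}. mean_of \<tau> v c + x c))\<^sup>2) \<partial>Rsp d) \<le> ennreal (real (qs j) / \<tau> j) * N0 \<tau>"
      using block_mean_moment[OF \<tau> j] by simp
  qed measurable
  have "(\<integral>\<^sup>+ \<eta>. ennreal (us \<eta> j) \<partial>?E) \<le> (\<integral>\<^sup>+ \<eta>. ennreal (1 / \<kappa>0) * ennreal (\<Sum>i<n. (lp i \<eta>)\<^sup>2) + ennreal (1 / real (qs j)) * ennreal ((bsum j \<eta>)\<^sup>2) \<partial>?E)"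
  proof (rule nn_integral_mono)
    fix \<eta>
    have "ennreal (us \<eta> j) \<le> ennreal ((1 / \<kappa>0) * (\<Sum>i<n. (lp i \<eta>)\<^sup>2) + (1 / real (qs j)) * (bsum j \<eta>)\<^sup>2)"
      using us_split[OF j, of \<eta>] by (intro ennreal_leI) simp
    also have "\<dots> = ennreal ((1 / \<kappa>0) * (\<Sum>i<n. (lp i \<eta>)\<^sup>2)) + ennreal ((1 / real (qs j)) * (bsum j \<eta>)\<^sup>2)"
      using \<kappa>0(1) by (intro ennreal_plus mult_nonneg_nonneg sum_nonneg) auto
    also have "\<dots> = ennreal (1 / \<kappa>0) * ennreal (\<Sum>i<n. (lp i \<eta>)\<^sup>2) + ennreal (1 / real (qs j)) * ennreal ((bsum j \<eta>)\<^sup>2)"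
      using \<kappa>0(1) by (intro arg_cong2[where f="(+)"] ennreal_mult sum_nonneg) auto
    finally show "ennreal (us \<eta> j) \<le> ennreal (1 / \<kappa>0) * ennreal (\<Sum>i<n. (lp i \<eta>)\<^sup>2) + ennreal (1 / real (qs j)) * ennreal ((bsum j \<eta>)\<^sup>2)" .
  qed
  also have "\<dots> = ennreal (1 / \<kappa>0) * (\<integral>\<^sup>+ \<eta>. ennreal (\<Sum>i<n. (lp i \<eta>)\<^sup>2) \<partial>?E) + ennreal (1 / real (qs j)) * (\<integral>\<^sup>+ \<eta>. ennreal ((bsum j \<eta>)\<^sup>2) \<partial>?E)"
    by (simp add: nn_integral_add nn_integral_cmult)
  also have "\<dots> \<le> ennreal (1 / \<kappa>0) * ennreal (2 * (\<Sum>i<n. (v i)\<^sup>2) + Kc) + ennreal (1 / real (qs j)) * ennreal (real (qs j) / \<tau> j)"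
    by (intro add_mono mult_left_mono 1 2) auto
  also have "\<dots> = ennreal ((1 / \<kappa>0) * (2 * (\<Sum>i<n. (v i)\<^sup>2) + Kc)) + ennreal (1 / real (qs j) * (real (qs j) / \<tau> j))"
    using \<kappa>0(1) tj q by (intro arg_cong2[where f="(+)"] ennreal_mult[symmetric]) (auto simp: Kc_def intro!: add_nonneg_nonneg sum_nonneg)
  also have "\<dots> = ennreal ((1 / \<kappa>0) * (2 * (\<Sum>i<n. (v i)\<^sup>2) + Kc) + 1 / real (qs j) * (real (qs j) / \<tau> j))"
    using \<kappa>0(1) tj q by (intro ennreal_plus[symmetric] mult_nonneg_nonneg add_nonneg_nonneg sum_nonneg) (auto simp: Kc_def)
  also have "1 / real (qs j) * (real (qs j) / \<tau> j) = 1 / \<tau> j" using q by simp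
  finally show ?thesis .
qed

end

section \<open>Inverse moments of a block\<close>

lemma sigma_finite_Rsp: "sigma_finite_measure (Rsp m)"
  unfolding Rsp_def
proof -
  interpret finite_product_sigma_finite "\<lambda>_. lborel :: real measure" "{..<m}" by standard simp
  show "sigma_finite_measure (lebP {..<m})" by standard
qed

context probit_gibbs
begin

definition bsc :: "nat \<Rightarrow> real \<Rightarrow> nat \<Rightarrow> real" where
  "bsc j t c = (if \<exists>k<qs j. c = blk j k then t else 1)"

text \<open>Dilation of block \<open>j\<close> alone; the summand \<open>0 +\<close> matches the
  affine substitution rule.\<close>

definition bscale :: "nat \<Rightarrow> real \<Rightarrow> (nat \<Rightarrow> real) \<Rightarrow> nat \<Rightarrow> real" where
  "bscale j t x = (\<lambda>c\<in>{..<d}. 0 + bsc j t c * x c)"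

lemma bsc_blk: "j < r \<Longrightarrow> j' < r \<Longrightarrow> k < qs j' \<Longrightarrow> bsc j t (blk j' k) = (if j' = j then t else 1)"
  using blk_inj[of k j' _ j] by (auto simp: bsc_def)

lemma bsc_beta: assumes "c < p" shows "bsc j t c = 1"
proof -
  have "\<not> (\<exists>k<qs j. c = blk j k)" using blk_ge[of j] assms by (metis leD)
  then show ?thesis by (auto simp: bsc_def)
qed

lemma bscale_blk: "j < r \<Longrightarrow> j' < r \<Longrightarrow> k < qs j' \<Longrightarrow> bscale j t x (blk j' k) = (if j' = j then t else 1) * x (blk j' k)"
  by (simp add: bscale_def blk_less bsc_blk)

lemma bscale_beta: "c < p \<Longrightarrow> bscale j t x c = x c"
  by (simp add: bscale_def bsc_beta d_def)

lemma lp_bscale: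
  assumes i: "i < n" and j: "j < r"
  shows "lp i (bscale j t x) = lp i x + (t - 1) * x (blk j (lev j i))"
proof -
  have "(\<Sum>j'<r. bscale j t x (blk j' (lev j' i))) = (\<Sum>j'<r. x (blk j' (lev j' i)) + (if j' = j then (t - 1) * x (blk j' (lev j' i)) else 0))"
    using lev_range i j by (intro sum.cong refl) (auto simp: bscale_blk algebra_simps)
  also have "\<dots> = (\<Sum>j'<r. x (blk j' (lev j' i))) + (t - 1) * x (blk j (lev j i))"
    unfolding sum.distrib using j by simp
  finally show ?thesis unfolding lp_eq[OF i] by (simp add: bscale_beta)
qed

lemma us_bscale: assumes "j < r" "j' < r" shows "us (bscale j t x) j' = (if j' = j then t\<^sup>2 * us x j' else us x j')"
  unfolding us_def using assms by (simp add: bscale_blk power_mult_distrib sum_distrib_left)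

lemma nn_bscale:
  assumes f: "f \<in> borel_measurable (Rsp d)" and t: "t \<noteq> 0" and j: "j < r"
  shows "(\<integral>\<^sup>+ x. f x \<partial>Rsp d) = ennreal (\<bar>t\<bar> ^ qs j) * (\<integral>\<^sup>+ x. f (bscale j t x) \<partial>Rsp d)"
proof -
  have "(\<integral>\<^sup>+ x. f x \<partial>lebP {..<d}) = (\<Prod>c<d. ennreal \<bar>bsc j t c\<bar>) * (\<integral>\<^sup>+ x. f (\<lambda>c\<in>{..<d}. 0 + bsc j t c * x c) \<partial>lebP {..<d})"
    using f t unfolding Rsp_def by (intro nn_integral_PiM_affine) (auto simp: bsc_def)
  also have "(\<Prod>c<d. ennreal \<bar>bsc j t c\<bar>) = ennreal (\<bar>t\<bar> ^ qs j)"
  proof -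
    have b: "(\<Prod>k<qs j'. ennreal \<bar>bsc j t (blk j' k)\<bar>) = (if j' = j then ennreal (\<bar>t\<bar> ^ qs j) else 1)" if "j' < r" for j'
      using j that by (simp add: bsc_blk ennreal_power)
    have "(\<Prod>c<d. ennreal \<bar>bsc j t c\<bar>) = (\<Prod>j'<r. if j' = j then ennreal (\<bar>t\<bar> ^ qs j) else 1)"
      unfolding prod_d using b by (simp add: bsc_beta)
    then show ?thesis using j by simp
  qed
  finally show ?thesis by (simp only: Rsp_def bscale_def)
qed

text \<open>A bound on the Laplace transform of the squared block norm, obtained by dilating the
  block by \<open>w\<close>. The Jacobian yields the power, the quadratic part is no smaller than
  before, and the linear part shrinks. The linear part has no sign, so the integral is averaged over
  the reflection of the block, where monotonicity of the hyperbolic cosine applies.\<close>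

lemma block_scale_bound:
  assumes \<tau>: "\<forall>j<r. 0 < \<tau> j" and j: "j < r" and t: "0 < t"
  shows "(\<integral>\<^sup>+ \<eta>. ennreal (G \<tau> v \<eta>) * ennreal (exp (- (us \<eta> j / 2) * t)) \<partial>Rsp d)
     \<le> ennreal ((1 + t / (\<tau> j + real n)) powr (- (real (qs j) / 2))) * NG \<tau> v"
proof -
  define \<Lambda> where "\<Lambda> = \<tau> j + real n"
  have tj: "0 < \<tau> j" using \<tau> j by simp
  have \<Lambda>: "0 < \<Lambda>" using tj by (simp add: \<Lambda>_def)
  \<comment> \<open>Chosen so that \<open>w^2 * (1 + t / \<Lambda>) = 1\<close>: the dilated
    quadratic part including the new term \<open>t * us x j\<close> dominates the original
    one.\<close>
  define w where "w = 1 / sqrt (1 + t / \<Lambda>)"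
  have t\<Lambda>: "0 < t / \<Lambda>" using t \<Lambda> by simp
  have w: "0 < w" "w \<le> 1" using t\<Lambda> by (auto simp: w_def divide_le_eq_1)
  have w2: "w\<^sup>2 * (1 + t / \<Lambda>) = 1" using t\<Lambda> by (simp add: w_def power_divide)
  define l where "l i x = x (blk j (lev j i))" for i and x :: "nat \<Rightarrow> real"
  define rr where "rr i x = v i - lp i x + l i x" for i x
  define q2 where "q2 x = (\<Sum>i<n. (l i x)\<^sup>2) + \<tau> j * us x j" for x
  define L where "L x = (\<Sum>i<n. rr i x * l i x)" for x
  define R where "R x = (\<Sum>i<n. (rr i x)\<^sup>2) + (\<Sum>j'\<in>{..<r} - {j}. \<tau> j' * us x j')" for x
  have lm[measurable]: "\<And>i. i \<in> {..<n} \<Longrightarrow> (\<lambda>x. l i x) \<in> borel_measurable (Rsp d)"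
    unfolding l_def using lev_range j by (intro measurable_coord[OF measurable_ident_sets[OF refl]] blk_less) auto
  have um: "\<And>j. j \<in> {..<r} \<Longrightarrow> (\<lambda>x. us x j) \<in> borel_measurable (Rsp d)" by (rule measurable_us) auto
  have um1[measurable]: "(\<lambda>x. us x j) \<in> borel_measurable (Rsp d)" using um j by simp
  have rm[measurable]: "\<And>i. i \<in> {..<n} \<Longrightarrow> (\<lambda>x. rr i x) \<in> borel_measurable (Rsp d)" unfolding rr_def by measurable
  have [measurable]: "q2 \<in> borel_measurable (Rsp d)" "L \<in> borel_measurable (Rsp d)" "R \<in> borel_measurable (Rsp d)"
    unfolding q2_def[abs_def] L_def[abs_def] R_def[abs_def] using um
    by (auto intro!: borel_measurable_add borel_measurable_sum borel_measurable_times borel_measurable_power lm rm)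
  have GD: "G \<tau> v (bscale j u x) = exp (u * L x - (1/2) * R x - (1/2) * u\<^sup>2 * q2 x)" for u x
  proof -
    have "(\<Sum>i<n. (v i - lp i (bscale j u x))\<^sup>2) = (\<Sum>i<n. (rr i x)\<^sup>2 - 2 * u * (rr i x * l i x) + u\<^sup>2 * (l i x)\<^sup>2)"
      using j by (intro sum.cong refl) (simp add: lp_bscale rr_def l_def power2_eq_square algebra_simps)
    also have "\<dots> = (\<Sum>i<n. (rr i x)\<^sup>2) - 2 * u * L x + u\<^sup>2 * (\<Sum>i<n. (l i x)\<^sup>2)"
      by (simp only: sum.distrib sum_subtractf sum_distrib_left L_def)
    finally have 1: "(\<Sum>i<n. (v i - lp i (bscale j u x))\<^sup>2) = (\<Sum>i<n. (rr i x)\<^sup>2) - 2 * u * L x + u\<^sup>2 * (\<Sum>i<n. (l i x)\<^sup>2)" .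
    have "(\<Sum>j'<r. \<tau> j' * us (bscale j u x) j') = \<tau> j * us (bscale j u x) j + (\<Sum>j'\<in>{..<r} - {j}. \<tau> j' * us (bscale j u x) j')"
      using j by (intro sum.remove) auto
    also have "\<dots> = u\<^sup>2 * (\<tau> j * us x j) + (\<Sum>j'\<in>{..<r} - {j}. \<tau> j' * us x j')"
      using j by (simp add: us_bscale)
    finally have 2: "(\<Sum>j'<r. \<tau> j' * us (bscale j u x) j') = u\<^sup>2 * (\<tau> j * us x j) + (\<Sum>j'\<in>{..<r} - {j}. \<tau> j' * us x j')" .
    show ?thesis unfolding G_def 1 2 R_def q2_def by (simp add: algebra_simps)
  qed
  have G1: "G \<tau> v x = exp (L x - (1/2) * R x - (1/2) * q2 x)" for x
  proof -
    have "G \<tau> v (bscale j 1 x) = G \<tau> v x" by (rule G_cong) (simp add: bscale_def bsc_def)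
    then show ?thesis using GD[of 1 x] by simp
  qed
  \<comment> \<open>Each observation reads one entry of the block, whence the crude upper bound
    \<open>\<tau> j + n\<close> on the precision of the block.\<close>
  have q2le: "q2 x \<le> \<Lambda> * us x j" for x
  proof -
    have "(l i x)\<^sup>2 \<le> us x j" if "i < n" for i
      unfolding us_def l_def using lev_range j that by (intro member_le_sum[of "lev j i"]) auto
    then have "(\<Sum>i<n. (l i x)\<^sup>2) \<le> (\<Sum>i<n. us x j)" by (intro sum_mono) auto
    then show ?thesis by (simp add: q2_def \<Lambda>_def algebra_simps)
  qed
  let ?f = "\<lambda>\<eta>. ennreal (G \<tau> v \<eta>) * ennreal (exp (- (us \<eta> j / 2) * t))"
  let ?H = "\<lambda>x. ennreal (exp (w * L x - (1/2) * R x - (1/2) * q2 x))"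
  let ?H' = "\<lambda>x. ennreal (exp (- (w * L x) - (1/2) * R x - (1/2) * q2 x))"
  have fH: "?f (bscale j w x) \<le> ?H x" for x
  proof -
    have "q2 x \<le> w\<^sup>2 * (q2 x + t * us x j)"
    proof -
      have "w\<^sup>2 * (q2 x + t * (q2 x / \<Lambda>)) = (w\<^sup>2 * (1 + t / \<Lambda>)) * q2 x" by (simp add: algebra_simps)
      then have "q2 x = w\<^sup>2 * (q2 x + t * (q2 x / \<Lambda>))" unfolding w2 by simp
      also have "\<dots> \<le> w\<^sup>2 * (q2 x + t * us x j)"
        using q2le[of x] \<Lambda> t by (intro mult_left_mono add_left_mono) (auto simp: divide_le_eq mult.commute)
      finally show ?thesis .
    qed
    then have "G \<tau> v (bscale j w x) * exp (- (us (bscale j w x) j / 2) * t) \<le> exp (w * L x - (1/2) * R x - (1/2) * q2 x)"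
      unfolding GD us_bscale[OF j j] exp_add[symmetric] by (simp add: algebra_simps)
    then show ?thesis by (simp add: ennreal_mult[symmetric] G_pos less_imp_le ennreal_leI)
  qed
  have LD: "L (bscale j (- 1) x) = - L x" "R (bscale j (- 1) x) = R x" "q2 (bscale j (- 1) x) = q2 x" for x
  proof -
    have ll: "l i (bscale j (- 1) x) = - l i x" if "i < n" for i
      unfolding l_def using lev_range j that by (simp add: bscale_blk)
    have rl: "rr i (bscale j (- 1) x) = rr i x" if "i < n" for i
      unfolding rr_def ll[OF that] lp_bscale[OF that j] by (simp add: l_def)
    show "L (bscale j (- 1) x) = - L x" unfolding L_def using ll rl by (simp add: sum_negf)
    show "R (bscale j (- 1) x) = R x" unfolding R_def using rl j by (simp add: us_bscale)
    show "q2 (bscale j (- 1) x) = q2 x" unfolding q2_def using ll j by (simp add: us_bscale)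
  qed
  \<comment> \<open>Reflecting block \<open>j\<close> changes the sign of the linear part
    \<open>L\<close> and nothing else, and its Jacobian is 1.\<close>
  have HH': "(\<integral>\<^sup>+ x. ?H x \<partial>Rsp d) = (\<integral>\<^sup>+ x. ?H' x \<partial>Rsp d)"
    using nn_bscale[of ?H "- 1", OF _ _ j] by (simp add: LD)
  have Gm: "(\<integral>\<^sup>+ x. ennreal (G \<tau> v (bscale j (- 1) x)) \<partial>Rsp d) = NG \<tau> v"
    using nn_bscale[of "\<lambda>x. ennreal (G \<tau> v x)" "- 1", OF _ _ j] by simp
  have mG[measurable]: "(\<lambda>x. G \<tau> v (bscale j (- 1) x)) \<in> borel_measurable (Rsp d)"
    unfolding GD by measurable
  have "(\<integral>\<^sup>+ x. ?H x \<partial>Rsp d) + (\<integral>\<^sup>+ x. ?H x \<partial>Rsp d) = (\<integral>\<^sup>+ x. ?H x \<partial>Rsp d) + (\<integral>\<^sup>+ x. ?H' x \<partial>Rsp d)" using HH' by simp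
  also have "\<dots> = (\<integral>\<^sup>+ x. ?H x + ?H' x \<partial>Rsp d)" by (rule nn_integral_add[symmetric]) measurable
  also have "\<dots> \<le> (\<integral>\<^sup>+ x. ennreal (G \<tau> v x) + ennreal (G \<tau> v (bscale j (- 1) x)) \<partial>Rsp d)"
  proof (rule nn_integral_mono)
    fix x
    let ?e = "exp (- (1/2) * R x - (1/2) * q2 x)"
    have "exp (w * L x - (1/2) * R x - (1/2) * q2 x) + exp (- (w * L x) - (1/2) * R x - (1/2) * q2 x) = ?e * (exp (w * L x) + exp (- (w * L x)))"
      by (simp add: distrib_left exp_add[symmetric] algebra_simps)
    also have "\<dots> \<le> ?e * (exp (L x) + exp (- L x))" using w by (intro mult_left_mono two_cosh_mono) auto
    also have "\<dots> = G \<tau> v x + G \<tau> v (bscale j (- 1) x)" by (subst GD, subst G1) (simp add: distrib_left exp_add[symmetric] algebra_simps)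
    finally show "?H x + ?H' x \<le> ennreal (G \<tau> v x) + ennreal (G \<tau> v (bscale j (- 1) x))"
      by (simp add: ennreal_plus[symmetric] G_pos less_imp_le ennreal_leI del: ennreal_plus)
  qed
  also have "\<dots> = NG \<tau> v + NG \<tau> v" by (subst nn_integral_add) (measurable, simp only: Gm)
  finally have HN: "(\<integral>\<^sup>+ x. ?H x \<partial>Rsp d) \<le> NG \<tau> v"
    unfolding mult_2[symmetric] by (simp add: ennreal_mult_le_mult_iff)
  have "(\<integral>\<^sup>+ \<eta>. ?f \<eta> \<partial>Rsp d) = ennreal (\<bar>w\<bar> ^ qs j) * (\<integral>\<^sup>+ x. ?f (bscale j w x) \<partial>Rsp d)"
    using w j by (intro nn_bscale) auto
  also have "\<dots> \<le> ennreal (\<bar>w\<bar> ^ qs j) * (\<integral>\<^sup>+ x. ?H x \<partial>Rsp d)" by (intro mult_left_mono nn_integral_mono fH) simp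
  also have "\<dots> \<le> ennreal (\<bar>w\<bar> ^ qs j) * NG \<tau> v" by (intro mult_left_mono HN) simp
  also have "\<bar>w\<bar> ^ qs j = (1 + t / \<Lambda>) powr (- (real (qs j) / 2))"
  proof -
    have "w = (1 + t / \<Lambda>) powr (- (1/2))" using t\<Lambda> by (simp add: w_def powr_minus powr_half_sqrt field_simps)
    then have "\<bar>w\<bar> ^ qs j = ((1 + t / \<Lambda>) powr (- (1/2))) powr real (qs j)" using w t\<Lambda> by (simp add: powr_realpow)
    then show ?thesis by (simp add: powr_powr)
  qed
  finally show ?thesis by (simp only: \<Lambda>_def)
qed

text \<open>A negative power is a Gamma mixture of exponentials, so the bound on the Laplace
  transform integrates to a beta-prime integral. For large \<open>\<tau> j\<close> the constant is
  that of a centred Gaussian block with precision \<open>\<tau> j\<close>, as the strict Gamma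
  inequality requires.\<close>

lemma eta_inverse_moment:
  assumes \<tau>: "\<forall>j<r. 0 < \<tau> j" and j: "j < r" and c: "0 < c" "c < real (qs j) / 2"
  shows "(\<integral>\<^sup>+ \<eta>. ennreal ((us \<eta> j / 2) powr (- c)) \<partial>eta_draw n p r qs X lev \<tau> v)
    \<le> ennreal ((\<tau> j + real n) powr c * (Gamma (real (qs j) / 2 - c) / Gamma (real (qs j) / 2)))"
proof -
  let ?h = "real (qs j) / 2" and ?\<Lambda> = "\<tau> j + real n"
  have \<Lambda>: "0 < ?\<Lambda>" using \<tau> j by (simp add: add_pos_nonneg)
  have Gp: "0 < Gamma c" "0 < Gamma (?h - c)" "0 < Gamma ?h" using c by (auto intro: Gamma_real_pos)
  have um[measurable]: "(\<lambda>x. us x j) \<in> borel_measurable (Rsp d)" by (rule measurable_us[OF _ j]) simp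
  interpret R: sigma_finite_measure "Rsp d" by (rule sigma_finite_Rsp)
  interpret RL: pair_sigma_finite "Rsp d" "lborel :: real measure" by standard
  let ?f = "\<lambda>\<eta>. ennreal ((us \<eta> j / 2) powr (- c))"
  have "ennreal (Gamma c) * (\<integral>\<^sup>+ \<eta>. ennreal (G \<tau> v \<eta>) * ?f \<eta> \<partial>Rsp d) = (\<integral>\<^sup>+ \<eta>. ennreal (Gamma c) * (ennreal (G \<tau> v \<eta>) * ?f \<eta>) \<partial>Rsp d)"
    by (rule nn_integral_cmult[symmetric]) measurable
  also have "\<dots> \<le> (\<integral>\<^sup>+ \<eta>. \<integral>\<^sup>+ t. ennreal (G \<tau> v \<eta>) * ennreal (gaw c (us \<eta> j / 2) t) \<partial>lborel \<partial>Rsp d)"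
  proof (rule nn_integral_mono)
    fix \<eta>
    \<comment> \<open>Only an inequality is claimed: at a vanishing block the power
      \<open>0 powr (- c)\<close> is 0 by convention, while otherwise equality holds.\<close>
    have "ennreal (Gamma c) * ?f \<eta> \<le> (\<integral>\<^sup>+ t. ennreal (gaw c (us \<eta> j / 2) t) \<partial>lborel)"
    proof (cases "us \<eta> j = 0")
      case False
      then have "0 < us \<eta> j / 2" using us_nonneg[of \<eta> j] by simp
      then show ?thesis using gaw_integral[OF c(1), of "us \<eta> j / 2"] Gp by (simp add: ennreal_mult)
    qed simp
    then have "ennreal (G \<tau> v \<eta>) * (ennreal (Gamma c) * ?f \<eta>) \<le> ennreal (G \<tau> v \<eta>) * (\<integral>\<^sup>+ t. ennreal (gaw c (us \<eta> j / 2) t) \<partial>lborel)"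
      by (rule mult_left_mono) simp
    also have "\<dots> = (\<integral>\<^sup>+ t. ennreal (G \<tau> v \<eta>) * ennreal (gaw c (us \<eta> j / 2) t) \<partial>lborel)"
      by (rule nn_integral_cmult[symmetric]) measurable
    finally show "ennreal (Gamma c) * (ennreal (G \<tau> v \<eta>) * ?f \<eta>) \<le> (\<integral>\<^sup>+ t. ennreal (G \<tau> v \<eta>) * ennreal (gaw c (us \<eta> j / 2) t) \<partial>lborel)"
      by (simp only: mult_ac)
  qed
  also have "\<dots> = (\<integral>\<^sup>+ t. \<integral>\<^sup>+ \<eta>. ennreal (G \<tau> v \<eta>) * ennreal (gaw c (us \<eta> j / 2) t) \<partial>Rsp d \<partial>lborel)"
    by (rule RL.Fubini'[symmetric]) measurable
  also have "\<dots> \<le> (\<integral>\<^sup>+ t. ennreal (indicator {0<..} t * t powr (c - 1) * (1 + t / ?\<Lambda>) powr (- ?h)) * NG \<tau> v \<partial>lborel)"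
  proof (rule nn_integral_mono)
    fix t :: real
    show "(\<integral>\<^sup>+ \<eta>. ennreal (G \<tau> v \<eta>) * ennreal (gaw c (us \<eta> j / 2) t) \<partial>Rsp d) \<le> ennreal (indicator {0<..} t * t powr (c - 1) * (1 + t / ?\<Lambda>) powr (- ?h)) * NG \<tau> v"
    proof (cases "0 < t")
      case True
      have "(\<integral>\<^sup>+ \<eta>. ennreal (G \<tau> v \<eta>) * ennreal (gaw c (us \<eta> j / 2) t) \<partial>Rsp d)
         = (\<integral>\<^sup>+ \<eta>. ennreal (t powr (c - 1)) * (ennreal (G \<tau> v \<eta>) * ennreal (exp (- (us \<eta> j / 2) * t))) \<partial>Rsp d)"
        using True by (intro nn_integral_cong) (simp add: gaw_def ennreal_mult mult_ac)
      also have "\<dots> = ennreal (t powr (c - 1)) * (\<integral>\<^sup>+ \<eta>. ennreal (G \<tau> v \<eta>) * ennreal (exp (- (us \<eta> j / 2) * t)) \<partial>Rsp d)"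
        by (rule nn_integral_cmult) measurable
      also have "\<dots> \<le> ennreal (t powr (c - 1)) * (ennreal ((1 + t / ?\<Lambda>) powr (- ?h)) * NG \<tau> v)"
        by (intro mult_left_mono block_scale_bound \<tau> j True) simp
      finally show ?thesis using True by (simp add: ennreal_mult mult.assoc)
    qed (simp add: gaw_def)
  qed
  also have "\<dots> = (\<integral>\<^sup>+ t. ennreal (indicator {0<..} t * t powr (c - 1) * (1 + t / ?\<Lambda>) powr (- ?h)) \<partial>lborel) * NG \<tau> v"
    by (rule nn_integral_multc) measurable
  also have "\<dots> = ennreal (?\<Lambda> powr c * Gamma c * Gamma (?h - c) / Gamma ?h) * NG \<tau> v"
    unfolding nn_integral_beta_prime[OF c \<Lambda>] ..
  also have "ennreal (?\<Lambda> powr c * Gamma c * Gamma (?h - c) / Gamma ?h) = ennreal (Gamma c) * ennreal (?\<Lambda> powr c * (Gamma (?h - c) / Gamma ?h))"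
    using Gp by (subst ennreal_mult[symmetric]) (auto simp: mult_ac)
  finally have *: "ennreal (Gamma c) * (\<integral>\<^sup>+ \<eta>. ennreal (G \<tau> v \<eta>) * ?f \<eta> \<partial>Rsp d) \<le> ennreal (Gamma c) * (ennreal (?\<Lambda> powr c * (Gamma (?h - c) / Gamma ?h)) * NG \<tau> v)"
    by (simp only: mult.assoc)
  have le: "(\<integral>\<^sup>+ \<eta>. ennreal (G \<tau> v \<eta>) * ?f \<eta> \<partial>Rsp d) \<le> ennreal (?\<Lambda> powr c * (Gamma (?h - c) / Gamma ?h)) * NG \<tau> v"
    using * Gp by (subst (asm) ennreal_mult_le_mult_iff) (auto simp: ennreal_eq_0_iff)
  show ?thesis unfolding eta_draw_eq
    by (rule nn_integral_normdens_le[OF _ _ NG_nz NG_fin[OF \<tau>] le]) measurable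
qed

end

section \<open>Transition kernels and their densities\<close>

lemma density_kernel:
  assumes N: "sigma_finite_measure N" "space N \<noteq> {}"
    and f[measurable]: "case_prod f \<in> borel_measurable (M \<Otimes>\<^sub>M N)"
    and le: "\<And>x. x \<in> space M \<Longrightarrow> (\<integral>\<^sup>+ z. f x z \<partial>N) \<le> 1"
  shows "(\<lambda>x. density N (f x)) \<in> measurable M (subprob_algebra N)"
proof -
  interpret N: sigma_finite_measure N by fact
  have fx[measurable]: "f x \<in> borel_measurable N" if "x \<in> space M" for x
    using measurable_Pair2[OF f that] by simp
  show ?thesis
  proof (rule measurable_subprob_algebra)
    show "subprob_space (density N (f x))" if "x \<in> space M" for x
    proof (rule subprob_spaceI)
      show "emeasure (density N (f x)) (space (density N (f x))) \<le> 1"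
        using le[OF that] fx[OF that] by (simp add: emeasure_density)
      show "space (density N (f x)) \<noteq> {}" using N by simp
    qed
    show "sets (density N (f x)) = sets N" for x by simp
    fix A assume A[measurable]: "A \<in> sets N"
    have "(\<lambda>x. \<integral>\<^sup>+ z. f x z * indicator A z \<partial>N) \<in> borel_measurable M"
      by (rule N.borel_measurable_nn_integral) measurable
    then show "(\<lambda>x. emeasure (density N (f x)) A) \<in> borel_measurable M"
      by (rule measurable_cong[THEN iffD1, rotated]) (simp add: emeasure_density fx)
  qed
qed

text \<open>Likelihood factor as the mass of the latent normal variable on its half-line, via the
  reflection of \<open>t\<close> to \<open>m - t\<close>. This links the posterior to the
  normalisers of the truncated draws.\<close>

lemma Phi_half:
  "0 \<le> (if yi then Phi m else 1 - Phi m)"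
  "ennreal (if yi then Phi m else 1 - Phi m) = ennreal (1 / sqrt (2 * pi)) * (\<integral>\<^sup>+ v. ennreal (tnw m yi v) \<partial>lborel)"
proof -
  let ?\<phi> = "std_normal_density"
  have int: "integrable lborel (\<lambda>t. indicator A t * ?\<phi> t)" if "A \<in> sets borel" for A :: "real set"
    using integrable_real_mult_indicator[of A lborel ?\<phi>] that by (simp add: mult.commute)
  have one: "1 - Phi m = (\<integral>t. indicator {m<..} t * ?\<phi> t \<partial>lborel)"
  proof -
    have "1 = (\<integral>t. indicator {..m} t * ?\<phi> t + indicator {m<..} t * ?\<phi> t \<partial>lborel)"
    proof -
      have "(\<integral>t. indicator {..m} t * ?\<phi> t + indicator {m<..} t * ?\<phi> t \<partial>lborel) = (\<integral>t. ?\<phi> t \<partial>lborel)"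
        by (intro Bochner_Integration.integral_cong) (auto simp: indicator_def)
      then show ?thesis by simp
    qed
    also have "\<dots> = Phi m + (\<integral>t. indicator {m<..} t * ?\<phi> t \<partial>lborel)"
      unfolding Phi_def by (intro Bochner_Integration.integral_add int) auto
    finally show ?thesis by simp
  qed
  let ?A = "if yi then {..m} else {m<..}"
  have eq: "(if yi then Phi m else 1 - Phi m) = (\<integral>t. indicator ?A t * ?\<phi> t \<partial>lborel)"
    using one by (simp add: Phi_def)
  show "0 \<le> (if yi then Phi m else 1 - Phi m)" unfolding eq by (intro integral_nonneg_AE AE_I2) auto
  have "ennreal (if yi then Phi m else 1 - Phi m) = (\<integral>\<^sup>+ t. ennreal (indicator ?A t * ?\<phi> t) \<partial>lborel)"
    unfolding eq by (rule nn_integral_eq_integral[symmetric]) (auto intro!: int AE_I2)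
  also have "\<dots> = (\<integral>\<^sup>+ t. ennreal (1 / sqrt (2 * pi)) * ennreal (tnw m yi (m + (- 1) * t)) \<partial>lborel)"
  proof (rule nn_integral_cong_AE)
    \<comment> \<open>At \<open>t = m\<close> the open and the closed half-line are exchanged by the
      reflection; the point has measure 0.\<close>
    have "AE t in lborel. t \<noteq> m" by (rule AE_lborel_singleton)
    then show "AE t in lborel. ennreal (indicator ?A t * ?\<phi> t) = ennreal (1 / sqrt (2 * pi)) * ennreal (tnw m yi (m + (- 1) * t))"
    proof eventually_elim
      case (elim t)
      have "indicator ?A t = (indicator (halfline yi) (m + (- 1) * t) :: real)" using elim by (auto simp: indicator_def)
      then show ?case by (simp add: tnw_def std_normal_density_def ennreal_mult[symmetric] mult_ac)
    qed
  qed
  also have "\<dots> = ennreal (1 / sqrt (2 * pi)) * (\<integral>\<^sup>+ t. ennreal (tnw m yi (m + (- 1) * t)) \<partial>lborel)"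
    by (rule nn_integral_cmult) measurable
  also have "(\<integral>\<^sup>+ t. ennreal (tnw m yi (m + (- 1) * t)) \<partial>lborel) = (\<integral>\<^sup>+ v. ennreal (tnw m yi v) \<partial>lborel)"
    using nn_integral_real_affine[of "\<lambda>v. ennreal (tnw m yi v)" "- 1" m] by simp
  finally show "ennreal (if yi then Phi m else 1 - Phi m) = ennreal (1 / sqrt (2 * pi)) * (\<integral>\<^sup>+ v. ennreal (tnw m yi v) \<partial>lborel)" .
qed

lemma AE_Rsp_coord_nz: assumes "c < m" shows "AE x in Rsp m. x c \<noteq> 0"
proof (rule AE_I)
  show "{x \<in> space (Rsp m). \<not> x c \<noteq> 0} \<subseteq> Pi\<^sub>E {..<m} (\<lambda>k. if k = c then {0} else UNIV)"
    using assms by (auto simp: Rsp_def space_PiM PiE_iff extensional_def)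
  have "emeasure (lebP {..<m}) (Pi\<^sub>E {..<m} (\<lambda>k. if k = c then {0} else UNIV)) = (\<Prod>k<m. emeasure lborel (if k = c then {0::real} else UNIV))"
    by (subst lb.emeasure_PiM) auto
  also have "\<dots> = 0" using assms by (intro prod_zero bexI[of _ c]) auto
  finally show "emeasure (Rsp m) (Pi\<^sub>E {..<m} (\<lambda>k. if k = c then {0} else UNIV)) = 0" by (simp add: Rsp_def)
  show "Pi\<^sub>E {..<m} (\<lambda>k. if k = c then {0} else UNIV) \<in> sets (Rsp m)"
    unfolding Rsp_def by (intro sets_PiM_I_finite) auto
qed

lemma space_Rsp_ne: "space (Rsp m) \<noteq> {}"
  by (auto simp: Rsp_def space_PiM PiE_eq_empty_iff)

context probit_gibbs
begin

definition al :: "nat \<Rightarrow> real" where "al j = a j + real (qs j) / 2"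

lemma al_gt: "j < r \<Longrightarrow> 1/2 < al j" using B2 by (auto simp: al_def field_simps)

lemma al_pos: "j < r \<Longrightarrow> 0 < al j" using al_gt[of j] by simp

definition rho :: "(nat \<Rightarrow> real) \<Rightarrow> nat \<Rightarrow> real" where "rho \<eta> j = erate (b j + us \<eta> j / 2)"

lemma rho_pos: "0 < rho \<eta> j" by (simp add: rho_def erate_pos)

lemma measurable_rho: "f \<in> measurable M (Rsp d) \<Longrightarrow> j < r \<Longrightarrow> (\<lambda>x. rho (f x) j) \<in> borel_measurable M"
  unfolding rho_def by (intro measurable_compose[OF _ measurable_erate] borel_measurable_add borel_measurable_const borel_measurable_divide measurable_us)

definition ga :: "(nat \<Rightarrow> real) \<Rightarrow> (nat \<Rightarrow> real) \<Rightarrow> ennreal" where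
  "ga \<eta> \<tau> = (\<Prod>j<r. gad (al j) (rho \<eta> j) (\<tau> j))"

definition tv :: "(nat \<Rightarrow> real) \<Rightarrow> (nat \<Rightarrow> real) \<Rightarrow> ennreal" where
  "tv \<eta> v = (\<Prod>i<n. tnd (lp i \<eta>) (y i) (v i))"

definition ed :: "(nat \<Rightarrow> real) \<Rightarrow> (nat \<Rightarrow> real) \<Rightarrow> (nat \<Rightarrow> real) \<Rightarrow> ennreal" where
  "ed \<tau> v \<eta> = ennreal (G \<tau> v \<eta>) / NG \<tau> v"

abbreviation "tauD \<equiv> tau_draw p r qs a b"
abbreviation "vD \<equiv> v_draw n p r qs X lev y"
abbreviation "etaD \<equiv> eta_draw n p r qs X lev"
abbreviation "Kg \<equiv> gibbs_kernel n p r qs X lev y a b"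
abbreviation "post \<equiv> post_dens n p r qs X lev y a b"

lemma tau_density: "tauD \<eta> = density (Rsp r) (ga \<eta>)"
  unfolding tau_draw_def gamma_meas_density Rsp_def ga_def rho_def al_def[symmetric]
  by (rule PiM_density_lborel) (auto simp: gad_integral al_pos erate_pos)

lemma v_density: "vD \<eta> = density (Rsp n) (tv \<eta>)"
  unfolding v_draw_def truncnorm_density Rsp_def tv_def d_def[symmetric] lp_def[symmetric]
  by (rule PiM_density_lborel) (auto simp: tnd_integral)

lemma eta_density: "etaD \<tau> v = density (Rsp d) (ed \<tau> v)"
  unfolding eta_draw_eq normdens_def ed_def ..

lemma measurable_ga[measurable (raw)]:
  assumes f: "f \<in> measurable M (Rsp d)" and g: "g \<in> measurable M (Rsp r)"
  shows "(\<lambda>x. ga (f x) (g x)) \<in> borel_measurable M"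
  unfolding ga_def by (intro borel_measurable_prod_ennreal measurable_gad measurable_rho[OF f] measurable_coord[OF g]) auto

lemma measurable_tv[measurable (raw)]:
  assumes f: "f \<in> measurable M (Rsp d)" and g: "g \<in> measurable M (Rsp n)"
  shows "(\<lambda>x. tv (f x) (g x)) \<in> borel_measurable M"
  unfolding tv_def by (intro borel_measurable_prod_ennreal measurable_tnd measurable_lp[OF f] measurable_coord[OF g]) auto

lemma measurable_ga1[measurable]: "ga \<eta> \<in> borel_measurable (Rsp r)"
  unfolding ga_def[abs_def]
  by (intro borel_measurable_prod_ennreal measurable_gad borel_measurable_const measurable_coord[OF measurable_ident_sets[OF refl]]) auto

lemma measurable_tv1[measurable]: "tv \<eta> \<in> borel_measurable (Rsp n)"
  unfolding tv_def[abs_def]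
  by (intro borel_measurable_prod_ennreal measurable_tnd borel_measurable_const measurable_coord[OF measurable_ident_sets[OF refl]]) auto

lemma measurable_NG[measurable (raw)]:
  assumes [measurable]: "f \<in> measurable M (Rsp r)" "g \<in> measurable M (Rsp n)"
  shows "(\<lambda>x. NG (f x) (g x)) \<in> borel_measurable M"
proof -
  interpret R: sigma_finite_measure "Rsp d" by (rule sigma_finite_Rsp)
  show ?thesis by (rule R.borel_measurable_nn_integral) measurable
qed

lemma measurable_ed[measurable (raw)]:
  assumes [measurable]: "f \<in> measurable M (Rsp r)" "g \<in> measurable M (Rsp n)" "h \<in> measurable M (Rsp d)"
  shows "(\<lambda>x. ed (f x) (g x) (h x)) \<in> borel_measurable M"
  unfolding ed_def by measurable

lemma prob_space_tauD: "prob_space (tauD \<eta>)"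
  unfolding tau_draw_def by (rule prob_space_PiM) (use al_pos in \<open>auto intro!: prob_space_gamma_meas simp: al_def\<close>)

lemma prob_space_vD: "prob_space (vD \<eta>)"
  unfolding v_draw_def by (rule prob_space_PiM) (auto intro!: prob_space_truncnorm)

lemma ga_integral: "(\<integral>\<^sup>+ \<tau>. ga \<eta> \<tau> \<partial>Rsp r) = 1"
  using prob_space.emeasure_space_1[OF prob_space_tauD[of \<eta>]] unfolding tau_density
  by (simp add: emeasure_density)

lemma tv_integral: "(\<integral>\<^sup>+ v. tv \<eta> v \<partial>Rsp n) = 1"
  using prob_space.emeasure_space_1[OF prob_space_vD[of \<eta>]] unfolding v_density
  by (simp add: emeasure_density)

text \<open>For a \<open>\<tau>\<close> without a proper Gaussian law the mass \<open>NG\<close> is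
  infinite and the density is 0. Hence the draw is only a subprobability kernel on the full space of
  precisions, which suffices for measurability of the composition.\<close>

lemma ed_integral_le: "(\<integral>\<^sup>+ \<eta>. ed \<tau> v \<eta> \<partial>Rsp d) \<le> 1"
proof -
  have "(\<integral>\<^sup>+ \<eta>. ed \<tau> v \<eta> \<partial>Rsp d) = NG \<tau> v / NG \<tau> v" unfolding ed_def by (rule nn_integral_divide) measurable
  also have "\<dots> \<le> 1" using NG_nz[of \<tau> v] by (cases "NG \<tau> v = \<infinity>") (auto simp: ennreal_divide_self top.not_eq_extremum)
  finally show ?thesis .
qed

lemma ed_integral: "\<forall>j<r. 0 < \<tau> j \<Longrightarrow> (\<integral>\<^sup>+ \<eta>. ed \<tau> v \<eta> \<partial>Rsp d) = 1"
proof -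
  assume \<tau>: "\<forall>j<r. 0 < \<tau> j"
  have "(\<integral>\<^sup>+ \<eta>. ed \<tau> v \<eta> \<partial>Rsp d) = NG \<tau> v / NG \<tau> v" unfolding ed_def by (rule nn_integral_divide) measurable
  then show ?thesis using NG_nz[of \<tau> v] NG_fin[OF \<tau>, of v] by (simp add: ennreal_divide_self top.not_eq_extremum)
qed

lemma tauD_kernel: "tauD \<in> measurable (Rsp d) (subprob_algebra (Rsp r))"
  unfolding tau_density by (rule density_kernel[OF sigma_finite_Rsp space_Rsp_ne]) (measurable, simp add: ga_integral)

lemma vD_kernel: "vD \<in> measurable (Rsp d) (subprob_algebra (Rsp n))"
  unfolding v_density by (rule density_kernel[OF sigma_finite_Rsp space_Rsp_ne]) (measurable, simp add: tv_integral)

lemma etaD_kernel: "(\<lambda>z. etaD (fst z) (snd z)) \<in> measurable (Rsp r \<Otimes>\<^sub>M Rsp n) (subprob_algebra (Rsp d))"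
  unfolding eta_density by (rule density_kernel[OF sigma_finite_Rsp space_Rsp_ne]) (measurable, simp add: ed_integral_le)

lemma etaD_kernel2: "\<tau> \<in> space (Rsp r) \<Longrightarrow> etaD \<tau> \<in> measurable (Rsp n) (subprob_algebra (Rsp d))"
  using measurable_compose[OF measurable_Pair1' etaD_kernel, of \<tau>] by simp

lemma inner_kernel: "(\<lambda>x. vD (fst x) \<bind> etaD (snd x)) \<in> measurable (Rsp d \<Otimes>\<^sub>M Rsp r) (subprob_algebra (Rsp d))"
proof (rule measurable_bind)
  show "(\<lambda>x. vD (fst x)) \<in> measurable (Rsp d \<Otimes>\<^sub>M Rsp r) (subprob_algebra (Rsp n))"
    by (rule measurable_compose[OF measurable_fst vD_kernel])
  have "(\<lambda>x. (snd (fst x), snd x)) \<in> measurable ((Rsp d \<Otimes>\<^sub>M Rsp r) \<Otimes>\<^sub>M Rsp n) (Rsp r \<Otimes>\<^sub>M Rsp n)" by measurable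
  from measurable_compose[OF this etaD_kernel]
  show "(\<lambda>x. etaD (snd (fst x)) (snd x)) \<in> measurable ((Rsp d \<Otimes>\<^sub>M Rsp r) \<Otimes>\<^sub>M Rsp n) (subprob_algebra (Rsp d))" by simp
qed

lemma gibbs_kernel_measurable: "Kg \<in> measurable (Rsp d) (subprob_algebra (Rsp d))"
proof -
  have "(\<lambda>\<eta>. tauD \<eta> \<bind> (\<lambda>\<tau>. vD \<eta> \<bind> etaD \<tau>)) \<in> measurable (Rsp d) (subprob_algebra (Rsp d))"
    by (rule measurable_bind[OF tauD_kernel]) (use inner_kernel in simp)
  then show ?thesis unfolding gibbs_kernel_def[abs_def] by simp
qed

lemma inner_kernel_tau: "\<eta> \<in> space (Rsp d) \<Longrightarrow> (\<lambda>\<tau>. vD \<eta> \<bind> etaD \<tau>) \<in> measurable (Rsp r) (subprob_algebra (Rsp d))"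
  using measurable_compose[OF measurable_Pair1' inner_kernel, of \<eta>] by simp

lemma sets_tauD[simp, measurable_cong]: "sets (tauD \<eta>) = sets (Rsp r)" by (simp add: tau_density)
lemma sets_vD[simp, measurable_cong]: "sets (vD \<eta>) = sets (Rsp n)" by (simp add: v_density)
lemma space_tauD[simp]: "space (tauD \<eta>) = space (Rsp r)" by (simp add: tau_density)
lemma space_vD[simp]: "space (vD \<eta>) = space (Rsp n)" by (simp add: v_density)

lemma tauD_pos: assumes "\<eta> \<in> space (Rsp d)" shows "AE \<tau> in tauD \<eta>. \<forall>j<r. 0 < \<tau> j"
proof -
  have "0 < \<tau> j" if "0 < ga \<eta> \<tau>" "j < r" for \<tau> j
  proof (rule ccontr)
    assume "\<not> 0 < \<tau> j"
    then have "ga \<eta> \<tau> = 0" unfolding ga_def using that by (intro prod_zero bexI[of _ j]) (auto simp: gad_zero)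
    then show False using that by simp
  qed
  then show ?thesis unfolding tau_density by (subst AE_density) (auto intro!: AE_I2)
qed

lemma vD_sup: assumes "\<eta> \<in> space (Rsp d)" shows "AE v in vD \<eta>. vsup v"
proof -
  have "vsup v" if "0 < tv \<eta> v" for v
  proof (unfold vsup_def, intro allI impI, rule ccontr)
    fix i assume i: "i < n" "v i \<notin> halfline (y i)"
    then have "tnd (lp i \<eta>) (y i) (v i) = 0" by (simp add: tnd_def tnw_def)
    then have "tv \<eta> v = 0" unfolding tv_def using i by (intro prod_zero bexI[of _ i]) auto
    then show False using that by simp
  qed
  then show ?thesis unfolding v_density by (subst AE_density) (auto intro!: AE_I2)
qed

lemma nn_integral_gibbs:
  assumes \<eta>: "\<eta> \<in> space (Rsp d)" and f[measurable]: "f \<in> borel_measurable (Rsp d)"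
  shows "(\<integral>\<^sup>+ x. f x \<partial>Kg \<eta>) = (\<integral>\<^sup>+ \<tau>. \<integral>\<^sup>+ v. \<integral>\<^sup>+ x. f x \<partial>etaD \<tau> v \<partial>vD \<eta> \<partial>tauD \<eta>)"
proof -
  have m1: "(\<lambda>\<tau>. vD \<eta> \<bind> etaD \<tau>) \<in> measurable (tauD \<eta>) (subprob_algebra (Rsp d))"
    using inner_kernel_tau[OF \<eta>] by (simp cong: measurable_cong_sets)
  have "(\<integral>\<^sup>+ x. f x \<partial>Kg \<eta>) = (\<integral>\<^sup>+ \<tau>. \<integral>\<^sup>+ x. f x \<partial>(vD \<eta> \<bind> etaD \<tau>) \<partial>tauD \<eta>)"
    unfolding gibbs_kernel_def by (rule nn_integral_bind[OF f m1])
  also have "\<dots> = (\<integral>\<^sup>+ \<tau>. \<integral>\<^sup>+ v. \<integral>\<^sup>+ x. f x \<partial>etaD \<tau> v \<partial>vD \<eta> \<partial>tauD \<eta>)"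
  proof (rule nn_integral_cong)
    fix \<tau> assume "\<tau> \<in> space (tauD \<eta>)"
    then have "etaD \<tau> \<in> measurable (vD \<eta>) (subprob_algebra (Rsp d))" using etaD_kernel2 by (simp cong: measurable_cong_sets)
    then show "(\<integral>\<^sup>+ x. f x \<partial>(vD \<eta> \<bind> etaD \<tau>)) = (\<integral>\<^sup>+ v. \<integral>\<^sup>+ x. f x \<partial>etaD \<tau> v \<partial>vD \<eta>)"
      by (rule nn_integral_bind[OF f])
  qed
  finally show ?thesis .
qed

lemma sets_gibbs[simp]: "\<eta> \<in> space (Rsp d) \<Longrightarrow> sets (Kg \<eta>) = sets (Rsp d)"
  using sets_kernel[OF gibbs_kernel_measurable] .

lemma prob_space_gibbs: assumes \<eta>: "\<eta> \<in> space (Rsp d)" shows "prob_space (Kg \<eta>)"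
proof (rule prob_spaceI)
  interpret T: prob_space "tauD \<eta>" by (rule prob_space_tauD)
  interpret V: prob_space "vD \<eta>" by (rule prob_space_vD)
  have "emeasure (Kg \<eta>) (space (Kg \<eta>)) = (\<integral>\<^sup>+ x. 1 \<partial>Kg \<eta>)" by simp
  also have "\<dots> = (\<integral>\<^sup>+ \<tau>. \<integral>\<^sup>+ v. \<integral>\<^sup>+ x. 1 \<partial>etaD \<tau> v \<partial>vD \<eta> \<partial>tauD \<eta>)" by (rule nn_integral_gibbs[OF \<eta>]) simp
  also have "\<dots> = (\<integral>\<^sup>+ \<tau>. 1 \<partial>tauD \<eta>)"
  proof (rule nn_integral_cong_AE)
    show "AE \<tau> in tauD \<eta>. (\<integral>\<^sup>+ v. \<integral>\<^sup>+ x. 1 \<partial>etaD \<tau> v \<partial>vD \<eta>) = 1"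
      using tauD_pos[OF \<eta>]
    proof eventually_elim
      case (elim \<tau>)
      have "(\<integral>\<^sup>+ x. 1 \<partial>etaD \<tau> v) = 1" for v
        using prob_space.emeasure_space_1[OF prob_space_eta_draw[OF elim, of v]] by simp
      then show ?case by (simp add: V.emeasure_space_1[simplified])
    qed
  qed
  also have "\<dots> = 1" by (simp add: T.emeasure_space_1[simplified])
  finally show "emeasure (Kg \<eta>) (space (Kg \<eta>)) = 1" .
qed

end

section \<open>Joint density and invariance of the posterior\<close>

lemma ennreal_mult_divide_cancel: "Z \<noteq> 0 \<Longrightarrow> Z \<noteq> \<infinity> \<Longrightarrow> Z * (x / Z) = (x :: ennreal)"
  by (metis ennreal_times_divide infinity_ennreal_def mult.commute mult_divide_eq_ennreal)

lemma prod_less_top_ennreal: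
  fixes f :: "'a \<Rightarrow> ennreal"
  assumes "finite A" "\<And>i. i \<in> A \<Longrightarrow> f i < \<infinity>"
  shows "(\<Prod>i\<in>A. f i) < \<infinity>"
  using assms by (induction A rule: finite_induct) (auto simp: ennreal_mult_less_top)

lemma gaw_shift: "gaw sh (\<beta> + u) t = gaw sh \<beta> t * exp (- (t * u))"
  by (simp add: gaw_def exp_add[symmetric] algebra_simps)

text \<open>Rate 0 is included; there the integral may be infinite, but comparison with rate
  \<open>\<rho> + 1\<close> still shows that it is positive.\<close>

lemma gaw_integral_nz':
  assumes "0 < sh" "0 \<le> \<rho>"
  shows "(\<integral>\<^sup>+ t. ennreal (gaw sh \<rho> t) \<partial>lborel) \<noteq> 0"
proof -
  have "(\<integral>\<^sup>+ t. ennreal (gaw sh (\<rho> + 1) t) \<partial>lborel) \<le> (\<integral>\<^sup>+ t. ennreal (gaw sh \<rho> t) \<partial>lborel)"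
    by (intro nn_integral_mono ennreal_leI) (auto simp: gaw_def indicator_def algebra_simps intro!: mult_left_mono)
  moreover have "(\<integral>\<^sup>+ t. ennreal (gaw sh (\<rho> + 1) t) \<partial>lborel) \<noteq> 0" using assms by (intro gaw_integral_nz) auto
  ultimately show ?thesis by auto
qed

context probit_gibbs
begin

abbreviation c2 :: "nat \<Rightarrow> real" where "c2 j \<equiv> (2 * pi) powr (- (real (qs j) / 2))"

text \<open>Exhibits the posterior weight as a product of the normalisers of the truncated normal
  and Gamma draws, up to constants, so that they cancel against the conditional densities.\<close>

lemma post_eq:
  "post \<eta> = (\<Prod>i<n. ennreal (1 / sqrt (2 * pi)) * (\<integral>\<^sup>+ v. ennreal (tnw (lp i \<eta>) (y i) v) \<partial>lborel)) *
     (\<Prod>j<r. ennreal (c2 j) * (\<integral>\<^sup>+ t. ennreal (gaw (al j) (b j + us \<eta> j / 2) t) \<partial>lborel))"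
proof -
  have 1: "ennreal (\<Prod>i<n. let pr = Phi (\<Sum>c<p + qtot r qs. Wmat p r qs X lev i c * \<eta> c) in if y i then pr else 1 - pr)
     = (\<Prod>i<n. ennreal (1 / sqrt (2 * pi)) * (\<integral>\<^sup>+ v. ennreal (tnw (lp i \<eta>) (y i) v) \<partial>lborel))"
    unfolding d_def[symmetric] lp_def[symmetric] Let_def Phi_half(2)[symmetric]
    by (rule prod_ennreal[symmetric]) (rule Phi_half(1))
  have 2: "(\<integral>\<^sup>+ t. ennreal (indicator {0<..} t * ((t / (2 * pi)) powr (real (qs j) / 2) * exp (- t * us \<eta> j / 2)) *
          (t powr (a j - 1) * exp (- b j * t))) \<partial>lborel) = ennreal (c2 j) * (\<integral>\<^sup>+ t. ennreal (gaw (al j) (b j + us \<eta> j / 2) t) \<partial>lborel)" for j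
  proof -
    have "indicator {0<..} t * ((t / (2 * pi)) powr (real (qs j) / 2) * exp (- t * us \<eta> j / 2)) * (t powr (a j - 1) * exp (- b j * t))
       = c2 j * gaw (al j) (b j + us \<eta> j / 2) t" for t :: real
    proof (cases "0 < t")
      case True
      have e: "exp (- t * us \<eta> j / 2) * exp (- b j * t) = exp (- (b j + us \<eta> j / 2) * t)"
        by (simp add: exp_add[symmetric] algebra_simps)
      have p1: "(t / (2 * pi)) powr (real (qs j) / 2) = c2 j * t powr (real (qs j) / 2)"
        using True by (simp add: powr_divide powr_minus field_simps)
      have p2: "t powr (real (qs j) / 2) * t powr (a j - 1) = t powr (al j - 1)"
        by (simp add: powr_add[symmetric] al_def algebra_simps)
      have "indicator {0<..} t * ((t / (2 * pi)) powr (real (qs j) / 2) * exp (- t * us \<eta> j / 2)) * (t powr (a j - 1) * exp (- b j * t))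
        = c2 j * (t powr (real (qs j) / 2) * t powr (a j - 1)) * (exp (- t * us \<eta> j / 2) * exp (- b j * t))"
        unfolding p1 using True by (simp add: mult_ac)
      also have "\<dots> = c2 j * gaw (al j) (b j + us \<eta> j / 2) t" unfolding p2 e using True by (simp add: gaw_def)
      finally show ?thesis .
    qed (simp add: gaw_def)
    then have "(\<integral>\<^sup>+ t. ennreal (indicator {0<..} t * ((t / (2 * pi)) powr (real (qs j) / 2) * exp (- t * us \<eta> j / 2)) *
          (t powr (a j - 1) * exp (- b j * t))) \<partial>lborel) = (\<integral>\<^sup>+ t. ennreal (c2 j) * ennreal (gaw (al j) (b j + us \<eta> j / 2) t) \<partial>lborel)"
      by (intro nn_integral_cong) (simp only: ennreal_mult powr_ge_zero gaw_nonneg)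
    then show ?thesis by (simp add: nn_integral_cmult)
  qed
  show ?thesis unfolding post_dens_def 1 2 ..
qed

lemma measurable_post[measurable]: "post \<in> borel_measurable (Rsp d)"
proof -
  have "(\<lambda>\<eta>. \<integral>\<^sup>+ v. ennreal (tnw (lp i \<eta>) (y i) v) \<partial>lborel) \<in> borel_measurable (Rsp d)" for i by measurable
  moreover have "(\<lambda>\<eta>. \<integral>\<^sup>+ t. ennreal (gaw (al j) (b j + us \<eta> j / 2) t) \<partial>lborel) \<in> borel_measurable (Rsp d)" if "j < r" for j
  proof -
    have [measurable]: "(\<lambda>\<eta>. us \<eta> j) \<in> borel_measurable (Rsp d)" by (rule measurable_us[OF _ that]) simp
    show ?thesis by measurable
  qed
  ultimately show ?thesis unfolding post_eq
    by (intro borel_measurable_times_ennreal borel_measurable_prod_ennreal borel_measurable_const) auto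
qed

text \<open>The part of the joint density free of \<open>\<eta>\<close>: supports of the latent
  variables and prior of the precisions.\<close>

definition CW :: "(nat \<Rightarrow> real) \<Rightarrow> (nat \<Rightarrow> real) \<Rightarrow> real" where
  "CW \<tau> v = (\<Prod>i<n. 1 / sqrt (2 * pi) * indicator (halfline (y i)) (v i)) * (\<Prod>j<r. c2 j * gaw (al j) (b j) (\<tau> j))"

lemma CW_nonneg: "0 \<le> CW \<tau> v"
  unfolding CW_def by (intro mult_nonneg_nonneg prod_nonneg) (auto simp: gaw_nonneg)

lemma measurable_CW[measurable (raw)]:
  assumes f: "f \<in> measurable M (Rsp r)" and g: "g \<in> measurable M (Rsp n)"
  shows "(\<lambda>x. CW (f x) (g x)) \<in> borel_measurable M"
proof -
  have [measurable]: "\<And>j. j \<in> {..<r} \<Longrightarrow> (\<lambda>x. f x j) \<in> borel_measurable M" "\<And>i. i \<in> {..<n} \<Longrightarrow> (\<lambda>x. g x i) \<in> borel_measurable M"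
    using measurable_coord[OF f] measurable_coord[OF g] by auto
  have [measurable]: "\<And>i. halfline (y i) \<in> sets borel" by auto
  show ?thesis unfolding CW_def by measurable
qed

text \<open>The normalisers in \<open>post\<close> cancel those of the two conditional draws; the
  remaining exponentials in \<open>\<eta>\<close> collect to \<open>G\<close>. Positive rates
  exclude the states where the default rate replaces the true one.\<close>

lemma joint_density:
  assumes \<eta>: "\<forall>j<r. 0 < b j + us \<eta> j / 2"
  shows "post \<eta> * (ga \<eta> \<tau> * tv \<eta> v) = ennreal (CW \<tau> v) * ennreal (G \<tau> v \<eta>)"
proof -
  let ?s = "1 / sqrt (2 * pi)"
  have s0: "0 \<le> ?s" by simp
  let ?Zi = "\<lambda>i. \<integral>\<^sup>+ v. ennreal (tnw (lp i \<eta>) (y i) v) \<partial>lborel"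
  let ?Zj = "\<lambda>j. \<integral>\<^sup>+ t. ennreal (gaw (al j) (b j + us \<eta> j / 2) t) \<partial>lborel"
  have "post \<eta> * (ga \<eta> \<tau> * tv \<eta> v) = ((\<Prod>i<n. ennreal ?s * ?Zi i) * tv \<eta> v) * ((\<Prod>j<r. ennreal (c2 j) * ?Zj j) * ga \<eta> \<tau>)"
    unfolding post_eq by (simp only: mult_ac)
  also have "(\<Prod>i<n. ennreal ?s * ?Zi i) * tv \<eta> v = (\<Prod>i<n. ennreal (?s * tnw (lp i \<eta>) (y i) (v i)))"
    unfolding tv_def prod.distrib[symmetric]
  proof (rule prod.cong[OF refl])
    fix i
    have "ennreal ?s * ?Zi i * tnd (lp i \<eta>) (y i) (v i) = ennreal ?s * (?Zi i * (ennreal (tnw (lp i \<eta>) (y i) (v i)) / ?Zi i))"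
      unfolding tnd_def by (simp only: mult.assoc)
    also have "\<dots> = ennreal ?s * ennreal (tnw (lp i \<eta>) (y i) (v i))"
      by (subst ennreal_mult_divide_cancel) (rule tnw_integral refl)+
    finally show "ennreal ?s * ?Zi i * tnd (lp i \<eta>) (y i) (v i) = ennreal (?s * tnw (lp i \<eta>) (y i) (v i))"
      by (simp only: ennreal_mult[OF s0 tnw_nonneg])
  qed
  also have "(\<Prod>j<r. ennreal (c2 j) * ?Zj j) * ga \<eta> \<tau> = (\<Prod>j<r. ennreal (c2 j * gaw (al j) (b j + us \<eta> j / 2) (\<tau> j)))"
    unfolding ga_def prod.distrib[symmetric]
  proof (rule prod.cong[OF refl])
    fix j assume "j \<in> {..<r}" then have j: "j < r" by simp
    have rh: "rho \<eta> j = b j + us \<eta> j / 2" using \<eta> j by (simp add: rho_def erate_def)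
    have "ennreal (c2 j) * ?Zj j * gad (al j) (rho \<eta> j) (\<tau> j) = ennreal (c2 j) * (?Zj j * (ennreal (gaw (al j) (b j + us \<eta> j / 2) (\<tau> j)) / ?Zj j))"
      unfolding gad_def rh by (simp only: mult.assoc)
    also have "\<dots> = ennreal (c2 j) * ennreal (gaw (al j) (b j + us \<eta> j / 2) (\<tau> j))"
      using \<eta> j al_pos[OF j] by (subst ennreal_mult_divide_cancel[OF gaw_integral_nz]) auto
    finally show "ennreal (c2 j) * ?Zj j * gad (al j) (rho \<eta> j) (\<tau> j) = ennreal (c2 j * gaw (al j) (b j + us \<eta> j / 2) (\<tau> j))"
      by (simp only: ennreal_mult[OF powr_ge_zero gaw_nonneg])
  qed
  also have "(\<Prod>i<n. ennreal (?s * tnw (lp i \<eta>) (y i) (v i))) = ennreal (\<Prod>i<n. ?s * tnw (lp i \<eta>) (y i) (v i))"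
    by (rule prod_ennreal) (simp add: tnw_nonneg)
  also have "(\<Prod>j<r. ennreal (c2 j * gaw (al j) (b j + us \<eta> j / 2) (\<tau> j))) = ennreal (\<Prod>j<r. c2 j * gaw (al j) (b j + us \<eta> j / 2) (\<tau> j))"
    by (rule prod_ennreal) (simp add: gaw_nonneg)
  also have "(\<Prod>i<n. ?s * tnw (lp i \<eta>) (y i) (v i)) = (\<Prod>i<n. ?s * indicator (halfline (y i)) (v i)) * exp (- (1/2) * (\<Sum>i<n. (v i - lp i \<eta>)\<^sup>2))"
  proof -
    have "exp (- (1/2) * (\<Sum>i<n. (v i - lp i \<eta>)\<^sup>2)) = (\<Prod>i<n. exp (- ((v i - lp i \<eta>)\<^sup>2) / 2))"
      by (subst exp_sum[symmetric]) (auto simp: sum_distrib_left sum_negf sum_divide_distrib)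
    then show ?thesis by (simp only: prod.distrib[symmetric] tnw_def mult.assoc)
  qed
  also have "(\<Prod>j<r. c2 j * gaw (al j) (b j + us \<eta> j / 2) (\<tau> j)) = (\<Prod>j<r. c2 j * gaw (al j) (b j) (\<tau> j)) * exp (- (1/2) * (\<Sum>j<r. \<tau> j * us \<eta> j))"
  proof -
    have "exp (- (1/2) * (\<Sum>j<r. \<tau> j * us \<eta> j)) = (\<Prod>j<r. exp (- (\<tau> j * (us \<eta> j / 2))))"
      by (subst exp_sum[symmetric]) (auto simp: sum_distrib_left sum_negf sum_divide_distrib)
    then show ?thesis by (simp only: prod.distrib[symmetric] gaw_shift mult.assoc)
  qed
  also have "ennreal ((\<Prod>i<n. ?s * indicator (halfline (y i)) (v i)) * exp (- (1/2) * (\<Sum>i<n. (v i - lp i \<eta>)\<^sup>2))) *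
      ennreal ((\<Prod>j<r. c2 j * gaw (al j) (b j) (\<tau> j)) * exp (- (1/2) * (\<Sum>j<r. \<tau> j * us \<eta> j)))
    = ennreal (((\<Prod>i<n. ?s * indicator (halfline (y i)) (v i)) * exp (- (1/2) * (\<Sum>i<n. (v i - lp i \<eta>)\<^sup>2))) *
       ((\<Prod>j<r. c2 j * gaw (al j) (b j) (\<tau> j)) * exp (- (1/2) * (\<Sum>j<r. \<tau> j * us \<eta> j))))"
    by (rule ennreal_mult[symmetric]) (auto intro!: mult_nonneg_nonneg prod_nonneg simp: gaw_nonneg)
  also have "((\<Prod>i<n. ?s * indicator (halfline (y i)) (v i)) * exp (- (1/2) * (\<Sum>i<n. (v i - lp i \<eta>)\<^sup>2))) *
       ((\<Prod>j<r. c2 j * gaw (al j) (b j) (\<tau> j)) * exp (- (1/2) * (\<Sum>j<r. \<tau> j * us \<eta> j))) = CW \<tau> v * G \<tau> v \<eta>"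
    unfolding CW_def G_def diff_conv_add_uminus exp_add by (simp add: mult_ac)
  also have "ennreal (CW \<tau> v * G \<tau> v \<eta>) = ennreal (CW \<tau> v) * ennreal (G \<tau> v \<eta>)"
    by (rule ennreal_mult) (auto simp: CW_nonneg G_pos less_imp_le)
  finally show ?thesis .
qed

text \<open>For \<open>b j = 0\<close> the rate vanishes only if the whole block does, in particular
  its first coordinate, which is a null event.\<close>

lemma AE_rate_pos: "AE \<eta> in Rsp d. \<forall>j<r. 0 < b j + us \<eta> j / 2"
proof -
  have "AE \<eta> in Rsp d. \<forall>j\<in>{..<r}. 0 < b j + us \<eta> j / 2"
  proof (rule AE_finite_allI)
    fix j assume "j \<in> {..<r}" then have j: "j < r" by simp
    have q: "0 < qs j" using qs_pos j by simp
    show "AE \<eta> in Rsp d. 0 < b j + us \<eta> j / 2"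
    proof (cases "0 < b j")
      case True then show ?thesis using us_nonneg by (intro AE_I2) (simp add: add_pos_nonneg)
    next
      case False
      then have b: "b j = 0" using B1 j by auto
      show ?thesis using AE_Rsp_coord_nz[OF blk_less[OF j q]]
      proof eventually_elim
        case (elim \<eta>)
        have "0 < (\<eta> (blk j 0))\<^sup>2" using elim by simp
        also have "\<dots> \<le> us \<eta> j" unfolding us_def using q by (intro member_le_sum[of 0]) auto
        finally show ?case using b by simp
      qed
    qed
  qed simp
  then show ?thesis by eventually_elim auto
qed

abbreviation M2 :: "((nat \<Rightarrow> real) \<times> (nat \<Rightarrow> real)) measure" where "M2 \<equiv> Rsp r \<Otimes>\<^sub>M Rsp n"

lemma sigma_finite_M2: "sigma_finite_measure M2"
proof -
  interpret pair_sigma_finite "Rsp r" "Rsp n" by (simp add: pair_sigma_finite_def sigma_finite_Rsp)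
  show ?thesis by standard
qed

lemma M2_nested:
  assumes "f \<in> borel_measurable M2"
  shows "(\<integral>\<^sup>+ z. f z \<partial>M2) = (\<integral>\<^sup>+ \<tau>. \<integral>\<^sup>+ v. f (\<tau>, v) \<partial>Rsp n \<partial>Rsp r)"
proof -
  interpret sigma_finite_measure "Rsp n" by (rule sigma_finite_Rsp)
  show ?thesis by (rule nn_integral_fst[symmetric, OF assms])
qed

lemma nn_integral_gibbs_M2:
  assumes \<eta>: "\<eta> \<in> space (Rsp d)" and f[measurable]: "f \<in> borel_measurable (Rsp d)"
  shows "(\<integral>\<^sup>+ x. f x \<partial>Kg \<eta>) = (\<integral>\<^sup>+ z. (ga \<eta> (fst z) * tv \<eta> (snd z)) * (\<integral>\<^sup>+ x. ed (fst z) (snd z) x * f x \<partial>Rsp d) \<partial>M2)"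
proof -
  interpret D: sigma_finite_measure "Rsp d" by (rule sigma_finite_Rsp)
  interpret Nn: sigma_finite_measure "Rsp n" by (rule sigma_finite_Rsp)
  let ?I = "\<lambda>\<tau> v. \<integral>\<^sup>+ x. ed \<tau> v x * f x \<partial>Rsp d"
  have mI[measurable (raw)]: "(\<lambda>x. ?I (g x) (h x)) \<in> borel_measurable M" if [measurable]: "g \<in> measurable M (Rsp r)" "h \<in> measurable M (Rsp n)" for g h and M :: "'z measure"
    by (rule D.borel_measurable_nn_integral) measurable
  have mga[measurable]: "ga \<eta> \<in> borel_measurable (Rsp r)" and mtv[measurable]: "tv \<eta> \<in> borel_measurable (Rsp n)" by measurable
  have i3: "(\<integral>\<^sup>+ x. f x \<partial>etaD \<tau> v) = ?I \<tau> v" if "\<tau> \<in> space (Rsp r)" "v \<in> space (Rsp n)" for \<tau> v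
    unfolding eta_density using that by (intro nn_integral_density f measurable_ed[where f="\<lambda>_. \<tau>" and g="\<lambda>_. v"]) auto
  have mI2: "(\<lambda>v. ?I \<tau> v) \<in> borel_measurable (Rsp n)" if "\<tau> \<in> space (Rsp r)" for \<tau>
    using that by (intro mI) auto
  have mI1: "(\<lambda>\<tau>. \<integral>\<^sup>+ v. tv \<eta> v * ?I \<tau> v \<partial>Rsp n) \<in> borel_measurable (Rsp r)"
  proof (rule Nn.borel_measurable_nn_integral)
    have "(\<lambda>z. tv \<eta> (snd z) * ?I (fst z) (snd z)) \<in> borel_measurable (Rsp r \<Otimes>\<^sub>M Rsp n)"
      by (intro borel_measurable_times_ennreal measurable_compose[OF measurable_snd mtv] mI) auto
    then show "(\<lambda>(\<tau>, v). tv \<eta> v * ?I \<tau> v) \<in> borel_measurable (Rsp r \<Otimes>\<^sub>M Rsp n)" by (simp add: case_prod_beta')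
  qed
  have "(\<integral>\<^sup>+ x. f x \<partial>Kg \<eta>) = (\<integral>\<^sup>+ \<tau>. \<integral>\<^sup>+ v. ?I \<tau> v \<partial>vD \<eta> \<partial>tauD \<eta>)"
    unfolding nn_integral_gibbs[OF \<eta> f] by (intro nn_integral_cong) (simp add: i3)
  also have "\<dots> = (\<integral>\<^sup>+ \<tau>. \<integral>\<^sup>+ v. tv \<eta> v * ?I \<tau> v \<partial>Rsp n \<partial>tauD \<eta>)"
    unfolding v_density by (intro nn_integral_cong nn_integral_density mtv mI2) simp
  also have "\<dots> = (\<integral>\<^sup>+ \<tau>. ga \<eta> \<tau> * (\<integral>\<^sup>+ v. tv \<eta> v * ?I \<tau> v \<partial>Rsp n) \<partial>Rsp r)"
    unfolding tau_density by (intro nn_integral_density mga mI1)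
  also have "\<dots> = (\<integral>\<^sup>+ \<tau>. \<integral>\<^sup>+ v. (ga \<eta> \<tau> * tv \<eta> v) * ?I \<tau> v \<partial>Rsp n \<partial>Rsp r)"
    by (intro nn_integral_cong) (subst nn_integral_cmult[symmetric], auto intro!: borel_measurable_times_ennreal mtv mI2 simp: mult.assoc)
  also have "\<dots> = (\<integral>\<^sup>+ z. (ga \<eta> (fst z) * tv \<eta> (snd z)) * ?I (fst z) (snd z) \<partial>M2)"
    by (subst M2_nested) (auto intro!: borel_measurable_times_ennreal measurable_compose[OF measurable_snd mtv] measurable_compose[OF measurable_fst mga] mI)
  finally show ?thesis .
qed

lemma ga_tv_integral: "(\<integral>\<^sup>+ z. ga \<eta> (fst z) * tv \<eta> (snd z) \<partial>M2) = 1"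
proof -
  have "(\<integral>\<^sup>+ z. ga \<eta> (fst z) * tv \<eta> (snd z) \<partial>M2) = (\<integral>\<^sup>+ \<tau>. \<integral>\<^sup>+ v. ga \<eta> \<tau> * tv \<eta> v \<partial>Rsp n \<partial>Rsp r)"
    by (subst M2_nested) (auto intro!: borel_measurable_times_ennreal measurable_compose[OF measurable_snd measurable_tv1] measurable_compose[OF measurable_fst measurable_ga1])
  also have "\<dots> = (\<integral>\<^sup>+ \<tau>. ga \<eta> \<tau> * 1 \<partial>Rsp r)"
    unfolding tv_integral[of \<eta>, symmetric] by (intro nn_integral_cong nn_integral_cmult) measurable
  finally show ?thesis by (simp add: ga_integral)
qed

text \<open>Density of the stationary flow from \<open>\<eta>\<close> to \<open>x\<close>. As
  \<open>ed\<close> is \<open>G\<close> divided by a normaliser that does not involve the state, the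
  integrand is symmetric in the two states.\<close>

definition Wt :: "(nat \<Rightarrow> real) \<Rightarrow> (nat \<Rightarrow> real) \<Rightarrow> ennreal" where
  "Wt \<eta> x = (\<integral>\<^sup>+ z. (ennreal (CW (fst z) (snd z)) * ennreal (G (fst z) (snd z) \<eta>)) * ed (fst z) (snd z) x \<partial>M2)"

lemma Wt_sym: "Wt \<eta> x = Wt x \<eta>"
  unfolding Wt_def ed_def divide_ennreal_def by (intro nn_integral_cong) (simp only: mult_ac)

lemma measurable_Wt[measurable (raw)]:
  assumes [measurable]: "f \<in> measurable M (Rsp d)" "g \<in> measurable M (Rsp d)"
  shows "(\<lambda>x. Wt (f x) (g x)) \<in> borel_measurable M"
proof -
  interpret sigma_finite_measure M2 by (rule sigma_finite_M2)
  show ?thesis unfolding Wt_def by measurable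
qed

lemma post_gibbs:
  assumes \<eta>: "\<eta> \<in> space (Rsp d)" "\<forall>j<r. 0 < b j + us \<eta> j / 2" and f[measurable]: "f \<in> borel_measurable (Rsp d)"
  shows "post \<eta> * (\<integral>\<^sup>+ x. f x \<partial>Kg \<eta>) = (\<integral>\<^sup>+ x. Wt \<eta> x * f x \<partial>Rsp d)"
proof -
  interpret D: sigma_finite_measure "Rsp d" by (rule sigma_finite_Rsp)
  interpret M2: sigma_finite_measure M2 by (rule sigma_finite_M2)
  interpret P: pair_sigma_finite M2 "Rsp d" by standard
  have e[measurable]: "(\<lambda>_. \<eta>) \<in> measurable M (Rsp d)" for M :: "'z measure" using \<eta>(1) by simp
  let ?c = "\<lambda>z. ennreal (CW (fst z) (snd z)) * ennreal (G (fst z) (snd z) \<eta>)"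
  have [measurable]: "?c \<in> borel_measurable M2" by measurable
  have mI: "(\<lambda>z. \<integral>\<^sup>+ x. ed (fst z) (snd z) x * f x \<partial>Rsp d) \<in> borel_measurable M2" by measurable
  have "post \<eta> * (\<integral>\<^sup>+ x. f x \<partial>Kg \<eta>) = (\<integral>\<^sup>+ z. post \<eta> * ((ga \<eta> (fst z) * tv \<eta> (snd z)) * (\<integral>\<^sup>+ x. ed (fst z) (snd z) x * f x \<partial>Rsp d)) \<partial>M2)"
    unfolding nn_integral_gibbs_M2[OF \<eta>(1) f] by (rule nn_integral_cmult[symmetric]) measurable
  also have "\<dots> = (\<integral>\<^sup>+ z. ?c z * (\<integral>\<^sup>+ x. ed (fst z) (snd z) x * f x \<partial>Rsp d) \<partial>M2)"
    using joint_density[OF \<eta>(2)] by (simp add: mult.assoc[symmetric])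
  also have "\<dots> = (\<integral>\<^sup>+ z. (\<integral>\<^sup>+ x. ?c z * (ed (fst z) (snd z) x * f x) \<partial>Rsp d) \<partial>M2)"
    by (intro nn_integral_cong nn_integral_cmult[symmetric]) (auto intro!: borel_measurable_times_ennreal f measurable_ed simp: space_pair_measure)
  also have "\<dots> = (\<integral>\<^sup>+ x. (\<integral>\<^sup>+ z. ?c z * (ed (fst z) (snd z) x * f x) \<partial>M2) \<partial>Rsp d)"
    by (rule P.Fubini'[symmetric]) measurable
  also have "\<dots> = (\<integral>\<^sup>+ x. Wt \<eta> x * f x \<partial>Rsp d)"
  proof (rule nn_integral_cong)
    fix x assume x: "x \<in> space (Rsp d)"
    then have [measurable]: "(\<lambda>_. x) \<in> measurable M2 (Rsp d)" by simp
    have "(\<integral>\<^sup>+ z. ?c z * (ed (fst z) (snd z) x * f x) \<partial>M2) = (\<integral>\<^sup>+ z. (?c z * ed (fst z) (snd z) x) * f x \<partial>M2)" by (simp only: mult.assoc)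
    also have "\<dots> = Wt \<eta> x * f x" unfolding Wt_def by (rule nn_integral_multc) measurable
    finally show "(\<integral>\<^sup>+ z. ?c z * (ed (fst z) (snd z) x * f x) \<partial>M2) = Wt \<eta> x * f x" .
  qed
  finally show ?thesis .
qed

text \<open>Detailed balance through the symmetry of \<open>Wt\<close>: after Fubini, the inner
  integral is the total flow out of \<open>x\<close>, and the kernel has mass 1. Almost everywhere
  statements suffice since \<open>post\<close> is a density.\<close>

lemma post_invariant:
  assumes f[measurable]: "f \<in> borel_measurable (Rsp d)"
  shows "(\<integral>\<^sup>+ \<eta>. post \<eta> * (\<integral>\<^sup>+ x. f x \<partial>Kg \<eta>) \<partial>Rsp d) = (\<integral>\<^sup>+ \<eta>. post \<eta> * f \<eta> \<partial>Rsp d)"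
proof -
  interpret D: sigma_finite_measure "Rsp d" by (rule sigma_finite_Rsp)
  interpret P: pair_sigma_finite "Rsp d" "Rsp d" by standard
  have "(\<integral>\<^sup>+ \<eta>. post \<eta> * (\<integral>\<^sup>+ x. f x \<partial>Kg \<eta>) \<partial>Rsp d) = (\<integral>\<^sup>+ \<eta>. (\<integral>\<^sup>+ x. Wt \<eta> x * f x \<partial>Rsp d) \<partial>Rsp d)"
    by (rule nn_integral_cong_AE) (use AE_rate_pos AE_space in \<open>eventually_elim, auto intro: post_gibbs\<close>)
  also have "\<dots> = (\<integral>\<^sup>+ x. (\<integral>\<^sup>+ \<eta>. Wt \<eta> x * f x \<partial>Rsp d) \<partial>Rsp d)"
    by (rule P.Fubini'[symmetric]) measurable
  also have "\<dots> = (\<integral>\<^sup>+ x. post x * f x \<partial>Rsp d)"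
  proof (rule nn_integral_cong_AE)
    show "AE x in Rsp d. (\<integral>\<^sup>+ \<eta>. Wt \<eta> x * f x \<partial>Rsp d) = post x * f x"
      using AE_rate_pos AE_space
    proof eventually_elim
      case (elim x)
      then have [measurable]: "(\<lambda>_. x) \<in> measurable (Rsp d) (Rsp d)" by simp
      have "(\<integral>\<^sup>+ \<eta>. Wt \<eta> x * f x \<partial>Rsp d) = (\<integral>\<^sup>+ \<eta>. Wt x \<eta> * 1 \<partial>Rsp d) * f x"
        by (subst nn_integral_multc) (measurable, simp add: Wt_sym[of x])
      also have "(\<integral>\<^sup>+ \<eta>. Wt x \<eta> * 1 \<partial>Rsp d) = post x * (\<integral>\<^sup>+ \<eta>. 1 \<partial>Kg x)"
        by (rule post_gibbs[symmetric]) (use elim in auto)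
      also have "(\<integral>\<^sup>+ \<eta>. 1 \<partial>Kg x) = 1" using prob_space.emeasure_space_1[OF prob_space_gibbs[OF elim(2)]] by simp
      finally show ?case by simp
    qed
  qed
  finally show ?thesis .
qed

end

section \<open>Propriety of the posterior\<close>

context probit_gibbs
begin

definition \<delta>1 :: real where "\<delta>1 = 1 / (4 * (2 / \<delta>0 + 2))"

lemma \<delta>1: "0 < \<delta>1" using \<delta>0(1) by (simp add: \<delta>1_def add_pos_pos)

text \<open>Half of the residual norm is divided equally. One quarter pays for \<open>v\<close> by
  the orthant gap, the other for the linear predictors, whose norm is at most
  \<open>2 / \<delta>0 + 2\<close> times the residual; this is the origin of
  \<open>\<delta>1\<close>.\<close>

lemma residual_split:
  assumes v: "vsup v"
  shows "\<delta>0 / 4 * (\<Sum>i<n. (v i)\<^sup>2) + \<delta>1 * (\<Sum>i<n. (lp i \<eta>)\<^sup>2) \<le> (1/2) * (\<Sum>i<n. (v i - lp i \<eta>)\<^sup>2)"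
proof -
  let ?V = "\<Sum>i<n. (v i)\<^sup>2" and ?L = "\<Sum>i<n. (lp i \<eta>)\<^sup>2" and ?E = "\<Sum>i<n. (v i - lp i \<eta>)\<^sup>2"
  have 1: "\<delta>0 * ?V \<le> ?E" by (rule \<delta>0(3)[OF v])
  have "?L \<le> (\<Sum>i<n. 2 * (v i)\<^sup>2 + 2 * (v i - lp i \<eta>)\<^sup>2)"
  proof (rule sum_mono)
    fix i
    have "0 \<le> (2 * v i - lp i \<eta>)\<^sup>2" by simp
    then show "(lp i \<eta>)\<^sup>2 \<le> 2 * (v i)\<^sup>2 + 2 * (v i - lp i \<eta>)\<^sup>2" by (simp add: power2_eq_square algebra_simps)
  qed
  also have "\<dots> = 2 * ?V + 2 * ?E" by (simp add: sum.distrib sum_distrib_left)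
  also have "?V \<le> ?E / \<delta>0" using 1 \<delta>0(1) by (simp add: pos_le_divide_eq mult.commute)
  finally have "?L \<le> (2 / \<delta>0 + 2) * ?E" by (simp add: algebra_simps)
  moreover have k: "0 < 2 / \<delta>0 + 2" using \<delta>0(1) by (simp add: add_pos_pos)
  ultimately have "?L / (2 / \<delta>0 + 2) \<le> ?E" by (simp add: pos_divide_le_eq mult.commute)
  moreover have gen: "1 / (4 * k) * l = l / k / 4" for k l :: real by simp
  ultimately have "\<delta>1 * ?L \<le> ?E / 4" unfolding \<delta>1_def gen by (intro divide_right_mono) auto
  then show ?thesis using 1 by simp
qed

lemma NG_bound:
  "\<exists>C\<ge>0. \<forall>\<tau> v. (\<forall>j<r. 0 < \<tau> j) \<longrightarrow> vsup v \<longrightarrow> NG \<tau> v \<le> ennreal (exp (- (\<delta>0 / 4) * (\<Sum>i<n. (v i)\<^sup>2))) * ennreal (C * prof \<tau>)"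
proof -
  obtain C where C: "C \<ge> 0" "\<And>\<tau>. (\<forall>j<r. 0 < \<tau> j) \<Longrightarrow>
    (\<integral>\<^sup>+ \<eta>. ennreal (exp (- \<delta>1 * (\<Sum>i<n. (lp i \<eta>)\<^sup>2) - (1/2) * (\<Sum>j<r. \<tau> j * us \<eta> j))) \<partial>Rsp d) \<le> ennreal (C * prof \<tau>)"
    using gauss_bound[OF \<delta>1] by blast
  have "NG \<tau> v \<le> ennreal (exp (- (\<delta>0 / 4) * (\<Sum>i<n. (v i)\<^sup>2))) * ennreal (C * prof \<tau>)" if \<tau>: "\<forall>j<r. 0 < \<tau> j" and v: "vsup v" for \<tau> v
  proof -
    let ?f = "\<lambda>\<eta>. exp (- \<delta>1 * (\<Sum>i<n. (lp i \<eta>)\<^sup>2) - (1/2) * (\<Sum>j<r. \<tau> j * us \<eta> j))"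
    let ?e = "exp (- (\<delta>0 / 4) * (\<Sum>i<n. (v i)\<^sup>2))"
    have [measurable]: "\<And>j. j \<in> {..<r} \<Longrightarrow> (\<lambda>x. us x j) \<in> borel_measurable (Rsp d)" by (rule measurable_us) auto
    have "NG \<tau> v \<le> (\<integral>\<^sup>+ \<eta>. ennreal ?e * ennreal (?f \<eta>) \<partial>Rsp d)"
    proof (rule nn_integral_mono)
      fix \<eta>
      have "G \<tau> v \<eta> \<le> exp (- (\<delta>0 / 4) * (\<Sum>i<n. (v i)\<^sup>2) + (- \<delta>1 * (\<Sum>i<n. (lp i \<eta>)\<^sup>2) - (1/2) * (\<Sum>j<r. \<tau> j * us \<eta> j)))"
        unfolding G_def using residual_split[OF v, of \<eta>] by simp
      then show "ennreal (G \<tau> v \<eta>) \<le> ennreal ?e * ennreal (?f \<eta>)"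
        unfolding exp_add by (simp add: ennreal_mult[symmetric] ennreal_leI)
    qed
    also have "\<dots> = ennreal ?e * (\<integral>\<^sup>+ \<eta>. ennreal (?f \<eta>) \<partial>Rsp d)" by (rule nn_integral_cmult) measurable
    also have "\<dots> \<le> ennreal ?e * ennreal (C * prof \<tau>)" by (intro mult_left_mono C \<tau>) simp
    finally show ?thesis .
  qed
  then show ?thesis using C(1) by blast
qed

text \<open>One-dimensional factor of the \<open>\<tau>\<close> integral: prior times the
  contribution of block \<open>j\<close> to \<open>prof\<close>.\<close>

definition hB :: "nat \<Rightarrow> real \<Rightarrow> real" where
  "hB j t = c2 j * gaw (al j) (b j) t * (t powr (- (1/2)) * (1 + t) powr (- (real (qs j) - 1) / 2))"

text \<open>Near 0 the integrand behaves like \<open>t powr (al j - 3/2)\<close>, integrable by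
  (B2); at infinity either the exponential with \<open>b j > 0\<close> helps or the power, which
  decays fast enough because \<open>a j < 0\<close>.\<close>

lemma hB_integral: assumes j: "j < r" shows "(\<integral>\<^sup>+ t. ennreal (hB j t) \<partial>lborel) < \<infinity>"
proof -
  have s: "0 < al j - 1/2" using al_gt[OF j] by simp
  have g: "gaw (al j) (b j) t * t powr (- (1/2)) = gaw (al j - 1/2) (b j) t" for t
    by (cases "0 < t") (auto simp: gaw_def powr_add[symmetric] algebra_simps)
  have eq: "hB j t = c2 j * (gaw (al j - 1/2) (b j) t * (1 + t) powr (- (real (qs j) - 1) / 2))" for t
    unfolding hB_def g[symmetric] by (simp only: mult_ac)
  show ?thesis
  proof (cases "0 < b j")
    case True
    have q: "0 \<le> (real (qs j) - 1) / 2" using qs_pos j by (simp add: Suc_le_eq[symmetric])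
    have "hB j t \<le> c2 j * gaw (al j - 1/2) (b j) t" for t
    proof (cases "0 < t")
      case True
      have "(1 + t) powr (- (real (qs j) - 1) / 2) \<le> (1 + t) powr 0" using True q by (intro powr_mono) auto
      then have "(1 + t) powr (- (real (qs j) - 1) / 2) \<le> 1" using True by simp
      then show ?thesis unfolding eq by (intro mult_left_mono mult_left_le) (auto simp: gaw_nonneg)
    qed (simp add: eq gaw_def)
    then have "(\<integral>\<^sup>+ t. ennreal (hB j t) \<partial>lborel) \<le> (\<integral>\<^sup>+ t. ennreal (c2 j) * ennreal (gaw (al j - 1/2) (b j) t) \<partial>lborel)"
      by (intro nn_integral_mono) (simp only: ennreal_mult[OF powr_ge_zero gaw_nonneg, symmetric] ennreal_leI)
    also have "\<dots> = ennreal (c2 j) * ennreal (Gamma (al j - 1/2) * b j powr (- (al j - 1/2)))"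
      by (subst nn_integral_cmult) (use gaw_integral[OF s True] in auto)
    also have "\<dots> < \<infinity>" by (simp add: ennreal_mult_less_top)
    finally show ?thesis .
  next
    \<comment> \<open>Without an exponential the integral is a beta-prime integral; its convergence
      condition \<open>al j - 1/2 < ?h\<close> is exactly \<open>a j < 0\<close>.\<close>
    case False
    then have b: "b j = 0" "a j < 0" "2 \<le> qs j" using B1 j by auto
    let ?h = "(real (qs j) - 1) / 2"
    have hh: "al j - 1/2 < ?h" using b by (simp add: al_def field_simps)
    have "hB j t = c2 j * (indicator {0<..} t * t powr (al j - 1/2 - 1) * (1 + t / 1) powr (- ?h))" for t
    proof -
      have eqh: "- (real (qs j) - 1) / 2 = - ?h" by (rule minus_divide_left[symmetric])
      show ?thesis unfolding eq b(1) gaw_def eqh by simp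
    qed
    then have "(\<integral>\<^sup>+ t. ennreal (hB j t) \<partial>lborel) = (\<integral>\<^sup>+ t. ennreal (c2 j) * ennreal (indicator {0<..} t * t powr (al j - 1/2 - 1) * (1 + t / 1) powr (- ?h)) \<partial>lborel)"
      by (intro nn_integral_cong) (simp add: ennreal_mult)
    also have "\<dots> = ennreal (c2 j) * (\<integral>\<^sup>+ t. ennreal (indicator {0<..} t * t powr (al j - 1/2 - 1) * (1 + t / 1) powr (- ?h)) \<partial>lborel)"
      by (rule nn_integral_cmult) measurable
    also have "\<dots> < \<infinity>" unfolding nn_integral_beta_prime[OF s hh zero_less_one] by (simp add: ennreal_mult_less_top)
    finally show ?thesis .
  qed
qed

lemma CW_zero:
  "\<not> vsup v \<Longrightarrow> CW \<tau> v = 0" "\<not> (\<forall>j<r. 0 < \<tau> j) \<Longrightarrow> CW \<tau> v = 0"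
proof -
  assume "\<not> vsup v"
  then obtain i where "i < n" "v i \<notin> halfline (y i)" by (auto simp: vsup_def)
  then have "(\<Prod>i<n. 1 / sqrt (2 * pi) * indicator (halfline (y i)) (v i) :: real) = 0" by (intro prod_zero bexI[of _ i]) auto
  then show "CW \<tau> v = 0" by (simp add: CW_def)
next
  assume "\<not> (\<forall>j<r. 0 < \<tau> j)"
  then obtain j where "j < r" "\<not> 0 < \<tau> j" by auto
  then have "(\<Prod>j<r. c2 j * gaw (al j) (b j) (\<tau> j)) = 0" by (intro prod_zero bexI[of _ j]) (auto simp: gaw_def)
  then show "CW \<tau> v = 0" by (simp add: CW_def)
qed

lemma post_integral_eq: "(\<integral>\<^sup>+ \<eta>. post \<eta> \<partial>Rsp d) = (\<integral>\<^sup>+ z. ennreal (CW (fst z) (snd z)) * NG (fst z) (snd z) \<partial>M2)"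
proof -
  interpret D: sigma_finite_measure "Rsp d" by (rule sigma_finite_Rsp)
  interpret M2: sigma_finite_measure M2 by (rule sigma_finite_M2)
  interpret P: pair_sigma_finite M2 "Rsp d" by standard
  have "(\<integral>\<^sup>+ \<eta>. post \<eta> \<partial>Rsp d) = (\<integral>\<^sup>+ \<eta>. (\<integral>\<^sup>+ z. ennreal (CW (fst z) (snd z)) * ennreal (G (fst z) (snd z) \<eta>) \<partial>M2) \<partial>Rsp d)"
  proof (rule nn_integral_cong_AE)
    show "AE \<eta> in Rsp d. post \<eta> = (\<integral>\<^sup>+ z. ennreal (CW (fst z) (snd z)) * ennreal (G (fst z) (snd z) \<eta>) \<partial>M2)"
      using AE_rate_pos
    proof eventually_elim
      case (elim \<eta>)
      have "post \<eta> = post \<eta> * (\<integral>\<^sup>+ z. ga \<eta> (fst z) * tv \<eta> (snd z) \<partial>M2)" by (simp add: ga_tv_integral)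
      also have "\<dots> = (\<integral>\<^sup>+ z. post \<eta> * (ga \<eta> (fst z) * tv \<eta> (snd z)) \<partial>M2)"
        by (rule nn_integral_cmult[symmetric]) (auto intro!: borel_measurable_times_ennreal measurable_compose[OF measurable_snd measurable_tv1] measurable_compose[OF measurable_fst measurable_ga1])
      finally show ?case by (simp only: joint_density[OF elim])
    qed
  qed
  also have "\<dots> = (\<integral>\<^sup>+ z. (\<integral>\<^sup>+ \<eta>. ennreal (CW (fst z) (snd z)) * ennreal (G (fst z) (snd z) \<eta>) \<partial>Rsp d) \<partial>M2)"
    by (rule P.Fubini') measurable
  also have "\<dots> = (\<integral>\<^sup>+ z. ennreal (CW (fst z) (snd z)) * NG (fst z) (snd z) \<partial>M2)"
    by (intro nn_integral_cong nn_integral_cmult) measurable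
  finally show ?thesis .
qed

text \<open>With \<open>\<eta>\<close> integrated out first, the bound on \<open>NG\<close>
  separates the variables, so a product of finite one-dimensional integrals in \<open>\<tau>\<close>
  and \<open>v\<close> remains.\<close>

lemma post_finite: "(\<integral>\<^sup>+ \<eta>. post \<eta> \<partial>Rsp d) \<noteq> \<infinity>"
proof -
  obtain C where C: "C \<ge> 0" "\<And>\<tau> v. (\<forall>j<r. 0 < \<tau> j) \<Longrightarrow> vsup v \<Longrightarrow> NG \<tau> v \<le> ennreal (exp (- (\<delta>0 / 4) * (\<Sum>i<n. (v i)\<^sup>2))) * ennreal (C * prof \<tau>)"
    using NG_bound by blast
  let ?A = "\<lambda>v. \<Prod>i<n. ennreal (exp (- (\<delta>0 / 4) * (v i)\<^sup>2))"
  let ?B = "\<lambda>\<tau>. \<Prod>j<r. ennreal (hB j (\<tau> j))"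
  have hBn: "0 \<le> hB j t" for j t unfolding hB_def by (simp add: gaw_nonneg)
  have hBm[measurable]: "hB j \<in> borel_measurable borel" for j unfolding hB_def[abs_def] by measurable
  have mA: "?A \<in> borel_measurable (Rsp n)" unfolding Rsp_def by measurable
  have mB: "?B \<in> borel_measurable (Rsp r)" unfolding Rsp_def by measurable
  have mBA: "(\<lambda>z. ?B (fst z) * ?A (snd z)) \<in> borel_measurable M2"
    by (intro borel_measurable_times_ennreal measurable_compose[OF measurable_fst mB] measurable_compose[OF measurable_snd mA])
  have pt: "ennreal (CW \<tau> v) * NG \<tau> v \<le> ennreal C * (?B \<tau> * ?A v)" for \<tau> v
  proof (cases "(\<forall>j<r. 0 < \<tau> j) \<and> vsup v")
    case True
    let ?e = "exp (- (\<delta>0 / 4) * (\<Sum>i<n. (v i)\<^sup>2))"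
    have pr: "0 \<le> prof \<tau>" unfolding prof_def by (intro prod_nonneg) auto
    have "ennreal (CW \<tau> v) * NG \<tau> v \<le> ennreal (CW \<tau> v) * (ennreal ?e * ennreal (C * prof \<tau>))"
      using True by (intro mult_left_mono C(2)) auto
    also have "\<dots> = ennreal (CW \<tau> v * (?e * (C * prof \<tau>)))"
      using CW_nonneg C(1) pr by (simp add: ennreal_mult)
    also have "\<dots> \<le> ennreal (C * ((\<Prod>j<r. hB j (\<tau> j)) * ?e))"
    proof (rule ennreal_leI)
      have ind: "(\<Prod>i<n. 1 / sqrt (2 * pi) * indicator (halfline (y i)) (v i)) \<le> (\<Prod>i<n. 1 :: real)"
      proof (intro prod_mono conjI)
        have "(1::real) \<le> sqrt (2 * pi)" using pi_gt3 by (intro real_le_rsqrt) auto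
        then show "1 / sqrt (2 * pi) * indicator (halfline (y i)) (v i) \<le> (1::real)" for i
          by (auto simp: indicator_def divide_le_eq_1)
      qed auto
      have "CW \<tau> v \<le> (\<Prod>j<r. c2 j * gaw (al j) (b j) (\<tau> j))"
        unfolding CW_def using ind by (intro mult_left_le_one_le) (auto intro!: prod_nonneg simp: gaw_nonneg)
      then have "CW \<tau> v * (?e * (C * prof \<tau>)) \<le> (\<Prod>j<r. c2 j * gaw (al j) (b j) (\<tau> j)) * (?e * (C * prof \<tau>))"
        using C(1) pr by (intro mult_right_mono) auto
      also have "\<dots> = C * (((\<Prod>j<r. c2 j * gaw (al j) (b j) (\<tau> j)) * prof \<tau>) * ?e)" by (simp only: mult_ac)
      also have "(\<Prod>j<r. c2 j * gaw (al j) (b j) (\<tau> j)) * prof \<tau> = (\<Prod>j<r. hB j (\<tau> j))"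
        unfolding prof_def hB_def prod.distrib[symmetric] ..
      finally show "CW \<tau> v * (?e * (C * prof \<tau>)) \<le> C * ((\<Prod>j<r. hB j (\<tau> j)) * ?e)" .
    qed
    also have "\<dots> = ennreal C * (ennreal (\<Prod>j<r. hB j (\<tau> j)) * ennreal ?e)"
      using C(1) hBn by (simp add: ennreal_mult prod_nonneg)
    also have "ennreal (\<Prod>j<r. hB j (\<tau> j)) = ?B \<tau>" by (rule prod_ennreal[symmetric]) (rule hBn)
    also have "ennreal ?e = ?A v" by (simp add: prod_ennreal exp_sum[symmetric] sum_distrib_left)
    finally show ?thesis .
  next
    case False
    then have "CW \<tau> v = 0" using CW_zero by blast
    then show ?thesis by simp
  qed
  have "(\<integral>\<^sup>+ \<eta>. post \<eta> \<partial>Rsp d) \<le> (\<integral>\<^sup>+ z. ennreal C * (?B (fst z) * ?A (snd z)) \<partial>M2)"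
    unfolding post_integral_eq by (intro nn_integral_mono pt)
  also have "\<dots> = ennreal C * (\<integral>\<^sup>+ z. ?B (fst z) * ?A (snd z) \<partial>M2)"
    by (rule nn_integral_cmult[OF mBA])
  also have "(\<integral>\<^sup>+ z. ?B (fst z) * ?A (snd z) \<partial>M2) = (\<integral>\<^sup>+ \<tau>. \<integral>\<^sup>+ v. ?B \<tau> * ?A v \<partial>Rsp n \<partial>Rsp r)"
    by (rule trans[OF M2_nested[OF mBA]]) (simp only: fst_conv snd_conv)
  also have "\<dots> = (\<integral>\<^sup>+ \<tau>. ?B \<tau> * (\<integral>\<^sup>+ v. ?A v \<partial>Rsp n) \<partial>Rsp r)"
    by (intro nn_integral_cong nn_integral_cmult mA)
  also have "\<dots> = (\<integral>\<^sup>+ \<tau>. ?B \<tau> \<partial>Rsp r) * (\<integral>\<^sup>+ v. ?A v \<partial>Rsp n)" by (rule nn_integral_multc[OF mB])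
  also have "(\<integral>\<^sup>+ \<tau>. ?B \<tau> \<partial>Rsp r) = (\<Prod>j<r. \<integral>\<^sup>+ t. ennreal (hB j t) \<partial>lborel)"
    unfolding Rsp_def by (rule lb.product_nn_integral_prod) auto
  also have "(\<integral>\<^sup>+ v. ?A v \<partial>Rsp n) = (\<Prod>i<n. \<integral>\<^sup>+ t. ennreal (exp (- (\<delta>0 / 4) * t\<^sup>2)) \<partial>lborel)"
    unfolding Rsp_def by (rule lb.product_nn_integral_prod) auto
  also have "\<dots> = (\<Prod>i<n. ennreal (sqrt (pi / (\<delta>0 / 4))))"
    using nn_integral_gauss[of "\<delta>0 / 4"] \<delta>0(1) by simp
  also have "ennreal C * ((\<Prod>j<r. \<integral>\<^sup>+ t. ennreal (hB j t) \<partial>lborel) * (\<Prod>i<n. ennreal (sqrt (pi / (\<delta>0 / 4))))) < \<infinity>"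
  proof -
    have "(\<Prod>j<r. \<integral>\<^sup>+ t. ennreal (hB j t) \<partial>lborel) < \<infinity>" by (rule prod_less_top_ennreal) (auto intro: hB_integral[simplified])
    moreover have "(\<Prod>i<n. ennreal (sqrt (pi / (\<delta>0 / 4)))) < \<infinity>" by (rule prod_less_top_ennreal) auto
    ultimately show ?thesis by (simp add: ennreal_mult_less_top)
  qed
  finally show ?thesis by simp
qed

lemma post_nonzero: "(\<integral>\<^sup>+ \<eta>. post \<eta> \<partial>Rsp d) \<noteq> 0"
proof (rule Rsp_integral_pos)
  fix \<eta>
  have "b j + us \<eta> j / 2 \<ge> 0" if "j < r" for j using B1 that us_nonneg[of \<eta> j] by (auto intro: add_nonneg_nonneg)
  then have "ennreal (c2 j) * (\<integral>\<^sup>+ t. ennreal (gaw (al j) (b j + us \<eta> j / 2) t) \<partial>lborel) \<noteq> 0" if "j < r" for j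
    using that gaw_integral_nz'[OF al_pos[OF that], of "b j + us \<eta> j / 2"] by (simp add: ennreal_eq_0_iff not_le)
  moreover have "ennreal (1 / sqrt (2 * pi)) * (\<integral>\<^sup>+ v. ennreal (tnw (lp i \<eta>) (y i) v) \<partial>lborel) \<noteq> 0" for i
    using tnw_integral(3)[of "lp i \<eta>" "y i"] by (simp add: ennreal_eq_0_iff not_le)
  ultimately have "post \<eta> \<noteq> 0" unfolding post_eq by (auto simp: prod_zero_iff)
  then show "0 < post \<eta>" by (simp add: zero_less_iff_neq_zero)
qed measurable

abbreviation "PO \<equiv> posterior n p r qs X lev y a b"

lemma PO_eq: "PO = normdens (Rsp d) post"
  by (simp add: posterior_def d_def)

lemma prob_space_PO: "prob_space PO"
  unfolding PO_eq by (rule prob_space_normdens[OF _ post_nonzero post_finite]) measurable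

lemma PO_invariant: "PO \<bind> Kg = PO"
proof (rule measure_eqI)
  have sP: "sets PO = sets (Rsp d)" by (simp add: PO_eq)
  have spP: "space PO = space (Rsp d)" by (simp add: PO_eq)
  have m: "Kg \<in> measurable PO (subprob_algebra (Rsp d))" using gibbs_kernel_measurable sP by (simp cong: measurable_cong_sets)
  have sets: "sets (PO \<bind> Kg) = sets (Rsp d)" by (rule sets_bind) (auto simp: spP space_Rsp_ne)
  show "sets (PO \<bind> Kg) = sets PO" using sets sP by simp
  fix A assume "A \<in> sets (PO \<bind> Kg)"
  then have A[measurable]: "A \<in> sets (Rsp d)" using sets by simp
  have mK[measurable]: "(\<lambda>\<eta>. \<integral>\<^sup>+ x. indicator A x \<partial>Kg \<eta>) \<in> borel_measurable (Rsp d)"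
    by (rule measurable_compose[OF gibbs_kernel_measurable nn_integral_measurable_subprob_algebra]) measurable
  have "emeasure (PO \<bind> Kg) A = (\<integral>\<^sup>+ x. indicator A x \<partial>(PO \<bind> Kg))" using sets by simp
  also have "\<dots> = (\<integral>\<^sup>+ \<eta>. (\<integral>\<^sup>+ x. indicator A x \<partial>Kg \<eta>) \<partial>PO)" by (rule nn_integral_bind[OF _ m]) simp
  also have "\<dots> = (\<integral>\<^sup>+ \<eta>. post \<eta> * (\<integral>\<^sup>+ x. indicator A x \<partial>Kg \<eta>) \<partial>Rsp d) / (\<integral>\<^sup>+ \<eta>. post \<eta> \<partial>Rsp d)"
    unfolding PO_eq by (rule nn_integral_normdens) measurable
  also have "\<dots> = (\<integral>\<^sup>+ \<eta>. post \<eta> * indicator A \<eta> \<partial>Rsp d) / (\<integral>\<^sup>+ \<eta>. post \<eta> \<partial>Rsp d)"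
    by (subst post_invariant) auto
  also have "\<dots> = (\<integral>\<^sup>+ \<eta>. indicator A \<eta> \<partial>PO)" unfolding PO_eq by (rule nn_integral_normdens[symmetric]) measurable
  also have "\<dots> = emeasure PO A" using sP by simp
  finally show "emeasure (PO \<bind> Kg) A = emeasure PO A" .
qed

end

section \<open>The drift condition\<close>

lemma powr_subadd:
  fixes x y s :: real
  assumes "0 \<le> x" "0 \<le> y" "0 < s" "s \<le> 1"
  shows "(x + y) powr s \<le> x powr s + y powr s"
proof (cases "x + y = 0")
  case True then show ?thesis using assms by simp
next
  case False
  define t where "t = x + y"
  have t: "0 < t" using False assms by (simp add: t_def)
  have le: "u / t \<le> (u / t) powr s" if "0 \<le> u" "u \<le> t" for u
  proof (cases "u = 0")
    case False
    define w where "w = u / t"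
    have w: "0 < w" "w \<le> 1" using that t False by (auto simp: w_def)
    then have "w powr 1 \<le> w powr s" using assms by (intro powr_mono') auto
    then have "w \<le> w powr s" using w by simp
    then show ?thesis by (simp only: w_def)
  qed simp
  have "1 = x / t + y / t" using t by (simp add: t_def add_divide_distrib[symmetric])
  also have "\<dots> \<le> (x / t) powr s + (y / t) powr s" using assms by (intro add_mono le) (auto simp: t_def)
  finally have "t powr s * 1 \<le> t powr s * ((x / t) powr s + (y / t) powr s)" by (intro mult_left_mono) auto
  also have "\<dots> = x powr s + y powr s" using t assms by (simp add: distrib_left powr_divide)
  finally show ?thesis by (simp add: t_def)
qed

lemma powr_le_1_plus: fixes x s :: real assumes "0 \<le> x" "0 < s" "s \<le> 1" shows "x powr s \<le> 1 + x"
proof (cases "x \<le> 1")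
  case True
  then have "x powr s \<le> 1 powr s" using assms by (intro powr_mono2) auto
  then show ?thesis using assms by simp
next
  case False
  then have "x powr s \<le> x powr 1" using assms by (intro powr_mono) auto
  then show ?thesis using False by simp
qed

context probit_gibbs
begin

lemma vD_second_moment:
  assumes \<epsilon>: "0 < \<epsilon>"
  shows "(\<integral>\<^sup>+ v. ennreal (\<Sum>i<n. (v i)\<^sup>2) \<partial>vD \<eta>) \<le> ennreal ((1 + \<epsilon>) * (\<Sum>i<n. (lp i \<eta>)\<^sup>2) + real n * ((1 + 1 / \<epsilon>) * (8 / 3)))"
proof -
  let ?k = "(1 + 1 / \<epsilon>) * (8 / 3)"
  have k: "0 \<le> ?k" using \<epsilon> by simp
  have c: "(\<integral>\<^sup>+ v. ennreal ((v i)\<^sup>2) \<partial>vD \<eta>) \<le> ennreal ((1 + \<epsilon>) * (lp i \<eta>)\<^sup>2 + ?k)" if i: "i < n" for i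
  proof -
    let ?T = "\<lambda>i. truncnorm (lp i \<eta>) (y i)"
    have v: "vD \<eta> = PiM {..<n} ?T" unfolding v_draw_def d_def[symmetric] lp_def[symmetric] ..
    have dc: "distr (PiM {..<n} ?T) (?T i) (\<lambda>v. v i) = ?T i"
      using i by (intro distr_PiM_component prob_space_truncnorm) auto
    have "(\<integral>\<^sup>+ v. ennreal ((v i)\<^sup>2) \<partial>vD \<eta>) = (\<integral>\<^sup>+ t. ennreal (t\<^sup>2) \<partial>distr (PiM {..<n} ?T) (?T i) (\<lambda>v. v i))"
      unfolding v using i by (subst nn_integral_distr) (auto simp: truncnorm_eq)
    also have "\<dots> = (\<integral>\<^sup>+ t. ennreal (t\<^sup>2) \<partial>?T i)" unfolding dc ..
    also have "\<dots> \<le> ennreal ((1 + \<epsilon>) * (lp i \<eta>)\<^sup>2 + ?k)" unfolding truncnorm_eq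
      by (rule nn_integral_normdens_le[OF _ _ tnw_integral(3,2) tnw_second_moment[OF \<epsilon>]]) auto
    finally show ?thesis .
  qed
  have [measurable]: "\<And>i. i \<in> {..<n} \<Longrightarrow> (\<lambda>v. v i) \<in> borel_measurable (vD \<eta>)"
    using measurable_coord[OF measurable_ident_sets[OF sets_vD]] by auto
  have "(\<integral>\<^sup>+ v. ennreal (\<Sum>i<n. (v i)\<^sup>2) \<partial>vD \<eta>) = (\<integral>\<^sup>+ v. (\<Sum>i<n. ennreal ((v i)\<^sup>2)) \<partial>vD \<eta>)"
    by (intro nn_integral_cong) (simp add: sum_ennreal)
  also have "\<dots> = (\<Sum>i<n. \<integral>\<^sup>+ v. ennreal ((v i)\<^sup>2) \<partial>vD \<eta>)" by (rule nn_integral_sum) measurable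
  also have "\<dots> \<le> (\<Sum>i<n. ennreal ((1 + \<epsilon>) * (lp i \<eta>)\<^sup>2 + ?k))" by (intro sum_mono c) simp
  also have "\<dots> = ennreal (\<Sum>i<n. (1 + \<epsilon>) * (lp i \<eta>)\<^sup>2 + ?k)"
    using \<epsilon> k by (intro sum_ennreal add_nonneg_nonneg mult_nonneg_nonneg) auto
  also have "(\<Sum>i<n. (1 + \<epsilon>) * (lp i \<eta>)\<^sup>2 + ?k) = (1 + \<epsilon>) * (\<Sum>i<n. (lp i \<eta>)\<^sup>2) + real n * ?k"
    by (simp add: sum.distrib sum_distrib_left)
  finally show ?thesis .
qed

lemma tauD_moment:
  assumes j: "j < r" and e: "0 < al j + e"
  shows "(\<integral>\<^sup>+ \<tau>. ennreal (\<tau> j powr e) \<partial>tauD \<eta>) = ennreal (Gamma (al j + e) / Gamma (al j) * rho \<eta> j powr (- e))"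
proof -
  let ?T = "\<lambda>j. gamma_meas (al j) (b j + us \<eta> j / 2)"
  have t: "tauD \<eta> = PiM {..<r} ?T" unfolding tau_draw_def al_def[symmetric] ..
  have dc: "distr (PiM {..<r} ?T) (?T j) (\<lambda>v. v j) = ?T j"
    using j al_pos by (intro distr_PiM_component prob_space_gamma_meas) auto
  have "(\<integral>\<^sup>+ \<tau>. ennreal (\<tau> j powr e) \<partial>tauD \<eta>) = (\<integral>\<^sup>+ t. ennreal (t powr e) \<partial>distr (PiM {..<r} ?T) (?T j) (\<lambda>v. v j))"
    unfolding t using j by (subst nn_integral_distr) (auto simp: gamma_meas_eq)
  also have "\<dots> = (\<integral>\<^sup>+ t. ennreal (t powr e) \<partial>?T j)" unfolding dc ..
  finally show ?thesis unfolding rho_def using gamma_meas_moment[OF al_pos[OF j] e] by simp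
qed

definition Zb :: "nat set" where "Zb = {j. j < r \<and> b j = 0}"

text \<open>The bound \<open>- a j / 2\<close> meets the spacing condition of
  \<open>Gamma_shift_less\<close> between \<open>al j\<close> and \<open>q_j / 2\<close>, whose
  difference is \<open>- a j\<close>; the bound 1 makes the power subadditive.\<close>

definition cc :: "nat \<Rightarrow> real" where "cc j = min 1 (- a j / 2)"

lemma b_cases: "j < r \<Longrightarrow> 0 < b j \<or> j \<in> Zb" using B1 by (auto simp: Zb_def)

lemma b_nonneg: "j < r \<Longrightarrow> 0 \<le> b j" using B1 by force

lemma cc: assumes "j \<in> Zb" shows "0 < cc j" "cc j \<le> 1" "cc j \<le> - a j / 2" "cc j < real (qs j) / 2"
proof -
  have a: "a j < 0" "j < r" using assms B1 by (auto simp: Zb_def)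
  show "0 < cc j" "cc j \<le> 1" "cc j \<le> - a j / 2" using a by (auto simp: cc_def)
  moreover have "- a j / 2 < real (qs j) / 2" using B2 a by (auto simp: field_simps)
  ultimately show "cc j < real (qs j) / 2" by linarith
qed

definition kq :: "nat \<Rightarrow> real" where "kq j = Gamma (real (qs j) / 2 - cc j) / Gamma (real (qs j) / 2)"

definition kz :: "nat \<Rightarrow> real" where "kz j = Gamma (al j + cc j) / Gamma (al j) * kq j"

lemma kq_pos: "j \<in> Zb \<Longrightarrow> 0 < kq j"
  unfolding kq_def using cc[of j] by (intro divide_pos_pos Gamma_real_pos) auto

text \<open>\<open>kz\<close> multiplies the moment \<open>cc j\<close> of the Gamma draw by the
  inverse moment of a Gaussian block. A negative \<open>a j\<close> separates the two Gamma
  arguments, so moving both inwards strictly lowers the product.\<close>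

lemma kz_less: assumes j: "j \<in> Zb" shows "kz j < 1"
proof -
  have jr: "j < r" using j by (simp add: Zb_def)
  have "Gamma (al j + cc j) * Gamma (real (qs j) / 2 - cc j) < Gamma (al j) * Gamma (real (qs j) / 2)"
    using al_pos[OF jr] cc[OF j] by (intro Gamma_shift_less) (auto simp: al_def)
  moreover have "0 < Gamma (al j)" "0 < Gamma (real (qs j) / 2)" using al_pos[OF jr] cc[OF j] by (auto intro!: Gamma_real_pos)
  ultimately show ?thesis unfolding kz_def kq_def by (simp add: divide_less_eq_1_pos)
qed

text \<open>The summand 1 covers the default rate at a vanishing block.\<close>

lemma rho_upper: assumes "j < r" shows "rho \<eta> j \<le> (1 + b j) + us \<eta> j / 2"
  using b_nonneg[OF assms] us_nonneg[of \<eta> j] by (auto simp: rho_def erate_def)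

lemma rho_lower: "j < r \<Longrightarrow> 0 < b j \<Longrightarrow> b j \<le> rho \<eta> j"
  using us_nonneg[of \<eta> j] by (auto simp: rho_def erate_def)

lemma rho_inv: "j \<in> Zb \<Longrightarrow> rho \<eta> j powr (- cc j) \<le> 1 + (us \<eta> j / 2) powr (- cc j)"
  using us_nonneg[of \<eta> j] by (auto simp: rho_def erate_def Zb_def)

end

text \<open>\<open>gam\<close> is the hypothesis for a single block, with the trace replaced by its
  lower bound 1.\<close>

locale probit_gibbs_drift = probit_gibbs +
  fixes s :: real
  assumes s: "0 < s" "s \<le> 1" and s_al: "\<And>j. j < r \<Longrightarrow> s < al j"
    and gam: "\<And>j. j < r \<Longrightarrow> 2 powr (- s) * (Gamma (al j - s) / Gamma (al j)) < 1"
begin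

definition \<epsilon>0 :: real where "\<epsilon>0 = \<delta>0 / 8"
definition E0 :: real where "E0 = 2 / \<kappa>0"
text \<open>The terms \<open>rho \<eta> j powr s\<close> together feed back at most
  \<open>r * E0 * ||v||^2\<close>; this weight makes the feedback at most the fraction
  \<open>\<delta>0 / 4\<close> of the \<open>Ldr\<close> term.\<close>

definition A0 :: real where "A0 = 1 + real r * E0 * (1 + \<epsilon>0) * (4 / \<delta>0)"

definition Ldr :: "(nat \<Rightarrow> real) \<Rightarrow> real" where "Ldr \<eta> = (\<Sum>i<n. (lp i \<eta>)\<^sup>2)"

definition Vdr :: "(nat \<Rightarrow> real) \<Rightarrow> real" where
  "Vdr \<eta> = A0 * Ldr \<eta> + (\<Sum>j<r. rho \<eta> j powr s) + (\<Sum>j\<in>Zb. rho \<eta> j powr (- cc j))"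

lemma \<epsilon>0: "0 < \<epsilon>0" "\<epsilon>0 \<le> 1/16" using \<delta>0 by (auto simp: \<epsilon>0_def)

lemma E0: "0 < E0" using \<kappa>0(1) by (simp add: E0_def)

lemma A0: "1 \<le> A0" using E0 \<epsilon>0 \<delta>0(1) by (simp add: A0_def)

lemma finite_Zb[simp]: "finite Zb" by (simp add: Zb_def)

lemma Ldr_nonneg: "0 \<le> Ldr \<eta>" by (simp add: Ldr_def sum_nonneg)

lemma Vdr_nonneg: "0 \<le> Vdr \<eta>"
  unfolding Vdr_def using A0 Ldr_nonneg by (intro add_nonneg_nonneg mult_nonneg_nonneg sum_nonneg) auto

lemma measurable_rho1: "j < r \<Longrightarrow> (\<lambda>\<eta>. rho \<eta> j) \<in> borel_measurable (Rsp d)" by (rule measurable_rho) auto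

lemma measurable_rho_s[measurable]: "j \<in> {..<r} \<Longrightarrow> (\<lambda>\<eta>. rho \<eta> j) \<in> borel_measurable (Rsp d)"
  "j \<in> Zb \<Longrightarrow> (\<lambda>\<eta>. rho \<eta> j) \<in> borel_measurable (Rsp d)"
  by (auto intro: measurable_rho1 simp: Zb_def)

lemma measurable_Ldr[measurable]: "Ldr \<in> borel_measurable (Rsp d)" unfolding Ldr_def[abs_def] by measurable

lemma measurable_Vdr[measurable]: "Vdr \<in> borel_measurable (Rsp d)" unfolding Vdr_def[abs_def] by measurable

lemma ennreal_Vdr: "ennreal (Vdr \<eta>) = ennreal A0 * ennreal (Ldr \<eta>) + (\<Sum>j<r. ennreal (rho \<eta> j powr s)) + (\<Sum>j\<in>Zb. ennreal (rho \<eta> j powr (- cc j)))"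
proof -
  have "ennreal (Vdr \<eta>) = ennreal (A0 * Ldr \<eta>) + ennreal (\<Sum>j<r. rho \<eta> j powr s) + ennreal (\<Sum>j\<in>Zb. rho \<eta> j powr (- cc j))"
    unfolding Vdr_def using A0 Ldr_nonneg[of \<eta>] by (simp add: ennreal_plus sum_nonneg)
  then show ?thesis using A0 Ldr_nonneg[of \<eta>] by (simp add: ennreal_mult sum_ennreal)
qed

definition D0 :: "nat \<Rightarrow> real" where "D0 j = (1 + b j) powr s + 1 + Kc / \<kappa>0"

lemma Kc_nonneg: "0 \<le> Kc" by (simp add: Kc_def)

lemma D0_nonneg: "0 \<le> D0 j" unfolding D0_def using Kc_nonneg \<kappa>0(1) by (intro add_nonneg_nonneg) auto

text \<open>Jensen at the exponent \<open>s\<close>, then subadditivity to isolate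
  \<open>\<tau> j powr (- s)\<close> with its exact coefficient \<open>2 powr (- s)\<close>.
  Everything else goes into constants and a multiple of \<open>||v||^2\<close>, where replacing a
  power by \<open>1 +\<close> its base is harmless.\<close>

lemma eta_rho_moment:
  assumes \<tau>: "\<forall>j<r. 0 < \<tau> j" and v: "vsup v" and j: "j < r"
  shows "(\<integral>\<^sup>+ \<eta>. ennreal (rho \<eta> j powr s) \<partial>etaD \<tau> v) \<le> ennreal (D0 j + E0 * (\<Sum>i<n. (v i)\<^sup>2) + 2 powr (- s) * \<tau> j powr (- s))"
proof -
  let ?E = "etaD \<tau> v" and ?S = "\<Sum>i<n. (v i)\<^sup>2"
  interpret E: prob_space ?E by (rule prob_space_eta_draw[OF \<tau>])
  have um[measurable]: "(\<lambda>\<eta>. us \<eta> j) \<in> borel_measurable (Rsp d)" by (rule measurable_us[OF _ j]) simp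
  have tj: "0 < \<tau> j" using \<tau> j by simp
  have S0: "0 \<le> ?S" by (simp add: sum_nonneg)
  let ?C = "(1 / \<kappa>0) * (2 * ?S + Kc)"
  have C0: "0 \<le> ?C" using \<kappa>0(1) S0 Kc_nonneg by simp
  have up: "(\<integral>\<^sup>+ \<eta>. ennreal (us \<eta> j powr s) \<partial>?E) \<le> ennreal ((?C + 1 / \<tau> j) powr s)"
    by (rule powr_moment_le[OF E.prob_space_axioms _ us_nonneg s _ eta_us_moment[OF \<tau> v j]]) (use C0 tj in \<open>auto intro: add_nonneg_pos\<close>)
  have pt: "rho \<eta> j powr s \<le> (1 + b j) powr s + 2 powr (- s) * us \<eta> j powr s" for \<eta>
  proof -
    have "rho \<eta> j powr s \<le> ((1 + b j) + us \<eta> j / 2) powr s"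
      using rho_upper[OF j] rho_pos[of \<eta> j] s by (intro powr_mono2) (auto simp: less_imp_le)
    also have "\<dots> \<le> (1 + b j) powr s + (us \<eta> j / 2) powr s"
      using b_nonneg[OF j] us_nonneg[of \<eta> j] s by (intro powr_subadd) auto
    also have "(us \<eta> j / 2) powr s = 2 powr (- s) * us \<eta> j powr s"
      using us_nonneg[of \<eta> j] by (simp add: powr_divide powr_minus field_simps)
    finally show ?thesis .
  qed
  have "(\<integral>\<^sup>+ \<eta>. ennreal (rho \<eta> j powr s) \<partial>?E) \<le> (\<integral>\<^sup>+ \<eta>. ennreal ((1 + b j) powr s) + ennreal (2 powr (- s)) * ennreal (us \<eta> j powr s) \<partial>?E)"
    using pt by (intro nn_integral_mono) (simp add: ennreal_mult[symmetric] ennreal_plus[symmetric] ennreal_leI del: ennreal_plus)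
  also have "\<dots> = ennreal ((1 + b j) powr s) + ennreal (2 powr (- s)) * (\<integral>\<^sup>+ \<eta>. ennreal (us \<eta> j powr s) \<partial>?E)"
    using E.emeasure_space_1 by (simp add: nn_integral_add nn_integral_cmult)
  also have "\<dots> \<le> ennreal ((1 + b j) powr s) + ennreal (2 powr (- s)) * ennreal ((?C + 1 / \<tau> j) powr s)"
    by (intro add_left_mono mult_left_mono up) simp
  also have "\<dots> = ennreal ((1 + b j) powr s + 2 powr (- s) * (?C + 1 / \<tau> j) powr s)"
    by (simp add: ennreal_mult[symmetric] ennreal_plus[symmetric] del: ennreal_plus)
  also have "\<dots> \<le> ennreal (D0 j + E0 * ?S + 2 powr (- s) * \<tau> j powr (- s))"
  proof (rule ennreal_leI)
    have "(?C + 1 / \<tau> j) powr s \<le> ?C powr s + (1 / \<tau> j) powr s" using C0 tj s by (intro powr_subadd) auto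
    also have "?C powr s \<le> 1 + ?C" by (rule powr_le_1_plus[OF C0 s])
    also have "(1 / \<tau> j) powr s = \<tau> j powr (- s)" using tj by (simp add: powr_divide powr_minus_divide)
    finally have "2 powr (- s) * (?C + 1 / \<tau> j) powr s \<le> 2 powr (- s) * (1 + ?C + \<tau> j powr (- s))" by (intro mult_left_mono) auto
    also have "\<dots> = 2 powr (- s) * (1 + ?C) + 2 powr (- s) * \<tau> j powr (- s)" by (simp add: distrib_left)
    also have "2 powr (- s) * (1 + ?C) \<le> 1 * (1 + ?C)"
    proof (rule mult_right_mono)
      have "(2::real) powr (- s) \<le> 2 powr 0" using s by (intro powr_mono) auto
      then show "(2::real) powr (- s) \<le> 1" by simp
    qed (use C0 in simp)
    also have "1 * (1 + ?C) = 1 + Kc / \<kappa>0 + E0 * ?S" by (simp add: E0_def distrib_left add_divide_distrib)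
    finally show "(1 + b j) powr s + 2 powr (- s) * (?C + 1 / \<tau> j) powr s \<le> D0 j + E0 * ?S + 2 powr (- s) * \<tau> j powr (- s)"
      by (simp add: D0_def)
  qed
  finally show ?thesis .
qed

definition F0 :: "nat \<Rightarrow> real" where "F0 j = 1 + kq j * real n powr cc j"

lemma eta_rho_inverse:
  assumes \<tau>: "\<forall>j<r. 0 < \<tau> j" and j: "j \<in> Zb"
  shows "(\<integral>\<^sup>+ \<eta>. ennreal (rho \<eta> j powr (- cc j)) \<partial>etaD \<tau> v) \<le> ennreal (F0 j + kq j * \<tau> j powr cc j)"
proof -
  let ?E = "etaD \<tau> v"
  have jr: "j < r" using j by (simp add: Zb_def)
  interpret E: prob_space ?E by (rule prob_space_eta_draw[OF \<tau>])
  have um[measurable]: "(\<lambda>\<eta>. us \<eta> j) \<in> borel_measurable (Rsp d)" by (rule measurable_us[OF _ jr]) simp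
  have tj: "0 < \<tau> j" using \<tau> jr by simp
  have "(\<integral>\<^sup>+ \<eta>. ennreal (rho \<eta> j powr (- cc j)) \<partial>?E) \<le> (\<integral>\<^sup>+ \<eta>. 1 + ennreal ((us \<eta> j / 2) powr (- cc j)) \<partial>?E)"
    using rho_inv[OF j] by (intro nn_integral_mono) (simp add: ennreal_1[symmetric] ennreal_plus[symmetric] ennreal_leI del: ennreal_plus ennreal_1)
  also have "\<dots> = 1 + (\<integral>\<^sup>+ \<eta>. ennreal ((us \<eta> j / 2) powr (- cc j)) \<partial>?E)"
    using E.emeasure_space_1 by (simp add: nn_integral_add)
  also have "\<dots> \<le> 1 + ennreal ((\<tau> j + real n) powr cc j * kq j)"
    unfolding kq_def by (intro add_left_mono eta_inverse_moment[OF \<tau> jr cc(1,4)[OF j]])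
  also have "\<dots> = ennreal (1 + (\<tau> j + real n) powr cc j * kq j)"
    using kq_pos[OF j] by (simp add: ennreal_plus[symmetric] ennreal_1[symmetric] del: ennreal_plus ennreal_1)
  also have "\<dots> \<le> ennreal (F0 j + kq j * \<tau> j powr cc j)"
  proof (rule ennreal_leI)
    have "(\<tau> j + real n) powr cc j \<le> \<tau> j powr cc j + real n powr cc j" using tj cc[OF j] by (intro powr_subadd) auto
    then have "(\<tau> j + real n) powr cc j * kq j \<le> (\<tau> j powr cc j + real n powr cc j) * kq j"
      using kq_pos[OF j] by (intro mult_right_mono) auto
    then show "1 + (\<tau> j + real n) powr cc j * kq j \<le> F0 j + kq j * \<tau> j powr cc j" by (simp add: F0_def algebra_simps)
  qed
  finally show ?thesis .
qed

lemma F0_nonneg: "j \<in> Zb \<Longrightarrow> 0 \<le> F0 j" unfolding F0_def using kq_pos[of j] by (simp add: add_nonneg_nonneg less_imp_le)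

definition C1 :: real where "C1 = A0 * ((1 + 1 / \<epsilon>0) * (4 * sqrt 2 ^ d)) + (\<Sum>j<r. D0 j) + (\<Sum>j\<in>Zb. F0 j)"
definition c1 :: real where "c1 = A0 * ((1 + \<epsilon>0) * (1 - \<delta>0)) + real r * E0"

definition Tm :: "(nat \<Rightarrow> real) \<Rightarrow> ennreal" where
  "Tm \<tau> = (\<Sum>j<r. ennreal (2 powr (- s)) * ennreal (\<tau> j powr (- s))) + (\<Sum>j\<in>Zb. ennreal (kq j) * ennreal (\<tau> j powr cc j))"

lemma C1_nonneg: "0 \<le> C1"
  unfolding C1_def using A0 \<epsilon>0 D0_nonneg F0_nonneg by (intro add_nonneg_nonneg mult_nonneg_nonneg sum_nonneg) auto

lemma c1_nonneg: "0 \<le> c1"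
  unfolding c1_def using A0 \<epsilon>0 \<delta>0 E0 by (intro add_nonneg_nonneg mult_nonneg_nonneg) auto

lemma eta_step:
  assumes \<tau>: "\<forall>j<r. 0 < \<tau> j" and v: "vsup v"
  shows "(\<integral>\<^sup>+ \<eta>. ennreal (Vdr \<eta>) \<partial>etaD \<tau> v) \<le> ennreal C1 + ennreal c1 * ennreal (\<Sum>i<n. (v i)\<^sup>2) + Tm \<tau>"
proof -
  let ?E = "etaD \<tau> v" and ?S = "\<Sum>i<n. (v i)\<^sup>2"
  have S0: "0 \<le> ?S" by (simp add: sum_nonneg)
  let ?x = "(1 + \<epsilon>0) * (1 - \<delta>0) * ?S + (1 + 1 / \<epsilon>0) * (4 * sqrt 2 ^ d)"
  have x0: "0 \<le> ?x" using \<epsilon>0 \<delta>0 S0 by (intro add_nonneg_nonneg mult_nonneg_nonneg) auto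
  have ir: "(\<lambda>j. (\<integral>\<^sup>+ \<eta>. ennreal (rho \<eta> j powr s) \<partial>?E)) j \<le> ennreal (D0 j + E0 * ?S) + ennreal (2 powr (- s)) * ennreal (\<tau> j powr (- s))" if "j < r" for j
    using eta_rho_moment[OF \<tau> v that] D0_nonneg[of j] E0 S0 by (simp add: ennreal_mult[symmetric] ennreal_plus[symmetric] del: ennreal_plus)
  have iz: "(\<lambda>j. (\<integral>\<^sup>+ \<eta>. ennreal (rho \<eta> j powr (- cc j)) \<partial>?E)) j \<le> ennreal (F0 j) + ennreal (kq j) * ennreal (\<tau> j powr cc j)" if "j \<in> Zb" for j
    using eta_rho_inverse[OF \<tau> that, of v] F0_nonneg[OF that] kq_pos[OF that] by (simp add: ennreal_mult[symmetric] ennreal_plus[symmetric] del: ennreal_plus)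
  have "(\<integral>\<^sup>+ \<eta>. ennreal (Vdr \<eta>) \<partial>?E) = ennreal A0 * (\<integral>\<^sup>+ \<eta>. ennreal (Ldr \<eta>) \<partial>?E) + (\<Sum>j<r. \<integral>\<^sup>+ \<eta>. ennreal (rho \<eta> j powr s) \<partial>?E)
      + (\<Sum>j\<in>Zb. \<integral>\<^sup>+ \<eta>. ennreal (rho \<eta> j powr (- cc j)) \<partial>?E)"
    unfolding ennreal_Vdr
    by (subst nn_integral_add, measurable, subst nn_integral_add, measurable, subst nn_integral_cmult, measurable, subst nn_integral_sum, measurable, subst nn_integral_sum, measurable)
  also have "\<dots> \<le> ennreal A0 * ennreal ?x + (\<Sum>j<r. ennreal (D0 j + E0 * ?S) + ennreal (2 powr (- s)) * ennreal (\<tau> j powr (- s)))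
      + (\<Sum>j\<in>Zb. ennreal (F0 j) + ennreal (kq j) * ennreal (\<tau> j powr cc j))"
    using ir iz eta_lp_moment[OF \<tau> v \<epsilon>0(1)] unfolding Ldr_def by (intro add_mono mult_left_mono sum_mono) auto
  also have "\<dots> = (ennreal A0 * ennreal ?x + (\<Sum>j<r. ennreal (D0 j + E0 * ?S)) + (\<Sum>j\<in>Zb. ennreal (F0 j))) + Tm \<tau>"
    unfolding Tm_def sum.distrib by (simp only: add_ac)
  also have "ennreal A0 * ennreal ?x + (\<Sum>j<r. ennreal (D0 j + E0 * ?S)) + (\<Sum>j\<in>Zb. ennreal (F0 j))
     = ennreal (A0 * ?x + (\<Sum>j<r. D0 j + E0 * ?S) + (\<Sum>j\<in>Zb. F0 j))"
  proof -
    have 1: "(\<Sum>j<r. ennreal (D0 j + E0 * ?S)) = ennreal (\<Sum>j<r. D0 j + E0 * ?S)"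
      using D0_nonneg E0 S0 by (intro sum_ennreal add_nonneg_nonneg mult_nonneg_nonneg) auto
    have 2: "(\<Sum>j\<in>Zb. ennreal (F0 j)) = ennreal (\<Sum>j\<in>Zb. F0 j)" using F0_nonneg by (intro sum_ennreal) auto
    have 3: "0 \<le> (\<Sum>j<r. D0 j + E0 * ?S)" using D0_nonneg E0 S0 by (intro sum_nonneg add_nonneg_nonneg mult_nonneg_nonneg) auto
    have 4: "0 \<le> (\<Sum>j\<in>Zb. F0 j)" using F0_nonneg by (intro sum_nonneg) auto
    have 5: "ennreal A0 * ennreal ?x = ennreal (A0 * ?x)" "0 \<le> A0 * ?x" using A0 x0 by (auto simp: ennreal_mult)
    show ?thesis unfolding 1 2 5(1) using 3 4 5(2) by (simp only: ennreal_plus[symmetric] add_nonneg_nonneg)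
  qed
  also have "A0 * ?x + (\<Sum>j<r. D0 j + E0 * ?S) + (\<Sum>j\<in>Zb. F0 j) = C1 + c1 * ?S"
    unfolding C1_def c1_def by (simp add: sum.distrib algebra_simps)
  also have "ennreal (C1 + c1 * ?S) = ennreal C1 + ennreal c1 * ennreal ?S"
    using C1_nonneg c1_nonneg S0 by (simp add: ennreal_plus ennreal_mult)
  finally show ?thesis .
qed

definition C2 :: real where "C2 = C1 + c1 * (real n * ((1 + 1 / \<epsilon>0) * (8 / 3)))"

lemma C2_nonneg: "0 \<le> C2" unfolding C2_def using C1_nonneg c1_nonneg \<epsilon>0 by (intro add_nonneg_nonneg mult_nonneg_nonneg) auto

text \<open>The budget of \<open>\<delta>0\<close>: two factors \<open>1 + \<epsilon>0\<close>, one
  from the \<open>v\<close> draw and one from the \<open>\<eta>\<close> draw, cost half of it, the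
  feedback of the blocks another quarter, and a quarter remains.\<close>

lemma c1_bound: "c1 * (1 + \<epsilon>0) \<le> A0 * (1 - \<delta>0 / 4)"
proof -
  have e: "(1 + \<epsilon>0) * (1 - \<delta>0) * (1 + \<epsilon>0) \<le> 1 - \<delta>0 / 2"
  proof -
    have "(1 + \<epsilon>0) * (1 + \<epsilon>0) \<le> 1 + 3 * \<epsilon>0"
    proof -
      have "\<epsilon>0 * \<epsilon>0 \<le> \<epsilon>0 * 1" using \<epsilon>0 by (intro mult_left_mono) auto
      then show ?thesis by (simp add: algebra_simps)
    qed
    then have "(1 + \<epsilon>0) * (1 + \<epsilon>0) * (1 - \<delta>0) \<le> (1 + 3 * \<epsilon>0) * (1 - \<delta>0)" using \<delta>0 by (intro mult_right_mono) auto
    also have "1 + 3 * \<epsilon>0 = 1 + 3 / 8 * \<delta>0" by (simp add: \<epsilon>0_def)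
    also have "(1 + 3 / 8 * \<delta>0) * (1 - \<delta>0) = 1 - 5 / 8 * \<delta>0 - 3 / 8 * (\<delta>0 * \<delta>0)" by (simp add: field_simps)
    also have "\<dots> \<le> 1 - \<delta>0 / 2" using \<delta>0(1) mult_pos_pos[OF \<delta>0(1) \<delta>0(1)] by linarith
    finally show ?thesis by (simp only: mult_ac)
  qed
  have "real r * E0 * (1 + \<epsilon>0) * (4 / \<delta>0) \<le> A0" by (simp add: A0_def)
  then have "real r * E0 * (1 + \<epsilon>0) * (4 / \<delta>0) * (\<delta>0 / 4) \<le> A0 * (\<delta>0 / 4)" using \<delta>0(1) by (intro mult_right_mono) auto
  then have f: "real r * E0 * (1 + \<epsilon>0) \<le> A0 * (\<delta>0 / 4)" using \<delta>0(1) by simp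
  have "c1 * (1 + \<epsilon>0) = A0 * ((1 + \<epsilon>0) * (1 - \<delta>0) * (1 + \<epsilon>0)) + real r * E0 * (1 + \<epsilon>0)"
    by (simp add: c1_def distrib_right mult.assoc)
  also have "\<dots> \<le> A0 * (1 - \<delta>0 / 2) + A0 * (\<delta>0 / 4)" using e f A0 by (intro add_mono mult_left_mono) auto
  finally show ?thesis by (simp add: algebra_simps)
qed

text \<open>The estimate for fixed \<open>(\<tau>, v)\<close> has no mixed terms, so averaging needs
  only the second moment of \<open>v\<close> and one power moment of each \<open>\<tau> j\<close>.
  Each Gamma moment returns the same power of \<open>rho \<eta> j\<close> that enters
  \<open>Vdr\<close>.\<close>

lemma gibbs_step:
  assumes \<eta>: "\<eta> \<in> space (Rsp d)"
  shows "(\<integral>\<^sup>+ x. ennreal (Vdr x) \<partial>Kg \<eta>) \<le> ennreal (A0 * (1 - \<delta>0 / 4) * Ldr \<eta> + C2 + (\<Sum>j<r. 2 powr (- s) * (Gamma (al j - s) / Gamma (al j)) * rho \<eta> j powr s)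
      + (\<Sum>j\<in>Zb. kz j * rho \<eta> j powr (- cc j)))"
proof -
  interpret T: prob_space "tauD \<eta>" by (rule prob_space_tauD)
  interpret V: prob_space "vD \<eta>" by (rule prob_space_vD)
  have mv[measurable]: "\<And>i. i \<in> {..<n} \<Longrightarrow> (\<lambda>v. v i) \<in> borel_measurable (vD \<eta>)"
    using measurable_coord[OF measurable_ident_sets[OF sets_vD]] by auto
  have mt[measurable]: "\<And>j. j \<in> {..<r} \<Longrightarrow> (\<lambda>v. v j) \<in> borel_measurable (tauD \<eta>)" "\<And>j. j \<in> Zb \<Longrightarrow> (\<lambda>v. v j) \<in> borel_measurable (tauD \<eta>)"
    using measurable_coord[OF measurable_ident_sets[OF sets_tauD]] by (auto simp: Zb_def)
  have L0: "0 \<le> Ldr \<eta>" by (rule Ldr_nonneg)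
  have vstep: "(\<integral>\<^sup>+ v. \<integral>\<^sup>+ x. ennreal (Vdr x) \<partial>etaD \<tau> v \<partial>vD \<eta>) \<le> ennreal (A0 * (1 - \<delta>0 / 4) * Ldr \<eta> + C2) + Tm \<tau>" if \<tau>: "\<forall>j<r. 0 < \<tau> j" for \<tau>
  proof -
    have "(\<integral>\<^sup>+ v. \<integral>\<^sup>+ x. ennreal (Vdr x) \<partial>etaD \<tau> v \<partial>vD \<eta>) \<le> (\<integral>\<^sup>+ v. ennreal C1 + ennreal c1 * ennreal (\<Sum>i<n. (v i)\<^sup>2) + Tm \<tau> \<partial>vD \<eta>)"
    proof (rule nn_integral_mono_AE)
      show "AE v in vD \<eta>. (\<integral>\<^sup>+ x. ennreal (Vdr x) \<partial>etaD \<tau> v) \<le> ennreal C1 + ennreal c1 * ennreal (\<Sum>i<n. (v i)\<^sup>2) + Tm \<tau>"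
        using vD_sup[OF \<eta>] by eventually_elim (rule eta_step[OF \<tau>])
    qed
    also have "\<dots> = ennreal C1 + ennreal c1 * (\<integral>\<^sup>+ v. ennreal (\<Sum>i<n. (v i)\<^sup>2) \<partial>vD \<eta>) + Tm \<tau>"
    proof -
      have m: "(\<lambda>v. ennreal (\<Sum>i<n. (v i)\<^sup>2)) \<in> borel_measurable (vD \<eta>)" by measurable
      have e: "emeasure (vD \<eta>) (space (Rsp n)) = 1" using V.emeasure_space_1 by simp
      show ?thesis using m e by (simp add: nn_integral_add nn_integral_cmult)
    qed
    also have "\<dots> \<le> ennreal C1 + ennreal c1 * ennreal ((1 + \<epsilon>0) * Ldr \<eta> + real n * ((1 + 1 / \<epsilon>0) * (8 / 3))) + Tm \<tau>"
      unfolding Ldr_def by (intro add_mono mult_left_mono vD_second_moment \<epsilon>0) auto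
    also have "ennreal C1 + ennreal c1 * ennreal ((1 + \<epsilon>0) * Ldr \<eta> + real n * ((1 + 1 / \<epsilon>0) * (8 / 3)))
        = ennreal (C1 + c1 * ((1 + \<epsilon>0) * Ldr \<eta> + real n * ((1 + 1 / \<epsilon>0) * (8 / 3))))"
    proof -
      have "0 \<le> (1 + \<epsilon>0) * Ldr \<eta> + real n * ((1 + 1 / \<epsilon>0) * (8 / 3))" using \<epsilon>0 L0 by (intro add_nonneg_nonneg mult_nonneg_nonneg) auto
      then show ?thesis using C1_nonneg c1_nonneg by (simp only: ennreal_plus ennreal_mult mult_nonneg_nonneg)
    qed
    also have "\<dots> \<le> ennreal (A0 * (1 - \<delta>0 / 4) * Ldr \<eta> + C2)"
    proof (rule ennreal_leI)
      have "c1 * (1 + \<epsilon>0) * Ldr \<eta> \<le> A0 * (1 - \<delta>0 / 4) * Ldr \<eta>" using c1_bound L0 by (intro mult_right_mono) auto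
      moreover have "C1 + c1 * ((1 + \<epsilon>0) * Ldr \<eta> + real n * ((1 + 1 / \<epsilon>0) * (8 / 3))) = c1 * (1 + \<epsilon>0) * Ldr \<eta> + C2"
      proof -
        have gen: "C + c * (e * L + k) = c * e * L + (C + c * k)" for C c e L k :: real by (simp add: algebra_simps)
        show ?thesis unfolding C2_def by (rule gen)
      qed
      ultimately show "C1 + c1 * ((1 + \<epsilon>0) * Ldr \<eta> + real n * ((1 + 1 / \<epsilon>0) * (8 / 3))) \<le> A0 * (1 - \<delta>0 / 4) * Ldr \<eta> + C2" by linarith
    qed
    finally show ?thesis by (simp add: add_right_mono)
  qed
  let ?b = "A0 * (1 - \<delta>0 / 4) * Ldr \<eta> + C2"
  have b0: "0 \<le> ?b" using A0 \<delta>0 L0 C2_nonneg by (intro add_nonneg_nonneg mult_nonneg_nonneg) auto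
  let ?g = "\<lambda>j. 2 powr (- s) * (Gamma (al j - s) / Gamma (al j)) * rho \<eta> j powr s"
  let ?z = "\<lambda>j. kz j * rho \<eta> j powr (- cc j)"
  have g0: "0 \<le> ?g j" if "j < r" for j
    using Gamma_real_pos[OF al_pos[OF that]] Gamma_real_pos[of "al j - s"] s_al[OF that] by (auto intro!: mult_nonneg_nonneg divide_nonneg_nonneg)
  have z0: "0 \<le> ?z j" if "j \<in> Zb" for j
  proof -
    have "0 < al j" using that al_pos by (auto simp: Zb_def)
    then have "0 < Gamma (al j + cc j)" "0 < Gamma (al j)" using cc(1)[OF that] by (auto intro!: Gamma_real_pos)
    then show ?thesis unfolding kz_def using kq_pos[OF that] by (auto intro!: mult_nonneg_nonneg divide_nonneg_nonneg)
  qed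
  have "(\<integral>\<^sup>+ x. ennreal (Vdr x) \<partial>Kg \<eta>) = (\<integral>\<^sup>+ \<tau>. \<integral>\<^sup>+ v. \<integral>\<^sup>+ x. ennreal (Vdr x) \<partial>etaD \<tau> v \<partial>vD \<eta> \<partial>tauD \<eta>)"
    by (rule nn_integral_gibbs[OF \<eta>]) measurable
  also have "\<dots> \<le> (\<integral>\<^sup>+ \<tau>. ennreal ?b + Tm \<tau> \<partial>tauD \<eta>)"
  proof (rule nn_integral_mono_AE)
    show "AE \<tau> in tauD \<eta>. (\<integral>\<^sup>+ v. \<integral>\<^sup>+ x. ennreal (Vdr x) \<partial>etaD \<tau> v \<partial>vD \<eta>) \<le> ennreal ?b + Tm \<tau>"
      using tauD_pos[OF \<eta>] by eventually_elim (rule vstep)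
  qed
  also have "\<dots> = ennreal ?b + ((\<Sum>j<r. ennreal (2 powr (- s)) * (\<integral>\<^sup>+ \<tau>. ennreal (\<tau> j powr (- s)) \<partial>tauD \<eta>)) + (\<Sum>j\<in>Zb. ennreal (kq j) * (\<integral>\<^sup>+ \<tau>. ennreal (\<tau> j powr cc j) \<partial>tauD \<eta>)))"
  proof -
    have 1: "(\<integral>\<^sup>+ \<tau>. (\<Sum>j<r. ennreal (2 powr (- s)) * ennreal (\<tau> j powr (- s))) \<partial>tauD \<eta>) = (\<Sum>j<r. ennreal (2 powr (- s)) * (\<integral>\<^sup>+ \<tau>. ennreal (\<tau> j powr (- s)) \<partial>tauD \<eta>))"
      by (subst nn_integral_sum, measurable, intro sum.cong refl nn_integral_cmult, measurable)
    have 2: "(\<integral>\<^sup>+ \<tau>. (\<Sum>j\<in>Zb. ennreal (kq j) * ennreal (\<tau> j powr cc j)) \<partial>tauD \<eta>) = (\<Sum>j\<in>Zb. ennreal (kq j) * (\<integral>\<^sup>+ \<tau>. ennreal (\<tau> j powr cc j) \<partial>tauD \<eta>))"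
      by (subst nn_integral_sum, measurable, intro sum.cong refl nn_integral_cmult, measurable)
    have m: "(\<lambda>\<tau>. \<Sum>j<r. ennreal (2 powr (- s)) * ennreal (\<tau> j powr (- s))) \<in> borel_measurable (tauD \<eta>)"
      "(\<lambda>\<tau>. \<Sum>j\<in>Zb. ennreal (kq j) * ennreal (\<tau> j powr cc j)) \<in> borel_measurable (tauD \<eta>)" by measurable
    have e: "emeasure (tauD \<eta>) (space (Rsp r)) = 1" using T.emeasure_space_1 by simp
    show ?thesis unfolding Tm_def 1[symmetric] 2[symmetric] using m e by (simp add: nn_integral_add)
  qed
  also have "(\<Sum>j<r. ennreal (2 powr (- s)) * (\<integral>\<^sup>+ \<tau>. ennreal (\<tau> j powr (- s)) \<partial>tauD \<eta>)) = (\<Sum>j<r. ennreal (?g j))"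
  proof (rule sum.cong[OF refl])
    fix j assume "j \<in> {..<r}" then have j: "j < r" by simp
    have "0 < al j + (- s)" using s_al[OF j] by simp
    from tauD_moment[OF j this, of \<eta>]
    show "ennreal (2 powr (- s)) * (\<integral>\<^sup>+ \<tau>. ennreal (\<tau> j powr (- s)) \<partial>tauD \<eta>) = ennreal (?g j)"
      by (simp add: ennreal_mult'[symmetric] mult.assoc)
  qed
  also have "(\<Sum>j\<in>Zb. ennreal (kq j) * (\<integral>\<^sup>+ \<tau>. ennreal (\<tau> j powr cc j) \<partial>tauD \<eta>)) = (\<Sum>j\<in>Zb. ennreal (?z j))"
  proof (rule sum.cong[OF refl])
    fix j assume j: "j \<in> Zb" then have jr: "j < r" by (simp add: Zb_def)
    have "0 < al j + cc j" using al_pos[OF jr] cc(1)[OF j] by simp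
    from tauD_moment[OF jr this, of \<eta>]
    show "ennreal (kq j) * (\<integral>\<^sup>+ \<tau>. ennreal (\<tau> j powr cc j) \<partial>tauD \<eta>) = ennreal (?z j)"
      using kq_pos[OF j] by (simp add: ennreal_mult'[symmetric] kz_def mult_ac)
  qed
  also have "(\<Sum>j<r. ennreal (?g j)) = ennreal (\<Sum>j<r. ?g j)" using g0 by (intro sum_ennreal) auto
  also have "(\<Sum>j\<in>Zb. ennreal (?z j)) = ennreal (\<Sum>j\<in>Zb. ?z j)" using z0 by (intro sum_ennreal) auto
  also have "ennreal ?b + (ennreal (\<Sum>j<r. ?g j) + ennreal (\<Sum>j\<in>Zb. ?z j)) = ennreal (?b + (\<Sum>j<r. ?g j) + (\<Sum>j\<in>Zb. ?z j))"
  proof -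
    have "0 \<le> (\<Sum>j<r. ?g j)" "0 \<le> (\<Sum>j\<in>Zb. ?z j)" using g0 z0 by (auto intro!: sum_nonneg)
    moreover have gen: "ennreal B + (ennreal G + ennreal Z) = ennreal (B + G + Z)" if "0 \<le> B" "0 \<le> G" "0 \<le> Z" for B G Z :: real
      using that by (simp add: ennreal_plus add.assoc)
    ultimately show ?thesis using b0 by (intro gen)
  qed
  finally show ?thesis .
qed

text \<open>The three kinds of terms in \<open>Vdr\<close> contract separately, so the largest of
  their factors serves as \<open>\<gamma>\<close>.\<close>

lemma drift_condition:
  "\<exists>\<gamma> C. 0 \<le> \<gamma> \<and> \<gamma> < 1 \<and> 0 \<le> C \<and> (\<forall>\<eta>\<in>space (Rsp d). (\<integral>\<^sup>+ x. ennreal (Vdr x) \<partial>Kg \<eta>) \<le> ennreal (\<gamma> * Vdr \<eta> + C))"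
proof -
  let ?g = "\<lambda>j. 2 powr (- s) * (Gamma (al j - s) / Gamma (al j))"
  define \<gamma> where "\<gamma> = Max ({1 - \<delta>0 / 4} \<union> ?g ` {..<r} \<union> kz ` Zb)"
  have fin: "finite ({1 - \<delta>0 / 4} \<union> ?g ` {..<r} \<union> kz ` Zb)" by simp
  have g1: "1 - \<delta>0 / 4 \<le> \<gamma>" unfolding \<gamma>_def using fin by (intro Max_ge) auto
  have g2: "?g j \<le> \<gamma>" if "j < r" for j unfolding \<gamma>_def using fin that by (intro Max_ge) auto
  have g3: "kz j \<le> \<gamma>" if "j \<in> Zb" for j unfolding \<gamma>_def using fin that by (intro Max_ge) auto
  have "\<gamma> < 1" unfolding \<gamma>_def using fin \<delta>0(1) gam kz_less by (subst Max_less_iff) auto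
  moreover have "0 \<le> \<gamma>" using g1 \<delta>0(2) by linarith
  moreover have "(\<integral>\<^sup>+ x. ennreal (Vdr x) \<partial>Kg \<eta>) \<le> ennreal (\<gamma> * Vdr \<eta> + C2)" if "\<eta> \<in> space (Rsp d)" for \<eta>
  proof (rule order_trans[OF gibbs_step[OF that] ennreal_leI])
    have 1: "A0 * (1 - \<delta>0 / 4) * Ldr \<eta> \<le> \<gamma> * (A0 * Ldr \<eta>)"
    proof -
      have "(1 - \<delta>0 / 4) * (A0 * Ldr \<eta>) \<le> \<gamma> * (A0 * Ldr \<eta>)" using g1 A0 Ldr_nonneg[of \<eta>] by (intro mult_right_mono) auto
      then show ?thesis by (simp only: mult_ac)
    qed
    have 2: "(\<Sum>j<r. ?g j * rho \<eta> j powr s) \<le> \<gamma> * (\<Sum>j<r. rho \<eta> j powr s)"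
      unfolding sum_distrib_left using g2 by (intro sum_mono mult_right_mono) auto
    have 3: "(\<Sum>j\<in>Zb. kz j * rho \<eta> j powr (- cc j)) \<le> \<gamma> * (\<Sum>j\<in>Zb. rho \<eta> j powr (- cc j))"
      unfolding sum_distrib_left using g3 by (intro sum_mono mult_right_mono) auto
    show "A0 * (1 - \<delta>0 / 4) * Ldr \<eta> + C2 + (\<Sum>j<r. ?g j * rho \<eta> j powr s) + (\<Sum>j\<in>Zb. kz j * rho \<eta> j powr (- cc j)) \<le> \<gamma> * Vdr \<eta> + C2"
      unfolding Vdr_def distrib_left using 1 2 3 by linarith
  qed
  ultimately show ?thesis using C2_nonneg by blast
qed

end

section \<open>Minorization on level sets\<close>

context probit_gibbs_drift
begin

text \<open>Each summand of \<open>Vdr\<close> is nonnegative, hence itself at most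
  \<open>R\<close>. The negative powers bound the Gamma rate from below in the blocks with
  \<open>b j = 0\<close>; in the others \<open>b j\<close> does.\<close>

lemma level_set_bounds:
  assumes V: "Vdr \<eta> \<le> R" and R: "1 \<le> R"
  shows "i < n \<Longrightarrow> (lp i \<eta>)\<^sup>2 \<le> R" "j < r \<Longrightarrow> rho \<eta> j \<le> R powr (1 / s)" "j \<in> Zb \<Longrightarrow> R powr (- (1 / cc j)) \<le> rho \<eta> j"
proof -
  have n1: "0 \<le> A0 * Ldr \<eta>" using A0 Ldr_nonneg[of \<eta>] by simp
  have n2: "0 \<le> (\<Sum>j<r. rho \<eta> j powr s)" "0 \<le> (\<Sum>j\<in>Zb. rho \<eta> j powr (- cc j))" by (auto intro!: sum_nonneg)
  show "(lp i \<eta>)\<^sup>2 \<le> R" if "i < n"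
  proof -
    have "(lp i \<eta>)\<^sup>2 \<le> Ldr \<eta>" unfolding Ldr_def using that by (intro member_le_sum) auto
    also have "\<dots> \<le> A0 * Ldr \<eta>" using A0 Ldr_nonneg[of \<eta>] by (simp add: mult_le_cancel_right1)
    finally show ?thesis using V n2 unfolding Vdr_def by linarith
  qed
  show "rho \<eta> j \<le> R powr (1 / s)" if "j < r"
  proof -
    have "rho \<eta> j powr s \<le> (\<Sum>j<r. rho \<eta> j powr s)" using that by (intro member_le_sum[of j]) auto
    then have "rho \<eta> j powr s \<le> R" using V n1 n2 unfolding Vdr_def by linarith
    then have "(rho \<eta> j powr s) powr (1 / s) \<le> R powr (1 / s)" using s by (intro powr_mono2) auto
    then show ?thesis using s rho_pos[of \<eta> j] by (simp add: powr_powr)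
  qed
  show "R powr (- (1 / cc j)) \<le> rho \<eta> j" if j: "j \<in> Zb"
  proof -
    have "rho \<eta> j powr (- cc j) \<le> (\<Sum>j\<in>Zb. rho \<eta> j powr (- cc j))" using j by (intro member_le_sum[of j]) auto
    then have "rho \<eta> j powr (- cc j) \<le> R" using V n1 n2 unfolding Vdr_def by linarith
    then have "R powr (- (1 / cc j)) \<le> (rho \<eta> j powr (- cc j)) powr (- (1 / cc j))"
      using cc(1)[OF j] rho_pos[of \<eta> j] by (intro powr_mono2') auto
    then show ?thesis using cc(1)[OF j] rho_pos[of \<eta> j] by (simp add: powr_powr)
  qed
qed

text \<open>The old state influences the new one only through \<open>\<tau>\<close> and
  \<open>v\<close>. On a level set their densities have common positive minorants, and mixing the
  \<open>\<eta>\<close> draws over these minorants gives the measure \<open>N\<close>.\<close>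

lemma minorization:
  "\<exists>N. sets N = sets (Rsp d) \<and> emeasure N (space (Rsp d)) \<noteq> 0 \<and> emeasure N (space (Rsp d)) \<noteq> \<infinity> \<and>
     (\<forall>x\<in>space (Rsp d). Vdr x \<le> R0 \<longrightarrow> (\<forall>A\<in>sets (Rsp d). emeasure N A \<le> emeasure (Kg x) A))"
proof (cases "\<exists>x\<in>space (Rsp d). Vdr x \<le> R0")
  \<comment> \<open>On an empty level set the domination is vacuous, and any probability measure
    serves.\<close>
  case False
  obtain x where x: "x \<in> space (Rsp d)" using space_Rsp_ne by blast
  have "emeasure (Kg x) (space (Rsp d)) = 1"
    using prob_space.emeasure_space_1[OF prob_space_gibbs[OF x]] sets_eq_imp_space_eq[OF sets_gibbs[OF x]] by simp
  then show ?thesis using False x by (intro exI[of _ "Kg x"]) auto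
next
  case True
  interpret D: sigma_finite_measure "Rsp d" by (rule sigma_finite_Rsp)
  interpret M2: sigma_finite_measure M2 by (rule sigma_finite_M2)
  interpret P: pair_sigma_finite M2 "Rsp d" by standard
  define R where "R = max 1 R0"
  have R: "1 \<le> R" "R0 \<le> R" by (auto simp: R_def)
  define u where "u = R powr (1 / s)"
  define l where "l j = (if j \<in> Zb then R powr (- (1 / cc j)) else b j)" for j
  have u: "0 < u" using R by (simp add: u_def)
  have l: "0 < l j" if "j < r" for j using b_cases[OF that] R by (auto simp: l_def)
  let ?gj = "\<lambda>j t. ennreal (gaw (al j) u t * l j powr al j / Gamma (al j))"
  let ?gi = "\<lambda>i v. ennreal (indicator (halfline (y i)) v * exp (- (v\<^sup>2) - R) / sqrt (2 * pi))"
  define g1 where "g1 \<tau> = (\<Prod>j<r. ?gj j (\<tau> j))" for \<tau> :: "nat \<Rightarrow> real"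
  define g2 where "g2 v = (\<Prod>i<n. ?gi i (v i))" for v :: "nat \<Rightarrow> real"
  have hm[measurable]: "halfline (y i) \<in> sets borel" for i by auto
  have m1[measurable]: "g1 \<in> borel_measurable (Rsp r)" unfolding g1_def[abs_def] Rsp_def by measurable
  have m2[measurable]: "g2 \<in> borel_measurable (Rsp n)" unfolding g2_def[abs_def] Rsp_def by measurable
  have lower: "g1 \<tau> * g2 v \<le> ga x \<tau> * tv x v" if x: "Vdr x \<le> R0" for x \<tau> v
  proof -
    have V: "Vdr x \<le> R" using x R by linarith
    have "g1 \<tau> \<le> ga x \<tau>" unfolding g1_def ga_def
    proof (rule prod_mono_ennreal)
      fix j assume "j \<in> {..<r}" then have j: "j < r" by simp
      have "l j \<le> rho x j" using level_set_bounds(3)[OF V R(1), of j] rho_lower[OF j, of x] b_cases[OF j] by (auto simp: l_def)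
      then show "?gj j (\<tau> j) \<le> gad (al j) (rho x j) (\<tau> j)"
        using level_set_bounds(2)[OF V R(1) j] l[OF j] unfolding u_def by (intro gad_lower al_pos j)
    qed
    moreover have "g2 v \<le> tv x v" unfolding g2_def tv_def
      using level_set_bounds(1)[OF V R(1)] by (intro prod_mono_ennreal tnd_lower) auto
    ultimately show ?thesis by (rule mult_mono) auto
  qed
  define N where "N = density (Rsp d) (\<lambda>x. \<integral>\<^sup>+ z. (g1 (fst z) * g2 (snd z)) * ed (fst z) (snd z) x \<partial>M2)"
  have Nem: "emeasure N A = (\<integral>\<^sup>+ z. (g1 (fst z) * g2 (snd z)) * (\<integral>\<^sup>+ x. ed (fst z) (snd z) x * indicator A x \<partial>Rsp d) \<partial>M2)"
    if A[measurable]: "A \<in> sets (Rsp d)" for A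
  proof -
    have "emeasure N A = (\<integral>\<^sup>+ x. (\<integral>\<^sup>+ z. (g1 (fst z) * g2 (snd z)) * ed (fst z) (snd z) x \<partial>M2) * indicator A x \<partial>Rsp d)"
      unfolding N_def by (rule emeasure_density) measurable
    also have "\<dots> = (\<integral>\<^sup>+ x. (\<integral>\<^sup>+ z. (g1 (fst z) * g2 (snd z)) * (ed (fst z) (snd z) x * indicator A x) \<partial>M2) \<partial>Rsp d)"
    proof (rule nn_integral_cong)
      fix x assume "x \<in> space (Rsp d)"
      then have [measurable]: "(\<lambda>_. x) \<in> measurable M2 (Rsp d)" by simp
      have "(\<integral>\<^sup>+ z. (g1 (fst z) * g2 (snd z)) * ed (fst z) (snd z) x \<partial>M2) * indicator A x = (\<integral>\<^sup>+ z. ((g1 (fst z) * g2 (snd z)) * ed (fst z) (snd z) x) * indicator A x \<partial>M2)"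
        by (rule nn_integral_multc[symmetric]) measurable
      then show "(\<integral>\<^sup>+ z. (g1 (fst z) * g2 (snd z)) * ed (fst z) (snd z) x \<partial>M2) * indicator A x = (\<integral>\<^sup>+ z. (g1 (fst z) * g2 (snd z)) * (ed (fst z) (snd z) x * indicator A x) \<partial>M2)"
        by (simp only: mult.assoc)
    qed
    also have "\<dots> = (\<integral>\<^sup>+ z. (\<integral>\<^sup>+ x. (g1 (fst z) * g2 (snd z)) * (ed (fst z) (snd z) x * indicator A x) \<partial>Rsp d) \<partial>M2)"
      by (rule P.Fubini') measurable
    also have "\<dots> = (\<integral>\<^sup>+ z. (g1 (fst z) * g2 (snd z)) * (\<integral>\<^sup>+ x. ed (fst z) (snd z) x * indicator A x \<partial>Rsp d) \<partial>M2)"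
      by (intro nn_integral_cong nn_integral_cmult) (auto intro!: borel_measurable_times_ennreal measurable_ed simp: space_pair_measure)
    finally show ?thesis .
  qed
  have le: "emeasure N A \<le> emeasure (Kg x) A" if x: "x \<in> space (Rsp d)" "Vdr x \<le> R0" and A: "A \<in> sets (Rsp d)" for x A
  proof -
    have "emeasure N A \<le> (\<integral>\<^sup>+ z. (ga x (fst z) * tv x (snd z)) * (\<integral>\<^sup>+ x. ed (fst z) (snd z) x * indicator A x \<partial>Rsp d) \<partial>M2)"
      unfolding Nem[OF A] by (intro nn_integral_mono mult_right_mono lower x) simp
    also have "\<dots> = (\<integral>\<^sup>+ x. indicator A x \<partial>Kg x)" by (rule nn_integral_gibbs_M2[OF x(1), symmetric]) (use A in simp)
    also have "\<dots> = emeasure (Kg x) A" using A x by simp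
    finally show ?thesis .
  qed
  have "emeasure N (space (Rsp d)) \<noteq> \<infinity>"
  proof -
    obtain x where x: "x \<in> space (Rsp d)" "Vdr x \<le> R0" using True by blast
    have "emeasure N (space (Rsp d)) \<le> emeasure (Kg x) (space (Rsp d))" by (rule le[OF x]) simp
    also have "\<dots> = 1"
      using prob_space.emeasure_space_1[OF prob_space_gibbs[OF x(1)]] sets_eq_imp_space_eq[OF sets_gibbs[OF x(1)]] by simp
    finally show ?thesis by (auto simp: top_unique)
  qed
  moreover have "emeasure N (space (Rsp d)) \<noteq> 0"
  proof -
    \<comment> \<open>Outside the positive precisions the \<open>\<eta>\<close> draw may lose mass,
      but there the minorant vanishes; so \<open>N\<close> has the full mass of
      \<open>g1 * g2\<close>.\<close>
    have g10: "g1 \<tau> = 0" if np: "\<not> (\<forall>j<r. 0 < \<tau> j)" for \<tau>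
    proof -
      obtain j where "j < r" "\<not> 0 < \<tau> j" using np by auto
      then show ?thesis unfolding g1_def by (intro prod_zero bexI[of _ j]) (auto simp: gaw_def)
    qed
    have "emeasure N (space (Rsp d)) = (\<integral>\<^sup>+ z. g1 (fst z) * g2 (snd z) \<partial>M2)"
      unfolding Nem[OF sets.top]
    proof (rule nn_integral_cong)
      fix z
      have "(\<integral>\<^sup>+ x. ed (fst z) (snd z) x * indicator (space (Rsp d)) x \<partial>Rsp d) = (\<integral>\<^sup>+ x. ed (fst z) (snd z) x \<partial>Rsp d)"
        by (intro nn_integral_cong) simp
      then show "(g1 (fst z) * g2 (snd z)) * (\<integral>\<^sup>+ x. ed (fst z) (snd z) x * indicator (space (Rsp d)) x \<partial>Rsp d) = g1 (fst z) * g2 (snd z)"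
        using g10[of "fst z"] ed_integral[of "fst z" "snd z"] by (cases "\<forall>j<r. 0 < fst z j") auto
    qed
    also have "\<dots> = (\<integral>\<^sup>+ \<tau>. \<integral>\<^sup>+ v. g1 \<tau> * g2 v \<partial>Rsp n \<partial>Rsp r)"
    proof -
      have "(\<lambda>z. g1 (fst z) * g2 (snd z)) \<in> borel_measurable M2" by measurable
      from M2_nested[OF this] show ?thesis by simp
    qed
    also have "\<dots> = (\<integral>\<^sup>+ \<tau>. g1 \<tau> * (\<integral>\<^sup>+ v. g2 v \<partial>Rsp n) \<partial>Rsp r)" by (intro nn_integral_cong nn_integral_cmult m2)
    also have "\<dots> = (\<integral>\<^sup>+ \<tau>. g1 \<tau> \<partial>Rsp r) * (\<integral>\<^sup>+ v. g2 v \<partial>Rsp n)" by (rule nn_integral_multc[OF m1])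
    also have "(\<integral>\<^sup>+ \<tau>. g1 \<tau> \<partial>Rsp r) = (\<Prod>j<r. \<integral>\<^sup>+ t. ?gj j t \<partial>lborel)"
      unfolding g1_def Rsp_def by (rule lb.product_nn_integral_prod) measurable
    also have "(\<integral>\<^sup>+ v. g2 v \<partial>Rsp n) = (\<Prod>i<n. \<integral>\<^sup>+ t. ?gi i t \<partial>lborel)"
      unfolding g2_def Rsp_def by (rule lb.product_nn_integral_prod) measurable
    finally have eq: "emeasure N (space (Rsp d)) = (\<Prod>j<r. \<integral>\<^sup>+ t. ?gj j t \<partial>lborel) * (\<Prod>i<n. \<integral>\<^sup>+ t. ?gi i t \<partial>lborel)" .
    have "(\<integral>\<^sup>+ t. ?gj j t \<partial>lborel) \<noteq> 0" if j: "j < r" for j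
    proof
      assume "(\<integral>\<^sup>+ t. ?gj j t \<partial>lborel) = 0"
      then have "AE t in lborel. ?gj j t = 0" by (subst (asm) nn_integral_0_iff_AE) auto
      then have "AE t in lborel. ennreal (gaw (al j) u t) = 0"
      proof eventually_elim
        case (elim t)
        have "0 < l j powr al j / Gamma (al j)" using l[OF j] Gamma_real_pos[OF al_pos[OF j]] by simp
        then show ?case using elim gaw_nonneg[of "al j" u t] Gamma_real_pos[OF al_pos[OF j]] l[OF j]
          by (auto simp: ennreal_eq_0_iff mult_le_0_iff divide_le_0_iff)
      qed
      then have "(\<integral>\<^sup>+ t. ennreal (gaw (al j) u t) \<partial>lborel) = 0" by (subst nn_integral_0_iff_AE) auto
      then show False using gaw_integral_nz(1)[OF al_pos[OF j] u] by simp
    qed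
    moreover have "(\<integral>\<^sup>+ t. ?gi i t \<partial>lborel) \<noteq> 0" for i
    proof
      assume "(\<integral>\<^sup>+ t. ?gi i t \<partial>lborel) = 0"
      then have "AE t in lborel. ?gi i t = 0" by (subst (asm) nn_integral_0_iff_AE) auto
      then have "AE t in lborel. ennreal (tnw 0 (y i) t) = 0"
      proof eventually_elim
        case (elim t)
        have "t \<notin> halfline (y i)"
        proof
          assume "t \<in> halfline (y i)"
          then have "?gi i t = ennreal (exp (- (t\<^sup>2) - R) / sqrt (2 * pi))" by simp
          moreover have "0 < exp (- (t\<^sup>2) - R) / sqrt (2 * pi)" by simp
          ultimately show False using elim by (metis ennreal_eq_0_iff not_le)
        qed
        then show ?case by (simp add: tnw_def)
      qed
      then have "(\<integral>\<^sup>+ t. ennreal (tnw 0 (y i) t) \<partial>lborel) = 0" by (subst nn_integral_0_iff_AE) auto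
      then show False using tnw_integral(3)[of 0 "y i"] by simp
    qed
    ultimately show ?thesis unfolding eq by (auto simp: prod_zero_iff)
  qed
  moreover have "sets N = sets (Rsp d)" by (simp add: N_def)
  ultimately show ?thesis using le by (intro exI[of _ N]) auto
qed

theorem gibbs_geom_ergodic: "geom_ergodic (Rsp d) Kg PO"
proof -
  obtain \<gamma> C where gC: "0 \<le> \<gamma>" "\<gamma> < 1" "0 \<le> C" "\<And>\<eta>. \<eta> \<in> space (Rsp d) \<Longrightarrow> (\<integral>\<^sup>+ x. ennreal (Vdr x) \<partial>Kg \<eta>) \<le> ennreal (\<gamma> * Vdr \<eta> + C)"
    using drift_condition by blast
  interpret dm: drift_minorization "Rsp d" Kg Vdr \<gamma> C PO
  proof (rule drift_minorization.intro)
    show "sets PO = sets (Rsp d)" by (simp add: PO_eq)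
    show "\<exists>N. sets N = sets (Rsp d) \<and> emeasure N (space (Rsp d)) \<noteq> 0 \<and> emeasure N (space (Rsp d)) \<noteq> \<infinity> \<and>
        (\<forall>x\<in>space (Rsp d). Vdr x \<le> R \<longrightarrow> (\<forall>A\<in>sets (Rsp d). emeasure N A \<le> emeasure (Kg x) A))" for R
      by (rule minorization)
    show "0 \<le> Vdr x" for x by (rule Vdr_nonneg)
  qed (fact gibbs_kernel_measurable prob_space_gibbs measurable_Vdr gC prob_space_PO PO_invariant)+
  show ?thesis by (rule dm.geom_ergodic_of_drift_minorization)
qed

end

section \<open>The trace in the hypothesis\<close>

context probit_gibbs
begin

text \<open>The indicator of block \<open>j\<close> is mapped by \<open>Z\<close> to the constant
  vector, which lies in the column space of \<open>X\<close>; so it is annihilated by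
  \<open>M\<close> and orthogonal to the range of \<open>PM\<close>. Divided by its length it is a
  unit vector fixed by the complement, which forces trace at least 1 within the block.\<close>

lemma null_trace_ge_1:
  defines "q \<equiv> qtot r qs"
  defines "PX \<equiv> proj n p X"
  defines "M \<equiv> mmul n (mmul n (mtrans (Zmat r qs lev)) (\<lambda>i k. idm i k - PX i k)) (Zmat r qs lev)"
  defines "PM \<equiv> proj q q M"
  assumes j: "j < r"
  shows "1 \<le> mtrace (qs j) (mmul q (mmul q (Rmat qs j) (\<lambda>i k. idm i k - PM i k)) (mtrans (Rmat qs j)))"
proof -
  let ?o = "off qs j" and ?B = "\<lambda>i k. idm i k - PM i k"
  have PX: "is_proj n p X PX" unfolding PX_def by (rule is_proj_proj)
  have PM: "is_proj q q M PM" unfolding PM_def by (rule is_proj_proj)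
  have oq: "?o + k < q" if "k < qs j" for k
    using block_index_less[of j r k qs] j that by (simp add: q_def qtot_def off_def)
  have tr: "mtrace (qs j) (mmul q (mmul q (Rmat qs j) ?B) (mtrans (Rmat qs j))) = (\<Sum>k<qs j. 1 - PM (?o + k) (?o + k))"
    unfolding mtrace_def
  proof (rule sum.cong[OF refl])
    fix k assume "k \<in> {..<qs j}" then have k: "k < qs j" by simp
    have r1: "mmul q (Rmat qs j) ?B k t = ?B (?o + k) t" for t
    proof -
      have "mmul q (Rmat qs j) ?B k t = (\<Sum>u<q. ?B u t * (if u = ?o + k then 1 else 0))"
        unfolding mmul_def Rmat_def by (intro sum.cong) auto
      then show ?thesis using sum_unit_vec[OF oq[OF k], of "\<lambda>u. ?B u t"] by simp
    qed
    have "mmul q (mmul q (Rmat qs j) ?B) (mtrans (Rmat qs j)) k k = (\<Sum>u<q. mmul q (Rmat qs j) ?B k u * (if u = ?o + k then 1 else 0))"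
      unfolding mmul_def[of q "mmul q (Rmat qs j) ?B"] mtrans_def Rmat_def ..
    also have "\<dots> = ?B (?o + k) (?o + k)" unfolding r1 by (rule sum_unit_vec[OF oq[OF k], of "\<lambda>u. ?B (?o + k) u"])
    finally show "mmul q (mmul q (Rmat qs j) ?B) (mtrans (Rmat qs j)) k k = 1 - PM (?o + k) (?o + k)" by (simp add: idm_def)
  qed
  \<comment> \<open>Indicator of block \<open>j\<close>: the random-effects part of
    \<open>ddir j\<close>.\<close>
  define z where "z c = (if \<exists>k<qs j. c = ?o + k then 1 else 0 :: real)" for c
  have zsum: "(\<Sum>c<q. f c * z c) = (\<Sum>k<qs j. f (?o + k))" for f
  proof -
    have zb: "z (off qs j' + k) = (if j' = j then 1 else 0)" if "j' < r" "k < qs j'" for j' k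
      using blk_inj[of k j' _ j] that unfolding z_def by (auto simp: blk_def)
    have "(\<Sum>c<q. f c * z c) = (\<Sum>j'<r. \<Sum>k<qs j'. f (off qs j' + k) * z (off qs j' + k))"
      unfolding q_def qtot_def sum_blocks off_def ..
    also have "\<dots> = (\<Sum>j'<r. if j' = j then (\<Sum>k<qs j'. f (off qs j' + k)) else 0)"
      by (intro sum.cong refl) (simp add: zb)
    finally show ?thesis using j by simp
  qed
  have one: "(\<Sum>t<n. PX u t) = 1" if u: "u < n" for u
  proof -
    have "\<forall>i<n. (\<lambda>_. 1) i = (\<Sum>l<p. X i l * (if l = 0 then 1 else 0))"
    proof (intro allI impI)
      fix i assume "i < n"
      then show "1 = (\<Sum>l<p. X i l * (if l = 0 then 1 else 0))" using sum_unit_vec[OF p_pos, of "X i"] intercept by simp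
    qed
    from is_proj_fix[OF PX this u] show ?thesis by simp
  qed
  \<comment> \<open>\<open>Z z\<close> is constant 1 since every observation has one level, and the
    columns of \<open>I - PX\<close> sum to 0 because \<open>PX\<close> is symmetric and fixes
    constants.\<close>
  have kill: "\<forall>l<q. (\<Sum>i<q. z i * M i l) = 0"
  proof (intro allI impI)
    fix l
    have zZ: "(\<Sum>i<q. z i * Zmat r qs lev u i) = 1" if "u < n" for u
    proof -
      have "(\<Sum>i<q. z i * Zmat r qs lev u i) = (\<Sum>k<qs j. Zmat r qs lev u (?o + k))"
        using zsum[of "Zmat r qs lev u"] by (simp only: mult.commute)
      also have "\<dots> = (\<Sum>k<qs j. (if lev j u = k then 1 else 0) * 1)" using j by (intro sum.cong) (auto simp: Zmat_blk)
      also have "\<dots> = 1" using sum_level[of "lev j u" "qs j" "\<lambda>_. 1"] lev_range j that by simp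
      finally show ?thesis .
    qed
    have "(\<Sum>i<q. z i * M i l) = (\<Sum>i<q. \<Sum>t<n. \<Sum>u<n. (z i * Zmat r qs lev u i) * ((idm u t - PX u t) * Zmat r qs lev t l))"
      unfolding M_def mmul_def mtrans_def by (simp add: sum_distrib_left sum_distrib_right mult.assoc)
    also have "\<dots> = (\<Sum>t<n. \<Sum>i<q. \<Sum>u<n. (z i * Zmat r qs lev u i) * ((idm u t - PX u t) * Zmat r qs lev t l))" by (rule sum.swap)
    also have "\<dots> = (\<Sum>t<n. \<Sum>u<n. \<Sum>i<q. (z i * Zmat r qs lev u i) * ((idm u t - PX u t) * Zmat r qs lev t l))"
      by (intro sum.cong refl sum.swap)
    also have "\<dots> = (\<Sum>t<n. \<Sum>u<n. (\<Sum>i<q. z i * Zmat r qs lev u i) * ((idm u t - PX u t) * Zmat r qs lev t l))"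
      by (simp only: sum_distrib_right)
    also have "\<dots> = (\<Sum>t<n. (\<Sum>u<n. idm u t - PX u t) * Zmat r qs lev t l)"
      by (intro sum.cong refl) (simp add: zZ sum_distrib_right)
    also have "\<dots> = 0"
    proof (intro sum.neutral ballI)
      fix t assume "t \<in> {..<n}" then have t: "t < n" by simp
      have "(\<Sum>u<n. idm u t) = 1" using sum_unit_vec[OF t, of "\<lambda>_. 1"] by (simp add: idm_def)
      moreover have "(\<Sum>u<n. PX u t) = (\<Sum>u<n. PX t u)" using is_proj_sym[OF PX _ t] by (intro sum.cong) auto
      ultimately show "(\<Sum>u<n. idm u t - PX u t) * Zmat r qs lev t l = 0" using one[OF t] by (simp add: sum_subtractf)
    qed
    finally show "(\<Sum>i<q. z i * M i l) = 0" .
  qed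
  have row: "(\<Sum>k'<qs j. PM (?o + k) (?o + k')) = 0" if "k < qs j" for k
    using is_proj_kill[OF PM kill oq[OF that]] zsum[of "PM (?o + k)"] by simp
  let ?T = "\<Sum>k<qs j. 1 - PM (?o + k) (?o + k)"
  \<comment> \<open>Summing the complement over all index pairs of the block gives
    \<open>q_j\<close>, as the rows of \<open>PM\<close> sum to 0 there; the entrywise bound turns
    this into \<open>q_j\<close> times the trace.\<close>
  have "2 * real (qs j) = (\<Sum>k<qs j. \<Sum>k'<qs j. 2 * (idm (?o + k) (?o + k') - PM (?o + k) (?o + k')))"
  proof -
    have "(\<Sum>k'<qs j. 2 * (idm (?o + k) (?o + k') - PM (?o + k) (?o + k'))) = 2" if k: "k < qs j" for k
    proof -
      have "(\<Sum>k'<qs j. idm (?o + k) (?o + k')) = 1" using sum_level[OF k, of "\<lambda>_. 1"] by (simp add: idm_def)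
      then show ?thesis using row[OF k] by (simp add: sum_distrib_left[symmetric] sum_subtractf)
    qed
    then show ?thesis by simp
  qed
  also have "\<dots> \<le> (\<Sum>k<qs j. \<Sum>k'<qs j. (1 - PM (?o + k) (?o + k)) + (1 - PM (?o + k') (?o + k')))"
    by (intro sum_mono complement_entry_bound[OF PM] oq) auto
  also have "\<dots> = 2 * (real (qs j) * ?T)"
  proof -
    have "(\<Sum>k<m. \<Sum>k'<m. A k + A k') = 2 * (real m * (\<Sum>k<m. A k))" for A :: "nat \<Rightarrow> real" and m :: nat
      by (simp add: sum.distrib sum_distrib_left[symmetric])
    then show ?thesis .
  qed
  finally have "real (qs j) * 1 \<le> real (qs j) * ?T" by simp
  then have "1 \<le> ?T" using qs_pos j by (simp only: mult_le_cancel_left_pos of_nat_0_less_iff)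
  then show ?thesis unfolding tr .
qed

end

theorem theorem3:
  fixes n p r :: nat and qs :: "nat \<Rightarrow> nat" and X :: "nat \<Rightarrow> nat \<Rightarrow> real"
    and lev :: "nat \<Rightarrow> nat \<Rightarrow> nat" and y :: "nat \<Rightarrow> bool" and a b :: "nat \<Rightarrow> real"
  assumes p_pos: "0 < p" and r_pos: "0 < r"
    and qs_pos: "\<forall>j<r. 0 < qs j"
    and lev_range: "\<forall>j<r. \<forall>i<n. lev j i < qs j"
    and intercept: "\<forall>i<n. X i 0 = 1"
    and B1: "\<forall>j<r. (a j < 0 \<and> b j = 0 \<and> 2 \<le> qs j) \<or> 0 < b j"
    and B2: "\<forall>j<r. 2 * a j + real (qs j) - 1 > 0"
    and B3: "\<forall>c::nat \<Rightarrow> real. (\<forall>i<n. (\<Sum>l<p + qtot r qs - r. Wtmat p r qs X lev i l * c l) = 0)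
               \<longrightarrow> (\<forall>l<p + qtot r qs - r. c l = 0)"
    and B4: "\<exists>e::nat \<Rightarrow> real. (\<forall>i<n. 0 < e i) \<and>
               (\<forall>l<p + qtot r qs - r.
                  (\<Sum>i<n. e i * ((1 - 2 * (if y i then 1 else 0)) * Wtmat p r qs X lev i l)) = 0)"
    and drift: "\<exists>s::real. 0 < s \<and> s \<le> 1 \<and> s < Min ((\<lambda>j. a j + real (qs j) / 2) ` {..<r}) \<and>
      (let q = qtot r qs;
           PX = proj n p X;
           M = mmul n (mmul n (mtrans (Zmat r qs lev)) (\<lambda>i k. idm i k - PX i k)) (Zmat r qs lev);
           PM = proj q q M
       in 2 powr (- s) * (\<Sum>j<r. Gamma (real (qs j) / 2 + a j - s) / Gamma (real (qs j) / 2 + a j) *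
              (mtrace (qs j) (mmul q (mmul q (Rmat qs j) (\<lambda>i k. idm i k - PM i k)) (mtrans (Rmat qs j))))
                powr s) < 1)"
  shows "prob_space (posterior n p r qs X lev y a b) \<and>
         geom_ergodic (Rsp (p + qtot r qs)) (gibbs_kernel n p r qs X lev y a b)
           (posterior n p r qs X lev y a b)"
proof -
  interpret probit_gibbs n p r qs X lev y a b
    by unfold_locales (fact p_pos r_pos qs_pos lev_range intercept B1 B2 B3 B4)+
  define tr where "tr j = (let q = qtot r qs; PX = proj n p X;
           M = mmul n (mmul n (mtrans (Zmat r qs lev)) (\<lambda>i k. idm i k - PX i k)) (Zmat r qs lev);
           PM = proj q q M in mtrace (qs j) (mmul q (mmul q (Rmat qs j) (\<lambda>i k. idm i k - PM i k)) (mtrans (Rmat qs j))))" for j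
  obtain s where s: "0 < s" "s \<le> 1" "s < Min ((\<lambda>j. a j + real (qs j) / 2) ` {..<r})"
    and sum: "2 powr (- s) * (\<Sum>j<r. Gamma (real (qs j) / 2 + a j - s) / Gamma (real (qs j) / 2 + a j) * tr j powr s) < 1"
    using drift unfolding tr_def Let_def by blast
  have sal: "s < al j" if "j < r" for j using s(3) that r_pos by (subst (asm) Min_gr_iff) (auto simp: al_def)
  have "2 powr (- s) * (Gamma (al j - s) / Gamma (al j)) < 1" if j: "j < r" for j
  proof -
    have ale: "real (qs j) / 2 + a j = al j" for j by (simp add: al_def)
    let ?f = "\<lambda>j. Gamma (al j - s) / Gamma (al j) * tr j powr s"
    have f0: "0 \<le> Gamma (al j - s) / Gamma (al j)" if "j < r" for j
      using Gamma_real_pos[OF al_pos[OF that]] Gamma_real_pos[of "al j - s"] sal[OF that] by (intro divide_nonneg_nonneg) auto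
    \<comment> \<open>All summands of the hypothesis are nonnegative, so the one for block
      \<open>j\<close> is at most the whole sum, and a trace of at least 1 can be lowered to
      1.\<close>
    have "1 \<le> tr j" unfolding tr_def Let_def by (rule null_trace_ge_1[OF j])
    then have "1 powr s \<le> tr j powr s" using s by (intro powr_mono2) auto
    then have "Gamma (al j - s) / Gamma (al j) * 1 \<le> ?f j" using f0[OF j] by (intro mult_left_mono) auto
    also have "?f j \<le> (\<Sum>j<r. ?f j)" using j f0 by (intro member_le_sum[of j "{..<r}" ?f] mult_nonneg_nonneg f0) auto
    finally have "2 powr (- s) * (Gamma (al j - s) / Gamma (al j)) \<le> 2 powr (- s) * (\<Sum>j<r. ?f j)" by (intro mult_left_mono) auto
    also have "\<dots> < 1" using sum unfolding ale .
    finally show ?thesis .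
  qed
  then interpret probit_gibbs_drift n p r qs X lev y a b s
    using s sal by unfold_locales auto
  show ?thesis using prob_space_PO gibbs_geom_ergodic unfolding d_def by blast
qed

end
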